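(* Assume that $b:[0,T]\times\mathbb{R}^d\to\mathbb{R}^d$ is measurable and bounded by $B<+\infty$, and that either $\sup_{t\in[0,T]}\|\nabla\cdot b(t,\cdot)\|_{L^\rho}<+\infty$ for some $\rho\in[d,+\infty]$, or $d=1$ and $\sup_{t\in[0,T]}\|\partial_x b(t,\cdot)\|_{\rm TV}<+\infty$, where $\nabla\cdot b(t,\cdot)$ and $\partial_x b(t,\cdot)$ are respectively the spatial divergence and the spatial derivative of $b$ in the sense of distributions. Then there exists $\tilde C<+\infty$ such that for all $h\in(0,T]$ and all integers $k$ with $1\le k\le\lfloor T/h\rfloor$, $$\left\|\mu_{kh}-\mu^h_{kh}\right\|_{\rm TV}\le\frac{\tilde C}{\sqrt{kh}}\big(1+\ln(k)\big)h.$$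
   Context: Let $d\ge 1$ be an integer, $T\in(0,+\infty)$, $m$ a probability measure on $\mathbb{R}^d$, $(W_t)_{t\ge0}$ a $d$-dimensional Brownian motion and $X_0$ an $\mathbb{R}^d$-valued random vector with law $m$, independent of $(W_t)_{t\ge 0}$. That $b=(b_i)_{1\le i\le d}$ is bounded by $B$ means $|b_i(t,x)|\le B$ for all $i$ and all $(t,x)\in[0,T]\times\mathbb{R}^d$. The process $(X_t)_{t\in[0,T]}$ is the solution of $X_t=X_0+W_t+\int_0^t b(s,X_s)\,ds$, $t\in[0,T]$. For a time-step $h\in(0,T]$, let $(\delta_k)_{k}$ be independent random variables, $\delta_k$ being uniformly distributed on $[kh,(k+1)h]$, independent from $(X_0,(W_t)_{t\ge0})$. The Euler-Maruyama scheme with randomized time variable is defined by $X^h_0=X_0$ and $X^h_{(k+1)h}=X^h_{kh}+(W_{(k+1)h}-W_{kh})+b(\delta_k,X^h_{kh})h$ for $0\le k\le\lfloor T/h\rfloor-1$. $\mu_t$ denotes the law of $X_t$ and $\mu^h_{kh}$ the law of $X^h_{kh}$. For a signed measure $\mu$ on $\mathbb{R}^d$, $\|\mu\|_{\rm TV}=\sup_{\varphi}\int_{\mathbb{R}^d}\varphi\,d\mu$, the supremum being over all measurable $\varphi:\mathbb{R}^d\to[-1,1]$. Finiteness of $\|\nabla\cdot b(t,\cdot)\|_{L^\rho}$ (resp. $\|\partial_xb(t,\cdot)\|_{\rm TV}$) includes that the distribution is given by a function in $L^\rho(\mathbb{R}^d)$ (resp. a finite signed measure on $\mathbb{R}$).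 *)

theory Defs
  imports "HOL-Probability.Probability"
begin

section \<open>Spatial divergence in the sense of distributions\<close>

definition partial_deriv :: "'n::finite \<Rightarrow> (real ^ 'n \<Rightarrow> real) \<Rightarrow> real ^ 'n \<Rightarrow> real" where
  "partial_deriv i f x = frechet_derivative f (at x) (axis i 1)"

text \<open>Functions of class \<open>C\<^sup>k\<close> on the whole space: total differentiability with partial
  derivatives of class \<open>C\<^sup>k\<close> is the same as being of class \<open>C\<^sup>k\<^sup>+\<^sup>1\<close>.\<close>

primrec C_k :: "nat \<Rightarrow> (real ^ 'n::finite \<Rightarrow> real) \<Rightarrow> bool" where
  "C_k 0 f \<longleftrightarrow> continuous_on UNIV f"
| "C_k (Suc k) f \<longleftrightarrow> (\<forall>x. f differentiable (at x)) \<and> (\<forall>i. C_k k (partial_deriv i f))"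

definition test_function :: "(real ^ 'n::finite \<Rightarrow> real) \<Rightarrow> bool" where
  "test_function \<phi> \<longleftrightarrow> (\<forall>k. C_k k \<phi>) \<and> compact (closure {x. \<phi> x \<noteq> 0})"

definition distr_div ::
    "(real ^ 'n::finite \<Rightarrow> real ^ 'n) \<Rightarrow> (real ^ 'n \<Rightarrow> real) \<Rightarrow> real" where
  "distr_div u \<phi> = - (LINT x|lborel. (\<Sum>i\<in>UNIV. u x $ i * partial_deriv i \<phi> x))"

definition div_is_function ::
    "(real ^ 'n::finite \<Rightarrow> real ^ 'n) \<Rightarrow> (real ^ 'n \<Rightarrow> real) \<Rightarrow> bool" where
  "div_is_function u g \<longleftrightarrow>
     g \<in> borel_measurable borel \<and>
     (\<forall>K. compact K \<longrightarrow> set_integrable lborel K g) \<and>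
     (\<forall>\<phi>. test_function \<phi> \<longrightarrow> distr_div u \<phi> = (LINT x|lborel. g x * \<phi> x))"

definition Lp_norm :: "ereal \<Rightarrow> (real ^ 'n::finite \<Rightarrow> real) \<Rightarrow> ereal" where
  "Lp_norm \<rho> g =
     (if \<rho> = \<infinity> then esssup lborel (\<lambda>x. ereal \<bar>g x\<bar>)
      else let p = real_of_ereal \<rho>; I = (\<integral>\<^sup>+ x. ennreal (\<bar>g x\<bar> powr p) \<partial>lborel)
           in if I = \<infinity> then \<infinity> else ereal (enn2real I powr (1 / p)))"

text \<open>The representing function is unique up to null sets, so the infimum is over at most one
  value; it is \<open>\<infinity>\<close> when the distribution is not given by a function.\<close>

definition div_Lp_norm :: "ereal \<Rightarrow> (real ^ 'n::finite \<Rightarrow> real ^ 'n) \<Rightarrow> ereal" where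
  "div_Lp_norm \<rho> u = Inf {Lp_norm \<rho> g | g. div_is_function u g}"

text \<open>A finite signed measure is encoded as a difference \<open>\<mu> - \<nu>\<close> of two finite measures.\<close>

definition finite_borel_measure :: "'a::topological_space measure \<Rightarrow> bool" where
  "finite_borel_measure \<mu> \<longleftrightarrow> finite_measure \<mu> \<and> sets \<mu> = sets borel"

definition TV_norm_diff :: "'a::topological_space measure \<Rightarrow> 'a measure \<Rightarrow> ereal" where
  "TV_norm_diff \<mu> \<nu> =
     (SUP \<phi> \<in> {\<phi>. \<phi> \<in> borel_measurable borel \<and> (\<forall>x. \<phi> x \<in> {-1..1::real})}.
        ereal ((LINT x|\<mu>. \<phi> x) - (LINT x|\<nu>. \<phi> x)))"

definition div_is_signed_measure ::
    "(real ^ 'n::finite \<Rightarrow> real ^ 'n) \<Rightarrow> (real ^ 'n) measure \<Rightarrow> (real ^ 'n) measure \<Rightarrow> bool" where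
  "div_is_signed_measure u \<mu> \<nu> \<longleftrightarrow>
     finite_borel_measure \<mu> \<and> finite_borel_measure \<nu> \<and>
     (\<forall>\<phi>. test_function \<phi> \<longrightarrow> distr_div u \<phi> = (LINT x|\<mu>. \<phi> x) - (LINT x|\<nu>. \<phi> x))"

text \<open>All pairs \<open>(\<mu>, \<nu>)\<close> below represent the same signed measure, so again the infimum
  is over at most one value. In dimension one the divergence is the derivative.\<close>

definition div_TV_norm :: "(real ^ 'n::finite \<Rightarrow> real ^ 'n) \<Rightarrow> ereal" where
  "div_TV_norm u = Inf {TV_norm_diff \<mu> \<nu> | \<mu> \<nu>. div_is_signed_measure u \<mu> \<nu>}"

section \<open>Brownian motion\<close>

text \<open>Independence of two random variables whose value types may differ
  (the library notion \<open>indep_var\<close> requires a common value type).\<close>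

definition indep_rv ::
    "'w measure \<Rightarrow> 'a measure \<Rightarrow> ('w \<Rightarrow> 'a) \<Rightarrow> 'b measure \<Rightarrow> ('w \<Rightarrow> 'b) \<Rightarrow> bool" where
  "indep_rv M A X B Y \<longleftrightarrow>
     X \<in> M \<rightarrow>\<^sub>M A \<and> Y \<in> M \<rightarrow>\<^sub>M B \<and>
     prob_space.indep_set M (sets (vimage_algebra (space M) X A))
                            (sets (vimage_algebra (space M) Y B))"

text \<open>A process indexed by \<open>[0,\<infinity>)\<close> seen as one random variable in the product space.\<close>

abbreviation path_space :: "(real \<Rightarrow> 'a::topological_space) measure" where
  "path_space \<equiv> (\<Pi>\<^sub>M t\<in>{0..}. borel)"

definition path_of :: "(real \<Rightarrow> 'w \<Rightarrow> 'a) \<Rightarrow> 'w \<Rightarrow> real \<Rightarrow> 'a" where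
  "path_of W \<omega> = (\<lambda>t\<in>{0..}. W t \<omega>)"

definition brownian_motion :: "'w measure \<Rightarrow> (real \<Rightarrow> 'w \<Rightarrow> real ^ 'n::finite) \<Rightarrow> bool" where
  "brownian_motion M W \<longleftrightarrow>
     (\<forall>t\<ge>0. W t \<in> borel_measurable M) \<and>
     (AE \<omega> in M. W 0 \<omega> = 0) \<and>
     (AE \<omega> in M. continuous_on {0..} (\<lambda>t. W t \<omega>)) \<and>
     (\<forall>s t. 0 \<le> s \<and> s < t \<longrightarrow>
        distributed M lborel (\<lambda>\<omega>. W t \<omega> - W s \<omega>)
          (\<lambda>x. ennreal (\<Prod>i\<in>UNIV. normal_density 0 (sqrt (t - s)) (x $ i)))) \<and>
     (\<forall>(n::nat) \<tau>. 0 \<le> \<tau> 0 \<and> (\<forall>i<n. \<tau> i \<le> \<tau> (Suc i)) \<longrightarrow>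
        prob_space.indep_vars M (\<lambda>_. borel) (\<lambda>i \<omega>. W (\<tau> (Suc i)) \<omega> - W (\<tau> i) \<omega>) {..<n})"

section \<open>The stochastic differential equation and the randomized Euler scheme\<close>

text \<open>As usual a solution is required to be adapted to some filtration that makes \<open>X0\<close>
  measurable at time 0 and for which \<open>W\<close> is still a Brownian motion. This includes strong
  solutions, i.e. those adapted to the augmented filtration of \<open>(X0, W)\<close>.\<close>

definition sde_solution ::
    "'w measure \<Rightarrow> real \<Rightarrow> (real \<Rightarrow> real ^ 'n \<Rightarrow> real ^ 'n) \<Rightarrow> ('w \<Rightarrow> real ^ 'n::finite) \<Rightarrow>
     (real \<Rightarrow> 'w \<Rightarrow> real ^ 'n) \<Rightarrow> (real \<Rightarrow> 'w \<Rightarrow> real ^ 'n) \<Rightarrow> bool" where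
  "sde_solution M T b X0 W X \<longleftrightarrow>
     (\<exists>F. filtration (space M) F \<and> (\<forall>t. subalgebra M (F t)) \<and>
        X0 \<in> borel_measurable (F 0) \<and>
        (\<forall>t\<ge>0. W t \<in> borel_measurable (F t)) \<and>
        (\<forall>s t. 0 \<le> s \<and> s < t \<longrightarrow>
           prob_space.indep_set M (sets (F s))
             (sets (vimage_algebra (space M) (\<lambda>\<omega>. W t \<omega> - W s \<omega>) borel))) \<and>
        (\<forall>t\<in>{0..T}. X t \<in> borel_measurable (F t))) \<and>
     (AE \<omega> in M. continuous_on {0..T} (\<lambda>t. X t \<omega>)) \<and>
     (AE \<omega> in M. \<forall>t\<in>{0..T}. X t \<omega> = X0 \<omega> + W t \<omega> + (LINT s:{0..t}|lborel. b s (X s \<omega>)))"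

definition random_times ::
    "'w measure \<Rightarrow> ('w \<Rightarrow> real ^ 'n) \<Rightarrow> (real \<Rightarrow> 'w \<Rightarrow> real ^ 'n::finite) \<Rightarrow>
     real \<Rightarrow> nat \<Rightarrow> (nat \<Rightarrow> 'w \<Rightarrow> real) \<Rightarrow> bool" where
  "random_times M X0 W h N \<delta> \<longleftrightarrow>
     prob_space.indep_vars M (\<lambda>_. borel) \<delta> {..<N} \<and>
     (\<forall>k<N. distr M borel (\<delta> k) = uniform_measure lborel {real k * h..real (k + 1) * h}) \<and>
     indep_rv M (\<Pi>\<^sub>M k\<in>{..<N}. borel) (\<lambda>\<omega>. \<lambda>k\<in>{..<N}. \<delta> k \<omega>)
                (borel \<Otimes>\<^sub>M path_space) (\<lambda>\<omega>. (X0 \<omega>, path_of W \<omega>))"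

text \<open>\<open>Y k\<close> is the value of the scheme at time \<open>k h\<close>. The recursion is imposed almost surely,
  so that the values of \<open>b\<close> outside the time interval are irrelevant.\<close>

definition randomized_euler ::
    "'w measure \<Rightarrow> (real \<Rightarrow> real ^ 'n \<Rightarrow> real ^ 'n) \<Rightarrow> ('w \<Rightarrow> real ^ 'n::finite) \<Rightarrow>
     (real \<Rightarrow> 'w \<Rightarrow> real ^ 'n) \<Rightarrow> real \<Rightarrow> nat \<Rightarrow> (nat \<Rightarrow> 'w \<Rightarrow> real) \<Rightarrow>
     (nat \<Rightarrow> 'w \<Rightarrow> real ^ 'n) \<Rightarrow> bool" where
  "randomized_euler M b X0 W h N \<delta> Y \<longleftrightarrow>
     (\<forall>k\<le>N. Y k \<in> borel_measurable M) \<and>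
     (AE \<omega> in M. Y 0 \<omega> = X0 \<omega>) \<and>
     (\<forall>k<N. AE \<omega> in M. Y (Suc k) \<omega> =
        Y k \<omega> + (W (real (k + 1) * h) \<omega> - W (real k * h) \<omega>) + h *\<^sub>R b (\<delta> k \<omega>) (Y k \<omega>))"

end

theory Submission
  imports Defs
begin

text \<open>Since the total variation norm is a supremum over measurable functions \<phi> with values in [-1, 1], one has
to bound E \<phi>(X_t) - E \<phi>(Y_n) for t = n h. Write P_s for the heat semigroup (\<open>heat s\<close>). Both expectations
are expanded along P.

For the diffusion, Duhamel's formula (theorem \<open>duhamel\<close>) reads
E \<phi>(X_t) = E P_t \<phi>(X_0) + \<integral>_0^t E (b_r \<bullet> \<nabla>P_{t-r} \<phi>)(X_r) dr.
For the scheme, E P_{t-jh} \<phi>(Y_j) changes in the step from j to j + 1 by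
\<integral>_{jh}^{(j+1)h} E (b_r \<bullet> \<nabla>P_{t-jh} \<phi>)(Y_j) dr, up to O(h / (n - j)) (\<open>euler_local\<close>): the Brownian increment
is exactly one step of the semigroup, the drift enters to first order, and because the time variable is
randomized it enters through its average over the interval, so that b need not be regular in time. The
remainders add up to h (1 + ln n), which is one source of the logarithm.

On each interval the two integrands are compared in three steps. The gradient of P_{t-r} \<phi> is replaced
by that of P_{t-jh} \<phi>; then X_r is replaced by X_{jh} inside the bounded function
\<psi> = b_r \<bullet> \<nabla>P_{t-jh} \<phi>, which is of size 1 / \<surd>(t - jh); finally X_{jh} is replaced by Y_j, which brings in
the error at the earlier time jh. The last step leads to a discrete Gronwall inequality with the weakly
singular kernel 1 / \<surd>(t - s) (\<open>singular_kernel\<close>, \<open>bound_by_halving\<close>), and the conclusion is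
\<open>euler_error\<close>.

For the first two steps the trivial bounds give only the rate \<surd>h: with \<tau> = t - r, the difference of
the gradients is O(min (1 / \<surd>\<tau>) (h / \<tau>^(3/2))), whose integral is O(\<surd>h), and the same differences
govern the regularity of the law in the second step. The order h is recovered from
|E (b_r \<bullet> \<nabla>P_\<epsilon> q)(X_r)| \<le> C sup|q| / \<surd>r uniformly in \<epsilon> > 0 (\<open>expectation_drift_grad\<close>): in
expectation, the singularity 1 / \<surd>\<epsilon> of the gradient is traded for a singularity at the initial time. With
q = P_{\<tau>/2+\<sigma>} \<phi> - P_{\<tau>/2} \<phi> = O(min 1 (\<sigma> / \<tau>)) this bounds the differences of gradients and, through
Duhamel's formula, the regularity in time of the law of X (\<open>expectation_time_regularity\<close>). The
uniform estimate is obtained by integration by parts, P_\<epsilon>(b \<bullet> \<nabla>f) = div P_\<epsilon>(b f) - P_\<epsilon>(f div b) with f = P_\<epsilon> q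
(\<open>heat_drift_by_parts\<close>): the first term is treated by Duhamel's formula again, and the second one
by a bound on Gaussian averages of |div b| along X (\<open>expectation_gauss_div\<close>).

The divergence enters only through \<open>gauss_div\<close>: it can be tested against Gaussians, and the averages of
its absolute value against Gaussians of variance s are O(1 + 1 / \<surd>s). This is where
the assumption comes in. If div b is in L^\<rho> with \<rho> \<ge> d, then Young's inequality
|g| \<le> a + |g|^\<rho> a^(1-\<rho>) with a = 1 + 1 / \<surd>s suffices, as the Gaussian is at most
s^(-d/2) \<le> a^d \<le> a^\<rho>. If d = 1 and div b is a finite signed measure, the Gaussian itself is at most 1 / \<surd>s.\<close>

section \<open>The Gaussian kernel\<close>

definition gk :: "real \<Rightarrow> real ^ 'n::finite \<Rightarrow> real" where
  "gk t x = (\<Prod>i\<in>UNIV. normal_density 0 (sqrt t) (x $ i))"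

definition bdd_meas :: "real \<Rightarrow> (real ^ 'n::finite \<Rightarrow> real) \<Rightarrow> bool" where
  "bdd_meas K g \<longleftrightarrow> g \<in> borel_measurable borel \<and> (\<forall>x. \<bar>g x\<bar> \<le> K)"

lemma bdd_measD:
  assumes "bdd_meas K g"
  shows "g \<in> borel_measurable borel" "\<And>x. \<bar>g x\<bar> \<le> K" "0 \<le> K"
  using assms unfolding bdd_meas_def by (auto intro: order_trans[OF abs_ge_zero])

lemma measurable_vec_component [measurable (raw)]:
  fixes f :: "'a \<Rightarrow> real ^ 'n::finite"
  assumes "f \<in> borel_measurable M"
  shows "(\<lambda>x. f x $ i) \<in> borel_measurable M"
proof -
  have "(\<lambda>x. f x \<bullet> axis i 1) \<in> borel_measurable M" using assms by measurable
  then show ?thesis by (simp add: inner_axis)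
qed

lemma measurable_gk [measurable (raw)]:
  assumes [measurable]: "f \<in> borel_measurable M" "g \<in> borel_measurable M"
  shows "(\<lambda>w. gk (f w) (g w :: real ^ 'n::finite)) \<in> borel_measurable M"
  unfolding gk_def normal_density_def by measurable

lemma gk_nonneg [simp]: "0 \<le> gk t x"
  unfolding gk_def by (intro prod_nonneg) auto

lemma gk_minus: "gk t (- x) = gk t x"
  unfolding gk_def normal_density_def by simp

lemma gk_minus_commute: "gk t (x - y) = gk t (y - x)"
  using gk_minus[of t "x - y"] by simp

lemma gk_exp:
  fixes x :: "real ^ 'n::finite"
  assumes "0 < t"
  shows "gk t x = (1 / sqrt (2 * pi * t)) ^ CARD('n) * exp (- (\<Sum>i\<in>UNIV. (x $ i)\<^sup>2) / (2 * t))"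
  using assms unfolding gk_def normal_density_def
  by (simp add: prod.distrib exp_sum sum_divide_distrib sum_negf [symmetric] power_one_over prod_dividef
      del: divide_minus_left)

lemma gk_le_sup:
  fixes x :: "real ^ 'n::finite"
  assumes "0 < t"
  shows "gk t x \<le> (1 / sqrt t) ^ CARD('n)"
proof -
  have "gk t x \<le> (1 / sqrt (2 * pi * t)) ^ CARD('n) * 1"
    unfolding gk_exp[OF assms] using assms
    by (intro mult_left_mono) (auto intro!: divide_nonneg_pos sum_nonneg)
  also have "\<dots> \<le> (1 / sqrt t) ^ CARD('n)"
    using assms pi_gt3
    by (auto intro!: power_mono divide_left_mono real_sqrt_le_mono simp: mult_le_cancel_right1)
  finally show ?thesis .
qed

text \<open>Completing the square: the kernel of a product of two Gaussians, seen as a function of the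
  middle point, is again Gaussian. The semigroup law, the commutation of the gradient with the
  semigroup and the integration by parts below all rest on this identity.\<close>

lemma gk_mult_gk:
  fixes x y w :: "real ^ 'n::finite"
  assumes "0 < s" "0 < t"
  shows "gk s (y - x) * gk t (w - y)
    = gk (s + t) (w - x) * gk (s * t / (s + t)) (y - (1 / (s + t)) *\<^sub>R (t *\<^sub>R x + s *\<^sub>R w))"
proof -
  have *: "normal_density 0 (sqrt s) (b - a) * normal_density 0 (sqrt t) (c - b)
    = normal_density 0 (sqrt (s + t)) (c - a)
      * normal_density 0 (sqrt (s * t / (s + t))) (b - (t * a + s * c) / (s + t))" for a b c
  proof -
    have 1: "- (b - a)\<^sup>2 / (2 * s) + - (c - b)\<^sup>2 / (2 * t)
      = - (c - a)\<^sup>2 / (2 * (s + t)) + - (b - (t * a + s * c) / (s + t))\<^sup>2 / (2 * (s * t / (s + t)))"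
    proof -
      have "b - (t * a + s * c) / (s + t) = (t * (b - a) - s * (c - b)) / (s + t)"
        using assms by (simp add: field_simps)
      moreover have "c - a = (b - a) + (c - b)" by simp
      ultimately show ?thesis
        using assms by (simp add: divide_simps power2_eq_square) (simp add: algebra_simps)
    qed
    have 2: "(2 * pi * s) * (2 * pi * t) = (2 * pi * (s + t)) * (2 * pi * (s * t / (s + t)))"
      using assms by (simp add: field_simps)
    have 3: "1 / sqrt (2 * pi * s) * (1 / sqrt (2 * pi * t))
        = 1 / sqrt (2 * pi * (s + t)) * (1 / sqrt (2 * pi * (s * t / (s + t))))"
      using arg_cong[OF 2, of sqrt] by (simp only: real_sqrt_mult[symmetric] times_divide_times_eq mult_1)
    have 4: "exp (- (b - a)\<^sup>2 / (2 * s)) * exp (- (c - b)\<^sup>2 / (2 * t)) = exp (- (c - a)\<^sup>2 / (2 * (s + t)))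
        * exp (- (b - (t * a + s * c) / (s + t))\<^sup>2 / (2 * (s * t / (s + t))))"
      by (simp only: exp_add[symmetric] 1)
    have 5: "(sqrt s)\<^sup>2 = s" "(sqrt t)\<^sup>2 = t" "(sqrt (s + t))\<^sup>2 = s + t"
      "(sqrt (s * t / (s + t)))\<^sup>2 = s * t / (s + t)"
      using assms by simp_all
    have 6: "(p * q) * (p' * q') = (u * v) * (u' * v')" if "p * p' = u * u'" "q * q' = v * v'"
      for p q p' q' u v u' v' :: real
      using that by (metis mult.commute mult.left_commute)
    show ?thesis
      unfolding normal_density_def 5 diff_0_right by (rule 6[OF 3 4])
  qed
  show ?thesis
    unfolding gk_def prod.distrib[symmetric]
    by (intro prod.cong refl) (simp add: * )
qed

section \<open>The heat semigroup\<close>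

lemma prod_Basis_vec:
  fixes f :: "'n::finite \<Rightarrow> 'a::comm_monoid_mult"
  shows "(\<Prod>b\<in>Basis. f (THE i. b = (axis i 1 :: real ^ 'n))) = (\<Prod>i\<in>UNIV. f i)"
proof -
  have B: "(Basis :: (real ^ 'n) set) = (\<lambda>i. axis i 1) ` UNIV"
    unfolding Basis_vec_def by auto
  have "inj (\<lambda>i. axis i (1::real) :: real ^ 'n)"
    by (auto simp: inj_def axis_eq_axis)
  then show ?thesis
    unfolding B by (subst prod.reindex) (auto simp: axis_eq_axis intro!: prod.cong arg_cong[where f=f])
qed

lemma nn_integral_prod_components:
  fixes f :: "'n::finite \<Rightarrow> real \<Rightarrow> ennreal"
  assumes [measurable]: "\<And>i. f i \<in> borel_measurable borel"
  shows "(\<integral>\<^sup>+x. (\<Prod>i\<in>UNIV. f i (x $ i)) \<partial>(lborel :: (real ^ 'n) measure)) = (\<Prod>i\<in>UNIV. \<integral>\<^sup>+y. f i y \<partial>lborel)"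
proof -
  define g where "g b = f (THE i. b = (axis i 1 :: real ^ 'n))" for b
  have "(\<integral>\<^sup>+x. (\<Prod>b\<in>Basis. g b (x \<bullet> b)) \<partial>(lborel :: (real ^ 'n) measure)) = (\<Prod>b\<in>Basis. \<integral>\<^sup>+y. g b y \<partial>lborel)"
    by (rule nn_integral_lborel_prod) (auto simp: g_def)
  moreover have "(\<Prod>b\<in>Basis. g b (x \<bullet> b)) = (\<Prod>i\<in>UNIV. f i (x $ i))" for x :: "real ^ 'n"
  proof -
    have "(\<Prod>b\<in>Basis. g b (x \<bullet> b)) = (\<Prod>b\<in>Basis. (\<lambda>i. f i (x $ i)) (THE i. b = (axis i 1 :: real ^ 'n)))"
      by (rule prod.cong[OF refl]) (auto simp: g_def Basis_vec_def axis_eq_axis inner_axis)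
    then show ?thesis using prod_Basis_vec[of "\<lambda>i. f i (x $ i)"] by simp
  qed
  moreover have "(\<Prod>b\<in>Basis. \<integral>\<^sup>+y. g b y \<partial>lborel) = (\<Prod>i\<in>UNIV. \<integral>\<^sup>+y. f i y \<partial>lborel)"
    unfolding g_def by (rule prod_Basis_vec)
  ultimately show ?thesis by simp
qed

lemma nn_integral_gk_0:
  assumes "0 < t"
  shows "(\<integral>\<^sup>+x. ennreal (gk t (x :: real ^ 'n::finite)) \<partial>lborel) = 1"
proof -
  have *: "(\<integral>\<^sup>+y. ennreal (normal_density 0 (sqrt t) y) \<partial>lborel) = 1"
    using assms by (subst nn_integral_eq_integral) auto
  show ?thesis
    using nn_integral_prod_components[of "\<lambda>(i::'n) y. ennreal (normal_density 0 (sqrt t) y)"]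
    unfolding gk_def by (simp add: prod_ennreal * )
qed

lemma lborel_distr_reflect:
  fixes c :: "'a::euclidean_space"
  shows "distr lborel borel (\<lambda>y. c - y) = lborel"
  using lborel_affine[of "-1" c] by (simp add: density_1)

lemma nn_integral_reflect:
  fixes c :: "'a::euclidean_space"
  assumes [measurable]: "f \<in> borel_measurable borel"
  shows "(\<integral>\<^sup>+y. f (c - y) \<partial>lborel) = (\<integral>\<^sup>+y. f y \<partial>lborel)"
  by (subst (2) lborel_distr_reflect[symmetric, of c], subst nn_integral_distr) auto

lemma integral_reflect:
  fixes c :: "'a::euclidean_space" and f :: "'a \<Rightarrow> real"
  assumes [measurable]: "f \<in> borel_measurable borel"
  shows "(\<integral>y. f (c - y) \<partial>lborel) = (\<integral>y. f y \<partial>lborel)"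
  by (subst (2) lborel_distr_reflect[symmetric, of c], subst integral_distr) auto

lemma nn_integral_gk:
  fixes x :: "real ^ 'n::finite"
  assumes "0 < t"
  shows "(\<integral>\<^sup>+y. ennreal (gk t (y - x)) \<partial>lborel) = 1" "(\<integral>\<^sup>+y. ennreal (gk t (x - y)) \<partial>lborel) = 1"
  using nn_integral_reflect[of "\<lambda>y. ennreal (gk t y)" x] nn_integral_gk_0[OF assms, where 'n='n]
  by (simp_all add: gk_minus_commute[of t _ x])

lemma integrable_gk: "0 < t \<Longrightarrow> integrable lborel (\<lambda>y. gk t (y - x :: real ^ 'n::finite))"
  by (intro integrableI_bounded) (auto simp: nn_integral_gk)

lemma integral_gk: "0 < t \<Longrightarrow> (\<integral>y. gk t (y - x :: real ^ 'n::finite) \<partial>lborel) = 1"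
  by (subst integral_eq_nn_integral) (auto simp: nn_integral_gk)

lemma normal_density_double: "0 < t \<Longrightarrow> normal_density 0 (sqrt t) y \<le> sqrt 2 * normal_density 0 (sqrt (2 * t)) y"
proof -
  assume t: "0 < t"
  have "exp (- (y\<^sup>2 / (t * 2))) \<le> exp (- (y\<^sup>2 / (t * 4)))" using t by (simp add: field_simps)
  then have "1 / sqrt (2 * pi * t) * exp (- (y\<^sup>2 / (t * 2))) \<le> 1 / sqrt (2 * pi * t) * exp (- (y\<^sup>2 / (t * 4)))"
    using t by (intro mult_left_mono) auto
  moreover have "1 / sqrt (2 * pi * t) = sqrt 2 * (1 / sqrt (2 * pi * (2 * t)))"
    using t real_sqrt_mult[of 2 "2 * pi * t"] by (simp add: mult_ac)
  ultimately have "1 / sqrt (2 * pi * t) * exp (- (y\<^sup>2 / (t * 2))) \<le> sqrt 2 * (1 / sqrt (2 * pi * (2 * t))) * exp (- (y\<^sup>2 / (t * 4)))"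
    by simp
  then show ?thesis using t
    unfolding normal_density_def by (simp add: mult_ac)
qed

lemma abs_mult_normal_density:
  assumes "0 < t"
  shows "\<bar>y\<bar> / t * normal_density 0 (sqrt t) y \<le> sqrt 2 * (1 / sqrt t) * normal_density 0 (sqrt (2 * t)) y"
proof -
  define z where "z = y / sqrt t"
  have y: "y = z * sqrt t" using assms by (simp add: z_def)
  have "\<bar>z\<bar> \<le> 1 + z\<^sup>2 / 4"
    using zero_le_power2[of "\<bar>z\<bar> / 2 - 1"] by (simp add: power2_eq_square algebra_simps)
  also have "\<dots> \<le> exp (z\<^sup>2 / 4)" by (rule exp_ge_add_one_self)
  finally have "\<bar>z\<bar> * exp (- z\<^sup>2 / 2) \<le> exp (z\<^sup>2 / 4) * exp (- z\<^sup>2 / 2)" by (intro mult_right_mono) auto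
  also have "\<dots> = exp (- z\<^sup>2 / 4)" by (simp add: exp_add[symmetric])
  finally have *: "\<bar>z\<bar> * exp (- z\<^sup>2 / 2) \<le> exp (- z\<^sup>2 / 4)" .
  have "\<bar>y\<bar> / t * normal_density 0 (sqrt t) y = (1 / sqrt t * (1 / sqrt (2 * pi * t))) * (\<bar>z\<bar> * exp (- z\<^sup>2 / 2))"
    using assms by (simp add: normal_density_def y abs_mult power_mult_distrib field_simps)
  also have "\<dots> \<le> (1 / sqrt t * (1 / sqrt (2 * pi * t))) * exp (- z\<^sup>2 / 4)"
    using assms * by (intro mult_left_mono) auto
  also have "\<dots> = sqrt 2 * (1 / sqrt t) * normal_density 0 (sqrt (2 * t)) y"
    using assms by (simp add: normal_density_def y abs_mult power_mult_distrib real_sqrt_mult field_simps)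
  finally show ?thesis .
qed

text \<open>One factor \<open>y $ i\<close> costs \<open>sqrt t\<close> and a doubling of the variance. As the estimate
  is pointwise, it also yields the moment bounds needed for the Gaussian.\<close>

lemma component_mult_gk:
  fixes x :: "real ^ 'n::finite"
  assumes "0 < t"
  shows "\<bar>x $ i\<bar> / t * gk t x \<le> sqrt 2 ^ CARD('n) / sqrt t * gk (2 * t) x"
proof -
  have "\<bar>x $ i\<bar> / t * gk t x = (\<bar>x $ i\<bar> / t * normal_density 0 (sqrt t) (x $ i)) * (\<Prod>j\<in>UNIV-{i}. normal_density 0 (sqrt t) (x $ j))"
    unfolding gk_def by (subst prod.remove[of _ i]) auto
  also have "\<dots> \<le> (sqrt 2 * (1 / sqrt t) * normal_density 0 (sqrt (2 * t)) (x $ i)) * (\<Prod>j\<in>UNIV-{i}. sqrt 2 * normal_density 0 (sqrt (2 * t)) (x $ j))"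
    using assms
    by (intro mult_mono abs_mult_normal_density prod_mono conjI normal_density_double prod_nonneg mult_nonneg_nonneg) auto
  also have "\<dots> = (1 / sqrt t) * (\<Prod>j\<in>UNIV. sqrt 2 * normal_density 0 (sqrt (2 * t)) (x $ j))"
    by (subst (2) prod.remove[of _ i]) auto
  also have "\<dots> = sqrt 2 ^ CARD('n) / sqrt t * gk (2 * t) x"
    unfolding gk_def by (simp add: prod.distrib)
  finally show ?thesis .
qed

text \<open>At \<open>t = 0\<close> the kernel vanishes identically, because the normalising factor is a
  division by zero; the value there is therefore prescribed separately.\<close>

definition heat :: "real \<Rightarrow> (real ^ 'n::finite \<Rightarrow> real) \<Rightarrow> real ^ 'n \<Rightarrow> real" where
  "heat t g x = (if t = 0 then g x else LINT y|lborel. gk t (y - x) * g y)"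

text \<open>The partial derivative of \<open>heat t g\<close> in direction \<open>i\<close>, with the derivative put on the
  kernel. That it is the gradient is expressed by \<open>heat_ftc\<close> below. At \<open>t = 0\<close> it is 0, again because of
  the division by zero.\<close>

definition hgrad :: "real \<Rightarrow> 'n \<Rightarrow> (real ^ 'n::finite \<Rightarrow> real) \<Rightarrow> real ^ 'n \<Rightarrow> real" where
  "hgrad t i g x = (LINT y|lborel. ((y - x) $ i / t * gk t (y - x)) * g y)"

lemma heat_0 [simp]: "heat 0 g = g"
  by (simp add: heat_def fun_eq_iff)

lemma heat_pos: "0 < t \<Longrightarrow> heat t g x = (LINT y|lborel. gk t (y - x) * g y)"
  by (simp add: heat_def)

lemma measurable_heat_pair [measurable (raw)]:
  assumes [measurable]: "f \<in> borel_measurable M" "x \<in> borel_measurable M" "g \<in> borel_measurable borel"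
  shows "(\<lambda>w. heat (f w) g (x w :: real ^ 'n::finite)) \<in> borel_measurable M"
  unfolding heat_def by measurable

lemma measurable_hgrad_pair [measurable (raw)]:
  assumes [measurable]: "f \<in> borel_measurable M" "x \<in> borel_measurable M" "g \<in> borel_measurable borel"
  shows "(\<lambda>w. hgrad (f w) i g (x w :: real ^ 'n::finite)) \<in> borel_measurable M"
  unfolding hgrad_def by measurable

lemma integrable_gk_mult:
  fixes x :: "real ^ 'n::finite"
  assumes "0 < t" and [measurable]: "g \<in> borel_measurable borel" and "\<And>y. \<bar>g y\<bar> \<le> K"
  shows "integrable lborel (\<lambda>y. gk t (y - x) * g y)"
proof (rule Bochner_Integration.integrable_bound)
  show "integrable lborel (\<lambda>y. K * gk t (y - x))" using integrable_gk[OF assms(1), of x] by simp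
  show "AE y in lborel. norm (gk t (y - x) * g y) \<le> norm (K * gk t (y - x))"
    using assms(3) order_trans[OF abs_ge_zero assms(3)] by (intro AE_I2) (auto simp: abs_mult mult.commute intro!: mult_right_mono)
qed simp

lemma integrable_gk_component:
  fixes x :: "real ^ 'n::finite"
  assumes "0 < t" and [measurable]: "g \<in> borel_measurable borel" and "\<And>y. \<bar>g y\<bar> \<le> K"
  shows "integrable lborel (\<lambda>y. ((y - x) $ i / t * gk t (y - x)) * g y)"
proof (rule Bochner_Integration.integrable_bound)
  show "integrable lborel (\<lambda>y. sqrt 2 ^ CARD('n) / sqrt t * gk (2 * t) (y - x) * K)"
    using integrable_gk[of "2 * t" x] assms(1) by simp
  have "\<bar>(y - x) $ i / t * gk t (y - x) * g y\<bar> \<le> sqrt 2 ^ CARD('n) / sqrt t * gk (2 * t) (y - x) * K" for y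
    using mult_mono[OF component_mult_gk[OF assms(1), of "y - x" i] assms(3)[of y]] assms(1)
    by (simp only: abs_mult abs_divide abs_of_pos[OF assms(1)] abs_of_nonneg[OF gk_nonneg]) simp
  then show "AE y in lborel. norm ((y - x) $ i / t * gk t (y - x) * g y) \<le> norm (sqrt 2 ^ CARD('n) / sqrt t * gk (2 * t) (y - x) * K)"
    by (intro AE_I2) (metis real_norm_def abs_ge_self order_trans)
qed simp

lemma abs_heat_le:
  assumes "0 \<le> t" "bdd_meas K g"
  shows "\<bar>heat t g x\<bar> \<le> K"
proof (cases "t = 0")
  case False
  then have t: "0 < t" using assms by simp
  have "\<bar>LINT y|lborel. gk t (y - x) * g y\<bar> \<le> (LINT y|lborel. K * gk t (y - x))"
    using bdd_measD[OF assms(2)] t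
    by (intro integral_abs_bound_integral integrable_gk_mult integrable_mult_right integrable_gk)
      (auto simp: abs_mult mult.commute intro!: mult_right_mono)
  then show ?thesis using t by (simp add: heat_def integral_gk)
qed (use bdd_measD[OF assms(2)] in simp)

lemma bdd_meas_heat: "0 \<le> t \<Longrightarrow> bdd_meas K g \<Longrightarrow> bdd_meas K (heat t g)"
  unfolding bdd_meas_def using abs_heat_le[of t K g] by (auto simp: bdd_meas_def)

text \<open>The bound by the heat flow instead of the supremum matters when \<open>g\<close> is a Gaussian average
  of the divergence, whose supremum blows up as its variance tends to 0 while its expectation along the
  diffusion stays bounded.\<close>

lemma abs_hgrad_le_heat:
  assumes t: "0 < t" and g: "bdd_meas K g"
  shows "\<bar>hgrad t i g (x :: real ^ 'n::finite)\<bar> \<le> sqrt 2 ^ CARD('n) / sqrt t * heat (2 * t) (\<lambda>y. \<bar>g y\<bar>) x"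
proof -
  note [measurable] = bdd_measD(1)[OF g]
  have "\<bar>hgrad t i g x\<bar> \<le> (LINT y|lborel. sqrt 2 ^ CARD('n) / sqrt t * (gk (2 * t) (y - x) * \<bar>g y\<bar>))"
    unfolding hgrad_def
  proof (intro integral_abs_bound_integral)
    fix y
    show "\<bar>(y - x) $ i / t * gk t (y - x) * g y\<bar> \<le> sqrt 2 ^ CARD('n) / sqrt t * (gk (2 * t) (y - x) * \<bar>g y\<bar>)"
      using mult_right_mono[OF component_mult_gk[OF t, of "y - x" i] abs_ge_zero[of "g y"]] t
      by (simp add: abs_mult mult.assoc)
  next
    show "integrable lborel (\<lambda>y. (y - x) $ i / t * gk t (y - x) * g y)"
      using t bdd_measD(1,2)[OF g] by (rule integrable_gk_component)
    show "integrable lborel (\<lambda>y. sqrt 2 ^ CARD('n) / sqrt t * (gk (2 * t) (y - x) * \<bar>g y\<bar>))"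
      using t bdd_measD[OF g] by (intro integrable_mult_right integrable_gk_mult[where K=K]) auto
  qed
  then show ?thesis using t by (simp add: heat_pos)
qed

lemma abs_hgrad_le:
  assumes t: "0 < t" and g: "bdd_meas K g"
  shows "\<bar>hgrad t i g (x :: real ^ 'n::finite)\<bar> \<le> sqrt 2 ^ CARD('n) / sqrt t * K"
proof -
  have "bdd_meas K (\<lambda>y. \<bar>g y\<bar>)" using g by (auto simp: bdd_meas_def)
  from abs_heat_le[OF _ this, of "2 * t" x] t show ?thesis
    by (intro order_trans[OF abs_hgrad_le_heat[OF t g]] mult_left_mono) auto
qed

lemma bdd_meas_hgrad:
  "0 < t \<Longrightarrow> bdd_meas K g \<Longrightarrow> bdd_meas (sqrt 2 ^ CARD('n) / sqrt t * K) (hgrad t i (g :: real ^ 'n::finite \<Rightarrow> real))"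
  unfolding bdd_meas_def using abs_hgrad_le[of t K g i] by (auto simp: bdd_meas_def)

lemma integrable_pairI:
  fixes f :: "'a \<times> 'b \<Rightarrow> real"
  assumes "sigma_finite_measure M2" and [measurable]: "f \<in> borel_measurable (M1 \<Otimes>\<^sub>M M2)"
    and le: "\<And>x. x \<in> space M1 \<Longrightarrow> (\<integral>\<^sup>+y. ennreal \<bar>f (x, y)\<bar> \<partial>M2) \<le> ennreal (u x)"
    and u: "integrable M1 u"
  shows "integrable (M1 \<Otimes>\<^sub>M M2) f"
proof (rule integrableI_bounded)
  interpret sigma_finite_measure M2 by fact
  have "(\<integral>\<^sup>+z. ennreal (norm (f z)) \<partial>(M1 \<Otimes>\<^sub>M M2)) = (\<integral>\<^sup>+x. \<integral>\<^sup>+y. ennreal (norm (f (x, y))) \<partial>M2 \<partial>M1)"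
    by (rule nn_integral_fst[symmetric]) simp
  also have "\<dots> \<le> (\<integral>\<^sup>+x. ennreal (norm (u x)) \<partial>M1)"
    using le by (intro nn_integral_mono) (auto intro!: order_trans[OF le] ennreal_leI)
  also have "\<dots> < \<infinity>" using u by (simp add: integrable_iff_bounded)
  finally show "(\<integral>\<^sup>+z. ennreal (norm (f z)) \<partial>(M1 \<Otimes>\<^sub>M M2)) < \<infinity>" .
qed simp

text \<open>Fubini's theorem for the composition of two integral kernels. The semigroup laws and the
  integration by parts are obtained by computing the inner integral on the right-hand side.\<close>

lemma kernel_comp:
  fixes a :: "'a \<Rightarrow> real" and b :: "'a \<times> 'b \<Rightarrow> real"
  assumes "sigma_finite_measure M1" "sigma_finite_measure M2"
    and [measurable]: "b \<in> borel_measurable (M1 \<Otimes>\<^sub>M M2)" "g \<in> borel_measurable M2"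
    and a: "integrable M1 a"
    and b: "\<And>y. y \<in> space M1 \<Longrightarrow> (\<integral>\<^sup>+w. ennreal \<bar>b (y, w)\<bar> \<partial>M2) \<le> ennreal C" "0 \<le> C"
    and g: "\<And>w. \<bar>g w\<bar> \<le> K" "0 \<le> K"
  shows "(\<integral>y. a y * (\<integral>w. b (y, w) * g w \<partial>M2) \<partial>M1) = (\<integral>w. (\<integral>y. a y * b (y, w) \<partial>M1) * g w \<partial>M2)"
    and "integrable M2 (\<lambda>w. (\<integral>y. a y * b (y, w) \<partial>M1) * g w)"
proof -
  interpret M1: sigma_finite_measure M1 by fact
  interpret M2: sigma_finite_measure M2 by fact
  interpret pair_sigma_finite M1 M2 ..
  have [measurable]: "a \<in> borel_measurable M1" using a by auto
  have int: "integrable (M1 \<Otimes>\<^sub>M M2) (\<lambda>(y, w). a y * b (y, w) * g w)"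
  proof (rule integrable_pairI[where u="\<lambda>y. \<bar>a y\<bar> * (C * K)"])
    fix y assume y: "y \<in> space M1"
    then have [measurable]: "(\<lambda>w. b (y, w)) \<in> borel_measurable M2" by simp
    have "(\<integral>\<^sup>+w. ennreal \<bar>case (y, w) of (y, w) \<Rightarrow> a y * b (y, w) * g w\<bar> \<partial>M2)
      \<le> (\<integral>\<^sup>+w. ennreal (\<bar>a y\<bar> * K) * ennreal \<bar>b (y, w)\<bar> \<partial>M2)"
      using g by (intro nn_integral_mono)
        (auto simp: abs_mult ennreal_mult[symmetric] mult.assoc mult.commute[of K] intro!: ennreal_leI mult_left_mono)
    also have "\<dots> = ennreal (\<bar>a y\<bar> * K) * (\<integral>\<^sup>+w. ennreal \<bar>b (y, w)\<bar> \<partial>M2)"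
      by (rule nn_integral_cmult) simp
    also have "\<dots> \<le> ennreal (\<bar>a y\<bar> * K) * ennreal C" by (intro mult_left_mono b y) simp
    also have "\<dots> = ennreal (\<bar>a y\<bar> * (C * K))" using b(2) g(2) by (simp add: ennreal_mult[symmetric] mult_ac)
    finally show "(\<integral>\<^sup>+w. ennreal \<bar>case (y, w) of (y, w) \<Rightarrow> a y * b (y, w) * g w\<bar> \<partial>M2) \<le> ennreal (\<bar>a y\<bar> * (C * K))" .
  qed (use a in \<open>auto intro!: M2.sigma_finite_measure_axioms\<close>)
  from integrable_snd[OF int] show "integrable M2 (\<lambda>w. (\<integral>y. a y * b (y, w) \<partial>M1) * g w)" by simp
  from Fubini_integral[OF int]
  have "(\<integral>w. (\<integral>y. a y * b (y, w) * g w \<partial>M1) \<partial>M2) = (\<integral>y. (\<integral>w. a y * b (y, w) * g w \<partial>M2) \<partial>M1)" .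
  then show "(\<integral>y. a y * (\<integral>w. b (y, w) * g w \<partial>M2) \<partial>M1) = (\<integral>w. (\<integral>y. a y * b (y, w) \<partial>M1) * g w \<partial>M2)"
    by (simp add: mult.assoc integral_mult_left_zero[symmetric] del: integral_mult_left_zero)
qed

lemma nn_integral_gk_component:
  fixes x :: "real ^ 'n::finite"
  assumes t: "0 < t"
  shows "(\<integral>\<^sup>+y. ennreal \<bar>(y - x) $ i / t * gk t (y - x)\<bar> \<partial>lborel) \<le> ennreal (sqrt 2 ^ CARD('n) / sqrt t)"
proof -
  have "(\<integral>\<^sup>+y. ennreal \<bar>(y - x) $ i / t * gk t (y - x)\<bar> \<partial>lborel)
      \<le> (\<integral>\<^sup>+y. ennreal (sqrt 2 ^ CARD('n) / sqrt t) * ennreal (gk (2 * t) (y - x)) \<partial>lborel)"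
  proof (intro nn_integral_mono)
    fix y
    show "ennreal \<bar>(y - x) $ i / t * gk t (y - x)\<bar> \<le> ennreal (sqrt 2 ^ CARD('n) / sqrt t) * ennreal (gk (2 * t) (y - x))"
      using component_mult_gk[OF t, of "y - x" i] t
      by (simp only: abs_mult abs_divide abs_of_pos[OF t] abs_of_nonneg[OF gk_nonneg])
        (auto simp: ennreal_mult[symmetric] intro!: ennreal_leI)
  qed
  also have "\<dots> = ennreal (sqrt 2 ^ CARD('n) / sqrt t)"
    using t by (subst nn_integral_cmult) (auto simp: nn_integral_gk)
  finally show ?thesis .
qed

lemma integrable_gk_component': "0 < t \<Longrightarrow> integrable lborel (\<lambda>y. (y - x) $ i / t * gk t (y - x :: real ^ 'n::finite))"
  using integrable_gk_component[of t "\<lambda>_. 1" 1 x i] by simp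

lemma integral_gk_component:
  fixes x :: "real ^ 'n::finite"
  assumes t: "0 < t"
  shows "(\<integral>y. (y - x) $ i / t * gk t (y - x) \<partial>lborel) = 0"
proof -
  have "(\<integral>y. (y - x) $ i / t * gk t (y - x) \<partial>lborel) = (\<integral>y. (2 *\<^sub>R x - y - x) $ i / t * gk t (2 *\<^sub>R x - y - x) \<partial>lborel)"
    by (rule integral_reflect[symmetric]) measurable
  also have "\<dots> = (\<integral>y. - ((y - x) $ i / t * gk t (y - x)) \<partial>lborel)"
  proof (rule Bochner_Integration.integral_cong[OF refl])
    fix y
    have "2 *\<^sub>R x - y - x = - (y - x)" by (simp add: scaleR_2)
    then show "(2 *\<^sub>R x - y - x) $ i / t * gk t (2 *\<^sub>R x - y - x) = - ((y - x) $ i / t * gk t (y - x))"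
      by (simp only: gk_minus vector_uminus_component minus_divide_left[symmetric] mult_minus_left)
  qed
  finally show ?thesis by simp
qed

lemma integral_gk_gk:
  fixes x w :: "real ^ 'n::finite"
  assumes "0 < s" "0 < t"
  shows "(\<integral>y. gk s (y - x) * gk t (w - y) \<partial>lborel) = gk (s + t) (w - x)"
  using assms by (simp add: gk_mult_gk integral_gk)

text \<open>By \<open>gk_mult_gk\<close> the integral is a first moment of a Gaussian centred at \<open>c\<close>, so only
  \<open>c - x\<close>, a multiple of \<open>w - x\<close>, remains.\<close>

lemma integral_gk_component_gk:
  fixes x w :: "real ^ 'n::finite"
  assumes s: "0 < s" and t: "0 < t"
  shows "(\<integral>y. ((y - x) $ i / s * gk s (y - x)) * gk t (w - y) \<partial>lborel) = (w - x) $ i / (s + t) * gk (s + t) (w - x)"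
proof -
  define c where "c = (1 / (s + t)) *\<^sub>R (t *\<^sub>R x + s *\<^sub>R w)"
  define r where "r = s * t / (s + t)"
  have r: "0 < r" using s t by (simp add: r_def)
  have "((y - x) $ i / s * gk s (y - x)) * gk t (w - y)
      = gk (s + t) (w - x) * (r / s) * ((y - c) $ i / r * gk r (y - c)) + (w - x) $ i / (s + t) * gk (s + t) (w - x) * gk r (y - c)" for y
  proof -
    have "c - x = (s / (s + t)) *\<^sub>R (w - x)"
    proof -
      have "1 / (s + t) * (t * a + s * b) - a = s / (s + t) * (b - a)" for a b
        using s t by (simp add: divide_simps) (simp add: algebra_simps)
      then show ?thesis by (simp add: c_def vec_eq_iff)
    qed
    then have "(c - x) $ i = s / (s + t) * (w - x) $ i" by (simp only: vector_scaleR_component real_scaleR_def)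
    then have "(c - x) $ i / s = (w - x) $ i / (s + t)" using s by simp
    moreover have "(y - x) $ i / s = (y - c) $ i / s + (c - x) $ i / s" by (simp add: diff_divide_distrib)
    ultimately have "(y - x) $ i / s = (y - c) $ i / s + (w - x) $ i / (s + t)" by simp
    moreover have "(y - c) $ i / s = (r / s) * ((y - c) $ i / r)" using r by simp
    ultimately have "((y - x) $ i / s) * (gk s (y - x) * gk t (w - y))
        = ((r / s) * ((y - c) $ i / r) + (w - x) $ i / (s + t)) * (gk (s + t) (w - x) * gk r (y - c))"
      unfolding gk_mult_gk[OF s t] c_def[symmetric] r_def[symmetric] by (simp only:)
    then show ?thesis by (simp add: algebra_simps)
  qed
  then have "(\<integral>y. ((y - x) $ i / s * gk s (y - x)) * gk t (w - y) \<partial>lborel)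
      = (\<integral>y. gk (s + t) (w - x) * (r / s) * ((y - c) $ i / r * gk r (y - c)) + (w - x) $ i / (s + t) * gk (s + t) (w - x) * gk r (y - c) \<partial>lborel)"
    by (intro Bochner_Integration.integral_cong[OF refl])
  also have "\<dots> = gk (s + t) (w - x) * (r / s) * (\<integral>y. (y - c) $ i / r * gk r (y - c) \<partial>lborel)
      + (w - x) $ i / (s + t) * gk (s + t) (w - x) * (\<integral>y. gk r (y - c) \<partial>lborel)"
    unfolding integral_mult_right_zero[symmetric]
    by (rule Bochner_Integration.integral_add)
      (intro integrable_mult_right integrable_gk_component' integrable_gk r)+
  finally show ?thesis using r by (simp only: integral_gk_component integral_gk mult_zero_right add_0 mult_1_right)
qed

lemma integral_gk_gk_component:
  fixes x w :: "real ^ 'n::finite"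
  assumes s: "0 < s" and t: "0 < t"
  shows "(\<integral>y. gk s (y - x) * ((w - y) $ i / t * gk t (w - y)) \<partial>lborel) = (w - x) $ i / (s + t) * gk (s + t) (w - x)"
proof -
  have "(\<integral>y. gk s (y - x) * ((w - y) $ i / t * gk t (w - y)) \<partial>lborel)
      = (\<integral>y. gk s (x + w - y - x) * ((w - (x + w - y)) $ i / t * gk t (w - (x + w - y))) \<partial>lborel)"
    by (rule integral_reflect[symmetric]) simp
  also have "\<dots> = (\<integral>y. ((y - x) $ i / t * gk t (y - x)) * gk s (w - y) \<partial>lborel)"
    by (rule Bochner_Integration.integral_cong[OF refl]) (simp add: algebra_simps)
  finally show ?thesis unfolding integral_gk_component_gk[OF t s] by (simp add: add.commute)
qed

lemma heat_heat:
  fixes g :: "real ^ 'n::finite \<Rightarrow> real"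
  assumes s: "0 \<le> s" and t: "0 \<le> t" and g: "bdd_meas K g"
  shows "heat s (heat t g) = heat (s + t) g"
proof (cases "s = 0 \<or> t = 0")
  case False
  then have s: "0 < s" and t: "0 < t" using s t by auto
  note [measurable] = bdd_measD(1)[OF g]
  show ?thesis
  proof
    fix x
    have "heat s (heat t g) x = (LINT y|lborel. gk s (y - x) * (LINT w|lborel. (\<lambda>(y, w). gk t (w - y)) (y, w) * g w))"
      using s t by (simp add: heat_pos)
    also have "\<dots> = (LINT w|lborel. (LINT y|lborel. gk s (y - x) * (\<lambda>(y, w). gk t (w - y)) (y, w)) * g w)"
      using s t bdd_measD[OF g]
      by (intro kernel_comp(1)[where C=1 and K=K]) (auto simp: nn_integral_gk integrable_gk lborel.sigma_finite_measure_axioms)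
    also have "\<dots> = heat (s + t) g x"
      using s t by (simp add: heat_pos integral_gk_gk)
    finally show "heat s (heat t g) x = heat (s + t) g x" .
  qed
qed auto

lemma hgrad_heat:
  fixes g :: "real ^ 'n::finite \<Rightarrow> real"
  assumes s: "0 < s" and t: "0 \<le> t" and g: "bdd_meas K g"
  shows "hgrad s i (heat t g) = hgrad (s + t) i g"
proof (cases "t = 0")
  case False
  then have t: "0 < t" using t by auto
  note [measurable] = bdd_measD(1)[OF g]
  show ?thesis
  proof
    fix x
    have "hgrad s i (heat t g) x = (LINT y|lborel. ((y - x) $ i / s * gk s (y - x)) * (LINT w|lborel. (\<lambda>(y, w). gk t (w - y)) (y, w) * g w))"
      using s t by (simp add: heat_pos hgrad_def)
    also have "\<dots> = (LINT w|lborel. (LINT y|lborel. ((y - x) $ i / s * gk s (y - x)) * (\<lambda>(y, w). gk t (w - y)) (y, w)) * g w)"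
      using s t bdd_measD[OF g] integrable_gk_component'[OF s, of x i]
      by (intro kernel_comp(1)[where C=1 and K=K]) (auto simp: nn_integral_gk lborel.sigma_finite_measure_axioms)
    also have "\<dots> = hgrad (s + t) i g x"
      unfolding hgrad_def prod.case integral_gk_component_gk[OF s t] by (rule refl)
    finally show "hgrad s i (heat t g) x = hgrad (s + t) i g x" .
  qed
qed auto

lemma heat_hgrad:
  fixes g :: "real ^ 'n::finite \<Rightarrow> real"
  assumes s: "0 \<le> s" and t: "0 < t" and g: "bdd_meas K g"
  shows "heat s (hgrad t i g) = hgrad (s + t) i g"
proof (cases "s = 0")
  case False
  then have s: "0 < s" using s by auto
  note [measurable] = bdd_measD(1)[OF g]
  show ?thesis
  proof
    fix x
    have "heat s (hgrad t i g) x = (LINT y|lborel. gk s (y - x) * (LINT w|lborel. (\<lambda>(y, w). (w - y) $ i / t * gk t (w - y)) (y, w) * g w))"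
      using s t by (simp add: heat_pos hgrad_def)
    also have "\<dots> = (LINT w|lborel. (LINT y|lborel. gk s (y - x) * (\<lambda>(y, w). (w - y) $ i / t * gk t (w - y)) (y, w)) * g w)"
      using s t bdd_measD[OF g] nn_integral_gk_component[OF t, of _ i]
      by (intro kernel_comp(1)[where C="sqrt 2 ^ CARD('n) / sqrt t" and K=K]) (auto simp: integrable_gk lborel.sigma_finite_measure_axioms)
    also have "\<dots> = hgrad (s + t) i g x"
      unfolding hgrad_def prod.case integral_gk_gk_component[OF s t] by (rule refl)
    finally show "heat s (hgrad t i g) x = hgrad (s + t) i g x" .
  qed
qed auto

text \<open>The semigroup commutes with both derivatives, so part of one time can be moved to the other.
  This swap of the two times is what closes the argument for \<open>expectation_drift_grad_unit\<close>.\<close>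

lemma hgrad_hgrad_shift:
  fixes g :: "real ^ 'n::finite \<Rightarrow> real"
  assumes "0 < s" "0 < t" "0 < s'" "0 < t'" "s + t = s' + t'" and g: "bdd_meas K g"
  shows "hgrad s i (hgrad t j g) = hgrad s' i (hgrad t' j g)"
proof -
  have *: "hgrad s i (hgrad t j g) = hgrad s' i (hgrad t' j g)"
    if "s \<le> s'" "0 < s" "0 < t" "0 < s'" "0 < t'" "s + t = s' + t'" for s t s' t' :: real
  proof -
    have "hgrad s i (hgrad t j g) = hgrad s i (heat (s' - s) (hgrad t' j g))"
      using that by (subst heat_hgrad[OF _ _ g]) (auto intro!: arg_cong[where f="\<lambda>r. hgrad s i (hgrad r j g)"])
    also have "\<dots> = hgrad s' i (hgrad t' j g)"
      using that by (subst hgrad_heat[OF _ _ bdd_meas_hgrad[OF _ g]]) auto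
    finally show ?thesis .
  qed
  show ?thesis
  proof (cases "s \<le> s'")
    case True
    then show ?thesis using * assms by blast
  next
    case False
    then show ?thesis using *[of s' s t' t] assms by simp
  qed
qed

section \<open>Smoothing estimates for the heat semigroup\<close>

lemma gk_line_deriv:
  fixes z v :: "real ^ 'n::finite"
  assumes t: "0 < t"
  shows "((\<lambda>\<theta>. gk t (z - \<theta> *\<^sub>R v)) has_real_derivative
    (\<Sum>i\<in>UNIV. v $ i * ((z - \<theta> *\<^sub>R v) $ i / t)) * gk t (z - \<theta> *\<^sub>R v)) (at \<theta>)"
proof -
  have "((\<lambda>\<theta>. (1 / sqrt (2 * pi * t)) ^ CARD('n) * exp (- (\<Sum>i\<in>UNIV. (z $ i - \<theta> * v $ i)\<^sup>2) / (2 * t))) has_real_derivative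
     (\<Sum>i\<in>UNIV. v $ i * ((z $ i - \<theta> * v $ i) / t)) * ((1 / sqrt (2 * pi * t)) ^ CARD('n) * exp (- (\<Sum>i\<in>UNIV. (z $ i - \<theta> * v $ i)\<^sup>2) / (2 * t)))) (at \<theta>)"
    apply (rule derivative_eq_intros refl)+
    using t
    apply (simp_all add: sum_distrib_left sum_negf[symmetric] sum_divide_distrib)
    done
  then show ?thesis using t by (simp add: gk_exp)
qed

text \<open>The fundamental theorem of calculus along a segment, with \<open>hgrad\<close> as the gradient of \<open>heat\<close>. All
  differentiability of the heat flow in space is used below in this integrated form.\<close>

lemma heat_ftc:
  fixes g :: "real ^ 'n::finite \<Rightarrow> real"
  assumes t: "0 < t" and g: "bdd_meas K g"
  shows "integrable lborel (\<lambda>\<theta>. (\<Sum>i\<in>UNIV. v $ i * hgrad t i g (x + \<theta> *\<^sub>R v)) * indicator {0..1} \<theta>)" (is ?I)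
    and "heat t g (x + v) - heat t g x
      = (LINT \<theta>|lborel. (\<Sum>i\<in>UNIV. v $ i * hgrad t i g (x + \<theta> *\<^sub>R v)) * indicator {0..1::real} \<theta>)" (is ?E)
proof -
  note [measurable] = bdd_measD(1)[OF g]
  define k where "k \<theta> y = (\<Sum>i\<in>UNIV. v $ i * ((y - (x + \<theta> *\<^sub>R v)) $ i / t * gk t (y - (x + \<theta> *\<^sub>R v))))" for \<theta> y
  define L where "L = sqrt 2 ^ CARD('n) / sqrt t"
  have L: "0 \<le> L" using t by (simp add: L_def)
  have [measurable]: "(\<lambda>(\<theta>, y). k \<theta> y) \<in> borel_measurable (lborel \<Otimes>\<^sub>M lborel)" unfolding k_def by measurable
  have [measurable]: "k \<theta> \<in> borel_measurable borel" "(\<lambda>\<theta>. k \<theta> y) \<in> borel_measurable borel" for \<theta> y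
    unfolding k_def by measurable
  have kg: "(LINT y|lborel. k \<theta> y * g y) = (\<Sum>i\<in>UNIV. v $ i * hgrad t i g (x + \<theta> *\<^sub>R v))" for \<theta>
  proof -
    have i: "integrable lborel (\<lambda>y. ((y - (x + \<theta> *\<^sub>R v)) $ i / t * gk t (y - (x + \<theta> *\<^sub>R v))) * g y)" for i
      by (rule integrable_gk_component[OF t bdd_measD(1,2)[OF g]])
    have "(\<Sum>i\<in>UNIV. v $ i * hgrad t i g (x + \<theta> *\<^sub>R v))
      = (\<Sum>i\<in>UNIV. LINT y|lborel. v $ i * (((y - (x + \<theta> *\<^sub>R v)) $ i / t * gk t (y - (x + \<theta> *\<^sub>R v))) * g y))"
      unfolding hgrad_def by (subst integral_mult_right_zero) (rule refl)
    also have "\<dots> = (LINT y|lborel. (\<Sum>i\<in>UNIV. v $ i * (((y - (x + \<theta> *\<^sub>R v)) $ i / t * gk t (y - (x + \<theta> *\<^sub>R v))) * g y)))"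
      by (rule Bochner_Integration.integral_sum[symmetric]) (intro integrable_mult_right i)
    also have "\<dots> = (LINT y|lborel. k \<theta> y * g y)"
      unfolding k_def sum_distrib_right mult.assoc by (rule refl)
    finally show ?thesis by simp
  qed
  have kb: "(\<integral>\<^sup>+y. ennreal \<bar>k \<theta> y\<bar> \<partial>lborel) \<le> ennreal ((\<Sum>i\<in>UNIV. \<bar>v $ i\<bar>) * L)" for \<theta>
  proof -
    have "(\<integral>\<^sup>+y. ennreal \<bar>k \<theta> y\<bar> \<partial>lborel) \<le> (\<integral>\<^sup>+y. (\<Sum>i\<in>UNIV. ennreal \<bar>v $ i\<bar> * ennreal \<bar>(y - (x + \<theta> *\<^sub>R v)) $ i / t * gk t (y - (x + \<theta> *\<^sub>R v))\<bar>) \<partial>lborel)"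
      unfolding k_def
    proof (intro nn_integral_mono)
      fix y
      have "\<bar>\<Sum>i\<in>UNIV. v $ i * ((y - (x + \<theta> *\<^sub>R v)) $ i / t * gk t (y - (x + \<theta> *\<^sub>R v)))\<bar>
        \<le> (\<Sum>i\<in>UNIV. \<bar>v $ i\<bar> * \<bar>(y - (x + \<theta> *\<^sub>R v)) $ i / t * gk t (y - (x + \<theta> *\<^sub>R v))\<bar>)"
        by (rule order_trans[OF sum_abs]) (simp only: abs_mult order_refl)
      then show "ennreal \<bar>\<Sum>i\<in>UNIV. v $ i * ((y - (x + \<theta> *\<^sub>R v)) $ i / t * gk t (y - (x + \<theta> *\<^sub>R v)))\<bar>
        \<le> (\<Sum>i\<in>UNIV. ennreal \<bar>v $ i\<bar> * ennreal \<bar>(y - (x + \<theta> *\<^sub>R v)) $ i / t * gk t (y - (x + \<theta> *\<^sub>R v))\<bar>)"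
        by (simp only: ennreal_mult[symmetric] abs_ge_zero sum_ennreal mult_nonneg_nonneg ennreal_leI)
    qed
    also have "\<dots> = (\<Sum>i\<in>UNIV. ennreal \<bar>v $ i\<bar> * (\<integral>\<^sup>+y. ennreal \<bar>(y - (x + \<theta> *\<^sub>R v)) $ i / t * gk t (y - (x + \<theta> *\<^sub>R v))\<bar> \<partial>lborel))"
      by (subst nn_integral_sum) (auto intro!: sum.cong nn_integral_cmult)
    also have "\<dots> \<le> (\<Sum>i\<in>UNIV. ennreal \<bar>v $ i\<bar> * ennreal L)"
      unfolding L_def by (intro sum_mono mult_left_mono nn_integral_gk_component t) auto
    also have "\<dots> = ennreal ((\<Sum>i\<in>UNIV. \<bar>v $ i\<bar>) * L)"
      using L by (simp add: ennreal_mult[symmetric] sum_distrib_right)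
    finally show ?thesis .
  qed
  have ind: "integrable lborel (\<lambda>\<theta>. indicator {0..1::real} \<theta> :: real)"
    by (auto intro!: integrable_real_indicator)
  have int: "integrable (lborel \<Otimes>\<^sub>M lborel) (\<lambda>(\<theta>, y). indicator {0..1} \<theta> * k \<theta> y * g y)"
  proof (rule integrable_pairI[where u="\<lambda>\<theta>. indicator {0..1} \<theta> * ((\<Sum>i\<in>UNIV. \<bar>v $ i\<bar>) * L * K)"])
    fix \<theta> :: real
    have "(\<integral>\<^sup>+y. ennreal \<bar>case (\<theta>, y) of (\<theta>, y) \<Rightarrow> indicator {0..1} \<theta> * k \<theta> y * g y\<bar> \<partial>lborel)
       \<le> (\<integral>\<^sup>+y. ennreal (indicator {0..1} \<theta> * K) * ennreal \<bar>k \<theta> y\<bar> \<partial>lborel)"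
      using bdd_measD[OF g]
      by (intro nn_integral_mono) (auto simp: abs_mult ennreal_mult[symmetric] mult.commute indicator_def intro!: ennreal_leI mult_right_mono)
    also have "\<dots> \<le> ennreal (indicator {0..1} \<theta> * K) * ennreal ((\<Sum>i\<in>UNIV. \<bar>v $ i\<bar>) * L)"
      by (subst nn_integral_cmult) (auto intro!: mult_left_mono kb)
    also have "\<dots> = ennreal (indicator {0..1} \<theta> * ((\<Sum>i\<in>UNIV. \<bar>v $ i\<bar>) * L * K))"
      using L bdd_measD(3)[OF g] by (simp add: ennreal_mult[symmetric] sum_nonneg mult_ac)
    finally show "(\<integral>\<^sup>+y. ennreal \<bar>case (\<theta>, y) of (\<theta>, y) \<Rightarrow> indicator {0..1} \<theta> * k \<theta> y * g y\<bar> \<partial>lborel)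
      \<le> ennreal (indicator {0..1} \<theta> * ((\<Sum>i\<in>UNIV. \<bar>v $ i\<bar>) * L * K))" .
  qed (use ind in \<open>auto intro!: lborel.sigma_finite_measure_axioms integrable_mult_left\<close>)
  have eq: "(LINT y|lborel. indicator {0..1} \<theta> * k \<theta> y * g y) = (\<Sum>i\<in>UNIV. v $ i * hgrad t i g (x + \<theta> *\<^sub>R v)) * indicator {0..1} \<theta>" for \<theta> :: real
    unfolding mult.assoc integral_mult_right_zero kg by simp
  from lborel_pair.integrable_fst'[OF int] show ?I by (simp add: eq)
  have "(LINT \<theta>|lborel. (\<Sum>i\<in>UNIV. v $ i * hgrad t i g (x + \<theta> *\<^sub>R v)) * indicator {0..1::real} \<theta>)
     = (LINT y|lborel. (LINT \<theta>|lborel. indicator {0..1} \<theta> * k \<theta> y * g y))"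
    unfolding eq[symmetric] by (rule lborel_pair.Fubini_integral[OF int, symmetric])
  also have "\<dots> = (LINT y|lborel. (gk t (y - (x + v)) - gk t (y - x)) * g y)"
  proof (rule Bochner_Integration.integral_cong[OF refl])
    fix y
    have d: "((\<lambda>\<theta>. gk t (y - (x + \<theta> *\<^sub>R v))) has_real_derivative k \<theta> y) (at \<theta>)" for \<theta>
      using gk_line_deriv[OF t, of "y - x" v \<theta>] unfolding k_def by (simp add: sum_distrib_left diff_diff_add mult_ac)
    have "(LINT \<theta>|lborel. k \<theta> y * indicator {0..1} \<theta>) = gk t (y - (x + 1 *\<^sub>R v)) - gk t (y - (x + 0 *\<^sub>R v))"
    proof (rule integral_FTC_Icc_real[OF _ d])
      show "isCont (\<lambda>\<theta>. k \<theta> y) \<theta>" for \<theta>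
        unfolding k_def by (intro continuous_intros DERIV_isCont[OF d]) (use t in auto)
    qed simp
    then show "(LINT \<theta>|lborel. indicator {0..1} \<theta> * k \<theta> y * g y) = (gk t (y - (x + v)) - gk t (y - x)) * g y"
      by (simp add: mult.commute)
  qed
  also have "\<dots> = heat t g (x + v) - heat t g x"
    using t integrable_gk_mult[OF t bdd_measD(1,2)[OF g]]
    by (simp add: heat_pos left_diff_distrib)
  finally show ?E by simp
qed

abbreviation nrm1 :: "real ^ 'n::finite \<Rightarrow> real" where
  "nrm1 v \<equiv> (\<Sum>i\<in>UNIV. \<bar>v $ i\<bar>)"

text \<open>The factor lost in \<open>component_mult_gk\<close>, one \<open>sqrt 2\<close> per coordinate for the doubled variance.\<close>

abbreviation dimc :: "'n::finite itself \<Rightarrow> real" where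
  "dimc (n :: 'n itself) \<equiv> sqrt 2 ^ CARD('n)"

lemma abs_sum_mult_le:
  fixes v :: "real ^ 'n::finite"
  assumes "\<And>i. \<bar>a i\<bar> \<le> M"
  shows "\<bar>\<Sum>i\<in>UNIV. v $ i * a i\<bar> \<le> nrm1 v * M"
  unfolding sum_distrib_right
  by (rule order_trans[OF sum_abs]) (auto intro!: sum_mono mult_left_mono assms simp: abs_mult)

lemma integral_unit_interval_bound:
  fixes f :: "real \<Rightarrow> real"
  assumes "\<And>\<theta>. \<theta> \<in> {0..1} \<Longrightarrow> \<bar>f \<theta>\<bar> \<le> M" "integrable lborel (\<lambda>\<theta>. f \<theta> * indicator {0..1} \<theta>)"
  shows "\<bar>LINT \<theta>|lborel. f \<theta> * indicator {0..1} \<theta>\<bar> \<le> M"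
proof -
  have "\<bar>LINT \<theta>|lborel. f \<theta> * indicator {0..1} \<theta>\<bar> \<le> (LINT \<theta>|lborel. M * indicator {0..1::real} \<theta>)"
    using assms(1)
    by (intro integral_abs_bound_integral integrable_mult_right integrable_real_indicator assms(2)) (auto simp: abs_mult split: split_indicator)
  then show ?thesis by simp
qed

lemma heat_lipschitz:
  fixes g :: "real ^ 'n::finite \<Rightarrow> real"
  assumes t: "0 < t" and g: "bdd_meas K g"
  shows "\<bar>heat t g (x + v) - heat t g x\<bar> \<le> nrm1 v * (dimc TYPE('n) / sqrt t * K)"
  unfolding heat_ftc(2)[OF t g]
  by (intro integral_unit_interval_bound heat_ftc(1)[OF t g] abs_sum_mult_le abs_hgrad_le[OF t g])

lemma hgrad_split:
  fixes g :: "real ^ 'n::finite \<Rightarrow> real"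
  assumes "0 < t" "bdd_meas K g"
  shows "hgrad t i g = heat (t / 2) (hgrad (t / 2) i g)"
  using heat_hgrad[of "t / 2" "t / 2" K g i] assms by simp

text \<open>The first half of the time is spent on the gradient, the second half on the Lipschitz bound.\<close>

lemma hgrad_lipschitz:
  fixes g :: "real ^ 'n::finite \<Rightarrow> real"
  assumes t: "0 < t" and g: "bdd_meas K g"
  shows "\<bar>hgrad t i g (x + v) - hgrad t i g x\<bar> \<le> nrm1 v * (2 * 2 ^ CARD('n) / t * K)"
proof -
  have s: "0 < t / 2" using t by simp
  have "(dimc TYPE('n) / sqrt (t / 2) * (dimc TYPE('n) / sqrt (t / 2) * K)) = 2 * 2 ^ CARD('n) / t * K"
    using t by (simp add: power_mult_distrib[symmetric])
  with heat_lipschitz[OF s bdd_meas_hgrad[OF s g, of i], of x v]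
  show ?thesis unfolding hgrad_split[OF t g, of i] by metis
qed

text \<open>The remainder is the average over the segment of the increments of the gradient, which is
  Lipschitz by \<open>hgrad_lipschitz\<close>.\<close>

lemma heat_taylor:
  fixes g :: "real ^ 'n::finite \<Rightarrow> real"
  assumes t: "0 < t" and g: "bdd_meas K g"
  shows "\<bar>heat t g (x + v) - heat t g x - (\<Sum>i\<in>UNIV. v $ i * hgrad t i g x)\<bar> \<le> (nrm1 v)\<^sup>2 * (2 * 2 ^ CARD('n) / t * K)"
proof -
  let ?f = "\<lambda>\<theta>. (\<Sum>i\<in>UNIV. v $ i * (hgrad t i g (x + \<theta> *\<^sub>R v) - hgrad t i g x))"
  have e: "?f \<theta> * indicator {0..1} \<theta> = (\<Sum>i\<in>UNIV. v $ i * hgrad t i g (x + \<theta> *\<^sub>R v)) * indicator {0..1} \<theta>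
      - (\<Sum>i\<in>UNIV. v $ i * hgrad t i g x) * indicator {0..1} \<theta>" for \<theta> :: real
    by (simp add: right_diff_distrib sum_subtractf left_diff_distrib)
  have i: "integrable lborel (\<lambda>\<theta>. (\<Sum>i\<in>UNIV. v $ i * hgrad t i g x) * indicator {0..1} (\<theta>::real))"
    by (intro integrable_mult_right integrable_real_indicator) auto
  have K: "0 \<le> 2 * 2 ^ CARD('n) / t * K" using t bdd_measD(3)[OF g] by simp
  have "heat t g (x + v) - heat t g x - (\<Sum>i\<in>UNIV. v $ i * hgrad t i g x) = (LINT \<theta>|lborel. ?f \<theta> * indicator {0..1} \<theta>)"
    unfolding e by (subst Bochner_Integration.integral_diff[OF heat_ftc(1)[OF t g] i]) (simp add: heat_ftc(2)[OF t g])
  also have "\<bar>\<dots>\<bar> \<le> nrm1 v * (nrm1 v * (2 * 2 ^ CARD('n) / t * K))"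
  proof (rule integral_unit_interval_bound)
    fix \<theta> :: real assume th: "\<theta> \<in> {0..1}"
    show "\<bar>?f \<theta>\<bar> \<le> nrm1 v * (nrm1 v * (2 * 2 ^ CARD('n) / t * K))"
    proof (rule abs_sum_mult_le)
      fix i
      have "nrm1 (\<theta> *\<^sub>R v) \<le> nrm1 v" using th by (auto simp: abs_mult intro!: sum_mono mult_left_le_one_le)
      then show "\<bar>hgrad t i g (x + \<theta> *\<^sub>R v) - hgrad t i g x\<bar> \<le> nrm1 v * (2 * 2 ^ CARD('n) / t * K)"
        using hgrad_lipschitz[OF t g, of i x "\<theta> *\<^sub>R v"] K by (meson mult_right_mono order_trans)
    qed
  next
    show "integrable lborel (\<lambda>\<theta>. ?f \<theta> * indicator {0..1} \<theta>)"
      unfolding e by (intro Bochner_Integration.integrable_diff heat_ftc(1)[OF t g] i)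
  qed
  finally show ?thesis by (simp add: power2_eq_square mult.assoc)
qed

lemma gk_second_moment:
  fixes x :: "real ^ 'n::finite"
  assumes t: "0 < t"
  shows "(nrm1 x)\<^sup>2 * gk t x \<le> t * (4 * real CARD('n) * real CARD('n) * (dimc TYPE('n) * dimc TYPE('n))) * gk (4 * t) x"
proof -
  define c where "c = sqrt 2 ^ CARD('n)"
  have c: "1 \<le> c" unfolding c_def by (rule one_le_power) simp
  have 0: "\<bar>x $ i\<bar> * gk r x \<le> sqrt r * c * gk (2 * r) x" if r: "0 < r" for i and r :: real
  proof -
    have "r * (\<bar>x $ i\<bar> / r * gk r x) \<le> r * (c / sqrt r * gk (2 * r) x)"
      unfolding c_def using component_mult_gk[OF r] r by (intro mult_left_mono) auto
    also have "\<dots> = (r / sqrt r) * c * gk (2 * r) x" by simp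
    finally show ?thesis using r by (simp add: real_div_sqrt)
  qed
  note 1 = 0[OF t]
  have 2: "\<bar>x $ i\<bar> * gk (2 * t) x \<le> sqrt (2 * t) * c * gk (4 * t) x" for i
    using 0[of "2 * t" i] t by simp
  have "\<bar>x $ i\<bar> * \<bar>x $ j\<bar> * gk t x \<le> t * (4 * c * c) * gk (4 * t) x" for i j
  proof -
    have "\<bar>x $ i\<bar> * (\<bar>x $ j\<bar> * gk t x) \<le> \<bar>x $ i\<bar> * (sqrt t * c * gk (2 * t) x)"
      by (intro mult_left_mono 1) auto
    also have "\<dots> = sqrt t * c * (\<bar>x $ i\<bar> * gk (2 * t) x)" by simp
    also have "\<dots> \<le> sqrt t * c * (sqrt (2 * t) * c * gk (4 * t) x)"
      using t c by (intro mult_left_mono 2) auto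
    also have "\<dots> = t * (sqrt 2 * c * c) * gk (4 * t) x"
      using t by (simp add: real_sqrt_mult)
    also have "\<dots> \<le> t * (4 * c * c) * gk (4 * t) x"
      using t c sqrt2_less_2 by (intro mult_right_mono mult_left_mono) auto
    finally show ?thesis by (simp add: mult.assoc)
  qed
  then have "(\<Sum>i\<in>UNIV. \<Sum>j\<in>UNIV. \<bar>x $ i\<bar> * \<bar>x $ j\<bar> * gk t x) \<le> (\<Sum>i\<in>(UNIV :: 'n set). \<Sum>j\<in>(UNIV :: 'n set). t * (4 * c * c) * gk (4 * t) x)"
    by (intro sum_mono)
  moreover have "(nrm1 x)\<^sup>2 * gk t x = (\<Sum>i\<in>UNIV. \<Sum>j\<in>UNIV. \<bar>x $ i\<bar> * \<bar>x $ j\<bar> * gk t x)"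
    unfolding power2_eq_square sum_product by (simp only: sum_distrib_right)
  ultimately show ?thesis
    by (simp add: c_def[symmetric] mult_ac)
qed

text \<open>The difference is the average of the increments of \<open>heat t g\<close> under a centred Gaussian
  of variance \<open>s\<close>. The first order term of \<open>heat_taylor\<close> averages to zero, and the second moment in the
  remainder is of order \<open>s\<close>.\<close>

lemma heat_time_lipschitz:
  fixes g :: "real ^ 'n::finite \<Rightarrow> real"
  assumes t: "0 < t" and s: "0 \<le> s" and g: "bdd_meas K g"
  shows "\<bar>heat (t + s) g x - heat t g x\<bar>
    \<le> s / t * (8 * real CARD('n) * real CARD('n) * (2 ^ CARD('n) * 2 ^ CARD('n)) * K)"
proof (cases "s = 0")
  case False
  then have s: "0 < s" using s by simp
  note [measurable] = bdd_measD(1)[OF g]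
  let ?f = "heat t g"
  have [measurable]: "?f \<in> borel_measurable borel" by measurable
  have f: "bdd_meas K ?f" using t by (intro bdd_meas_heat g) simp
  have K: "0 \<le> K" using bdd_measD(3)[OF g] .
  define R where "R y = ?f y - ?f x - (\<Sum>i\<in>UNIV. (y - x) $ i * hgrad t i g x)" for y
  have cmp: "integrable lborel (\<lambda>y. (y - x) $ i * gk s (y - x))" for i
    using integrable_mult_right[OF integrable_gk_component'[OF s, of x i], of s] s by simp
  have cmp0: "(LINT y|lborel. (y - x) $ i * gk s (y - x)) = 0" for i
  proof -
    have "(LINT y|lborel. (y - x) $ i * gk s (y - x)) = (LINT y|lborel. s * ((y - x) $ i / s * gk s (y - x)))"
      using s by simp
    also have "\<dots> = 0" unfolding integral_mult_right_zero integral_gk_component[OF s] by simp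
    finally show ?thesis .
  qed
  have 1: "integrable lborel (\<lambda>y. gk s (y - x) * ?f y)"
    by (rule integrable_gk_mult[OF s bdd_measD(1,2)[OF f]])
  have 2: "integrable lborel (\<lambda>y. gk s (y - x) * ?f x)"
    by (intro integrable_mult_left integrable_gk s)
  have 3: "integrable lborel (\<lambda>y. \<Sum>i\<in>UNIV. hgrad t i g x * ((y - x) $ i * gk s (y - x)))"
    by (intro Bochner_Integration.integrable_sum integrable_mult_right cmp)
  have e: "gk s (y - x) * R y = gk s (y - x) * ?f y - gk s (y - x) * ?f x - (\<Sum>i\<in>UNIV. hgrad t i g x * ((y - x) $ i * gk s (y - x)))" for y
    unfolding R_def by (simp only: right_diff_distrib sum_distrib_left mult_ac)
  have "heat (t + s) g x - heat t g x = (LINT y|lborel. gk s (y - x) * R y)"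
  proof -
    have "heat (t + s) g x = heat s ?f x" using t s by (subst heat_heat[OF _ _ g]) (auto simp: add.commute)
    moreover have "(LINT y|lborel. gk s (y - x) * ?f x) = ?f x" using s by (simp add: integral_gk)
    moreover have "(LINT y|lborel. (\<Sum>i\<in>UNIV. hgrad t i g x * ((y - x) $ i * gk s (y - x)))) = 0"
      by (subst Bochner_Integration.integral_sum) (intro integrable_mult_right cmp, simp only: integral_mult_right_zero cmp0, simp)
    ultimately show ?thesis
      unfolding e using s 1 2 3 by (simp add: heat_pos)
  qed
  also have "\<bar>\<dots>\<bar> \<le> (LINT y|lborel. s / t * (8 * real CARD('n) * real CARD('n) * (2 ^ CARD('n) * 2 ^ CARD('n)) * K) * gk (4 * s) (y - x))"
  proof (rule integral_abs_bound_integral)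
    show "integrable lborel (\<lambda>y. gk s (y - x) * R y)"
      unfolding e by (intro Bochner_Integration.integrable_diff 1 2 3)
    show "integrable lborel (\<lambda>y. s / t * (8 * real CARD('n) * real CARD('n) * (2 ^ CARD('n) * 2 ^ CARD('n)) * K) * gk (4 * s) (y - x))"
      using s by (intro integrable_mult_right integrable_gk) simp
    fix y
    have "\<bar>gk s (y - x) * R y\<bar> \<le> gk s (y - x) * ((nrm1 (y - x))\<^sup>2 * (2 * 2 ^ CARD('n) / t * K))"
      using mult_left_mono[OF heat_taylor[OF t g, of x "y - x"] gk_nonneg[of s "y - x"]]
      unfolding R_def by (simp only: abs_mult abs_of_nonneg[OF gk_nonneg] add_diff_cancel_left' diff_add_cancel add.commute[of x])
    also have "\<dots> = ((nrm1 (y - x))\<^sup>2 * gk s (y - x)) * (2 * 2 ^ CARD('n) / t * K)" by (simp add: mult_ac)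
    also have "\<dots> \<le> s * (4 * real CARD('n) * real CARD('n) * (dimc TYPE('n) * dimc TYPE('n))) * gk (4 * s) (y - x) * (2 * 2 ^ CARD('n) / t * K)"
      using t K by (intro mult_right_mono gk_second_moment s) auto
    also have "\<dots> = s / t * (8 * real CARD('n) * real CARD('n) * (2 ^ CARD('n) * 2 ^ CARD('n)) * K) * gk (4 * s) (y - x)"
      by (simp add: power_mult_distrib[symmetric])
    finally show "\<bar>gk s (y - x) * R y\<bar> \<le> s / t * (8 * real CARD('n) * real CARD('n) * (2 ^ CARD('n) * 2 ^ CARD('n)) * K) * gk (4 * s) (y - x)" .
  qed
  also have "\<dots> = s / t * (8 * real CARD('n) * real CARD('n) * (2 ^ CARD('n) * 2 ^ CARD('n)) * K)"
    using s integral_gk[of "4 * s" x] by simp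
  finally show ?thesis .
qed simp

section \<open>Gaussians as test functions\<close>

text \<open>Differentiability of order \<open>k\<close> in one variable. The derivative is existentially quantified, so
  that closure properties follow by induction without computing it.\<close>

primrec smooth1 :: "nat \<Rightarrow> (real \<Rightarrow> real) \<Rightarrow> bool" where
  "smooth1 0 f \<longleftrightarrow> continuous_on UNIV f"
| "smooth1 (Suc k) f \<longleftrightarrow> (\<exists>f'. (\<forall>x. (f has_real_derivative f' x) (at x)) \<and> smooth1 k f')"

lemma smooth1_SucI:
  "(\<And>x. (f has_real_derivative f' x) (at x)) \<Longrightarrow> smooth1 k f' \<Longrightarrow> smooth1 (Suc k) f"
  by auto

lemma smooth1_continuous: "smooth1 k f \<Longrightarrow> continuous_on UNIV f"
proof (cases k)
  case (Suc m)
  assume "smooth1 k f"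
  then obtain f' where "\<And>x. (f has_real_derivative f' x) (at x)" using Suc by auto
  then show ?thesis by (intro continuous_at_imp_continuous_on ballI DERIV_isCont)
qed simp

lemma smooth1_Suc: "smooth1 (Suc k) f \<Longrightarrow> smooth1 k f"
proof (induction k arbitrary: f)
  case 0
  then show ?case using smooth1_continuous[OF 0] by simp
next
  case (Suc k)
  then show ?case by (metis smooth1.simps(2))
qed

lemma smooth1_const: "smooth1 k (\<lambda>x. c)"
  by (induction k arbitrary: c) (auto intro!: exI[of _ "\<lambda>x. 0"])

lemma smooth1_add: "smooth1 k f \<Longrightarrow> smooth1 k g \<Longrightarrow> smooth1 k (\<lambda>x. f x + g x)"
proof (induction k arbitrary: f g)
  case 0
  then show ?case by (auto intro: continuous_on_add)
next
  case (Suc k)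
  then obtain f' g' where "\<And>x. (f has_real_derivative f' x) (at x)" "smooth1 k f'"
    "\<And>x. (g has_real_derivative g' x) (at x)" "smooth1 k g'" by auto
  then show ?case using Suc.IH
    by (auto intro!: exI[of _ "\<lambda>x. f' x + g' x"] derivative_eq_intros)
qed

lemma smooth1_mult: "smooth1 k f \<Longrightarrow> smooth1 k g \<Longrightarrow> smooth1 k (\<lambda>x. f x * g x)"
proof (induction k arbitrary: f g)
  case 0
  then show ?case by (auto intro: continuous_on_mult)
next
  case (Suc k)
  obtain f' g' where d: "\<And>x. (f has_real_derivative f' x) (at x)" "smooth1 k f'"
    "\<And>x. (g has_real_derivative g' x) (at x)" "smooth1 k g'" using Suc.prems by auto
  have "smooth1 k f" "smooth1 k g" using Suc.prems smooth1_Suc by blast+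
  then have "smooth1 k (\<lambda>x. f' x * g x + f x * g' x)"
    using d by (intro smooth1_add Suc.IH) auto
  moreover have "((\<lambda>x. f x * g x) has_real_derivative f' x * g x + f x * g' x) (at x)" for x
    by (rule derivative_eq_intros d refl)+ simp
  ultimately show ?case by (intro smooth1_SucI)
qed

lemma smooth1_affine: "smooth1 k f \<Longrightarrow> smooth1 k (\<lambda>x. f (a * x + c))"
proof (induction k arbitrary: f)
  case 0
  then show ?case by (auto intro!: continuous_on_compose2[of UNIV f] continuous_intros)
next
  case (Suc k)
  obtain f' where d: "\<And>x. (f has_real_derivative f' x) (at x)" "smooth1 k f'" using Suc.prems by auto
  have "((\<lambda>x. f (a * x + c)) has_real_derivative a * f' (a * x + c)) (at x)" for x
    by (rule DERIV_cong[OF DERIV_chain2[OF d(1)]]) (auto intro!: derivative_eq_intros)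
  moreover have "smooth1 k (\<lambda>x. a * f' (a * x + c))"
    by (intro smooth1_mult smooth1_const Suc.IH d)
  ultimately show ?case by (rule smooth1_SucI)
qed

lemma smooth1_gauss: "smooth1 k (\<lambda>x. x ^ j * exp (- a * x\<^sup>2))"
proof (induction k arbitrary: j)
  case 0
  show ?case by (auto intro!: continuous_intros)
next
  case (Suc k)
  have "((\<lambda>x. x ^ j * exp (- a * x\<^sup>2)) has_real_derivative
      real j * (x ^ (j - 1) * exp (- a * x\<^sup>2)) + (- 2 * a) * (x ^ (j + 1) * exp (- a * x\<^sup>2))) (at x)" for x
    by (rule derivative_eq_intros refl)+ (simp add: algebra_simps power2_eq_square)
  moreover have "smooth1 k (\<lambda>x. real j * (x ^ (j - 1) * exp (- a * x\<^sup>2)) + (- 2 * a) * (x ^ (j + 1) * exp (- a * x\<^sup>2)))"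
    by (intro smooth1_add smooth1_mult smooth1_const Suc.IH)
  ultimately show ?case by (rule smooth1_SucI)
qed

lemma smooth1_normal_density: "0 < s \<Longrightarrow> smooth1 k (\<lambda>x. normal_density 0 (sqrt s) (x - c))"
  using smooth1_mult[OF smooth1_const[of k "1 / sqrt (2 * pi * s)"] smooth1_affine[OF smooth1_gauss[of k 0 "1 / (2 * s)"], of 1 "- c"]]
  by (simp add: normal_density_def)

text \<open>The powers of \<open>1 / x\<close> make the family stable under differentiation, so one derivative at 0
  gives all of them.\<close>

definition flat_exp :: "nat \<Rightarrow> real \<Rightarrow> real" where
  "flat_exp k x = (if 0 < x then (1 / x) ^ k * exp (- (1 / x)) else 0)"

lemma flat_exp_tendsto_0: "(flat_exp k \<longlongrightarrow> 0) (at_right 0)"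
proof -
  have "((\<lambda>x::real. (inverse x) ^ k / exp (inverse x)) \<longlongrightarrow> 0) (at_right 0)"
    by (rule filterlim_compose[OF tendsto_power_div_exp_0 filterlim_inverse_at_top_right])
  then show ?thesis
    by (rule Lim_transform_eventually)
      (auto simp: eventually_at_right_less flat_exp_def exp_minus field_simps eventually_at_filter)
qed

lemma flat_exp_deriv:
  "(flat_exp k has_real_derivative flat_exp (k + 2) x + (- real k) * flat_exp (k + 1) x) (at x)"
proof -
  consider "x < 0" | "x = 0" | "0 < x" by linarith
  then show ?thesis
  proof cases
    case 1
    have "((\<lambda>x. 0) has_real_derivative 0) (at x)" by simp
    then have "(flat_exp k has_real_derivative 0) (at x)"
      by (rule has_field_derivative_transform_within_open[of _ _ _ "{..<0}"]) (use 1 in \<open>auto simp: flat_exp_def\<close>)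
    then show ?thesis using 1 by (simp add: flat_exp_def)
  next
    case 2
    have "((\<lambda>h. (flat_exp k (0 + h) - flat_exp k 0) / h) \<longlongrightarrow> 0) (at 0)"
    proof (rule filterlim_split_at)
      show "((\<lambda>h. (flat_exp k (0 + h) - flat_exp k 0) / h) \<longlongrightarrow> 0) (at_left 0)"
        by (rule tendsto_eventually) (auto simp: eventually_at_filter flat_exp_def)
      show "((\<lambda>h. (flat_exp k (0 + h) - flat_exp k 0) / h) \<longlongrightarrow> 0) (at_right 0)"
        by (rule Lim_transform_eventually[OF flat_exp_tendsto_0[of "k + 1"]]) (auto simp: eventually_at_filter flat_exp_def)
    qed
    then show ?thesis using 2 by (simp add: DERIV_def flat_exp_def)
  next
    case 3
    have "((\<lambda>x. (1 / x) ^ k * exp (- (1 / x))) has_real_derivative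
        (1 / x) ^ (k + 2) * exp (- (1 / x)) + (- real k) * ((1 / x) ^ (k + 1) * exp (- (1 / x)))) (at x)"
      apply (rule derivative_eq_intros refl | use 3 in force)+
      apply (cases k)
      using 3 by (auto simp: field_simps power2_eq_square)
    then have "(flat_exp k has_real_derivative
        (1 / x) ^ (k + 2) * exp (- (1 / x)) + (- real k) * ((1 / x) ^ (k + 1) * exp (- (1 / x)))) (at x)"
      by (rule has_field_derivative_transform_within_open[of _ _ _ "{0<..}"]) (use 3 in \<open>auto simp: flat_exp_def\<close>)
    then show ?thesis using 3 by (simp add: flat_exp_def)
  qed
qed

lemma smooth1_flat_exp: "smooth1 m (flat_exp k)"
proof (induction m arbitrary: k)
  case 0
  have "continuous_on UNIV (flat_exp k)"
    by (intro continuous_at_imp_continuous_on ballI DERIV_isCont[OF flat_exp_deriv])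
  then show ?case by simp
next
  case (Suc m)
  have "smooth1 m (\<lambda>x. flat_exp (k + 2) x + (- real k) * flat_exp (k + 1) x)"
    by (intro smooth1_add smooth1_mult smooth1_const Suc.IH)
  then show ?case by (rule smooth1_SucI[OF flat_exp_deriv])
qed

text \<open>Normalised so that \<open>bump 0 = 1\<close>: dilating it gives smooth cut-offs that converge to 1.\<close>

definition bump :: "real \<Rightarrow> real" where
  "bump x = exp 2 * (flat_exp 0 (1 - x) * flat_exp 0 (1 + x))"

lemma smooth1_bump: "smooth1 k bump"
  using smooth1_mult[OF smooth1_const[of k "exp 2"] smooth1_mult[OF smooth1_affine[OF smooth1_flat_exp, of k 0 "-1" 1] smooth1_affine[OF smooth1_flat_exp, of k 0 1 1]]]
  unfolding bump_def[abs_def] by (simp add: add.commute)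

lemma bump_0: "bump 0 = 1"
  by (simp add: bump_def flat_exp_def exp_add[symmetric])

lemma bump_eq_0: "1 \<le> \<bar>x\<bar> \<Longrightarrow> bump x = 0"
  by (auto simp: bump_def flat_exp_def abs_if split: if_splits)

lemma bump_nonneg: "0 \<le> bump x"
  by (simp add: bump_def flat_exp_def)

lemma bump_le: "bump x \<le> exp 2"
proof -
  have "flat_exp 0 y \<le> 1" "0 \<le> flat_exp 0 y" for y by (auto simp: flat_exp_def)
  then have "flat_exp 0 (1 - x) * flat_exp 0 (1 + x) \<le> 1 * 1" by (intro mult_mono) auto
  then show ?thesis unfolding bump_def using mult_left_mono[of _ 1 "exp 2 :: real"] by simp
qed

lemma bump_derivative:
  obtains b' M where "\<And>x. (bump has_real_derivative b' x) (at x)" "continuous_on UNIV b'"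
    "\<And>x. \<bar>b' x\<bar> \<le> M"
proof -
  obtain b' where b': "\<And>x. (bump has_real_derivative b' x) (at x)" "continuous_on UNIV b'"
    using smooth1_bump[of "Suc 0"] by auto
  have "compact (b' ` {-1..1})"
    using b'(2) by (intro compact_continuous_image) (auto intro: continuous_on_subset)
  then have "bounded (b' ` {-1..1})" by (rule compact_imp_bounded)
  then obtain M where M: "\<And>x. x \<in> {-1..1} \<Longrightarrow> \<bar>b' x\<bar> \<le> M"
    unfolding bounded_iff by (metis imageI real_norm_def)
  have "b' x = 0" if "x \<notin> {-1..1}" for x
  proof -
    have "((\<lambda>x. 0) has_real_derivative 0) (at x)" by simp
    then have "(bump has_real_derivative 0) (at x)"
    proof (rule has_field_derivative_transform_within_open[of _ _ _ "- {-1..1}"])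
      show "open (- {-1..1::real})" by (intro open_Compl closed_atLeastAtMost)
      show "x \<in> - {-1..1}" using that by simp
      fix y :: real assume "y \<in> - {-1..1}"
      then have "1 \<le> \<bar>y\<bar>" by (simp add: abs_if) linarith
      then show "0 = bump y" by (simp add: bump_eq_0)
    qed
    then show ?thesis using b'(1) DERIV_unique by blast
  qed
  then have "\<bar>b' x\<bar> \<le> \<bar>M\<bar>" for x
    using M[of x] by (cases "x \<in> {-1..1}") auto
  then show thesis using b' that by blast
qed

text \<open>Test functions are built as products over the coordinates; a partial derivative replaces one
  factor by its derivative and preserves this form, which makes \<open>C_k_prod_components\<close> an induction.\<close>

lemma prod_components_derivative:
  fixes f f' :: "'n::finite \<Rightarrow> real \<Rightarrow> real"
  assumes "\<And>i z. (f i has_real_derivative f' i z) (at z)"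
  shows "(\<lambda>x :: real ^ 'n. \<Prod>i\<in>UNIV. f i (x $ i)) differentiable (at x)"
    and "partial_deriv j (\<lambda>x :: real ^ 'n. \<Prod>i\<in>UNIV. f i (x $ i)) x = (\<Prod>i\<in>UNIV. (if i = j then f' i else f i) (x $ i))"
proof -
  have 1: "((\<lambda>x :: real ^ 'n. f i (x $ i)) has_derivative (\<lambda>v. f' i (x $ i) * v $ i)) (at x)" for i
  proof -
    have "((\<lambda>x :: real ^ 'n. x $ i) has_derivative (\<lambda>v. v $ i)) (at x)"
      by (rule bounded_linear_imp_has_derivative) (rule bounded_linear_vec_nth)
    from has_derivative_compose[OF this assms[unfolded has_field_derivative_def]] show ?thesis by simp
  qed
  have 2: "((\<lambda>x :: real ^ 'n. \<Prod>i\<in>UNIV. f i (x $ i)) has_derivative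
     (\<lambda>v. \<Sum>i\<in>UNIV. (f' i (x $ i) * v $ i) * (\<Prod>k\<in>UNIV - {i}. f k (x $ k)))) (at x)"
    by (rule has_derivative_prod) (rule 1)
  then show "(\<lambda>x :: real ^ 'n. \<Prod>i\<in>UNIV. f i (x $ i)) differentiable (at x)"
    unfolding differentiable_def by blast
  have "partial_deriv j (\<lambda>x :: real ^ 'n. \<Prod>i\<in>UNIV. f i (x $ i)) x = f' j (x $ j) * (\<Prod>k\<in>UNIV - {j}. f k (x $ k))"
    unfolding partial_deriv_def frechet_derivative_at[OF 2, symmetric]
    by (subst sum.remove[of _ j]) (auto simp: axis_def)
  also have "\<dots> = (\<Prod>i\<in>UNIV. (if i = j then f' i else f i) (x $ i))"
    by (subst prod.remove[of _ j]) (auto intro!: prod.cong)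
  finally show "partial_deriv j (\<lambda>x :: real ^ 'n. \<Prod>i\<in>UNIV. f i (x $ i)) x = (\<Prod>i\<in>UNIV. (if i = j then f' i else f i) (x $ i))" .
qed

lemma C_k_prod_components:
  fixes f :: "'n::finite \<Rightarrow> real \<Rightarrow> real"
  assumes "\<And>i. smooth1 k (f i)"
  shows "C_k k (\<lambda>x :: real ^ 'n. \<Prod>i\<in>UNIV. f i (x $ i))"
  using assms
proof (induction k arbitrary: f)
  case 0
  have "continuous_on UNIV (\<lambda>x :: real ^ 'n. f i (x $ i))" for i
    using 0[of i] by (auto intro!: continuous_on_compose2[of UNIV "f i"] continuous_intros)
  then show ?case by (auto intro!: continuous_on_prod)
next
  case (Suc k)
  then have "\<forall>i. \<exists>f'. (\<forall>z. (f i has_real_derivative f' z) (at z)) \<and> smooth1 k f'" by auto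
  then obtain f' where f': "\<And>i z. (f i has_real_derivative f' i z) (at z)" "\<And>i. smooth1 k (f' i)" by metis
  have "partial_deriv j (\<lambda>x :: real ^ 'n. \<Prod>i\<in>UNIV. f i (x $ i)) = (\<lambda>x. \<Prod>i\<in>UNIV. (if i = j then f' i else f i) (x $ i))" for j
    by (rule ext) (rule prod_components_derivative(2)[OF f'(1)])
  moreover have "C_k k (\<lambda>x :: real ^ 'n. \<Prod>i\<in>UNIV. (if i = j then f' i else f i) (x $ i))" for j
    by (rule Suc.IH) (use f'(2) Suc.prems smooth1_Suc in auto)
  ultimately show ?case using prod_components_derivative(1)[of f f', OF f'(1)] by simp
qed

lemma test_function_gauss_cutoff:
  fixes c :: "real ^ 'n::finite"
  assumes s: "0 < s" and R: "0 < R"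
  shows "test_function (\<lambda>y. \<Prod>i\<in>UNIV. bump (y $ i / R) * normal_density 0 (sqrt s) (y $ i - c $ i))"
  unfolding test_function_def
proof (intro conjI allI)
  fix k
  have "smooth1 k (\<lambda>z. bump (z / R))" using smooth1_affine[OF smooth1_bump, of k "1 / R" 0] by simp
  then show "C_k k (\<lambda>y. \<Prod>i\<in>UNIV. bump (y $ i / R) * normal_density 0 (sqrt s) (y $ i - c $ i))"
    by (intro C_k_prod_components[of k "\<lambda>i z. bump (z / R) * normal_density 0 (sqrt s) (z - c $ i)"] smooth1_mult smooth1_normal_density s)
next
  let ?S = "{x. (\<Prod>i\<in>UNIV. bump (x $ i / R) * normal_density 0 (sqrt s) (x $ i - c $ i)) \<noteq> 0}"
  have "\<bar>x $ i\<bar> \<le> R" if "x \<in> ?S" for x i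
  proof -
    have "bump (x $ i / R) \<noteq> 0" using that by auto
    then have "\<bar>x $ i / R\<bar> < 1" using bump_eq_0 by (meson not_le)
    then show ?thesis using R by (simp add: abs_div field_simps)
  qed
  then have "norm x \<le> (\<Sum>i\<in>(UNIV :: 'n set). R)" if "x \<in> ?S" for x
    using that by (intro order_trans[OF norm_le_l1_cart] sum_mono) blast
  then have "bounded ?S" unfolding bounded_iff by blast
  then show "compact (closure ?S)" by (simp add: compact_closure)
qed

text \<open>The Gaussian is multiplied by dilated bumps, which gives test functions. In the limit of large dilations
  the derivative of the cut-off at scale \<open>R\<close> is \<open>O(1 / R)\<close>, and all other terms are dominated by Gaussians
  of at most twice the variance.\<close>

lemma distr_div_gauss:
  fixes u :: "real ^ 'n::finite \<Rightarrow> real ^ 'n" and c :: "real ^ 'n"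
  assumes s: "0 < s" and um [measurable]: "u \<in> borel_measurable borel" and ub: "\<And>x i. \<bar>u x $ i\<bar> \<le> B"
    and sl [measurable_cong]: "sets lam = sets borel" and gm [measurable]: "g \<in> borel_measurable borel"
    and gi: "integrable lam (\<lambda>y. g y * gk s (y - c))"
    and div: "\<And>\<phi> C. test_function \<phi> \<Longrightarrow> bdd_meas C \<phi> \<Longrightarrow> distr_div u \<phi> = (LINT y|lam. g y * \<phi> y)"
  shows "(LINT y|lborel. (\<Sum>i\<in>UNIV. u y $ i * ((y - c) $ i / s * gk s (y - c)))) = (LINT y|lam. g y * gk s (y - c))"
proof -
  obtain b' M where b': "\<And>x. (bump has_real_derivative b' x) (at x)" "continuous_on UNIV b'" "\<And>x. \<bar>b' x\<bar> \<le> M"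
    using bump_derivative by metis
  have [measurable]: "b' \<in> borel_measurable borel" by (rule borel_measurable_continuous_onI[OF b'(2)])
  have [measurable]: "bump \<in> borel_measurable borel"
    by (rule borel_measurable_continuous_onI[OF smooth1_continuous[OF smooth1_bump[of 0]]])
  have cb: "isCont bump x" for x using b'(1) by (rule DERIV_isCont)
  have M0: "0 \<le> M" using b'(3)[of 0] by (rule order_trans[OF abs_ge_zero])
  have B0: "0 \<le> B" using ub by (rule order_trans[OF abs_ge_zero])
  define e where "e = exp (2::real)"
  have e: "0 \<le> e" "1 \<le> e" "\<And>x. \<bar>bump x\<bar> \<le> e" using bump_le bump_nonneg by (auto simp: e_def)
  define R where "R m = real m + 1" for m :: nat
  have R: "0 < R m" "1 \<le> R m" for m by (auto simp: R_def)
  have Rlim: "(\<lambda>m. a / R m) \<longlonglongrightarrow> 0" for a :: real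
    unfolding R_def using tendsto_mult[OF tendsto_const LIMSEQ_Suc[OF lim_1_over_n], of a]
    by (simp add: add.commute)
  define \<phi> where "\<phi> m y = (\<Prod>i\<in>UNIV. bump (y $ i / R m) * normal_density 0 (sqrt s) (y $ i - c $ i))" for m y
  have \<phi>_eq: "\<phi> m y = (\<Prod>i\<in>UNIV. bump (y $ i / R m)) * gk s (y - c)" for m y
    unfolding \<phi>_def gk_def prod.distrib by simp
  have chib: "\<bar>\<Prod>i\<in>S. bump (y $ i / R m)\<bar> \<le> e ^ CARD('n)" for S :: "'n set" and m y
  proof -
    have "\<bar>\<Prod>i\<in>S. bump (y $ i / R m)\<bar> \<le> (\<Prod>i\<in>S. e)"
      unfolding abs_prod by (intro prod_mono) (use e in auto)
    also have "\<dots> \<le> e ^ CARD('n)" using e(2) by (simp add: power_increasing card_mono)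
    finally show ?thesis .
  qed
  have chil: "(\<lambda>m. \<Prod>i\<in>S. bump (y $ i / R m)) \<longlonglongrightarrow> 1" for S :: "'n set" and y
  proof -
    have "(\<lambda>m. bump (y $ i / R m)) \<longlonglongrightarrow> bump 0" for i
      by (rule isCont_tendsto_compose[OF cb Rlim])
    then have "(\<lambda>m. \<Prod>i\<in>S. bump (y $ i / R m)) \<longlonglongrightarrow> (\<Prod>i\<in>S. bump 0)" by (intro tendsto_prod)
    then show ?thesis by (simp add: bump_0)
  qed
  have \<phi>m [measurable]: "\<phi> m \<in> borel_measurable borel" for m unfolding \<phi>_eq[abs_def] by measurable
  have \<phi>b: "bdd_meas (e ^ CARD('n) * (1 / sqrt s) ^ CARD('n)) (\<phi> m)" for m
    unfolding bdd_meas_def using gk_le_sup[OF s] chib e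
    by (auto simp: \<phi>_eq abs_mult intro!: mult_mono)
  have pd: "partial_deriv i (\<phi> m) y = (b' (y $ i / R m) / R m * (\<Prod>j\<in>UNIV-{i}. bump (y $ j / R m)) - (\<Prod>j\<in>UNIV. bump (y $ j / R m)) * ((y - c) $ i / s)) * gk s (y - c)" for i m y
  proof -
    have nd: "((\<lambda>z. normal_density 0 (sqrt s) (z - a)) has_real_derivative (- ((z - a) / s)) * normal_density 0 (sqrt s) (z - a)) (at z)" for a z
    proof -
      have e: "normal_density 0 (sqrt s) w = 1 / sqrt (2 * pi * s) * exp (- (w\<^sup>2) / (2 * s))" for w
        using s by (simp add: normal_density_def)
      have "((\<lambda>z. exp (- ((z - a)\<^sup>2) / (2 * s))) has_real_derivative (- ((z - a) / s)) * exp (- ((z - a)\<^sup>2) / (2 * s))) (at z)"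
        using s by (auto intro!: derivative_eq_intros simp: field_simps)
      then have "((\<lambda>z. 1 / sqrt (2 * pi * s) * exp (- ((z - a)\<^sup>2) / (2 * s))) has_real_derivative
          1 / sqrt (2 * pi * s) * ((- ((z - a) / s)) * exp (- ((z - a)\<^sup>2) / (2 * s)))) (at z)"
        by (rule DERIV_cmult)
      then show ?thesis unfolding e by (simp only: mult_ac)
    qed
    have bd: "((\<lambda>z. bump (z / R m)) has_real_derivative b' (z / R m) / R m) (at z)" for z
    proof -
      have "((\<lambda>z. z / R m) has_real_derivative 1 / R m) (at z)"
        using R(1)[of m] by (auto intro!: derivative_eq_intros)
      from DERIV_chain2[OF b'(1) this] show ?thesis by simp
    qed
    have d: "((\<lambda>z. bump (z / R m) * normal_density 0 (sqrt s) (z - c $ i)) has_real_derivative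
        (b' (z / R m) / R m - bump (z / R m) * ((z - c $ i) / s)) * normal_density 0 (sqrt s) (z - c $ i)) (at z)" for i z
      by (rule DERIV_cong[OF DERIV_mult[OF bd nd]]) (simp add: algebra_simps)
    have "partial_deriv i (\<phi> m) y = (\<Prod>j\<in>UNIV. (if j = i then (\<lambda>z. (b' (z / R m) / R m - bump (z / R m) * ((z - c $ j) / s)) * normal_density 0 (sqrt s) (z - c $ j))
       else (\<lambda>z. bump (z / R m) * normal_density 0 (sqrt s) (z - c $ j))) (y $ j))"
      unfolding \<phi>_def[abs_def] by (rule prod_components_derivative(2)[OF d])
    also have "\<dots> = (b' (y $ i / R m) / R m - bump (y $ i / R m) * ((y $ i - c $ i) / s)) * normal_density 0 (sqrt s) (y $ i - c $ i)
        * (\<Prod>j\<in>UNIV-{i}. bump (y $ j / R m) * normal_density 0 (sqrt s) (y $ j - c $ j))"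
      by (subst prod.remove[of _ i]) (auto intro!: prod.cong)
    also have "\<dots> = (b' (y $ i / R m) / R m * (\<Prod>j\<in>UNIV-{i}. bump (y $ j / R m)) - (bump (y $ i / R m) * (\<Prod>j\<in>UNIV-{i}. bump (y $ j / R m))) * ((y - c) $ i / s))
        * (normal_density 0 (sqrt s) (y $ i - c $ i) * (\<Prod>j\<in>UNIV-{i}. normal_density 0 (sqrt s) (y $ j - c $ j)))"
      by (simp add: prod.distrib algebra_simps)
    also have "bump (y $ i / R m) * (\<Prod>j\<in>UNIV-{i}. bump (y $ j / R m)) = (\<Prod>j\<in>UNIV. bump (y $ j / R m))"
      by (rule prod.remove[symmetric]) auto
    also have "normal_density 0 (sqrt s) (y $ i - c $ i) * (\<Prod>j\<in>UNIV-{i}. normal_density 0 (sqrt s) (y $ j - c $ j)) = gk s (y - c)"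
      unfolding gk_def by (subst prod.remove[of _ i]) auto
    finally show ?thesis .
  qed
  have pdm [measurable]: "partial_deriv i (\<phi> m) \<in> borel_measurable borel" for i m unfolding pd[abs_def] by measurable
  \<comment> \<open>the derivative falling on the cut-off vanishes in the limit, the one on the Gaussian remains\<close>
  have pdl: "(\<lambda>m. partial_deriv i (\<phi> m) y) \<longlonglongrightarrow> - ((y - c) $ i / s * gk s (y - c))" for i y
  proof -
    have "(\<lambda>m. \<bar>b' (y $ i / R m) / R m\<bar>) \<longlonglongrightarrow> 0"
    proof (rule tendsto_sandwich[OF _ _ tendsto_const Rlim[of M]])
      show "\<forall>\<^sub>F m in sequentially. \<bar>b' (y $ i / R m) / R m\<bar> \<le> M / R m"
      proof (intro always_eventually allI)
        fix m show "\<bar>b' (y $ i / R m) / R m\<bar> \<le> M / R m"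
          using divide_right_mono[OF b'(3) less_imp_le[OF R(1)], of "y $ i / R m" m] R(1)[of m] by (simp add: abs_divide)
      qed
    qed auto
    then have 1: "(\<lambda>m. b' (y $ i / R m) / R m) \<longlonglongrightarrow> 0" by (rule tendsto_rabs_zero_cancel)
    have "(\<lambda>m. partial_deriv i (\<phi> m) y) \<longlonglongrightarrow> (0 * 1 - 1 * ((y - c) $ i / s)) * gk s (y - c)"
      unfolding pd by (intro tendsto_intros 1 chil)
    then show ?thesis by simp
  qed
  define G where "G y = (\<Sum>i\<in>(UNIV :: 'n set). B * (e ^ CARD('n) * (M * gk s (y - c) + sqrt 2 ^ CARD('n) / sqrt s * gk (2 * s) (y - c))))" for y
  have pdb: "\<bar>partial_deriv i (\<phi> m) y\<bar> \<le> e ^ CARD('n) * (M * gk s (y - c) + sqrt 2 ^ CARD('n) / sqrt s * gk (2 * s) (y - c))" for i m y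
  proof -
    have 1: "\<bar>b' (y $ i / R m) / R m * (\<Prod>j\<in>UNIV-{i}. bump (y $ j / R m))\<bar> \<le> M * e ^ CARD('n)"
    proof -
      have "\<bar>b' (y $ i / R m) / R m\<bar> \<le> M / 1"
        unfolding abs_divide using b'(3) R(2)[of m] M0 by (intro frac_le) auto
      then show ?thesis unfolding abs_mult using chib M0 by (intro mult_mono) auto
    qed
    have 2: "\<bar>(\<Prod>j\<in>UNIV. bump (y $ j / R m)) * ((y - c) $ i / s)\<bar> \<le> e ^ CARD('n) * (\<bar>(y - c) $ i\<bar> / s)"
      unfolding abs_mult abs_divide abs_of_pos[OF s] using s by (intro mult_right_mono chib) auto
    have "\<bar>partial_deriv i (\<phi> m) y\<bar> \<le> (M * e ^ CARD('n) + e ^ CARD('n) * (\<bar>(y - c) $ i\<bar> / s)) * gk s (y - c)"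
      unfolding pd abs_mult abs_of_nonneg[OF gk_nonneg]
      by (intro mult_right_mono order_trans[OF abs_triangle_ineq4] add_mono 1 2) auto
    also have "\<dots> = e ^ CARD('n) * (M * gk s (y - c) + \<bar>(y - c) $ i\<bar> / s * gk s (y - c))" by (simp add: algebra_simps)
    also have "\<dots> \<le> e ^ CARD('n) * (M * gk s (y - c) + sqrt 2 ^ CARD('n) / sqrt s * gk (2 * s) (y - c))"
      using e by (intro mult_left_mono add_left_mono component_mult_gk s) auto
    finally show ?thesis .
  qed
  have "(\<lambda>m. LINT y|lborel. (\<Sum>i\<in>UNIV. u y $ i * partial_deriv i (\<phi> m) y)) \<longlonglongrightarrow> (LINT y|lborel. (\<Sum>i\<in>UNIV. u y $ i * - ((y - c) $ i / s * gk s (y - c))))"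
  proof (rule integral_dominated_convergence[where w=G])
    show "integrable lborel G" unfolding G_def
      using s by (intro Bochner_Integration.integrable_sum integrable_mult_right Bochner_Integration.integrable_add integrable_gk) auto
    show "AE y in lborel. norm (\<Sum>i\<in>UNIV. u y $ i * partial_deriv i (\<phi> m) y) \<le> G y" for m
    proof (intro AE_I2)
      fix y
      have "\<bar>u y $ i * partial_deriv i (\<phi> m) y\<bar> \<le> B * (e ^ CARD('n) * (M * gk s (y - c) + sqrt 2 ^ CARD('n) / sqrt s * gk (2 * s) (y - c)))" for i
        unfolding abs_mult by (intro mult_mono ub pdb B0) simp
      then show "norm (\<Sum>i\<in>UNIV. u y $ i * partial_deriv i (\<phi> m) y) \<le> G y"
        unfolding G_def real_norm_def
        by (intro order_trans[OF sum_abs] sum_mono)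
    qed
    show "AE y in lborel. (\<lambda>m. \<Sum>i\<in>UNIV. u y $ i * partial_deriv i (\<phi> m) y) \<longlonglongrightarrow> (\<Sum>i\<in>UNIV. u y $ i * - ((y - c) $ i / s * gk s (y - c)))"
      by (intro AE_I2 tendsto_intros pdl)
  qed measurable
  then have "(\<lambda>m. distr_div u (\<phi> m)) \<longlonglongrightarrow> (LINT y|lborel. (\<Sum>i\<in>UNIV. u y $ i * ((y - c) $ i / s * gk s (y - c))))"
    unfolding distr_div_def by (auto dest: tendsto_minus simp: sum_negf)
  moreover have "distr_div u (\<phi> m) = (LINT y|lam. g y * \<phi> m y)" for m
    by (rule div[OF _ \<phi>b]) (unfold \<phi>_def[abs_def], rule test_function_gauss_cutoff[OF s R(1)])
  moreover have "(\<lambda>m. LINT y|lam. g y * \<phi> m y) \<longlonglongrightarrow> (LINT y|lam. g y * (1 * gk s (y - c)))"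
  proof (rule integral_dominated_convergence[where w="\<lambda>y. e ^ CARD('n) * \<bar>g y * gk s (y - c)\<bar>"])
    show "integrable lam (\<lambda>y. e ^ CARD('n) * \<bar>g y * gk s (y - c)\<bar>)" using gi by auto
    show "AE y in lam. norm (g y * \<phi> m y) \<le> e ^ CARD('n) * \<bar>g y * gk s (y - c)\<bar>" for m
    proof (intro AE_I2)
      fix y
      show "norm (g y * \<phi> m y) \<le> e ^ CARD('n) * \<bar>g y * gk s (y - c)\<bar>"
        using mult_right_mono[OF chib[where S=UNIV and y=y and m=m], of "\<bar>g y * gk s (y - c)\<bar>"]
        by (simp add: \<phi>_eq abs_mult mult_ac)
    qed
    show "AE y in lam. (\<lambda>m. g y * \<phi> m y) \<longlonglongrightarrow> g y * (1 * gk s (y - c))"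
      unfolding \<phi>_eq by (intro AE_I2 tendsto_intros chil)
  qed measurable
  ultimately show ?thesis using LIMSEQ_unique by simp
qed

section \<open>A divergence that is controlled by Gaussians\<close>

text \<open>Both regularity hypotheses on the drift are used only through this property: the divergence is
  \<open>g\<close> times a measure, it may be tested against Gaussians, and its absolute value has Gaussian
  averages that blow up like \<open>1 / sqrt s\<close> when the variance \<open>s\<close> tends to 0.\<close>

definition gauss_div ::
    "(real ^ 'n::finite \<Rightarrow> real ^ 'n) \<Rightarrow> real \<Rightarrow> (real ^ 'n) measure \<Rightarrow> (real ^ 'n \<Rightarrow> real) \<Rightarrow> bool" where
  "gauss_div u K lam g \<longleftrightarrow>
     sigma_finite_measure lam \<and> sets lam = sets borel \<and> g \<in> borel_measurable borel \<and>
     (\<forall>c s. 0 < s \<longrightarrow> (\<integral>\<^sup>+y. ennreal (\<bar>g y\<bar> * gk s (y - c)) \<partial>lam) \<le> ennreal (K * (1 + 1 / sqrt s))) \<and>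
     (\<forall>c s. 0 < s \<longrightarrow> (LINT y|lborel. (\<Sum>i\<in>UNIV. u y $ i * ((y - c) $ i / s * gk s (y - c)))) = (LINT y|lam. g y * gk s (y - c)))"

lemma gauss_divI:
  assumes u: "u \<in> borel_measurable borel" "\<And>x i. \<bar>u x $ i\<bar> \<le> B"
    and lam: "sigma_finite_measure lam" "sets lam = sets borel" and g: "g \<in> borel_measurable borel"
    and K: "\<And>c s. 0 < s \<Longrightarrow> (\<integral>\<^sup>+y. ennreal (\<bar>g y\<bar> * gk s (y - c)) \<partial>lam) \<le> ennreal (K * (1 + 1 / sqrt s))"
    and div: "\<And>\<phi> C. test_function \<phi> \<Longrightarrow> bdd_meas C \<phi> \<Longrightarrow> distr_div u \<phi> = (LINT y|lam. g y * \<phi> y)"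
  shows "gauss_div u K lam g"
  unfolding gauss_div_def
proof (intro conjI allI impI)
  fix c :: "real ^ 'a" and s :: real assume s: "0 < s"
  note [measurable_cong] = lam(2) and [measurable] = g
  have "integrable lam (\<lambda>y. g y * gk s (y - c))"
    using K[OF s, of c] by (intro integrableI_bounded) (auto simp: abs_mult intro: le_less_trans)
  then show "(LINT y|lborel. (\<Sum>i\<in>UNIV. u y $ i * ((y - c) $ i / s * gk s (y - c)))) = (LINT y|lam. g y * gk s (y - c))"
    by (rule distr_div_gauss[OF s u lam(2) g _ div])
qed (use lam g K in auto)

text \<open>Young's inequality \<open>\<bar>g\<bar> \<le> a + \<bar>g\<bar> powr p * a powr (1 - p)\<close> with \<open>a = 1 + 1 / sqrt s\<close>; the
  condition \<open>p \<ge> CARD('n)\<close> is what makes the second term at most of order \<open>a\<close>.\<close>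

lemma Lp_gauss_bound:
  fixes g :: "real ^ 'n::finite \<Rightarrow> real"
  assumes [measurable]: "g \<in> borel_measurable borel" and p: "real CARD('n) \<le> p"
    and J: "(\<integral>\<^sup>+x. ennreal (\<bar>g x\<bar> powr p) \<partial>lborel) \<le> ennreal J" "0 \<le> J" and s: "0 < s"
  shows "(\<integral>\<^sup>+y. ennreal (\<bar>g y\<bar> * gk s (y - c)) \<partial>lborel) \<le> ennreal ((1 + J) * (1 + 1 / sqrt s))"
proof -
  define a where "a = 1 + 1 / sqrt s"
  have a: "1 \<le> a" "1 / sqrt s \<le> a" "0 < a" using s by (auto simp: a_def add_pos_nonneg)
  have p1: "1 \<le> p" using p by (rule order_trans[rotated]) (simp add: Suc_leI)
  define q where "q = a powr (1 - p) * a ^ CARD('n)"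
  have q: "q \<le> a"
  proof -
    have "q = a powr (1 - p + real CARD('n))" unfolding q_def using a by (simp add: powr_add powr_realpow)
    also have "\<dots> \<le> a powr 1" using a p by (intro powr_mono) auto
    finally show ?thesis using a by simp
  qed
  have young: "\<bar>g y\<bar> \<le> a + \<bar>g y\<bar> powr p * a powr (1 - p)" for y
  proof (cases "\<bar>g y\<bar> \<le> a")
    case False
    then have "\<bar>g y\<bar> = \<bar>g y\<bar> powr p * \<bar>g y\<bar> powr (1 - p)" using a by (simp add: powr_add[symmetric])
    also have "\<dots> \<le> \<bar>g y\<bar> powr p * a powr (1 - p)"
      using False a p1 by (intro mult_left_mono powr_mono2') auto
    finally show ?thesis using a by simp
  qed (use a in \<open>simp add: add_increasing2\<close>)
  have "\<bar>g y\<bar> * gk s (y - c) \<le> a * gk s (y - c) + q * \<bar>g y\<bar> powr p" for y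
  proof -
    have "\<bar>g y\<bar> * gk s (y - c) \<le> (a + \<bar>g y\<bar> powr p * a powr (1 - p)) * gk s (y - c)"
      by (intro mult_right_mono young) auto
    also have "\<dots> = a * gk s (y - c) + \<bar>g y\<bar> powr p * a powr (1 - p) * gk s (y - c)" by (simp add: algebra_simps)
    also have "\<dots> \<le> a * gk s (y - c) + \<bar>g y\<bar> powr p * a powr (1 - p) * a ^ CARD('n)"
      using s by (intro add_left_mono mult_left_mono order_trans[OF gk_le_sup[OF s]] power_mono a) auto
    finally show ?thesis by (simp add: q_def mult_ac)
  qed
  then have "(\<integral>\<^sup>+y. ennreal (\<bar>g y\<bar> * gk s (y - c)) \<partial>lborel) \<le> (\<integral>\<^sup>+y. ennreal a * ennreal (gk s (y - c)) + ennreal q * ennreal (\<bar>g y\<bar> powr p) \<partial>lborel)"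
    using a by (intro nn_integral_mono) (auto simp: q_def ennreal_mult[symmetric] ennreal_plus[symmetric] simp del: ennreal_plus intro!: ennreal_leI)
  also have "\<dots> = ennreal a + ennreal q * (\<integral>\<^sup>+y. ennreal (\<bar>g y\<bar> powr p) \<partial>lborel)"
    by (subst nn_integral_add) (auto simp: nn_integral_cmult nn_integral_gk s)
  also have "\<dots> \<le> ennreal a + ennreal a * ennreal J"
    using q J by (intro add_left_mono mult_mono ennreal_leI) auto
  also have "\<dots> = ennreal ((1 + J) * (1 + 1 / sqrt s))"
    using a J by (simp add: ennreal_mult[symmetric] ennreal_plus[symmetric] a_def[symmetric] algebra_simps del: ennreal_plus)
  finally show ?thesis .
qed

lemma gauss_div_Lp:
  fixes u :: "real ^ 'n::finite \<Rightarrow> real ^ 'n"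
  assumes u: "u \<in> borel_measurable borel" "\<And>x i. \<bar>u x $ i\<bar> \<le> B"
    and \<rho>: "ereal (real CARD('n)) \<le> \<rho>" and N: "div_Lp_norm \<rho> u < ereal N" "0 < N"
  shows "\<exists>g. gauss_div u (1 + N + N powr real_of_ereal \<rho>) lborel g"
proof -
  obtain g where g: "div_is_function u g" "Lp_norm \<rho> g < ereal N"
    using N(1) unfolding div_Lp_norm_def Inf_less_iff by auto
  have gm [measurable]: "g \<in> borel_measurable borel" using g(1) by (simp add: div_is_function_def)
  define P where "P = N powr real_of_ereal \<rho>"
  have "(\<integral>\<^sup>+y. ennreal (\<bar>g y\<bar> * gk s (y - c)) \<partial>lborel) \<le> ennreal ((1 + N + P) * (1 + 1 / sqrt s))"
    if s: "0 < s" for c s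
  proof (cases "\<rho> = \<infinity>")
    case True
    have "AE y in lborel. \<bar>g y\<bar> \<le> N"
      using esssup_AE[of "\<lambda>x. ereal \<bar>g x\<bar>" lborel] g(2) True
      by (auto simp: Lp_norm_def elim!: eventually_mono) (metis ereal_less_eq(3) less_imp_le order_trans)
    then have "(\<integral>\<^sup>+y. ennreal (\<bar>g y\<bar> * gk s (y - c)) \<partial>lborel) \<le> (\<integral>\<^sup>+y. ennreal N * ennreal (gk s (y - c)) \<partial>lborel)"
      using N(2) by (intro nn_integral_mono_AE) (auto simp: ennreal_mult[symmetric] intro!: ennreal_leI mult_right_mono elim!: eventually_mono)
    also have "\<dots> = ennreal (N * 1)" using s by (simp add: nn_integral_cmult nn_integral_gk)
    also have "\<dots> \<le> ennreal ((1 + N + P) * (1 + 1 / sqrt s))"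
      using N(2) s by (intro ennreal_leI mult_mono) (auto simp: P_def)
    finally show ?thesis .
  next
    case False
    define p where "p = real_of_ereal \<rho>"
    have p: "\<rho> = ereal p" using \<rho> False by (cases \<rho>) (auto simp: p_def)
    have pn: "real CARD('n) \<le> p" using \<rho> p by simp
    have p1: "1 \<le> p" using pn by (rule order_trans[rotated]) (simp add: Suc_leI)
    define I where "I = (\<integral>\<^sup>+x. ennreal (\<bar>g x\<bar> powr p) \<partial>lborel)"
    have If: "I \<noteq> \<infinity>" and Ip: "enn2real I powr (1 / p) < N"
      using g(2) False unfolding Lp_norm_def by (auto simp: p_def[symmetric] I_def[symmetric] Let_def split: if_splits)
    have "enn2real I = (enn2real I powr (1 / p)) powr p" using p1 by (simp add: powr_powr)
    also have "\<dots> \<le> N powr p" using Ip p1 by (intro powr_mono2) auto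
    finally have "enn2real I \<le> P" by (simp add: P_def p_def)
    then have "I \<le> ennreal P" using If by (metis ennreal_enn2real_if ennreal_leI infinity_ennreal_def)
    then have "(\<integral>\<^sup>+y. ennreal (\<bar>g y\<bar> * gk s (y - c)) \<partial>lborel) \<le> ennreal ((1 + P) * (1 + 1 / sqrt s))"
      unfolding I_def by (intro Lp_gauss_bound[OF gm pn _ _ s]) (auto simp: P_def)
    also have "\<dots> \<le> ennreal ((1 + N + P) * (1 + 1 / sqrt s))"
      using N(2) s by (intro ennreal_leI mult_right_mono) auto
    finally show ?thesis .
  qed
  then have "gauss_div u (1 + N + P) lborel g"
    using g(1) by (intro gauss_divI[OF u lborel.sigma_finite_measure_axioms _ gm]) (auto simp: div_is_function_def)
  then show ?thesis unfolding P_def by blast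
qed

lemma sum_of_measures:
  assumes "sets \<mu> = sets \<nu>"
  obtains lam where "sets lam = sets \<mu>" "\<And>A. A \<in> sets \<mu> \<Longrightarrow> emeasure lam A = emeasure \<mu> A + emeasure \<nu> A"
proof
  define lam where "lam = measure_of (space \<mu>) (sets \<mu>) (\<lambda>A. emeasure \<mu> A + emeasure \<nu> A)"
  show s: "sets lam = sets \<mu>" unfolding lam_def by simp
  fix A assume A: "A \<in> sets \<mu>"
  show "emeasure lam A = emeasure \<mu> A + emeasure \<nu> A"
  proof (rule emeasure_measure_of[OF lam_def])
    show "sets \<mu> \<subseteq> Pow (space \<mu>)" by (rule sets.space_closed)
    show "A \<in> sets lam" using A s by simp
    show "positive (sets lam) (\<lambda>A. emeasure \<mu> A + emeasure \<nu> A)" by (simp add: positive_def)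
    show "countably_additive (sets lam) (\<lambda>A. emeasure \<mu> A + emeasure \<nu> A)"
    proof (rule countably_additiveI)
      fix F :: "nat \<Rightarrow> 'a set" assume F: "range F \<subseteq> sets lam" "disjoint_family F"
      have "(\<Sum>i. emeasure \<mu> (F i) + emeasure \<nu> (F i)) = (\<Sum>i. emeasure \<mu> (F i)) + (\<Sum>i. emeasure \<nu> (F i))"
        by (rule suminf_add[symmetric]) auto
      then show "(\<Sum>i. emeasure \<mu> (F i) + emeasure \<nu> (F i)) = emeasure \<mu> (\<Union>i. F i) + emeasure \<nu> (\<Union>i. F i)"
        using F s assms by (simp add: suminf_emeasure)
    qed
  qed
qed

text \<open>In dimension one the kernel is at most \<open>1 / sqrt s\<close>, so a finite signed measure qualifies. Its
  total variation has density \<open>\<bar>D1 - D2\<bar>\<close> with respect to \<open>\<mu> + \<nu>\<close>, where \<open>D1\<close>, \<open>D2\<close> are the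
  densities of \<open>\<mu>\<close> and \<open>\<nu>\<close>.\<close>

lemma gauss_div_TV:
  fixes u :: "real ^ 'n::finite \<Rightarrow> real ^ 'n"
  assumes u: "u \<in> borel_measurable borel" "\<And>x i. \<bar>u x $ i\<bar> \<le> B" and n: "CARD('n) = 1"
    and N: "div_TV_norm u < ereal N"
  shows "\<exists>lam g. gauss_div u N lam g"
proof -
  obtain \<mu> \<nu> where mn: "div_is_signed_measure u \<mu> \<nu>" "TV_norm_diff \<mu> \<nu> < ereal N"
    using N unfolding div_TV_norm_def Inf_less_iff by auto
  have fin: "finite_measure \<mu>" "finite_measure \<nu>" and sb: "sets \<mu> = sets borel" "sets \<nu> = sets borel"
    using mn(1) by (auto simp: div_is_signed_measure_def finite_borel_measure_def)
  obtain lam where sl: "sets lam = sets \<mu>" and lam: "\<And>A. A \<in> sets \<mu> \<Longrightarrow> emeasure lam A = emeasure \<mu> A + emeasure \<nu> A"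
    using sum_of_measures[of \<mu> \<nu>] sb by auto
  have slb [measurable_cong]: "sets lam = sets borel" using sl sb by simp
  have spl: "space lam = UNIV" "space \<mu> = UNIV" "space \<nu> = UNIV" using slb sb by (auto dest: sets_eq_imp_space_eq)
  interpret lam: finite_measure lam
  proof
    show "emeasure lam (space lam) \<noteq> \<infinity>"
      using fin sb lam[of UNIV] spl finite_measure.emeasure_finite[of \<mu> UNIV] finite_measure.emeasure_finite[of \<nu> UNIV]
      by (auto simp: ennreal_add_eq_top)
  qed
  have ac: "absolutely_continuous lam \<mu>" "absolutely_continuous lam \<nu>"
    using lam sl sb by (auto simp: absolutely_continuous_def null_sets_def)
  obtain D1 where D1: "D1 \<in> borel_measurable lam" "AE x in lam. RN_deriv lam \<mu> x = ennreal (D1 x)" "\<And>x. 0 \<le> D1 x"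
    using lam.real_RN_deriv[OF fin(1) ac(1)] sl sb by metis
  obtain D2 where D2: "D2 \<in> borel_measurable lam" "AE x in lam. RN_deriv lam \<nu> x = ennreal (D2 x)" "\<And>x. 0 \<le> D2 x"
    using lam.real_RN_deriv[OF fin(2) ac(2)] sl sb by metis
  note [measurable] = D1(1) D2(1)
  have e1: "\<mu> = density lam (\<lambda>x. ennreal (D1 x))"
  proof -
    have "\<mu> = density lam (RN_deriv lam \<mu>)" using lam.density_RN_deriv[OF ac(1)] sl by simp
    also have "\<dots> = density lam (\<lambda>x. ennreal (D1 x))" by (rule density_cong) (use D1 in auto)
    finally show ?thesis .
  qed
  have e2: "\<nu> = density lam (\<lambda>x. ennreal (D2 x))"
  proof -
    have "\<nu> = density lam (RN_deriv lam \<nu>)" using lam.density_RN_deriv[OF ac(2)] sl sb by simp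
    also have "\<dots> = density lam (\<lambda>x. ennreal (D2 x))" by (rule density_cong) (use D2 in auto)
    finally show ?thesis .
  qed
  have i1: "integrable lam (\<lambda>y. D1 y * \<phi> y)" if "bdd_meas C \<phi>" for C \<phi>
  proof -
    note [measurable] = bdd_measD(1)[OF that]
    have "integrable \<mu> \<phi>"
      using fin(1) bdd_measD[OF that] sb by (intro finite_measure.integrable_const_bound[of _ _ C]) (auto cong: measurable_cong_sets)
    then show ?thesis unfolding e1 using D1 by (subst (asm) integrable_density) auto
  qed
  have i2: "integrable lam (\<lambda>y. D2 y * \<phi> y)" if "bdd_meas C \<phi>" for C \<phi>
  proof -
    note [measurable] = bdd_measD(1)[OF that]
    have "integrable \<nu> \<phi>"
      using fin(2) bdd_measD[OF that] sb by (intro finite_measure.integrable_const_bound[of _ _ C]) (auto cong: measurable_cong_sets)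
    then show ?thesis unfolding e2 using D2 by (subst (asm) integrable_density) auto
  qed
  have diff: "(LINT y|\<mu>. \<phi> y) - (LINT y|\<nu>. \<phi> y) = (LINT y|lam. (D1 y - D2 y) * \<phi> y)" if b: "bdd_meas C \<phi>" for C \<phi>
  proof -
    note [measurable] = bdd_measD(1)[OF b]
    have "(LINT y|\<mu>. \<phi> y) = (LINT y|lam. D1 y * \<phi> y)" unfolding e1 using D1 by (subst integral_density) auto
    moreover have "(LINT y|\<nu>. \<phi> y) = (LINT y|lam. D2 y * \<phi> y)" unfolding e2 using D2 by (subst integral_density) auto
    ultimately show ?thesis using i1[OF b] i2[OF b] by (simp add: left_diff_distrib)
  qed
  define D where "D y = D1 y - D2 y" for y
  have Dm [measurable]: "D \<in> borel_measurable borel"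
    using D1(1) D2(1) slb unfolding D_def by (auto cong: measurable_cong_sets)
  have one: "bdd_meas 1 (\<lambda>_. 1)" by (simp add: bdd_meas_def)
  have Di: "integrable lam D" using i1[OF one] i2[OF one] unfolding D_def[abs_def] by simp
  \<comment> \<open>the sign of the density is admissible in the supremum and attains the total variation\<close>
  define \<psi> where "\<psi> y = (if 0 \<le> D y then 1 else -1 :: real)" for y
  have \<psi>m: "\<psi> \<in> borel_measurable borel" unfolding \<psi>_def[abs_def] by measurable
  have "ereal ((LINT y|\<mu>. \<psi> y) - (LINT y|\<nu>. \<psi> y)) \<le> TV_norm_diff \<mu> \<nu>"
    unfolding TV_norm_diff_def by (rule SUP_upper) (auto simp: \<psi>m, auto simp: \<psi>_def)
  then have "(LINT y|\<mu>. \<psi> y) - (LINT y|\<nu>. \<psi> y) \<le> N" using mn(2)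
    by (metis ereal_less_eq(3) less_imp_le order_trans)
  moreover have "bdd_meas 1 \<psi>" using \<psi>m by (auto simp: bdd_meas_def \<psi>_def)
  moreover have "D y * \<psi> y = \<bar>D y\<bar>" for y by (simp add: \<psi>_def)
  ultimately have absD: "(LINT y|lam. \<bar>D y\<bar>) \<le> N" using diff[of 1 \<psi>] by (simp add: D_def[symmetric])
  have N0: "0 \<le> N" by (rule order_trans[OF _ absD]) simp
  have "gauss_div u N lam D"
  proof (rule gauss_divI[OF u lam.sigma_finite_measure_axioms slb Dm])
    fix c :: "real ^ 'n" and s :: real assume s: "0 < s"
    have "(\<integral>\<^sup>+y. ennreal (\<bar>D y\<bar> * gk s (y - c)) \<partial>lam) \<le> (\<integral>\<^sup>+y. ennreal (\<bar>D y\<bar>) * ennreal (1 / sqrt s) \<partial>lam)"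
    proof (intro nn_integral_mono)
      fix y
      show "ennreal (\<bar>D y\<bar> * gk s (y - c)) \<le> ennreal (\<bar>D y\<bar>) * ennreal (1 / sqrt s)"
        using mult_left_mono[OF gk_le_sup[OF s, of "y - c"], of "\<bar>D y\<bar>"] s n
        by (subst ennreal_mult[symmetric]) (auto intro!: ennreal_leI)
    qed
    also have "\<dots> = ennreal (LINT y|lam. \<bar>D y\<bar>) * ennreal (1 / sqrt s)"
      using Di by (subst nn_integral_multc) (auto simp: nn_integral_eq_integral)
    also have "\<dots> \<le> ennreal (N * (1 + 1 / sqrt s))"
      using mult_mono[OF absD, of "1 / sqrt s" "1 + 1 / sqrt s"] N0 s
      by (subst ennreal_mult[symmetric]) (auto intro!: ennreal_leI)
    finally show "(\<integral>\<^sup>+y. ennreal (\<bar>D y\<bar> * gk s (y - c)) \<partial>lam) \<le> ennreal (N * (1 + 1 / sqrt s))" .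
  next
    fix \<phi> :: "real ^ 'n \<Rightarrow> real" and C assume "test_function \<phi>" "bdd_meas C \<phi>"
    then show "distr_div u \<phi> = (LINT y|lam. D y * \<phi> y)"
      using mn(1) diff[of C \<phi>] by (simp add: div_is_signed_measure_def D_def)
  qed
  then show ?thesis by blast
qed

lemma gauss_div_uniform:
  fixes b :: "real \<Rightarrow> real ^ 'n::finite \<Rightarrow> real ^ 'n"
  assumes b: "\<And>t. t \<in> S \<Longrightarrow> b t \<in> borel_measurable borel" "\<And>t x i. t \<in> S \<Longrightarrow> \<bar>b t x $ i\<bar> \<le> B"
    and reg: "(\<exists>\<rho>. ereal (real CARD('n)) \<le> \<rho> \<and> (SUP t\<in>S. div_Lp_norm \<rho> (b t)) < \<infinity>) \<or>
      (CARD('n) = 1 \<and> (SUP t\<in>S. div_TV_norm (b t)) < \<infinity>)"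
  shows "\<exists>K. \<forall>t\<in>S. \<exists>lam g. gauss_div (b t) K lam g"
  using reg
proof
  assume "\<exists>\<rho>. ereal (real CARD('n)) \<le> \<rho> \<and> (SUP t\<in>S. div_Lp_norm \<rho> (b t)) < \<infinity>"
  then obtain \<rho> where \<rho>: "ereal (real CARD('n)) \<le> \<rho>" "(SUP t\<in>S. div_Lp_norm \<rho> (b t)) < \<infinity>" by blast
  obtain N :: nat where N: "(SUP t\<in>S. div_Lp_norm \<rho> (b t)) < ereal (real N)"
    using \<rho>(2) less_PInf_Ex_of_nat by auto
  have "\<exists>g. gauss_div (b t) (1 + real (Suc N) + real (Suc N) powr real_of_ereal \<rho>) lborel g" if t: "t \<in> S" for t
  proof (rule gauss_div_Lp[OF b[OF t] \<rho>(1)])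
    have "div_Lp_norm \<rho> (b t) \<le> (SUP t\<in>S. div_Lp_norm \<rho> (b t))" using t by (rule SUP_upper)
    also have "\<dots> < ereal (real N)" by fact
    also have "\<dots> \<le> ereal (real (Suc N))" by simp
    finally show "div_Lp_norm \<rho> (b t) < ereal (real (Suc N))" .
  qed simp_all
  then show ?thesis by blast
next
  assume n: "CARD('n) = 1 \<and> (SUP t\<in>S. div_TV_norm (b t)) < \<infinity>"
  then obtain N :: nat where N: "(SUP t\<in>S. div_TV_norm (b t)) < ereal (real N)"
    using less_PInf_Ex_of_nat by auto
  have "\<exists>lam g. gauss_div (b t) (real N) lam g" if t: "t \<in> S" for t
  proof (rule gauss_div_TV[OF b[OF t] conjunct1[OF n]])
    have "div_TV_norm (b t) \<le> (SUP t\<in>S. div_TV_norm (b t))" using t by (rule SUP_upper)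
    also have "\<dots> < ereal (real N)" by fact
    finally show "div_TV_norm (b t) < ereal (real N)" .
  qed
  then show ?thesis by blast
qed

section \<open>Linearity and continuity of the heat operators\<close>

lemma heat_linear:
  fixes f g :: "real ^ 'n::finite \<Rightarrow> real"
  assumes "0 \<le> t" "bdd_meas K f" "bdd_meas L g"
  shows "heat t (\<lambda>x. a * f x + c * g x) x = a * heat t f x + c * heat t g x"
proof (cases "t = 0")
  case False
  then have t: "0 < t" using assms by simp
  have "integrable lborel (\<lambda>y. a * (gk t (y - x) * f y))" "integrable lborel (\<lambda>y. c * (gk t (y - x) * g y))"
    using integrable_gk_mult[OF t bdd_measD(1,2)[OF assms(2)], of x] integrable_gk_mult[OF t bdd_measD(1,2)[OF assms(3)], of x] by auto
  from Bochner_Integration.integral_add[OF this] t show ?thesis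
    by (simp add: heat_pos algebra_simps)
qed simp

lemma hgrad_linear:
  fixes f g :: "real ^ 'n::finite \<Rightarrow> real"
  assumes t: "0 < t" and fg: "bdd_meas K f" "bdd_meas L g"
  shows "hgrad t i (\<lambda>x. a * f x + c * g x) x = a * hgrad t i f x + c * hgrad t i g x"
proof -
  have "integrable lborel (\<lambda>y. a * ((y - x) $ i / t * gk t (y - x) * f y))" "integrable lborel (\<lambda>y. c * ((y - x) $ i / t * gk t (y - x) * g y))"
    by (intro integrable_mult_right integrable_gk_component[OF t bdd_measD(1,2)[OF fg(1)]] integrable_gk_component[OF t bdd_measD(1,2)[OF fg(2)]])+
  from Bochner_Integration.integral_add[OF this] show ?thesis
    unfolding hgrad_def integral_mult_right_zero
    by (simp only: distrib_left mult_ac)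
qed

lemma heat_tendsto:
  fixes \<psi> :: "real ^ 'n::finite \<Rightarrow> real"
  assumes t: "0 \<le> t" and "\<And>k. bdd_meas K (\<psi>k k)" "bdd_meas K \<psi>" "\<And>x. (\<lambda>k. \<psi>k k x) \<longlonglongrightarrow> \<psi> x"
  shows "(\<lambda>k. heat t (\<psi>k k) x) \<longlonglongrightarrow> heat t \<psi> x"
proof (cases "t = 0")
  case False
  then have t: "0 < t" using assms by simp
  note [measurable] = bdd_measD(1)[OF assms(2)] bdd_measD(1)[OF assms(3)]
  have "(\<lambda>k. LINT y|lborel. gk t (y - x) * \<psi>k k y) \<longlonglongrightarrow> (LINT y|lborel. gk t (y - x) * \<psi> y)"
  proof (rule integral_dominated_convergence[where w="\<lambda>y. gk t (y - x) * K"])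
    show "integrable lborel (\<lambda>y. gk t (y - x) * K)" using t by (intro integrable_mult_left integrable_gk)
    show "AE y in lborel. norm (gk t (y - x) * \<psi>k k y) \<le> gk t (y - x) * K" for k
      using bdd_measD(2)[OF assms(2)] by (auto simp: abs_mult intro!: mult_left_mono)
    show "AE y in lborel. (\<lambda>k. gk t (y - x) * \<psi>k k y) \<longlonglongrightarrow> gk t (y - x) * \<psi> y"
      by (intro AE_I2 tendsto_intros assms)
  qed measurable
  then show ?thesis using t by (simp add: heat_pos)
qed (use assms in simp)

lemma hgrad_tendsto:
  fixes \<psi> :: "real ^ 'n::finite \<Rightarrow> real"
  assumes t: "0 < t" and "\<And>k. bdd_meas K (\<psi>k k)" "bdd_meas K \<psi>" "\<And>x. (\<lambda>k. \<psi>k k x) \<longlonglongrightarrow> \<psi> x"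
  shows "(\<lambda>k. hgrad t i (\<psi>k k) x) \<longlonglongrightarrow> hgrad t i \<psi> x"
proof -
  note [measurable] = bdd_measD(1)[OF assms(2)] bdd_measD(1)[OF assms(3)]
  show ?thesis unfolding hgrad_def
  proof (rule integral_dominated_convergence[where w="\<lambda>y. \<bar>(y - x) $ i / t * gk t (y - x)\<bar> * K"])
    show "integrable lborel (\<lambda>y. \<bar>(y - x) $ i / t * gk t (y - x)\<bar> * K)"
      using t by (intro integrable_mult_left integrable_abs integrable_gk_component')
    show "AE y in lborel. norm ((y - x) $ i / t * gk t (y - x) * \<psi>k k y) \<le> \<bar>(y - x) $ i / t * gk t (y - x)\<bar> * K" for k
      unfolding real_norm_def abs_mult[of _ "\<psi>k k _"]
      by (intro AE_I2 mult_left_mono bdd_measD(2)[OF assms(2)]) auto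
    show "AE y in lborel. (\<lambda>k. (y - x) $ i / t * gk t (y - x) * \<psi>k k y) \<longlonglongrightarrow> (y - x) $ i / t * gk t (y - x) * \<psi> y"
      by (intro AE_I2 tendsto_mult tendsto_const assms)
  qed measurable
qed

lemma hgrad_time_lipschitz:
  fixes g :: "real ^ 'n::finite \<Rightarrow> real"
  assumes t: "0 < t" and s: "0 \<le> s" and g: "bdd_meas K g"
  shows "\<bar>hgrad (t + s) i g x - hgrad t i g x\<bar>
    \<le> s / (t / 2) * (8 * real CARD('n) * real CARD('n) * (2 ^ CARD('n) * 2 ^ CARD('n)) * (dimc TYPE('n) / sqrt (t / 2) * K))"
proof -
  have t2: "0 < t / 2" using t by simp
  let ?f = "hgrad (t / 2) i g"
  have "hgrad (t + s) i g = heat (t / 2 + s) ?f" "hgrad t i g = heat (t / 2) ?f"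
    using t s by (subst heat_hgrad[OF _ _ g]; simp)+
  then show ?thesis using heat_time_lipschitz[OF t2 s bdd_meas_hgrad[OF t2 g, of i], of x] by simp
qed

lemma expectation_nrm1_gauss:
  fixes x :: "real ^ 'n::finite"
  assumes t: "0 < t"
  shows "integrable lborel (\<lambda>y. nrm1 (y - x) * gk t (y - x))"
    and "(LINT y|lborel. nrm1 (y - x) * gk t (y - x)) \<le> real CARD('n) * dimc TYPE('n) * sqrt t"
proof -
  have e: "nrm1 (y - x) * gk t (y - x) = (\<Sum>i\<in>UNIV. t * \<bar>(y - x) $ i / t * gk t (y - x)\<bar>)" for y
    using t by (simp add: sum_distrib_right abs_mult)
  have i: "integrable lborel (\<lambda>y. t * \<bar>(y - x) $ i / t * gk t (y - x)\<bar>)" for i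
    by (intro integrable_mult_right integrable_abs integrable_gk_component' t)
  show "integrable lborel (\<lambda>y. nrm1 (y - x) * gk t (y - x))"
    unfolding e by (intro Bochner_Integration.integrable_sum i)
  have "(LINT y|lborel. nrm1 (y - x) * gk t (y - x)) = (\<Sum>i\<in>UNIV. t * (LINT y|lborel. \<bar>(y - x) $ i / t * gk t (y - x)\<bar>))"
    unfolding e by (subst Bochner_Integration.integral_sum[OF i]) (simp only: integral_mult_right_zero)
  also have "\<dots> \<le> (\<Sum>i\<in>(UNIV :: 'n set). t * (dimc TYPE('n) / sqrt t))"
  proof (intro sum_mono mult_left_mono)
    fix i
    show "(LINT y|lborel. \<bar>(y - x) $ i / t * gk t (y - x)\<bar>) \<le> dimc TYPE('n) / sqrt t"
      by (subst integral_eq_nn_integral)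
        (use t nn_integral_gk_component[OF t, of x i] in \<open>auto intro!: enn2real_leI\<close>)
  qed (use t in auto)
  also have "\<dots> = real CARD('n) * dimc TYPE('n) * (t / sqrt t)" by simp
  finally show "(LINT y|lborel. nrm1 (y - x) * gk t (y - x)) \<le> real CARD('n) * dimc TYPE('n) * sqrt t"
    using t by (simp add: real_div_sqrt)
qed

lemma heat_near_0:
  fixes \<psi> :: "real ^ 'n::finite \<Rightarrow> real"
  assumes t: "0 < t" and \<psi>: "bdd_meas K \<psi>" and lip: "\<And>x y. \<bar>\<psi> y - \<psi> x\<bar> \<le> L * nrm1 (y - x)" and L: "0 \<le> L"
  shows "\<bar>heat t \<psi> x - \<psi> x\<bar> \<le> L * (real CARD('n) * dimc TYPE('n) * sqrt t)"
proof -
  have 1: "integrable lborel (\<lambda>y. gk t (y - x) * \<psi> y)" by (rule integrable_gk_mult[OF t bdd_measD(1,2)[OF \<psi>]])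
  have 2: "integrable lborel (\<lambda>y. gk t (y - x) * \<psi> x)" by (intro integrable_mult_left integrable_gk t)
  have "heat t \<psi> x - \<psi> x = (LINT y|lborel. gk t (y - x) * (\<psi> y - \<psi> x))"
    using t Bochner_Integration.integral_diff[OF 1 2] by (simp add: heat_pos right_diff_distrib integral_gk)
  also have "\<bar>\<dots>\<bar> \<le> (LINT y|lborel. L * (nrm1 (y - x) * gk t (y - x)))"
  proof (rule integral_abs_bound_integral)
    show "integrable lborel (\<lambda>y. gk t (y - x) * (\<psi> y - \<psi> x))"
      using Bochner_Integration.integrable_diff[OF 1 2] by (simp add: right_diff_distrib)
    show "integrable lborel (\<lambda>y. L * (nrm1 (y - x) * gk t (y - x)))"
      by (intro integrable_mult_right expectation_nrm1_gauss t)
    show "\<bar>gk t (y - x) * (\<psi> y - \<psi> x)\<bar> \<le> L * (nrm1 (y - x) * gk t (y - x))" for y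
      using mult_left_mono[OF lip[of y x] gk_nonneg[of t "y - x"]] by (simp add: abs_mult mult_ac)
  qed
  also have "\<dots> \<le> L * (real CARD('n) * dimc TYPE('n) * sqrt t)"
    unfolding integral_mult_right_zero by (intro mult_left_mono L expectation_nrm1_gauss t)
  finally show ?thesis .
qed

section \<open>Integrals over time intervals\<close>

lemma integral_inverse_sqrt_0:
  assumes t: "0 < t"
  shows "set_integrable lborel {0..t} (\<lambda>s. 1 / sqrt s)" "(LINT s:{0..t}|lborel. 1 / sqrt s) = 2 * sqrt t"
proof -
  note ftc = interval_integral_FTC_nonneg[of "ereal 0" "ereal t" "\<lambda>s. 2 * sqrt s" "\<lambda>s. 1 / sqrt s" 0 "2 * sqrt t"]
  have d: "DERIV (\<lambda>s. 2 * sqrt s) x :> 1 / sqrt x" if "0 < x" for x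
    using that by (auto intro!: derivative_eq_intros simp: field_simps)
  have l: "(((\<lambda>s. 2 * sqrt s) \<circ> real_of_ereal) \<longlongrightarrow> 0) (at_right (ereal 0))"
    using tendsto_intros unfolding o_def ereal_tendsto_simps1[unfolded o_def]
    by (auto intro!: tendsto_eq_intros)
  have r: "(((\<lambda>s. 2 * sqrt s) \<circ> real_of_ereal) \<longlongrightarrow> 2 * sqrt t) (at_left (ereal t))"
    unfolding o_def ereal_tendsto_simps1[unfolded o_def] by (auto intro!: tendsto_eq_intros)
  have c: "isCont (\<lambda>s. 1 / sqrt s) x" if "0 < x" for x using that by (intro continuous_intros) auto
  have 1: "set_integrable lborel (einterval (ereal 0) (ereal t)) (\<lambda>s. 1 / sqrt s)" "(LBINT s=ereal 0..ereal t. 1 / sqrt s) = 2 * sqrt t - 0"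
    by (rule ftc; use t d c l r in \<open>auto\<close>)+
  have "AE x in lborel. x \<noteq> 0 \<and> x \<noteq> t" using AE_lborel_singleton[of "0::real"] AE_lborel_singleton[of t] by eventually_elim auto
  then have ae: "AE x in lborel. indicator {0<..<t} x *\<^sub>R (1 / sqrt x) = indicator {0..t} x *\<^sub>R (1 / sqrt x)"
    by eventually_elim (auto simp: indicator_def)
  show "set_integrable lborel {0..t} (\<lambda>s. 1 / sqrt s)"
    using 1(1) unfolding set_integrable_def by (subst integrable_cong_AE[OF _ _ AE_symmetric[OF ae]]) (auto simp: einterval_eq)
  have "(LINT s:{0..t}|lborel. 1 / sqrt s) = (LINT s:{0<..<t}|lborel. 1 / sqrt s)"
    unfolding set_lebesgue_integral_def by (rule integral_cong_AE[OF _ _ AE_symmetric[OF ae]]) auto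
  then show "(LINT s:{0..t}|lborel. 1 / sqrt s) = 2 * sqrt t"
    using 1(2) t by (simp add: interval_integral_Ioo)
qed

lemma set_integral_reflect:
  fixes f :: "real \<Rightarrow> real"
  shows "set_integrable lborel {0..t} (\<lambda>s. f (t - s)) \<longleftrightarrow> set_integrable lborel {0..t} f"
    and "(LINT s:{0..t}|lborel. f (t - s)) = (LINT s:{0..t}|lborel. f s)"
proof -
  have e: "indicator {0..t} s *\<^sub>R f (t - s) = indicator {0..t} (t + (-1) * s) *\<^sub>R f (t + (-1) * s)" for s
    by (auto simp: indicator_def)
  show "set_integrable lborel {0..t} (\<lambda>s. f (t - s)) \<longleftrightarrow> set_integrable lborel {0..t} f"
    unfolding set_integrable_def e by (rule lborel_integrable_real_affine_iff) simp
  show "(LINT s:{0..t}|lborel. f (t - s)) = (LINT s:{0..t}|lborel. f s)"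
    unfolding set_lebesgue_integral_def e
    using lborel_integral_real_affine[of "-1" "\<lambda>s. indicator {0..t} s *\<^sub>R f s" t] by simp
qed

lemma integral_inverse_sqrt_t:
  assumes t: "0 < t"
  shows "set_integrable lborel {0..t} (\<lambda>s. 1 / sqrt (t - s))" "(LINT s:{0..t}|lborel. 1 / sqrt (t - s)) = 2 * sqrt t"
  using integral_inverse_sqrt_0[OF t] set_integral_reflect[of t "\<lambda>s. 1 / sqrt s"] by auto

lemma abs_integral_le:
  fixes f g :: "'a \<Rightarrow> real"
  assumes "integrable M f" "integrable M g" "\<And>x. x \<in> space M \<Longrightarrow> \<bar>f x\<bar> \<le> g x"
  shows "\<bar>\<integral>x. f x \<partial>M\<bar> \<le> (\<integral>x. g x \<partial>M)"
proof -
  have "\<bar>\<integral>x. f x \<partial>M\<bar> \<le> (\<integral>x. \<bar>f x\<bar> \<partial>M)" by (rule integral_abs_bound)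
  also have "\<dots> \<le> (\<integral>x. g x \<partial>M)" by (rule integral_mono) (use assms in auto)
  finally show ?thesis .
qed

lemma set_integral_bound:
  fixes f g :: "'a \<Rightarrow> real"
  assumes "set_integrable M A g" "set_borel_measurable M A f" "\<And>x. x \<in> A \<Longrightarrow> \<bar>f x\<bar> \<le> g x"
  shows "set_integrable M A f" "\<bar>LINT x:A|M. f x\<bar> \<le> (LINT x:A|M. g x)"
proof -
  show i: "set_integrable M A f"
    using assms(1,2) unfolding set_integrable_def set_borel_measurable_def
    by (rule Bochner_Integration.integrable_bound) (use assms(3) in \<open>auto simp: indicator_def intro!: AE_I2 order_trans[OF _ abs_ge_self]\<close>)
  show "\<bar>LINT x:A|M. f x\<bar> \<le> (LINT x:A|M. g x)"
    unfolding set_lebesgue_integral_def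
  proof (rule abs_integral_le)
    show "integrable M (\<lambda>x. indicator A x *\<^sub>R f x)" "integrable M (\<lambda>x. indicator A x *\<^sub>R g x)"
      using i assms(1) unfolding set_integrable_def by auto
  qed (use assms(3) in \<open>auto simp: indicator_def\<close>)
qed

text \<open>Cutting the interval into \<open>N\<close> pieces bounds the total increment by a multiple of \<open>1 / sqrt N\<close>. In this way
  a local expansion with error of order \<open>d * sqrt d\<close> becomes an exact identity.\<close>

lemma superlinear_increment_const:
  fixes f :: "real \<Rightarrow> real"
  assumes ab: "a \<le> b" and f: "\<And>x y. a \<le> x \<Longrightarrow> x < y \<Longrightarrow> y \<le> b \<Longrightarrow> \<bar>f y - f x\<bar> \<le> C * ((y - x) * sqrt (y - x))"
  shows "f b = f a"
proof (cases "a = b")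
  case False
  with ab have ab: "a < b" by simp
  define L where "L = b - a"
  have L: "0 < L" using ab by (simp add: L_def)
  have "\<bar>f b - f a\<bar> \<le> C * L * sqrt (L / real (Suc m))" for m
  proof -
    define N where "N = Suc m"
    have N: "0 < real N" by (simp add: N_def)
    define x where "x k = a + real k * (L / real N)" for k
    have st: "x (Suc k) - x k = L / real N" for k by (simp add: x_def algebra_simps add_divide_distrib)
    have "f b - f a = f (x N) - f (x 0)" using N by (simp add: x_def L_def)
    also have "\<dots> = (\<Sum>k<N. f (x (Suc k)) - f (x k))" by (rule sum_lessThan_telescope[symmetric])
    finally have "\<bar>f b - f a\<bar> \<le> (\<Sum>k<N. \<bar>f (x (Suc k)) - f (x k)\<bar>)" by simp
    also have "\<dots> \<le> (\<Sum>k<N. C * (L / real N * sqrt (L / real N)))"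
    proof (intro sum_mono)
      fix k assume "k \<in> {..<N}"
      then have k: "real (Suc k) \<le> real N" by simp
      have "x (Suc k) \<le> b"
      proof -
        have "real (Suc k) * (L / real N) \<le> real N * (L / real N)" using k L N by (intro mult_right_mono) auto
        then show ?thesis using N by (simp add: x_def L_def)
      qed
      moreover have "a \<le> x k" using L N by (simp add: x_def)
      moreover have "x k < x (Suc k)" using st[of k] divide_pos_pos[OF L N] by linarith
      ultimately show "\<bar>f (x (Suc k)) - f (x k)\<bar> \<le> C * (L / real N * sqrt (L / real N))"
        using f[of "x k" "x (Suc k)"] unfolding st by blast
    qed
    also have "\<dots> = C * L * sqrt (L / real N)" using N by simp
    finally show ?thesis by (simp add: N_def)
  qed
  moreover have "(\<lambda>m. C * L * sqrt (L / real (Suc m))) \<longlonglongrightarrow> C * L * sqrt 0"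
  proof -
    have "(\<lambda>m. L * (1 / real (Suc m))) \<longlonglongrightarrow> L * 0"
      by (intro tendsto_intros LIMSEQ_Suc[OF lim_1_over_n])
    then have "(\<lambda>m. L / real (Suc m)) \<longlonglongrightarrow> 0" by simp
    then show ?thesis by (intro tendsto_intros)
  qed
  ultimately have "\<bar>f b - f a\<bar> \<le> C * L * sqrt 0" by (intro LIMSEQ_le_const[of _ _ "\<bar>f b - f a\<bar>"]) auto
  then show ?thesis by simp
qed simp

lemma set_integrable_const_Icc: "set_integrable lborel {a..b::real} (\<lambda>_. c :: real)"
  unfolding set_integrable_def
  by (auto intro!: integrable_real_indicator simp: emeasure_lborel_Icc_eq)

lemma set_integral_const_Icc: "a \<le> b \<Longrightarrow> (LINT _:{a..b::real}|lborel. c :: real) = c * (b - a)"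
  by (simp add: set_lebesgue_integral_def)

lemma set_integral_Icc_split:
  fixes f :: "real \<Rightarrow> real"
  assumes "a \<le> b" "b \<le> c" "set_integrable lborel {a..c} f"
  shows "(LINT x:{a..c}|lborel. f x) = (LINT x:{a..b}|lborel. f x) + (LINT x:{b..c}|lborel. f x)"
proof -
  have i: "set_integrable lborel {a..b} f" "set_integrable lborel {b..c} f"
    by (rule set_integrable_subset[OF assms(3)]; use assms in auto)+
  have "AE x in lborel. indicator {a..c} x *\<^sub>R f x = indicator {a..b} x *\<^sub>R f x + indicator {b..c} x *\<^sub>R f x"
    using AE_lborel_singleton[of b] by eventually_elim (use assms in \<open>auto simp: indicator_def\<close>)
  then have "(LINT x:{a..c}|lborel. f x) = (LINT x|lborel. indicator {a..b} x *\<^sub>R f x + indicator {b..c} x *\<^sub>R f x)"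
    unfolding set_lebesgue_integral_def
    using i assms(3) unfolding set_integrable_def by (intro integral_cong_AE) auto
  then show ?thesis using i unfolding set_integrable_def set_lebesgue_integral_def by simp
qed

section \<open>Duhamel's formula along the diffusion\<close>

definition drift_grad ::
    "(real \<Rightarrow> real ^ 'n::finite \<Rightarrow> real ^ 'n) \<Rightarrow> real \<Rightarrow> real \<Rightarrow> (real ^ 'n \<Rightarrow> real) \<Rightarrow> real ^ 'n \<Rightarrow> real" where
  "drift_grad b r \<tau> \<psi> x = (\<Sum>i\<in>UNIV. b r x $ i * hgrad \<tau> i \<psi> x)"

text \<open>What is used of the stochastic differential equation: the integrated equation for increments, and
  the fact that adding the next Brownian increment to the present value amounts to one step of the heat
  flow. In this form the filtration has been eliminated, and a jointly measurable modification of the solution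
  can take the place of \<open>X\<close>.\<close>

locale sde_process = prob_space M for M :: "'w measure" +
  fixes b :: "real \<Rightarrow> real ^ 'n::finite \<Rightarrow> real ^ 'n" and B T Cw :: real
    and X W :: "real \<Rightarrow> 'w \<Rightarrow> real ^ 'n"
  assumes T_pos: "0 < T"
    and b_pair: "(\<lambda>p. b (fst p) (snd p)) \<in> borel_measurable borel"
    and b_bound: "\<And>t x i. \<bar>b t x $ i\<bar> \<le> B"
    and X_pair: "(\<lambda>p. X (fst p) (snd p)) \<in> borel_measurable (borel \<Otimes>\<^sub>M M)"
    and W_meas: "\<And>t. 0 \<le> t \<Longrightarrow> W t \<in> borel_measurable M"
    and increment: "\<And>s t. 0 \<le> s \<Longrightarrow> s < t \<Longrightarrow> t \<le> T \<Longrightarrow>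
      AE \<omega> in M. \<forall>i. (X t \<omega> - X s \<omega> - (W t \<omega> - W s \<omega>)) $ i = (LINT r:{s..t}|lborel. b r (X r \<omega>) $ i)"
    and gauss_step: "\<And>s t K f. 0 \<le> s \<Longrightarrow> s < t \<Longrightarrow> t \<le> T \<Longrightarrow> bdd_meas K f \<Longrightarrow>
      expectation (\<lambda>\<omega>. f (X s \<omega> + (W t \<omega> - W s \<omega>))) = expectation (\<lambda>\<omega>. heat (t - s) f (X s \<omega>))"
    and W_moment: "\<And>s t. 0 \<le> s \<Longrightarrow> s < t \<Longrightarrow> integrable M (\<lambda>\<omega>. nrm1 (W t \<omega> - W s \<omega>))"
      "\<And>s t. 0 \<le> s \<Longrightarrow> s < t \<Longrightarrow> expectation (\<lambda>\<omega>. nrm1 (W t \<omega> - W s \<omega>)) \<le> Cw * sqrt (t - s)"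
begin

lemma B_nonneg: "0 \<le> B"
  using b_bound[of 0 0] by (rule order_trans[OF abs_ge_zero])

lemma Cw_nonneg: "0 \<le> Cw"
proof -
  have "0 \<le> expectation (\<lambda>\<omega>. nrm1 (W 1 \<omega> - W 0 \<omega>))" by (intro integral_nonneg_AE) (auto intro!: sum_nonneg)
  also have "\<dots> \<le> Cw * sqrt (1 - 0)" by (rule W_moment(2)) auto
  finally show ?thesis by simp
qed

lemma b_measurable [measurable (raw)]:
  "f \<in> borel_measurable N \<Longrightarrow> g \<in> borel_measurable N \<Longrightarrow> (\<lambda>w. b (f w) (g w)) \<in> borel_measurable N"
  using measurable_compose[OF borel_measurable_Pair b_pair] by simp

lemma X_measurable [measurable (raw)]:
  "f \<in> borel_measurable N \<Longrightarrow> g \<in> N \<rightarrow>\<^sub>M M \<Longrightarrow> (\<lambda>w. X (f w) (g w)) \<in> borel_measurable N"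
  using measurable_compose[OF measurable_Pair X_pair] by simp

lemma drift_grad_measurable [measurable (raw)]:
  assumes [measurable]: "f \<in> borel_measurable N" "g \<in> borel_measurable N" "h \<in> borel_measurable N" "\<psi> \<in> borel_measurable borel"
  shows "(\<lambda>w. drift_grad b (f w) (g w) \<psi> (h w)) \<in> borel_measurable N"
  unfolding drift_grad_def by measurable

text \<open>The gradient of the heat flow at time \<open>\<tau>\<close> along the drift is of size \<open>G / sqrt \<tau>\<close> for functions
  bounded by 1, see \<open>abs_drift_grad_le\<close>.\<close>

definition G :: real where "G = real CARD('n) * B * dimc TYPE('n)"

lemma G_nonneg: "0 \<le> G"
  unfolding G_def using B_nonneg by simp

lemma sum_drift_le:
  assumes "\<And>i. \<bar>a i\<bar> \<le> A"
  shows "\<bar>\<Sum>i\<in>UNIV. b r x $ i * a i\<bar> \<le> real CARD('n) * B * A"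
proof -
  have "\<bar>\<Sum>i\<in>UNIV. b r x $ i * a i\<bar> \<le> (\<Sum>i\<in>(UNIV :: 'n set). B * A)"
    using B_nonneg by (intro order_trans[OF sum_abs] sum_mono) (auto simp: abs_mult intro!: mult_mono assms b_bound)
  then show ?thesis by simp
qed

lemma hgrad_0: "hgrad 0 i \<psi> x = 0"
  by (simp add: hgrad_def)

lemma abs_drift_grad_le:
  assumes "0 \<le> \<tau>" "bdd_meas K \<psi>"
  shows "\<bar>drift_grad b r \<tau> \<psi> x\<bar> \<le> G * K * (1 / sqrt \<tau>)"
proof (cases "\<tau> = 0")
  case False
  have "\<bar>drift_grad b r \<tau> \<psi> x\<bar> \<le> real CARD('n) * B * (dimc TYPE('n) / sqrt \<tau> * K)"
    unfolding drift_grad_def by (intro sum_drift_le abs_hgrad_le) (use False assms in auto)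
  then show ?thesis by (simp add: G_def mult_ac)
qed (simp add: drift_grad_def hgrad_0)

lemma integrable_bdd:
  assumes [measurable]: "f \<in> borel_measurable M" and "\<And>\<omega>. \<bar>f \<omega>\<bar> \<le> (K :: real)"
  shows "integrable M f"
  using assms by (intro integrable_const_bound[of _ K]) auto

lemma expectation_abs_le:
  assumes "\<And>\<omega>. \<bar>f \<omega>\<bar> \<le> (K :: real)"
  shows "\<bar>expectation f\<bar> \<le> K"
proof (cases "integrable M f")
  case True
  then have "\<bar>expectation f\<bar> \<le> expectation (\<lambda>_. K)" using assms by (intro abs_integral_le) auto
  then show ?thesis by (simp add: prob_space)
next
  case False
  then show ?thesis using assms by (simp add: not_integrable_integral_eq) (metis abs_ge_zero order_trans)
qed

text \<open>The integrand of Duhamel's formula with final time \<open>t\<close>.\<close>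

abbreviation J :: "real \<Rightarrow> (real ^ 'n \<Rightarrow> real) \<Rightarrow> real \<Rightarrow> real" where
  "J t \<psi> r \<equiv> expectation (\<lambda>\<omega>. drift_grad b r (t - r) \<psi> (X r \<omega>))"

lemma J_measurable: "\<psi> \<in> borel_measurable borel \<Longrightarrow> J t \<psi> \<in> borel_measurable borel"
  by measurable

lemma J_bound:
  assumes "r \<le> t" "bdd_meas K \<psi>"
  shows "\<bar>J t \<psi> r\<bar> \<le> G * K * (1 / sqrt (t - r))"
  using assms by (intro expectation_abs_le abs_drift_grad_le) auto

lemma J_integrable:
  assumes t: "0 < t" and \<psi>: "bdd_meas K \<psi>"
  shows "set_integrable lborel {0..t} (J t \<psi>)"
proof (rule set_integral_bound(1))
  show "set_integrable lborel {0..t} (\<lambda>s. G * K * (1 / sqrt (t - s)))"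
    using integral_inverse_sqrt_t(1)[OF t] by (rule set_integrable_mult_right)
  show "set_borel_measurable lborel {0..t} (J t \<psi>)"
    unfolding set_borel_measurable_def using J_measurable[OF bdd_measD(1)[OF \<psi>]] by measurable
qed (use J_bound[OF _ \<psi>] in auto)

lemma J_integrable_sub:
  assumes t: "0 < t" and \<psi>: "bdd_meas K \<psi>" and "0 \<le> r" "r' \<le> t"
  shows "set_integrable lborel {r..r'} (J t \<psi>)"
  by (rule set_integrable_subset[OF J_integrable[OF t \<psi>]]) (use assms in auto)

lemma fubini_time:
  fixes F :: "real \<Rightarrow> 'w \<Rightarrow> real"
  assumes [measurable]: "(\<lambda>p. F (fst p) (snd p)) \<in> borel_measurable (borel \<Otimes>\<^sub>M M)" and F: "\<And>v \<omega>. \<bar>F v \<omega>\<bar> \<le> K"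
  shows "expectation (\<lambda>\<omega>. LINT v:{r..r'}|lborel. F v \<omega>) = (LINT v:{r..r'}|lborel. expectation (F v))"
    and "integrable M (\<lambda>\<omega>. LINT v:{r..r'}|lborel. F v \<omega>)"
    and "set_integrable lborel {r..r'} (\<lambda>v. expectation (F v))"
proof -
  interpret P: pair_sigma_finite lborel M ..
  have int: "integrable (lborel \<Otimes>\<^sub>M M) (\<lambda>(v, \<omega>). indicator {r..r'} v *\<^sub>R F v \<omega>)"
  proof (rule integrable_pairI[where u="\<lambda>v. indicator {r..r'} v * K"])
    fix v :: real
    have K: "0 \<le> K" using F by (rule order_trans[OF abs_ge_zero])
    have "(\<integral>\<^sup>+\<omega>. ennreal \<bar>case (v, \<omega>) of (v, \<omega>) \<Rightarrow> indicator {r..r'} v *\<^sub>R F v \<omega>\<bar> \<partial>M) \<le> (\<integral>\<^sup>+\<omega>. ennreal (indicator {r..r'} v * K) \<partial>M)"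
      using F by (intro nn_integral_mono ennreal_leI) (auto simp: indicator_def)
    then show "(\<integral>\<^sup>+\<omega>. ennreal \<bar>case (v, \<omega>) of (v, \<omega>) \<Rightarrow> indicator {r..r'} v *\<^sub>R F v \<omega>\<bar> \<partial>M) \<le> ennreal (indicator {r..r'} v * K)"
      by (simp add: emeasure_space_1)
  next
    show "sigma_finite_measure M" ..
    show "(\<lambda>(v, \<omega>). indicator {r..r'} v *\<^sub>R F v \<omega>) \<in> borel_measurable (lborel \<Otimes>\<^sub>M M)"
      unfolding case_prod_beta by measurable
  next
    show "integrable lborel (\<lambda>v. indicator {r..r'} v * K)"
      using set_integrable_const_Icc[of r r' K] by (simp add: set_integrable_def)
  qed
  show "expectation (\<lambda>\<omega>. LINT v:{r..r'}|lborel. F v \<omega>) = (LINT v:{r..r'}|lborel. expectation (F v))"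
    using P.Fubini_integral[OF int] unfolding set_lebesgue_integral_def by simp
  show "integrable M (\<lambda>\<omega>. LINT v:{r..r'}|lborel. F v \<omega>)"
    using P.integrable_snd[OF int] unfolding set_lebesgue_integral_def by simp
  show "set_integrable lborel {r..r'} (\<lambda>v. expectation (F v))"
    using P.integrable_fst[OF int] unfolding set_integrable_def by simp
qed

lemma b_path_integrable: "\<omega> \<in> space M \<Longrightarrow> set_integrable lborel {r..r'} (\<lambda>v. b v (X v \<omega>) $ i)"
  unfolding set_integrable_def
proof (rule Bochner_Integration.integrable_bound)
  show "integrable lborel (\<lambda>v. indicator {r..r'} v *\<^sub>R B)"
    using set_integrable_const_Icc[of r r' B] by (simp add: set_integrable_def)
qed (use b_bound in \<open>auto simp: indicator_def intro!: AE_I2 order_trans[OF _ abs_ge_self]\<close>)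

lemma drift_displacement_le:
  assumes "0 \<le> s" "s < t" "t \<le> T"
  shows "AE \<omega> in M. nrm1 (X t \<omega> - X s \<omega> - (W t \<omega> - W s \<omega>)) \<le> real CARD('n) * B * (t - s)"
  using increment[OF assms] AE_space
proof eventually_elim
  case (elim \<omega>)
  have "\<bar>(X t \<omega> - X s \<omega> - (W t \<omega> - W s \<omega>)) $ i\<bar> \<le> B * (t - s)" for i
  proof -
    have i: "set_integrable lborel {s..t} (\<lambda>v. B)" by (rule set_integrable_const_Icc)
    have "\<bar>LINT r:{s..t}|lborel. b r (X r \<omega>) $ i\<bar> \<le> (LINT r:{s..t}|lborel. B)"
      by (rule set_integral_bound(2)[OF i]) (use b_path_integrable[OF elim(2), of s t i] b_bound in \<open>auto simp: set_borel_measurable_def set_integrable_def\<close>)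
    also have "\<dots> = B * (t - s)" using assms by (simp add: set_lebesgue_integral_def)
    finally show ?thesis using elim(1) by simp
  qed
  then have "nrm1 (X t \<omega> - X s \<omega> - (W t \<omega> - W s \<omega>)) \<le> (\<Sum>i\<in>(UNIV :: 'n set). B * (t - s))" by (rule sum_mono)
  then show ?case by simp
qed

lemma X_moment:
  assumes st: "0 \<le> s" "s \<le> t" "t \<le> T"
  shows "integrable M (\<lambda>\<omega>. nrm1 (X t \<omega> - X s \<omega>))"
    and "expectation (\<lambda>\<omega>. nrm1 (X t \<omega> - X s \<omega>)) \<le> Cw * sqrt (t - s) + real CARD('n) * B * (t - s)"
proof -
  have "integrable M (\<lambda>\<omega>. nrm1 (X t \<omega> - X s \<omega>)) \<and>
    expectation (\<lambda>\<omega>. nrm1 (X t \<omega> - X s \<omega>)) \<le> Cw * sqrt (t - s) + real CARD('n) * B * (t - s)"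
  proof (cases "s = t")
    case False
    with st have st: "0 \<le> s" "s < t" "t \<le> T" by auto
    have [measurable]: "W t \<in> borel_measurable M" "W s \<in> borel_measurable M" using W_meas st by auto
    have le: "AE \<omega> in M. nrm1 (X t \<omega> - X s \<omega>) \<le> nrm1 (W t \<omega> - W s \<omega>) + real CARD('n) * B * (t - s)"
      using drift_displacement_le[OF st]
    proof eventually_elim
      case (elim \<omega>)
      have "nrm1 (X t \<omega> - X s \<omega>) \<le> (\<Sum>i\<in>UNIV. \<bar>(W t \<omega> - W s \<omega>) $ i\<bar> + \<bar>(X t \<omega> - X s \<omega> - (W t \<omega> - W s \<omega>)) $ i\<bar>)"
        by (intro sum_mono) auto
      then show ?case using elim by (simp add: sum.distrib)
    qed
    have i2: "integrable M (\<lambda>\<omega>. nrm1 (W t \<omega> - W s \<omega>) + real CARD('n) * B * (t - s))"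
      by (intro Bochner_Integration.integrable_add W_moment st integrable_const)
    have i1: "integrable M (\<lambda>\<omega>. nrm1 (X t \<omega> - X s \<omega>))"
      by (rule Bochner_Integration.integrable_bound[OF i2])
        (measurable, use le in \<open>auto elim!: eventually_mono intro: order_trans\<close>)
    have "expectation (\<lambda>\<omega>. nrm1 (X t \<omega> - X s \<omega>)) \<le> expectation (\<lambda>\<omega>. nrm1 (W t \<omega> - W s \<omega>) + real CARD('n) * B * (t - s))"
      by (rule integral_mono_AE[OF i1 i2 le])
    also have "\<dots> = expectation (\<lambda>\<omega>. nrm1 (W t \<omega> - W s \<omega>)) + real CARD('n) * B * (t - s)"
      by (subst Bochner_Integration.integral_add[OF W_moment(1)[OF st(1,2)] integrable_const]) (simp add: prob_space)
    finally show ?thesis using i1 W_moment(2)[of s t] st by auto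
  qed simp
  then show "integrable M (\<lambda>\<omega>. nrm1 (X t \<omega> - X s \<omega>))"
    "expectation (\<lambda>\<omega>. nrm1 (X t \<omega> - X s \<omega>)) \<le> Cw * sqrt (t - s) + real CARD('n) * B * (t - s)" by auto
qed

text \<open>Over a short interval of length \<open>d\<close> the heat-flow value changes by the time integral of
  \<open>J\<close>, up to \<open>O(d * sqrt d)\<close>: the Brownian increment is absorbed by one heat step, and the
  drift displacement of size \<open>O(d)\<close> enters to first order.\<close>

lemma duhamel_local:
  assumes t: "t \<le> T" and r: "0 \<le> r" "r < r'" "r' \<le> t'" "t' < t" and \<psi>: "bdd_meas K \<psi>"
  defines "\<tau> \<equiv> t - t'" and "c2 \<equiv> 2 * 2 ^ CARD('n)"
    and "c3 \<equiv> 8 * real CARD('n) * real CARD('n) * (2 ^ CARD('n) * 2 ^ CARD('n))"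
    and "nB \<equiv> real CARD('n) * B"
  shows "\<bar>expectation (\<lambda>\<omega>. heat (t - r') \<psi> (X r' \<omega>)) - expectation (\<lambda>\<omega>. heat (t - r) \<psi> (X r \<omega>))
      - (LINT v:{r..r'}|lborel. J t \<psi> v)\<bar>
    \<le> (nB\<^sup>2 * (c2 / \<tau> * K) * sqrt T + nB * ((Cw + nB * sqrt T) * (c2 / \<tau> * K)
        + sqrt T / (\<tau> / 2) * (c3 * (dimc TYPE('n) / sqrt (\<tau> / 2) * K)))) * ((r' - r) * sqrt (r' - r))"
proof -
  define d where "d = r' - r"
  have d: "0 < d" "d \<le> T" using r t by (auto simp: d_def)
  have \<tau>: "0 < \<tau>" "\<tau> \<le> t - r'" using r by (auto simp: \<tau>_def)
  have K: "0 \<le> K" using bdd_measD(3)[OF \<psi>] .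
  have nB: "0 \<le> nB" using B_nonneg by (simp add: nB_def)
  have c23: "0 \<le> c2" "0 \<le> c3" by (auto simp: c2_def c3_def)
  note [measurable] = bdd_measD(1)[OF \<psi>]
  have [measurable]: "W r' \<in> borel_measurable M" "W r \<in> borel_measurable M" using W_meas r by auto
  define f where "f = heat (t - r') \<psi>"
  have tr': "0 < t - r'" using \<tau> by simp
  have f: "bdd_meas K f" unfolding f_def using tr' by (intro bdd_meas_heat \<psi>) simp
  note [measurable] = bdd_measD(1)[OF f]
  define A where "A \<omega> = X r' \<omega> - X r \<omega> - (W r' \<omega> - W r \<omega>)" for \<omega>
  have [measurable]: "A \<in> borel_measurable M" unfolding A_def by measurable
  have rr: "0 \<le> r" "r < r'" "r' \<le> T" using r t by auto
  define g where "g \<omega> v = (\<Sum>i\<in>UNIV. b v (X v \<omega>) $ i * hgrad (t - r') i \<psi> (X r' \<omega>))" for \<omega> v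
  have gm: "(\<lambda>p. g (snd p) (fst p)) \<in> borel_measurable (borel \<Otimes>\<^sub>M M)"
    unfolding g_def by measurable
  have gb: "\<bar>g \<omega> v\<bar> \<le> nB * (dimc TYPE('n) / sqrt (t - r') * K)" for \<omega> v
    unfolding g_def nB_def by (intro sum_drift_le abs_hgrad_le \<psi> tr')
  have ig: "integrable M (\<lambda>\<omega>. LINT v:{r..r'}|lborel. g \<omega> v)"
    by (rule fubini_time(2)[OF gm gb])
  have step: "expectation (\<lambda>\<omega>. heat (t - r) \<psi> (X r \<omega>)) = expectation (\<lambda>\<omega>. f (X r' \<omega> - A \<omega>))"
  proof -
    have "expectation (\<lambda>\<omega>. f (X r' \<omega> - A \<omega>)) = expectation (\<lambda>\<omega>. f (X r \<omega> + (W r' \<omega> - W r \<omega>)))"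
      by (intro arg_cong[where f=expectation] ext arg_cong[where f=f]) (simp add: A_def algebra_simps)
    also have "\<dots> = expectation (\<lambda>\<omega>. heat (r' - r) f (X r \<omega>))" by (rule gauss_step[OF rr f])
    also have "heat (r' - r) f = heat (t - r) \<psi>" unfolding f_def
      using r tr' by (subst heat_heat[OF _ _ \<psi>]) auto
    finally show ?thesis by simp
  qed
  \<comment> \<open>first order expansion in the drift displacement, with the gradient taken at the end point\<close>
  have taylor: "AE \<omega> in M. \<bar>f (X r' \<omega>) - f (X r' \<omega> - A \<omega>) - (LINT v:{r..r'}|lborel. g \<omega> v)\<bar> \<le> (nB * d)\<^sup>2 * (c2 / \<tau> * K)"
    using increment[OF rr] drift_displacement_le[OF rr] AE_space
  proof eventually_elim
    case (elim \<omega>)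
    have "(LINT v:{r..r'}|lborel. g \<omega> v) = (\<Sum>i\<in>UNIV. (LINT v:{r..r'}|lborel. b v (X v \<omega>) $ i) * hgrad (t - r') i \<psi> (X r' \<omega>))"
    proof -
      have "(LINT v:{r..r'}|lborel. g \<omega> v) = (LINT v|lborel. (\<Sum>i\<in>UNIV. indicator {r..r'} v *\<^sub>R b v (X v \<omega>) $ i * hgrad (t - r') i \<psi> (X r' \<omega>)))"
        unfolding set_lebesgue_integral_def g_def by (simp add: sum_distrib_left mult_ac)
      also have "\<dots> = (\<Sum>i\<in>UNIV. LINT v|lborel. indicator {r..r'} v *\<^sub>R b v (X v \<omega>) $ i * hgrad (t - r') i \<psi> (X r' \<omega>))"
        using b_path_integrable[OF elim(3), of r r'] unfolding set_integrable_def
        by (intro Bochner_Integration.integral_sum integrable_mult_left) auto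
      finally show ?thesis unfolding set_lebesgue_integral_def by simp
    qed
    also have "\<dots> = (\<Sum>i\<in>UNIV. A \<omega> $ i * hgrad (t - r') i \<psi> (X r' \<omega>))"
      using elim(1) by (simp add: A_def)
    finally have e: "(LINT v:{r..r'}|lborel. g \<omega> v) = (\<Sum>i\<in>UNIV. A \<omega> $ i * hgrad (t - r') i \<psi> (X r' \<omega>))" .
    have A1: "nrm1 (- A \<omega>) \<le> nB * d" using elim(2) by (simp add: A_def d_def nB_def abs_minus_commute)
    have "\<bar>f (X r' \<omega> + (- A \<omega>)) - f (X r' \<omega>) - (\<Sum>i\<in>UNIV. (- A \<omega>) $ i * hgrad (t - r') i \<psi> (X r' \<omega>))\<bar> \<le> (nrm1 (- A \<omega>))\<^sup>2 * (c2 / (t - r') * K)"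
      unfolding f_def c2_def by (rule heat_taylor[OF tr' \<psi>])
    also have "\<dots> \<le> (nB * d)\<^sup>2 * (c2 / \<tau> * K)"
      using A1 \<tau> c23 K by (intro mult_mono power_mono frac_le divide_nonneg_pos mult_nonneg_nonneg) (auto intro: sum_nonneg)
    finally show ?case unfolding e by (simp add: sum_negf abs_minus_commute algebra_simps)
  qed
  have i1: "integrable M (\<lambda>\<omega>. f (X r' \<omega>))" "integrable M (\<lambda>\<omega>. f (X r' \<omega> - A \<omega>))"
    using bdd_measD(2)[OF f] by (auto intro!: integrable_bdd[of _ K])
  have part1: "\<bar>expectation (\<lambda>\<omega>. f (X r' \<omega>)) - expectation (\<lambda>\<omega>. f (X r' \<omega> - A \<omega>)) - expectation (\<lambda>\<omega>. LINT v:{r..r'}|lborel. g \<omega> v)\<bar> \<le> (nB * d)\<^sup>2 * (c2 / \<tau> * K)"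
  proof -
    have "\<bar>expectation (\<lambda>\<omega>. f (X r' \<omega>) - f (X r' \<omega> - A \<omega>) - (LINT v:{r..r'}|lborel. g \<omega> v))\<bar> \<le> expectation (\<lambda>\<omega>. \<bar>f (X r' \<omega>) - f (X r' \<omega> - A \<omega>) - (LINT v:{r..r'}|lborel. g \<omega> v)\<bar>)"
      by (rule integral_abs_bound)
    also have "\<dots> \<le> expectation (\<lambda>\<omega>. (nB * d)\<^sup>2 * (c2 / \<tau> * K))"
      by (rule integral_mono_AE[OF _ _ taylor]) (intro integrable_abs Bochner_Integration.integrable_diff i1 ig integrable_const)+
    finally show ?thesis using i1 ig by (simp add: prob_space)
  qed
  define M2 where "M2 = (Cw + nB * sqrt T) * sqrt d * (c2 / \<tau> * K) + d / (\<tau> / 2) * (c3 * (dimc TYPE('n) / sqrt (\<tau> / 2) * K))"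
  \<comment> \<open>the gradient at the end point may be replaced by the one at the intermediate time\<close>
  have pt: "\<bar>expectation (\<lambda>\<omega>. g \<omega> v) - J t \<psi> v\<bar> \<le> nB * M2" if v: "v \<in> {r..r'}" for v
  proof -
    have v0: "0 \<le> v" "v \<le> r'" "r' \<le> T" using v rr by auto
    have tv: "0 < t - v" using v tr' by auto
    have le: "\<bar>g \<omega> v - drift_grad b v (t - v) \<psi> (X v \<omega>)\<bar>
      \<le> nB * (nrm1 (X r' \<omega> - X v \<omega>) * (c2 / \<tau> * K) + d / (\<tau> / 2) * (c3 * (dimc TYPE('n) / sqrt (\<tau> / 2) * K)))" for \<omega>
    proof -
      have "\<bar>hgrad (t - r') i \<psi> (X r' \<omega>) - hgrad (t - v) i \<psi> (X v \<omega>)\<bar>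
        \<le> nrm1 (X r' \<omega> - X v \<omega>) * (c2 / \<tau> * K) + d / (\<tau> / 2) * (c3 * (dimc TYPE('n) / sqrt (\<tau> / 2) * K))" for i
      proof -
        have "\<bar>hgrad (t - r') i \<psi> (X v \<omega> + (X r' \<omega> - X v \<omega>)) - hgrad (t - r') i \<psi> (X v \<omega>)\<bar> \<le> nrm1 (X r' \<omega> - X v \<omega>) * (c2 / (t - r') * K)"
          unfolding c2_def by (rule hgrad_lipschitz[OF tr' \<psi>])
        also have "\<dots> \<le> nrm1 (X r' \<omega> - X v \<omega>) * (c2 / \<tau> * K)"
          using \<tau> c23 K by (intro mult_left_mono mult_right_mono frac_le) (auto intro: sum_nonneg)
        finally have 1: "\<bar>hgrad (t - r') i \<psi> (X r' \<omega>) - hgrad (t - r') i \<psi> (X v \<omega>)\<bar> \<le> nrm1 (X r' \<omega> - X v \<omega>) * (c2 / \<tau> * K)" by simp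
        have "\<bar>hgrad (t - r' + (r' - v)) i \<psi> (X v \<omega>) - hgrad (t - r') i \<psi> (X v \<omega>)\<bar> \<le> (r' - v) / ((t - r') / 2) * (c3 * (dimc TYPE('n) / sqrt ((t - r') / 2) * K))"
          unfolding c3_def using v by (intro hgrad_time_lipschitz[OF tr' _ \<psi>]) auto
        also have "\<dots> \<le> d / (\<tau> / 2) * (c3 * (dimc TYPE('n) / sqrt (\<tau> / 2) * K))"
          using v \<tau> c23 K d tr' by (intro mult_mono mult_left_mono mult_right_mono frac_le) (auto simp: d_def)
        finally have "\<bar>hgrad (t - v) i \<psi> (X v \<omega>) - hgrad (t - r') i \<psi> (X v \<omega>)\<bar> \<le> d / (\<tau> / 2) * (c3 * (dimc TYPE('n) / sqrt (\<tau> / 2) * K))" by simp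
        with 1 show ?thesis by linarith
      qed
      then have "\<bar>\<Sum>i\<in>UNIV. b v (X v \<omega>) $ i * (hgrad (t - r') i \<psi> (X r' \<omega>) - hgrad (t - v) i \<psi> (X v \<omega>))\<bar>
        \<le> nB * (nrm1 (X r' \<omega> - X v \<omega>) * (c2 / \<tau> * K) + d / (\<tau> / 2) * (c3 * (dimc TYPE('n) / sqrt (\<tau> / 2) * K)))"
        unfolding nB_def by (rule sum_drift_le)
      then show ?thesis by (simp add: g_def drift_grad_def right_diff_distrib sum_subtractf)
    qed
    have ia: "integrable M (\<lambda>\<omega>. g \<omega> v)"
      by (rule integrable_bdd[OF _ gb]) (unfold g_def, measurable)
    have ib: "integrable M (\<lambda>\<omega>. drift_grad b v (t - v) \<psi> (X v \<omega>))"
      by (rule integrable_bdd[OF _ abs_drift_grad_le[OF less_imp_le[OF tv] \<psi>]]) measurable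
    have ic: "integrable M (\<lambda>\<omega>. nrm1 (X r' \<omega> - X v \<omega>))" by (rule X_moment(1)[OF v0])
    have "\<bar>expectation (\<lambda>\<omega>. g \<omega> v) - J t \<psi> v\<bar> = \<bar>expectation (\<lambda>\<omega>. g \<omega> v - drift_grad b v (t - v) \<psi> (X v \<omega>))\<bar>"
      using ia ib by simp
    also have "\<dots> \<le> expectation (\<lambda>\<omega>. nB * (nrm1 (X r' \<omega> - X v \<omega>) * (c2 / \<tau> * K) + d / (\<tau> / 2) * (c3 * (dimc TYPE('n) / sqrt (\<tau> / 2) * K))))"
      by (intro abs_integral_le le Bochner_Integration.integrable_diff ia ib integrable_mult_right Bochner_Integration.integrable_add integrable_mult_left ic integrable_const)
    also have "\<dots> = nB * (expectation (\<lambda>\<omega>. nrm1 (X r' \<omega> - X v \<omega>)) * (c2 / \<tau> * K) + d / (\<tau> / 2) * (c3 * (dimc TYPE('n) / sqrt (\<tau> / 2) * K)))"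
      unfolding integral_mult_right_zero
      by (subst Bochner_Integration.integral_add) (intro integrable_mult_left ic integrable_const, simp, simp only: integral_mult_left_zero, simp add: prob_space)
    also have "\<dots> \<le> nB * M2"
    proof -
      have "expectation (\<lambda>\<omega>. nrm1 (X r' \<omega> - X v \<omega>)) \<le> Cw * sqrt (r' - v) + nB * (r' - v)"
        unfolding nB_def by (rule X_moment(2)[OF v0])
      also have "\<dots> \<le> Cw * sqrt d + nB * (sqrt T * sqrt d)"
      proof -
        have "r' - v \<le> d" using v by (simp add: d_def)
        moreover have "d \<le> sqrt T * sqrt d"
          using d by (metis less_imp_le mult_right_mono real_sqrt_ge_zero real_sqrt_le_mono real_sqrt_mult_self abs_of_pos)
        ultimately show ?thesis using Cw_nonneg nB by (intro add_mono mult_left_mono) auto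
      qed
      also have "\<dots> = (Cw + nB * sqrt T) * sqrt d" by (simp add: algebra_simps)
      finally show ?thesis unfolding M2_def using c23 K \<tau> nB
        by (intro mult_left_mono add_right_mono mult_right_mono) auto
    qed
    finally show ?thesis .
  qed
  have part2: "\<bar>expectation (\<lambda>\<omega>. LINT v:{r..r'}|lborel. g \<omega> v) - (LINT v:{r..r'}|lborel. J t \<psi> v)\<bar> \<le> nB * M2 * d"
  proof -
    have e: "expectation (\<lambda>\<omega>. LINT v:{r..r'}|lborel. g \<omega> v) = (LINT v:{r..r'}|lborel. expectation (\<lambda>\<omega>. g \<omega> v))"
      by (rule fubini_time(1)[OF gm gb])
    have s1: "set_integrable lborel {r..r'} (\<lambda>v. expectation (\<lambda>\<omega>. g \<omega> v))" by (rule fubini_time(3)[OF gm gb])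
    have s2: "set_integrable lborel {r..r'} (J t \<psi>)" by (rule J_integrable_sub[OF _ \<psi>]) (use r in auto)
    have s3: "set_integrable lborel {r..r'} (\<lambda>v. nB * M2)" by (rule set_integrable_const_Icc)
    have "\<bar>LINT v:{r..r'}|lborel. expectation (\<lambda>\<omega>. g \<omega> v) - J t \<psi> v\<bar> \<le> (LINT v:{r..r'}|lborel. nB * M2)"
      by (rule set_integral_bound(2)[OF s3 _ pt])
        (use set_integral_diff(1)[OF s1 s2] in \<open>auto simp: set_integrable_def set_borel_measurable_def\<close>)
    also have "\<dots> = nB * M2 * d" using d by (simp add: set_lebesgue_integral_def d_def)
    finally show ?thesis unfolding e using set_integral_diff(2)[OF s1 s2] by simp
  qed
  have "\<bar>expectation (\<lambda>\<omega>. heat (t - r') \<psi> (X r' \<omega>)) - expectation (\<lambda>\<omega>. heat (t - r) \<psi> (X r \<omega>)) - (LINT v:{r..r'}|lborel. J t \<psi> v)\<bar>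
      \<le> (nB * d)\<^sup>2 * (c2 / \<tau> * K) + nB * M2 * d"
    using part1 part2 unfolding step f_def[symmetric] by linarith
  also have "\<dots> \<le> (nB\<^sup>2 * (c2 / \<tau> * K) * sqrt T + nB * ((Cw + nB * sqrt T) * (c2 / \<tau> * K)
        + sqrt T / (\<tau> / 2) * (c3 * (dimc TYPE('n) / sqrt (\<tau> / 2) * K)))) * (d * sqrt d)"
  proof -
    have dd: "d \<le> sqrt T * sqrt d"
      using d by (metis less_imp_le mult_right_mono real_sqrt_ge_zero real_sqrt_le_mono real_sqrt_mult_self abs_of_pos)
    have a: "(nB * d)\<^sup>2 * (c2 / \<tau> * K) \<le> nB\<^sup>2 * (c2 / \<tau> * K) * sqrt T * (d * sqrt d)"
    proof -
      have "(nB * d)\<^sup>2 * (c2 / \<tau> * K) = (nB\<^sup>2 * (c2 / \<tau> * K) * d) * d" by (simp add: power2_eq_square mult_ac)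
      also have "\<dots> \<le> (nB\<^sup>2 * (c2 / \<tau> * K) * d) * (sqrt T * sqrt d)"
        using dd d c23 K \<tau> by (intro mult_left_mono) auto
      finally show ?thesis by (simp add: mult_ac)
    qed
    define Z where "Z = c3 * (dimc TYPE('n) / sqrt (\<tau> / 2) * K)"
    have Z: "0 \<le> Z" using c23 K \<tau> by (simp add: Z_def)
    have b': "nB * (d / (\<tau> / 2) * Z) * d \<le> nB * ((sqrt T * sqrt d) / (\<tau> / 2) * Z) * d"
      using dd d nB Z \<tau> by (intro mult_left_mono mult_right_mono divide_right_mono) auto
    show ?thesis
      using a b' unfolding M2_def Z_def[symmetric] by (simp add: algebra_simps)
  qed
  finally show ?thesis unfolding d_def .
qed

text \<open>By \<open>duhamel_local\<close> the difference of the two sides has superlinear increments in \<open>t'\<close>. Stopping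
  before \<open>t\<close> keeps the time of the heat flow away from 0, where the local error blows up.\<close>

lemma duhamel_before:
  assumes t: "t \<le> T" "0 \<le> t'" "t' < t" and \<psi>: "bdd_meas K \<psi>"
  shows "expectation (\<lambda>\<omega>. heat (t - t') \<psi> (X t' \<omega>))
    = expectation (\<lambda>\<omega>. heat t \<psi> (X 0 \<omega>)) + (LINT v:{0..t'}|lborel. J t \<psi> v)"
proof -
  define F where "F r = expectation (\<lambda>\<omega>. heat (t - r) \<psi> (X r \<omega>)) - (LINT v:{0..r}|lborel. J t \<psi> v)" for r
  have "\<exists>C. \<forall>x y. 0 \<le> x \<longrightarrow> x < y \<longrightarrow> y \<le> t' \<longrightarrow>
      \<bar>expectation (\<lambda>\<omega>. heat (t - y) \<psi> (X y \<omega>)) - expectation (\<lambda>\<omega>. heat (t - x) \<psi> (X x \<omega>)) - (LINT v:{x..y}|lborel. J t \<psi> v)\<bar>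
        \<le> C * ((y - x) * sqrt (y - x))"
    by (intro exI allI impI) (rule duhamel_local[OF t(1) _ _ _ t(3) \<psi>])
  then obtain C where C: "\<And>x y. 0 \<le> x \<Longrightarrow> x < y \<Longrightarrow> y \<le> t' \<Longrightarrow>
      \<bar>expectation (\<lambda>\<omega>. heat (t - y) \<psi> (X y \<omega>)) - expectation (\<lambda>\<omega>. heat (t - x) \<psi> (X x \<omega>)) - (LINT v:{x..y}|lborel. J t \<psi> v)\<bar>
        \<le> C * ((y - x) * sqrt (y - x))" by blast
  have "F t' = F 0"
  proof (rule superlinear_increment_const[OF t(2)])
    fix x y assume xy: "0 \<le> x" "x < y" "y \<le> t'"
    have "(LINT v:{0..y}|lborel. J t \<psi> v) = (LINT v:{0..x}|lborel. J t \<psi> v) + (LINT v:{x..y}|lborel. J t \<psi> v)"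
      by (rule set_integral_Icc_split[OF _ _ J_integrable_sub[OF _ \<psi>]]) (use xy t in auto)
    then have "F y - F x = expectation (\<lambda>\<omega>. heat (t - y) \<psi> (X y \<omega>)) - expectation (\<lambda>\<omega>. heat (t - x) \<psi> (X x \<omega>)) - (LINT v:{x..y}|lborel. J t \<psi> v)"
      by (simp add: F_def)
    then show "\<bar>F y - F x\<bar> \<le> C * ((y - x) * sqrt (y - x))"
      using C[OF xy] by simp
  qed
  moreover have "(LINT v:{0..0}|lborel. J t \<psi> v) = 0"
    unfolding set_lebesgue_integral_def by (rule integral_eq_zero_AE) (use AE_lborel_singleton[of "0::real"] in \<open>auto elim!: eventually_mono\<close>)
  ultimately show ?thesis by (simp add: F_def)
qed

abbreviation duhamel :: "real \<Rightarrow> (real ^ 'n \<Rightarrow> real) \<Rightarrow> bool" where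
  "duhamel t \<psi> \<equiv> expectation (\<lambda>\<omega>. \<psi> (X t \<omega>))
    = expectation (\<lambda>\<omega>. heat t \<psi> (X 0 \<omega>)) + (LINT r:{0..t}|lborel. J t \<psi> r)"

text \<open>Passage to the limit \<open>t' \<rightarrow> t\<close>: for Lipschitz functions the heat flow over a time \<open>s\<close> changes the
  value by \<open>O(sqrt s)\<close> only.\<close>

lemma duhamel_lipschitz:
  assumes t: "0 < t" "t \<le> T" and \<psi>: "bdd_meas K \<psi>"
    and lip: "\<And>x y. \<bar>\<psi> y - \<psi> x\<bar> \<le> L * nrm1 (y - x)" and L: "0 \<le> L"
  shows "duhamel t \<psi>"
proof -
  define s where "s m = t / real (Suc (Suc m))" for m
  have s: "0 < s m" "s m \<le> t" for m using t by (auto simp: s_def divide_le_eq)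
  have sl: "s \<longlonglongrightarrow> 0"
  proof -
    have "(\<lambda>m. t * (1 / real (Suc (Suc m)))) \<longlonglongrightarrow> t * 0"
      by (intro tendsto_intros LIMSEQ_Suc[OF LIMSEQ_Suc[OF lim_1_over_n]])
    then show ?thesis by (simp add: s_def[abs_def])
  qed
  note [measurable] = bdd_measD(1)[OF \<psi>]
  have eq: "expectation (\<lambda>\<omega>. heat (s m) \<psi> (X (t - s m) \<omega>))
    = expectation (\<lambda>\<omega>. heat t \<psi> (X 0 \<omega>)) + (LINT v:{0..t - s m}|lborel. J t \<psi> v)" for m
    using duhamel_before[OF t(2) _ _ \<psi>, of "t - s m"] s[of m] by simp
  have lhs: "(\<lambda>m. expectation (\<lambda>\<omega>. heat (s m) \<psi> (X (t - s m) \<omega>))) \<longlonglongrightarrow> expectation (\<lambda>\<omega>. \<psi> (X t \<omega>))"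
  proof (rule LIMSEQ_I)
    have le: "\<bar>expectation (\<lambda>\<omega>. heat (s m) \<psi> (X (t - s m) \<omega>)) - expectation (\<lambda>\<omega>. \<psi> (X t \<omega>))\<bar>
      \<le> L * (real CARD('n) * dimc TYPE('n) * sqrt (s m)) + L * (Cw * sqrt (s m) + real CARD('n) * B * s m)" for m
    proof -
      have X0: "0 \<le> t - s m" "t - s m \<le> t" using s[of m] by auto
      have i1: "integrable M (\<lambda>\<omega>. heat (s m) \<psi> (X (t - s m) \<omega>))"
        by (rule integrable_bdd[OF _ abs_heat_le[OF less_imp_le[OF s(1)] \<psi>]]) measurable
      have i2: "integrable M (\<lambda>\<omega>. \<psi> (X t \<omega>))" by (rule integrable_bdd[OF _ bdd_measD(2)[OF \<psi>]]) measurable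
      have i3: "integrable M (\<lambda>\<omega>. nrm1 (X t \<omega> - X (t - s m) \<omega>))" by (rule X_moment(1)[OF X0 t(2)])
      have "\<bar>expectation (\<lambda>\<omega>. heat (s m) \<psi> (X (t - s m) \<omega>) - \<psi> (X t \<omega>))\<bar>
        \<le> expectation (\<lambda>\<omega>. L * (real CARD('n) * dimc TYPE('n) * sqrt (s m)) + L * nrm1 (X t \<omega> - X (t - s m) \<omega>))"
      proof (rule abs_integral_le)
        fix \<omega>
        show "\<bar>heat (s m) \<psi> (X (t - s m) \<omega>) - \<psi> (X t \<omega>)\<bar> \<le> L * (real CARD('n) * dimc TYPE('n) * sqrt (s m)) + L * nrm1 (X t \<omega> - X (t - s m) \<omega>)"
          using heat_near_0[OF s(1)[of m] \<psi> lip L, of "X (t - s m) \<omega>"] lip[of "X t \<omega>" "X (t - s m) \<omega>"] by linarith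
      qed (intro Bochner_Integration.integrable_diff Bochner_Integration.integrable_add integrable_mult_right i1 i2 i3 integrable_const)+
      also have "\<dots> = L * (real CARD('n) * dimc TYPE('n) * sqrt (s m)) + L * expectation (\<lambda>\<omega>. nrm1 (X t \<omega> - X (t - s m) \<omega>))"
        by (subst Bochner_Integration.integral_add[OF integrable_const integrable_mult_right[OF i3]])
          (simp only: integral_mult_right_zero, simp add: prob_space)
      also have "\<dots> \<le> L * (real CARD('n) * dimc TYPE('n) * sqrt (s m)) + L * (Cw * sqrt (s m) + real CARD('n) * B * s m)"
        using X_moment(2)[OF X0 t(2)] by (intro add_left_mono mult_left_mono L) simp
      finally show ?thesis using i1 i2 by simp
    qed
    have "(\<lambda>m. L * (real CARD('n) * dimc TYPE('n) * sqrt (s m)) + L * (Cw * sqrt (s m) + real CARD('n) * B * s m))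
      \<longlonglongrightarrow> L * (real CARD('n) * dimc TYPE('n) * sqrt 0) + L * (Cw * sqrt 0 + real CARD('n) * B * 0)"
      by (intro tendsto_intros sl)
    then have lim: "(\<lambda>m. L * (real CARD('n) * dimc TYPE('n) * sqrt (s m)) + L * (Cw * sqrt (s m) + real CARD('n) * B * s m)) \<longlonglongrightarrow> 0"
      by simp
    fix e :: real assume "0 < e"
    from LIMSEQ_D[OF lim this] obtain N where "\<And>m. N \<le> m \<Longrightarrow> L * (real CARD('n) * dimc TYPE('n) * sqrt (s m)) + L * (Cw * sqrt (s m) + real CARD('n) * B * s m) < e"
      by (auto simp: abs_less_iff)
    then show "\<exists>N. \<forall>m\<ge>N. norm (expectation (\<lambda>\<omega>. heat (s m) \<psi> (X (t - s m) \<omega>)) - expectation (\<lambda>\<omega>. \<psi> (X t \<omega>))) < e"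
      using le by (intro exI[of _ N]) (auto intro: le_less_trans)
  qed
  have rhs: "(\<lambda>m. LINT v:{0..t - s m}|lborel. J t \<psi> v) \<longlonglongrightarrow> (LINT v:{0..t}|lborel. J t \<psi> v)"
    unfolding set_lebesgue_integral_def
  proof (rule integral_dominated_convergence[where w="\<lambda>v. \<bar>indicator {0..t} v *\<^sub>R J t \<psi> v\<bar>"])
    show "integrable lborel (\<lambda>v. \<bar>indicator {0..t} v *\<^sub>R J t \<psi> v\<bar>)"
      using J_integrable[OF t(1) \<psi>] unfolding set_integrable_def by (rule integrable_abs)
    show "AE v in lborel. (\<lambda>m. indicator {0..t - s m} v *\<^sub>R J t \<psi> v) \<longlonglongrightarrow> indicator {0..t} v *\<^sub>R J t \<psi> v"
      using AE_lborel_singleton[of t]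
    proof eventually_elim
      case (elim v)
      have "\<forall>\<^sub>F m in sequentially. s m < t - v \<or> t < v"
        using elim order_tendstoD(2)[OF sl, of "t - v"] by (cases "v < t") (auto elim: eventually_mono)
      then have "\<forall>\<^sub>F m in sequentially. indicator {0..t - s m} v *\<^sub>R J t \<psi> v = indicator {0..t} v *\<^sub>R J t \<psi> v"
      proof eventually_elim
        case (elim m)
        then show ?case using s[of m] by (auto simp: indicator_def)
      qed
      then show ?case by (rule tendsto_eventually)
    qed
    show "AE v in lborel. norm (indicator {0..t - s m} v *\<^sub>R J t \<psi> v) \<le> \<bar>indicator {0..t} v *\<^sub>R J t \<psi> v\<bar>" for m
      using s(1)[of m] by (auto simp: indicator_def)
  qed (use J_measurable[OF bdd_measD(1)[OF \<psi>]] in measurable)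
  show ?thesis
    by (rule LIMSEQ_unique[OF lhs]) (unfold eq, intro tendsto_add tendsto_const rhs)
qed

lemma drift_grad_tendsto:
  assumes "0 < \<tau>" "\<And>k. bdd_meas K (\<psi>k k)" "bdd_meas K \<psi>" "\<And>x. (\<lambda>k. \<psi>k k x) \<longlonglongrightarrow> \<psi> x"
  shows "(\<lambda>k. drift_grad b r \<tau> (\<psi>k k) x) \<longlonglongrightarrow> drift_grad b r \<tau> \<psi> x"
  unfolding drift_grad_def by (intro tendsto_intros hgrad_tendsto[where K=K] assms)

text \<open>Bounded pointwise convergence suffices, since the integrand is dominated by a multiple of
  \<open>1 / sqrt (t - r)\<close>.\<close>

lemma duhamel_tendsto:
  assumes t: "0 < t" "t \<le> T" and \<psi>: "\<And>k. bdd_meas K (\<psi>k k)" "bdd_meas K \<psi>" "\<And>x. (\<lambda>k. \<psi>k k x) \<longlonglongrightarrow> \<psi> x"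
    and d: "\<And>k. duhamel t (\<psi>k k)"
  shows "duhamel t \<psi>"
proof -
  note [measurable] = bdd_measD(1)[OF \<psi>(1)] bdd_measD(1)[OF \<psi>(2)]
  have 1: "(\<lambda>k. expectation (\<lambda>\<omega>. \<psi>k k (X t \<omega>))) \<longlonglongrightarrow> expectation (\<lambda>\<omega>. \<psi> (X t \<omega>))"
    by (rule integral_dominated_convergence[where w="\<lambda>_. K"]) (use \<psi>(3) bdd_measD(2)[OF \<psi>(1)] in \<open>auto\<close>)
  have 2: "(\<lambda>k. expectation (\<lambda>\<omega>. heat t (\<psi>k k) (X 0 \<omega>))) \<longlonglongrightarrow> expectation (\<lambda>\<omega>. heat t \<psi> (X 0 \<omega>))"
    by (rule integral_dominated_convergence[where w="\<lambda>_. K"])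
      (use heat_tendsto[OF less_imp_le[OF t(1)] \<psi>] abs_heat_le[OF less_imp_le[OF t(1)] \<psi>(1)] in \<open>auto\<close>)
  have 3: "(\<lambda>k. J t (\<psi>k k) r) \<longlonglongrightarrow> J t \<psi> r" if "r < t" for r
    by (rule integral_dominated_convergence[where w="\<lambda>_. G * K * (1 / sqrt (t - r))"])
      (use that drift_grad_tendsto[OF _ \<psi>, of "t - r"] abs_drift_grad_le[OF _ \<psi>(1), of "t - r"] in \<open>auto\<close>)
  have 4: "(\<lambda>k. LINT r:{0..t}|lborel. J t (\<psi>k k) r) \<longlonglongrightarrow> (LINT r:{0..t}|lborel. J t \<psi> r)"
    unfolding set_lebesgue_integral_def
  proof (rule integral_dominated_convergence[where w="\<lambda>r. indicator {0..t} r *\<^sub>R (G * K * (1 / sqrt (t - r)))"])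
    show "integrable lborel (\<lambda>r. indicator {0..t} r *\<^sub>R (G * K * (1 / sqrt (t - r))))"
      using set_integrable_mult_right[OF integral_inverse_sqrt_t(1)[OF t(1)]] unfolding set_integrable_def .
    show "AE r in lborel. (\<lambda>k. indicator {0..t} r *\<^sub>R J t (\<psi>k k) r) \<longlonglongrightarrow> indicator {0..t} r *\<^sub>R J t \<psi> r"
      using AE_lborel_singleton[of t]
    proof eventually_elim
      case (elim r)
      then show ?case using 3[of r] by (cases "r < t") (auto intro: tendsto_intros simp: indicator_def)
    qed
    show "AE r in lborel. norm (indicator {0..t} r *\<^sub>R J t (\<psi>k k) r) \<le> indicator {0..t} r *\<^sub>R (G * K * (1 / sqrt (t - r)))" for k
      using J_bound[OF _ \<psi>(1)] by (auto simp: indicator_def)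
  qed measurable
  have "(\<lambda>k. expectation (\<lambda>\<omega>. \<psi>k k (X t \<omega>))) \<longlonglongrightarrow> expectation (\<lambda>\<omega>. heat t \<psi> (X 0 \<omega>)) + (LINT r:{0..t}|lborel. J t \<psi> r)"
    unfolding d by (intro tendsto_add 2 4)
  with 1 show ?thesis by (rule LIMSEQ_unique)
qed

lemma duhamel_linear:
  assumes t: "0 < t" "t \<le> T" and fg: "bdd_meas K f" "bdd_meas L g" and d: "duhamel t f" "duhamel t g"
  shows "duhamel t (\<lambda>x. a * f x + c * g x)"
proof -
  note [measurable] = bdd_measD(1)[OF fg(1)] bdd_measD(1)[OF fg(2)]
  have t0: "0 \<le> t" using t by simp
  have i: "integrable M (\<lambda>\<omega>. f (X t \<omega>))" "integrable M (\<lambda>\<omega>. g (X t \<omega>))"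
    by (rule integrable_bdd[OF _ bdd_measD(2)[OF fg(1)]], measurable) (rule integrable_bdd[OF _ bdd_measD(2)[OF fg(2)]], measurable)
  have h: "integrable M (\<lambda>\<omega>. heat t f (X 0 \<omega>))" "integrable M (\<lambda>\<omega>. heat t g (X 0 \<omega>))"
    by (rule integrable_bdd[OF _ abs_heat_le[OF t0 fg(1)]], measurable) (rule integrable_bdd[OF _ abs_heat_le[OF t0 fg(2)]], measurable)
  have j: "J t (\<lambda>x. a * f x + c * g x) r = a * J t f r + c * J t g r" if "r \<in> {0..<t}" for r
  proof -
    have r: "0 \<le> t - r" "0 < t - r" using that by auto
    have k: "integrable M (\<lambda>\<omega>. drift_grad b r (t - r) f (X r \<omega>))" "integrable M (\<lambda>\<omega>. drift_grad b r (t - r) g (X r \<omega>))"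
      by (rule integrable_bdd[OF _ abs_drift_grad_le[OF r(1) fg(1)]], measurable) (rule integrable_bdd[OF _ abs_drift_grad_le[OF r(1) fg(2)]], measurable)
    have "drift_grad b r (t - r) (\<lambda>x. a * f x + c * g x) x = a * drift_grad b r (t - r) f x + c * drift_grad b r (t - r) g x" for x
      unfolding drift_grad_def hgrad_linear[OF r(2) fg]
      by (simp add: sum.distrib sum_distrib_left algebra_simps)
    then show ?thesis using k by simp
  qed
  have "(LINT r:{0..t}|lborel. J t (\<lambda>x. a * f x + c * g x) r) = (LINT r:{0..t}|lborel. a * J t f r + c * J t g r)"
    unfolding set_lebesgue_integral_def
  proof (rule integral_cong_AE)
    show "AE r in lborel. indicator {0..t} r *\<^sub>R J t (\<lambda>x. a * f x + c * g x) r = indicator {0..t} r *\<^sub>R (a * J t f r + c * J t g r)"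
      using AE_lborel_singleton[of t]
    proof eventually_elim
      case (elim r)
      then show ?case using j[of r] by (auto simp: indicator_def)
    qed
  qed measurable
  also have "\<dots> = a * (LINT r:{0..t}|lborel. J t f r) + c * (LINT r:{0..t}|lborel. J t g r)"
    using J_integrable[OF t(1) fg(1)] J_integrable[OF t(1) fg(2)]
    by (simp add: set_integral_add)
  finally have "(LINT r:{0..t}|lborel. J t (\<lambda>x. a * f x + c * g x) r) = a * (LINT r:{0..t}|lborel. J t f r) + c * (LINT r:{0..t}|lborel. J t g r)" .
  then show ?thesis using i h d unfolding heat_linear[OF t0 fg] by (simp add: algebra_simps)
qed

lemma duhamel_const:
  assumes t: "0 < t" "t \<le> T" shows "duhamel t (\<lambda>_. c)"
  by (rule duhamel_lipschitz[OF t, of "\<bar>c\<bar>" _ 0]) (auto simp: bdd_meas_def)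

text \<open>Indicators of open sets are limits of Lipschitz functions, and the sets for which the formula
  holds form a Dynkin system.\<close>

lemma duhamel_indicator:
  assumes t: "0 < t" "t \<le> T" and A: "A \<in> sets borel"
  shows "duhamel t (indicator A)"
proof -
  have st: "Int_stable {S :: (real ^ 'n) set. open S}" by (auto simp: Int_stable_def)
  have pw: "{S :: (real ^ 'n) set. open S} \<subseteq> Pow UNIV" by simp
  from st pw A[unfolded sets_borel] show ?thesis
  proof (induct rule: sigma_sets_induct_disjoint)
    case (basic A)
    then have A: "open A" by simp
    show ?case
    proof (cases "A = UNIV")
      case True
      then show ?thesis using duhamel_const[OF t, of 1] by simp
    next
      case False
      define \<psi> where "\<psi> k x = min 1 (real k * infdist x (- A))" for k :: nat and x :: "real ^ 'n"
      have lip: "\<bar>\<psi> k y - \<psi> k x\<bar> \<le> real k * nrm1 (y - x)" for k x y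
      proof -
        have "\<bar>\<psi> k y - \<psi> k x\<bar> \<le> \<bar>real k * infdist y (- A) - real k * infdist x (- A)\<bar>" by (simp add: \<psi>_def min_def)
        also have "\<dots> = real k * \<bar>infdist y (- A) - infdist x (- A)\<bar>" by (simp add: right_diff_distrib[symmetric] abs_mult)
        also have "\<dots> \<le> real k * nrm1 (y - x)"
          using infdist_triangle_abs[of y "- A" x] norm_le_l1_cart[of "y - x"] by (intro mult_left_mono) (auto simp: dist_norm)
        finally show ?thesis .
      qed
      have [measurable]: "(\<lambda>x. infdist x (- A)) \<in> borel_measurable borel"
        by (intro borel_measurable_continuous_onI continuous_intros)
      have b: "bdd_meas 1 (\<psi> k)" for k
        unfolding bdd_meas_def
      proof
        show "\<psi> k \<in> borel_measurable borel" unfolding \<psi>_def[abs_def] by measurable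
        have "0 \<le> \<psi> k x" for x by (simp add: \<psi>_def infdist_nonneg)
        then show "\<forall>x. \<bar>\<psi> k x\<bar> \<le> 1" by (simp add: \<psi>_def)
      qed
      have l: "(\<lambda>k. \<psi> k x) \<longlonglongrightarrow> indicator A x" for x
      proof (cases "x \<in> A")
        case True
        then have p: "0 < infdist x (- A)" using A False by (intro infdist_pos_not_in_closed) auto
        obtain N :: nat where N: "1 / infdist x (- A) \<le> real N" using real_arch_simple by blast
        have "\<psi> k x = 1" if "N \<le> k" for k
        proof -
          have "1 / infdist x (- A) \<le> real k" using N that by linarith
          then have "1 \<le> real k * infdist x (- A)" using p by (simp add: divide_le_eq)
          then show ?thesis by (simp add: \<psi>_def)
        qed
        then have "\<forall>\<^sub>F k in sequentially. \<psi> k x = indicator A x" using True by (auto simp: eventually_sequentially)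
        then show ?thesis by (rule tendsto_eventually)
      next
        case False
        then show ?thesis by (simp add: \<psi>_def)
      qed
      have i: "bdd_meas 1 (indicator A)" using A by (auto simp: bdd_meas_def indicator_def)
      show ?thesis by (rule duhamel_tendsto[OF t b i l duhamel_lipschitz[OF t b lip]]) simp
    qed
  next
    case empty
    then show ?case using duhamel_const[OF t, of 0] by simp
  next
    case (compl A)
    then have A: "A \<in> sets borel" by (simp add: sets_borel)
    have e: "indicator (UNIV - A) = (\<lambda>x :: real ^ 'n. 1 * 1 + (-1) * indicator A x :: real)" by (auto simp: indicator_def)
    have "duhamel t (\<lambda>x. 1 * 1 + (-1) * indicator A x)"
      by (rule duhamel_linear[OF t _ _ duhamel_const[OF t] compl(2), of 1 1]) (use A in \<open>auto simp: bdd_meas_def indicator_def\<close>)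
    then show ?case unfolding e .
  next
    case (union A)
    have A [measurable]: "A i \<in> sets borel" for i using union(2) by (auto simp: sets_borel)
    have b: "bdd_meas 1 (indicator S)" if "S \<in> sets borel" for S :: "(real ^ 'n) set"
      using that by (auto simp: bdd_meas_def indicator_def)
    have p: "duhamel t (indicator (\<Union>i<k. A i))" for k
    proof (induction k)
      case 0
      then show ?case using duhamel_const[OF t, of 0] by simp
    next
      case (Suc k)
      have "A i \<inter> A k = {}" if "i < k" for i
        using union(1) that unfolding disjoint_family_on_def by (metis UNIV_I less_irrefl)
      then have "(\<Union>i<k. A i) \<inter> A k = {}" by blast
      then have e: "indicator (\<Union>i<Suc k. A i) = (\<lambda>x. 1 * indicator (\<Union>i<k. A i) x + 1 * indicator (A k) x :: real)"
        by (auto simp: indicator_def less_Suc_eq fun_eq_iff)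
      have "duhamel t (\<lambda>x. 1 * indicator (\<Union>i<k. A i) x + 1 * indicator (A k) x)"
        by (rule duhamel_linear[OF t b b Suc union(3)]) auto
      then show ?case unfolding e .
    qed
    have l: "(\<lambda>k. indicator (\<Union>i<k. A i) x :: real) \<longlonglongrightarrow> indicator (\<Union>i. A i) x" for x
      by (rule LIMSEQ_indicator_UN)
    show ?case by (rule duhamel_tendsto[OF t b b l p]) auto
  qed
qed

theorem duhamel:
  assumes t: "0 < t" "t \<le> T" and \<psi>: "bdd_meas K \<psi>"
  shows "duhamel t \<psi>"
proof -
  note [measurable] = bdd_measD(1)[OF \<psi>]
  \<comment> \<open>boundedness is part of the inductive statement, since the induction rule does not carry it along\<close>
  have pos: "bdd_meas C u \<longrightarrow> duhamel t u" if u: "u \<in> borel_measurable borel" "\<And>x. 0 \<le> u x" for u C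
    using u
  proof (induct u arbitrary: C rule: borel_measurable_induct_real)
    case (set A)
    then show ?case using duhamel_indicator[OF t] by simp
  next
    case (mult u c)
    show ?case
    proof (cases "c = 0")
      case True
      then show ?thesis using duhamel_const[OF t, of 0] by simp
    next
      case False
      show ?thesis
      proof
        assume b: "bdd_meas C (\<lambda>x. c * u x)"
        have "bdd_meas (C / c) u"
          using mult False bdd_measD(2)[OF b] by (auto simp: bdd_meas_def abs_mult field_simps)
        then show "duhamel t (\<lambda>x. c * u x)"
          using duhamel_linear[OF t, of "C / c" u "C / c" u c 0] mult by simp
      qed
    qed
  next
    case (add u v)
    show ?case
    proof
      assume b: "bdd_meas C (\<lambda>x. v x + u x)"
      have "\<bar>u x\<bar> \<le> C" "\<bar>v x\<bar> \<le> C" for x using bdd_measD(2)[OF b, of x] add(2)[of x] add(5)[of x] by auto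
      then have "bdd_meas C u" "bdd_meas C v" using add by (auto simp: bdd_meas_def)
      then show "duhamel t (\<lambda>x. v x + u x)"
        using duhamel_linear[OF t, of C v C u 1 1] add by simp
    qed
  next
    case (seq U)
    show ?case
    proof
      assume b: "bdd_meas C u"
      have "U i x \<le> u x" for i x
        using seq(5)[of x] incseq_le[of "\<lambda>i. U i x" "u x" i] seq(4) by (auto simp: incseq_def le_fun_def)
      moreover have "u x \<le> C" for x using bdd_measD(2)[OF b, of x] by simp
      ultimately have "U i x \<le> C" for i x by (rule order_trans)
      then have Ub: "bdd_meas C (U i)" for i
        using seq(1,2) by (auto simp: bdd_meas_def)
      show "duhamel t u"
      proof (rule duhamel_tendsto[OF t Ub b])
        show "(\<lambda>i. U i x) \<longlonglongrightarrow> u x" for x using seq(5) by simp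
        show "duhamel t (U i)" for i using seq(3)[of C i] Ub by blast
      qed
    qed
  qed
  have K: "0 \<le> K" using bdd_measD(3)[OF \<psi>] .
  have p: "0 \<le> \<psi> x + K" for x using bdd_measD(2)[OF \<psi>, of x] by linarith
  have b: "bdd_meas (2 * K) (\<lambda>x. \<psi> x + K)"
    using bdd_measD(2)[OF \<psi>] unfolding bdd_meas_def abs_le_iff
    by (auto simp: K) (smt (verit, best))+
  have c: "bdd_meas 1 (\<lambda>_ :: real ^ 'n. 1)" by (simp add: bdd_meas_def)
  have "duhamel t (\<lambda>x. \<psi> x + K)" using pos[of "\<lambda>x. \<psi> x + K" "2 * K"] p b by simp
  from duhamel_linear[OF t b c this duhamel_const[OF t], of 1 "- K"] show ?thesis by simp
qed

end

section \<open>A Gronwall argument for weakly singular kernels\<close>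

text \<open>A consequence of \<open>sqrt t \<le> sqrt s + sqrt (t - s)\<close>. It separates the two singularities at the price of the
  singularity \<open>1 / sqrt t\<close>, which has the form of the claimed bounds.\<close>

lemma sqrt_kernel_split:
  assumes "0 < t" "0 \<le> s" "s \<le> t"
  shows "1 / sqrt (t - s) * (1 / sqrt s) \<le> 1 / sqrt t * (1 / sqrt s + 1 / sqrt (t - s))"
proof (cases "s = 0 \<or> s = t")
  case False
  then have s: "0 < s" "0 < t - s" using assms by auto
  have "sqrt t \<le> sqrt s + sqrt (t - s)" using sqrt_add_le_add_sqrt[of s "t - s"] s by simp
  then have "1 / sqrt (t - s) * (1 / sqrt s) * sqrt t \<le> 1 / sqrt (t - s) * (1 / sqrt s) * (sqrt s + sqrt (t - s))"
    using s by (intro mult_left_mono) auto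
  also have "\<dots> = 1 / sqrt s + 1 / sqrt (t - s)" using s by (simp add: field_simps)
  finally show ?thesis using assms by (simp add: field_simps)
qed (use assms in auto)

text \<open>The decay \<open>exp (- l * s)\<close> is weakened to \<open>1 / (1 + l * s)\<close>, for which there is an elementary
  primitive.\<close>

lemma integral_sqrt_arctan:
  assumes t: "0 < t" and l: "0 < l"
  shows "set_integrable lborel {0..t} (\<lambda>s. 1 / sqrt s / (1 + l * s))"
    and "(LINT s:{0..t}|lborel. 1 / sqrt s / (1 + l * s)) \<le> 4 / sqrt l"
proof -
  let ?F = "\<lambda>s. 2 / sqrt l * arctan (sqrt (l * s))"
  note ftc = interval_integral_FTC_nonneg[of "ereal 0" "ereal t" ?F "\<lambda>s. 1 / sqrt s / (1 + l * s)" 0 "?F t"]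
  have d: "DERIV ?F x :> 1 / sqrt x / (1 + l * x)" if x: "0 < x" for x
  proof -
    have lx: "0 < l * x" using x l by simp
    have "DERIV (\<lambda>s. sqrt (l * s)) x :> l / (2 * sqrt (l * x))"
      using lx by (auto intro!: derivative_eq_intros simp: field_simps)
    then have "DERIV ?F x :> 2 / sqrt l * (inverse (1 + (sqrt (l * x))\<^sup>2) * (l / (2 * sqrt (l * x))))"
      by (intro DERIV_cmult DERIV_chain2[OF DERIV_arctan])
    moreover have "2 / sqrt l * (inverse (1 + (sqrt (l * x))\<^sup>2) * (l / (2 * sqrt (l * x)))) = 1 / sqrt x / (1 + l * x)"
    proof -
      have "(sqrt (l * x))\<^sup>2 = l * x" using lx by simp
      moreover have "2 / sqrt l * (l / (2 * sqrt (l * x))) = 1 / sqrt x"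
      proof -
        have "2 / sqrt l * (l / (2 * sqrt (l * x))) = (l / (sqrt l * sqrt l)) * (1 / sqrt x)"
          by (simp add: real_sqrt_mult)
        then show ?thesis using l by simp
      qed
      moreover have "2 / sqrt l * (inverse (1 + (sqrt (l * x))\<^sup>2) * (l / (2 * sqrt (l * x))))
          = (2 / sqrt l * (l / (2 * sqrt (l * x)))) / (1 + (sqrt (l * x))\<^sup>2)"
        by (simp add: inverse_eq_divide)
      ultimately show ?thesis by simp
    qed
    ultimately show ?thesis by simp
  qed
  have c0: "(?F \<longlongrightarrow> ?F x) (at x within S)" for x S by (intro tendsto_intros)
  have l': "((?F \<circ> real_of_ereal) \<longlongrightarrow> 0) (at_right (ereal 0))"
    unfolding ereal_tendsto_simps1 using c0[of 0 "{0<..}"] by simp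
  have r': "((?F \<circ> real_of_ereal) \<longlongrightarrow> ?F t) (at_left (ereal t))"
    unfolding ereal_tendsto_simps1 using c0[of t "{..<t}"] by simp
  have c: "isCont (\<lambda>s. 1 / sqrt s / (1 + l * s)) x" if x: "0 < x" for x
  proof -
    have "1 + l * x \<noteq> 0" using x l by (metis add_pos_pos less_numeral_extra(1) less_numeral_extra(3) mult_pos_pos)
    then show ?thesis using x by (intro continuous_intros) auto
  qed
  have nn: "0 \<le> 1 / sqrt x / (1 + l * x)" if "0 < x" for x using that l by simp
  have 1: "set_integrable lborel (einterval (ereal 0) (ereal t)) (\<lambda>s. 1 / sqrt s / (1 + l * s))"
      "(LBINT s=ereal 0..ereal t. 1 / sqrt s / (1 + l * s)) = ?F t - 0"
    by (rule ftc; use t d c nn l' r' in \<open>auto\<close>)+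
  have "AE x in lborel. x \<noteq> 0 \<and> x \<noteq> t" using AE_lborel_singleton[of "0::real"] AE_lborel_singleton[of t] by eventually_elim auto
  then have ae: "AE x in lborel. indicator {0<..<t} x *\<^sub>R (1 / sqrt x / (1 + l * x)) = indicator {0..t} x *\<^sub>R (1 / sqrt x / (1 + l * x))"
    by eventually_elim (auto simp: indicator_def)
  show "set_integrable lborel {0..t} (\<lambda>s. 1 / sqrt s / (1 + l * s))"
    using 1(1) unfolding set_integrable_def by (subst integrable_cong_AE[OF _ _ AE_symmetric[OF ae]]) (auto simp: einterval_eq)
  have "(LINT s:{0..t}|lborel. 1 / sqrt s / (1 + l * s)) = (LINT s:{0<..<t}|lborel. 1 / sqrt s / (1 + l * s))"
    unfolding set_lebesgue_integral_def by (rule integral_cong_AE[OF _ _ AE_symmetric[OF ae]]) auto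
  also have "\<dots> = 2 / sqrt l * arctan (sqrt (l * t))"
    using 1(2) t by (simp add: interval_integral_Ioo)
  also have "\<dots> \<le> 2 / sqrt l * 2"
    using arctan_ubound[of "sqrt (l * t)"] pi_half_less_two l by (intro mult_left_mono) auto
  finally show "(LINT s:{0..t}|lborel. 1 / sqrt s / (1 + l * s)) \<le> 4 / sqrt l" by simp
qed

text \<open>With the weight \<open>exp (l * s) / sqrt s\<close> the singular kernel becomes a contraction for large
  \<open>l\<close>. The value of \<open>l\<close> below makes the factor at most one half.\<close>

definition rate :: "real \<Rightarrow> real" where
  "rate c = (24 * c + 1)\<^sup>2"

lemma rate_pos: "0 \<le> c \<Longrightarrow> 0 < rate c"
  unfolding rate_def by (simp add: add_nonneg_pos)

lemma singular_kernel:
  assumes t: "0 < t" and c: "0 \<le> c"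
  defines "l \<equiv> rate c"
  shows "set_integrable lborel {0..t} (\<lambda>s. 1 / sqrt (t - s) * (1 / sqrt s * exp (l * s)))"
    and "c * (LINT s:{0..t}|lborel. 1 / sqrt (t - s) * (1 / sqrt s * exp (l * s))) \<le> 1 / 2 * (1 / sqrt t * exp (l * t))"
proof -
  have l: "0 < l" unfolding l_def by (rule rate_pos[OF c])
  let ?f = "\<lambda>u. 1 / sqrt u / (1 + l * u)"
  have e: "exp (- l * u) * (1 / sqrt u) \<le> ?f u" if "0 \<le> u" for u
  proof -
    have "exp (- l * u) = 1 / exp (l * u)" by (simp add: exp_minus field_simps)
    also have "\<dots> \<le> 1 / (1 + l * u)" using that l by (intro divide_left_mono exp_ge_add_one_self mult_pos_pos) (auto intro: add_pos_nonneg)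
    finally have "exp (- l * u) * (1 / sqrt u) \<le> 1 / (1 + l * u) * (1 / sqrt u)" using that by (intro mult_right_mono) auto
    then show ?thesis by (simp add: mult.commute)
  qed
  have pt: "\<bar>1 / sqrt (t - s) * (1 / sqrt s * exp (l * s))\<bar> \<le> 1 / sqrt t * exp (l * t) * (2 * ?f (t - s) + ?f s)"
    if s: "s \<in> {0..t}" for s
  proof (cases "s = t")
    case True
    then show ?thesis using t l by simp
  next
    case st: False
    have s0: "0 \<le> s" "s \<le> t" "0 \<le> t - s" using s by auto
    have es: "exp (l * s) = exp (l * t) * exp (- l * (t - s))" by (simp add: exp_add[symmetric] algebra_simps)
    \<comment> \<open>the smaller one of \<open>s\<close> and \<open>t - s\<close> can be used in both factors\<close>
    have "exp (- l * (t - s)) * (1 / sqrt s) \<le> ?f (t - s) + ?f s"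
    proof (cases "0 < t - s \<and> t - s \<le> s")
      case True
      then have "1 / sqrt s \<le> 1 / sqrt (t - s)" by (intro divide_left_mono real_sqrt_le_mono) auto
      then have "exp (- l * (t - s)) * (1 / sqrt s) \<le> exp (- l * (t - s)) * (1 / sqrt (t - s))" by (intro mult_left_mono) auto
      also have "\<dots> \<le> ?f (t - s)" by (rule e[OF s0(3)])
      finally show ?thesis using l s0 by (simp add: add_increasing2)
    next
      case False
      then have "exp (- l * (t - s)) \<le> exp (- l * s)" using st s0 l by auto
      then have "exp (- l * (t - s)) * (1 / sqrt s) \<le> exp (- l * s) * (1 / sqrt s)" using s0 by (intro mult_right_mono) auto
      also have "\<dots> \<le> ?f s" by (rule e[OF s0(1)])
      finally show ?thesis using l s0 by (simp add: add_increasing)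
    qed
    then have "exp (- l * (t - s)) * (1 / sqrt s + 1 / sqrt (t - s)) \<le> 2 * ?f (t - s) + ?f s"
      using e[OF s0(3)] by (simp add: distrib_left)
    then have "1 / sqrt t * exp (l * t) * (exp (- l * (t - s)) * (1 / sqrt s + 1 / sqrt (t - s))) \<le> 1 / sqrt t * exp (l * t) * (2 * ?f (t - s) + ?f s)"
      using t by (intro mult_left_mono) auto
    moreover have "1 / sqrt (t - s) * (1 / sqrt s) * exp (l * s) \<le> 1 / sqrt t * (1 / sqrt s + 1 / sqrt (t - s)) * exp (l * s)"
      by (intro mult_right_mono sqrt_kernel_split t s0) auto
    ultimately show ?thesis unfolding es using s0 t by (simp add: abs_mult mult_ac)
  qed
  have i1: "set_integrable lborel {0..t} ?f" "(LINT s:{0..t}|lborel. ?f s) \<le> 4 / sqrt l" by (rule integral_sqrt_arctan[OF t l])+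
  have i2: "set_integrable lborel {0..t} (\<lambda>s. ?f (t - s))" "(LINT s:{0..t}|lborel. ?f (t - s)) \<le> 4 / sqrt l"
    using set_integral_reflect[of t ?f] i1 by auto
  have i3: "set_integrable lborel {0..t} (\<lambda>s. 1 / sqrt t * exp (l * t) * (2 * ?f (t - s) + ?f s))"
    by (intro set_integrable_mult_right set_integral_add i1 i2)
  have m: "set_borel_measurable lborel {0..t} (\<lambda>s. 1 / sqrt (t - s) * (1 / sqrt s * exp (l * s)))"
    unfolding set_borel_measurable_def by measurable
  show "set_integrable lborel {0..t} (\<lambda>s. 1 / sqrt (t - s) * (1 / sqrt s * exp (l * s)))"
    by (rule set_integral_bound(1)[OF i3 m pt])
  have "(LINT s:{0..t}|lborel. 1 / sqrt (t - s) * (1 / sqrt s * exp (l * s))) \<le> (LINT s:{0..t}|lborel. 1 / sqrt t * exp (l * t) * (2 * ?f (t - s) + ?f s))"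
    using set_integral_bound(2)[OF i3 m pt] by simp
  also have "\<dots> = 1 / sqrt t * exp (l * t) * (2 * (LINT s:{0..t}|lborel. ?f (t - s)) + (LINT s:{0..t}|lborel. ?f s))"
    unfolding set_integral_mult_right
    by (subst set_integral_add(2)[OF set_integrable_mult_right[OF i2(1)] i1(1)]) (simp only: set_integral_mult_right)
  also have "\<dots> \<le> 1 / sqrt t * exp (l * t) * (2 * (4 / sqrt l) + 4 / sqrt l)"
    using i1 i2 t by (intro mult_left_mono add_mono) auto
  finally have "c * (LINT s:{0..t}|lborel. 1 / sqrt (t - s) * (1 / sqrt s * exp (l * s))) \<le> c * (1 / sqrt t * exp (l * t) * (12 / sqrt l))"
    using c by (intro mult_left_mono) auto
  also have "\<dots> = (c * 12 / sqrt l) * (1 / sqrt t * exp (l * t))" by (simp add: mult_ac)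
  also have "\<dots> \<le> 1 / 2 * (1 / sqrt t * exp (l * t))"
  proof (rule mult_right_mono)
    show "c * 12 / sqrt l \<le> 1 / 2" using c by (simp add: l_def rate_def divide_le_eq)
  qed (use t in auto)
  finally show "c * (LINT s:{0..t}|lborel. 1 / sqrt (t - s) * (1 / sqrt s * exp (l * s))) \<le> 1 / 2 * (1 / sqrt t * exp (l * t))" .
qed

text \<open>Instead of a Gronwall inequality for a supremum, whose measurability in time would have to be
  discussed, an a priori bound \<open>a0\<close> of any size is improved by iterating \<open>a \<mapsto> c + a / 2\<close>; the final
  bound does not depend on \<open>a0\<close>.\<close>

lemma bound_by_halving:
  fixes P :: "real \<Rightarrow> bool"
  assumes "P a0" "0 \<le> a0" "0 \<le> c"
    and step: "\<And>a. 0 \<le> a \<Longrightarrow> P a \<Longrightarrow> P (c + a / 2)"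
    and mono: "\<And>a a'. P a \<Longrightarrow> a \<le> a' \<Longrightarrow> P a'"
  shows "P (2 * c + 1)"
proof -
  have *: "P (2 * c + a0 / 2 ^ k)" for k
  proof (induction k)
    case 0
    show ?case using mono[OF assms(1), of "2 * c + a0"] assms by simp
  next
    case (Suc k)
    have "0 \<le> 2 * c + a0 / 2 ^ k" using assms by simp
    from step[OF this Suc] show ?case by (simp add: add_divide_distrib mult.commute)
  qed
  obtain k :: nat where "a0 \<le> 2 ^ k"
    using real_arch_pow[of 2 a0] by (auto intro: less_imp_le)
  then have "a0 / 2 ^ k \<le> 1" by (simp add: divide_le_eq)
  then show ?thesis using mono[OF *[of k]] by simp
qed

text \<open>At the end points singular kernels take the value 0 as divisions by zero, so the bound can only
  be asked for in the interior.\<close>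

lemma set_integral_bound_open:
  fixes f g :: "real \<Rightarrow> real"
  assumes g: "set_integrable lborel {a..b} g" and f: "set_borel_measurable lborel {a..b} f"
    and le: "\<And>x. a < x \<Longrightarrow> x < b \<Longrightarrow> \<bar>f x\<bar> \<le> g x"
  shows "\<bar>LINT x:{a..b}|lborel. f x\<bar> \<le> (LINT x:{a..b}|lborel. g x)"
proof -
  have "AE x in lborel. x \<noteq> a \<and> x \<noteq> b" using AE_lborel_singleton[of a] AE_lborel_singleton[of b] by eventually_elim auto
  then have ae: "AE x in lborel. norm (indicator {a..b} x *\<^sub>R f x) \<le> indicator {a..b} x *\<^sub>R g x"
    by eventually_elim (use le in \<open>auto simp: indicator_def\<close>)
  have i: "integrable lborel (\<lambda>x. indicator {a..b} x *\<^sub>R f x)"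
    using g f unfolding set_integrable_def set_borel_measurable_def
    by (rule Bochner_Integration.integrable_bound) (use ae in \<open>auto elim!: eventually_mono\<close>)
  have "\<bar>LINT x:{a..b}|lborel. f x\<bar> \<le> (LINT x|lborel. \<bar>indicator {a..b} x *\<^sub>R f x\<bar>)"
    unfolding set_lebesgue_integral_def by (rule integral_abs_bound)
  also have "\<dots> \<le> (LINT x:{a..b}|lborel. g x)"
    unfolding set_lebesgue_integral_def
    using i g ae unfolding set_integrable_def by (intro integral_mono_AE) auto
  finally show ?thesis .
qed

section \<open>Integration by parts against the heat kernel\<close>

lemma heat_sum:
  fixes f :: "'i \<Rightarrow> real ^ 'n::finite \<Rightarrow> real"
  assumes "finite I" "0 \<le> t" "\<And>i. i \<in> I \<Longrightarrow> bdd_meas K (f i)"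
  shows "heat t (\<lambda>x. \<Sum>i\<in>I. f i x) x = (\<Sum>i\<in>I. heat t (f i) x)"
proof (cases "t = 0")
  case False
  then have t: "0 < t" using assms by simp
  have "(LINT y|lborel. (\<Sum>i\<in>I. gk t (y - x) * f i y)) = (\<Sum>i\<in>I. LINT y|lborel. gk t (y - x) * f i y)"
    by (rule Bochner_Integration.integral_sum) (rule integrable_gk_mult[OF t bdd_measD(1,2)[OF assms(3)]])
  then show ?thesis using t by (simp add: heat_pos sum_distrib_left)
qed simp

lemma hgrad_sum:
  fixes f :: "'i \<Rightarrow> real ^ 'n::finite \<Rightarrow> real"
  assumes "finite I" "0 < t" "\<And>i. i \<in> I \<Longrightarrow> bdd_meas K (f i)"
  shows "hgrad t j (\<lambda>x. \<Sum>i\<in>I. f i x) x = (\<Sum>i\<in>I. hgrad t j (f i) x)"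
proof -
  have "(LINT y|lborel. (\<Sum>i\<in>I. (y - x) $ j / t * gk t (y - x) * f i y)) = (\<Sum>i\<in>I. LINT y|lborel. (y - x) $ j / t * gk t (y - x) * f i y)"
    by (rule Bochner_Integration.integral_sum) (rule integrable_gk_component[OF assms(2) bdd_measD(1,2)[OF assms(3)]])
  then show ?thesis by (simp add: hgrad_def sum_distrib_left)
qed

text \<open>\<open>P (u \<bullet> \<nabla>f) = div P (u f) - P (f div u)\<close> for \<open>f = P q\<close>, where \<open>P = heat \<epsilon>\<close>. The product of the two
  Gaussians is a Gaussian in the integration variable, so the hypothesis on the divergence applies.\<close>

lemma heat_drift_by_parts:
  fixes u :: "real ^ 'n::finite \<Rightarrow> real ^ 'n"
  assumes um [measurable]: "u \<in> borel_measurable borel" and ub: "\<And>x i. \<bar>u x $ i\<bar> \<le> B"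
    and gd: "gauss_div u K0 lam g" and eps: "0 < \<epsilon>" and q: "bdd_meas K q"
  shows "heat \<epsilon> (\<lambda>y. \<Sum>i\<in>UNIV. u y $ i * hgrad \<epsilon> i q y) x
    = (\<Sum>i\<in>UNIV. hgrad \<epsilon> i (\<lambda>y. u y $ i * heat \<epsilon> q y) x) - (LINT y|lam. (g y * gk \<epsilon> (y - x)) * heat \<epsilon> q y)"
proof -
  have lam: "sigma_finite_measure lam" and sl [measurable_cong]: "sets lam = sets borel" and gm [measurable]: "g \<in> borel_measurable borel"
    and gK: "\<And>c s. 0 < s \<Longrightarrow> (\<integral>\<^sup>+y. ennreal (\<bar>g y\<bar> * gk s (y - c)) \<partial>lam) \<le> ennreal (K0 * (1 + 1 / sqrt s))"
    and gdiv: "\<And>c s. 0 < s \<Longrightarrow> (LINT y|lborel. (\<Sum>i\<in>UNIV. u y $ i * ((y - c) $ i / s * gk s (y - c)))) = (LINT y|lam. g y * gk s (y - c))"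
    using gd by (auto simp: gauss_div_def)
  note [measurable] = bdd_measD(1)[OF q]
  note sf = lborel.sigma_finite_measure_axioms
  have B: "0 \<le> B" using ub by (rule order_trans[OF abs_ge_zero])
  define aD where "aD i y = (y - x) $ i / \<epsilon> * gk \<epsilon> (y - x) * u y $ i" for i y
  define aH where "aH i y = gk \<epsilon> (y - x) * u y $ i" for i y
  define bD where "bD p = gk \<epsilon> (snd p - fst p)" for p :: "(real ^ 'n) \<times> (real ^ 'n)"
  define bH where "bH i p = (snd p - fst p) $ i / \<epsilon> * gk \<epsilon> (snd p - fst p)" for i and p :: "(real ^ 'n) \<times> (real ^ 'n)"
  have aDi: "integrable lborel (aD i)" for i
    unfolding aD_def by (rule integrable_gk_component[OF eps]) (use ub in auto)
  have aHi: "integrable lborel (aH i)" for i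
    unfolding aH_def by (rule integrable_gk_mult[OF eps]) (use ub in auto)
  have bDm: "bD \<in> borel_measurable (lborel \<Otimes>\<^sub>M lborel)" unfolding bD_def by measurable
  have bHm: "bH i \<in> borel_measurable (lborel \<Otimes>\<^sub>M lborel)" for i unfolding bH_def by measurable
  have qm: "q \<in> borel_measurable lborel" by measurable
  have bDb: "(\<integral>\<^sup>+w. ennreal \<bar>bD (y, w)\<bar> \<partial>lborel) \<le> ennreal 1" for y
    using eps by (simp add: bD_def nn_integral_gk)
  have bHb: "(\<integral>\<^sup>+w. ennreal \<bar>bH i (y, w)\<bar> \<partial>lborel) \<le> ennreal (dimc TYPE('n) / sqrt \<epsilon>)" for i y
    using nn_integral_gk_component[OF eps, of y i] by (simp add: bH_def)
  note kD = kernel_comp[OF sf sf bDm qm aDi bDb _ bdd_measD(2,3)[OF q], simplified]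
  note kH = kernel_comp[OF sf sf bHm qm aHi bHb _ bdd_measD(2,3)[OF q]]
  have c0: "0 \<le> dimc TYPE('n) / sqrt \<epsilon>" using eps by simp
  have D: "(\<Sum>i\<in>UNIV. hgrad \<epsilon> i (\<lambda>y. u y $ i * heat \<epsilon> q y) x) = (\<Sum>i\<in>UNIV. LINT w|lborel. (LINT y|lborel. aD i y * bD (y, w)) * q w)"
  proof (intro sum.cong refl)
    fix i
    have "hgrad \<epsilon> i (\<lambda>y. u y $ i * heat \<epsilon> q y) x = (LINT y|lborel. aD i y * (LINT w|lborel. bD (y, w) * q w))"
      using eps by (simp add: hgrad_def aD_def bD_def heat_pos mult.assoc)
    then show "hgrad \<epsilon> i (\<lambda>y. u y $ i * heat \<epsilon> q y) x = (LINT w|lborel. (LINT y|lborel. aD i y * bD (y, w)) * q w)"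
      using kD(1)[of i] by simp
  qed
  have H: "heat \<epsilon> (\<lambda>y. \<Sum>i\<in>UNIV. u y $ i * hgrad \<epsilon> i q y) x = (\<Sum>i\<in>UNIV. LINT w|lborel. (LINT y|lborel. aH i y * bH i (y, w)) * q w)"
  proof -
    have b: "bdd_meas (B * (dimc TYPE('n) / sqrt \<epsilon> * K)) (\<lambda>y. u y $ i * hgrad \<epsilon> i q y)" for i
      unfolding bdd_meas_def abs_mult
    proof (intro conjI allI)
      show "\<bar>u y $ i\<bar> * \<bar>hgrad \<epsilon> i q y\<bar> \<le> B * (dimc TYPE('n) / sqrt \<epsilon> * K)" for y
        by (intro mult_mono ub abs_hgrad_le[OF eps q] B) auto
    qed measurable
    have "heat \<epsilon> (\<lambda>y. \<Sum>i\<in>UNIV. u y $ i * hgrad \<epsilon> i q y) x = (\<Sum>i\<in>UNIV. heat \<epsilon> (\<lambda>y. u y $ i * hgrad \<epsilon> i q y) x)"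
      by (rule heat_sum[OF finite less_imp_le[OF eps] b])
    also have "\<dots> = (\<Sum>i\<in>UNIV. LINT w|lborel. (LINT y|lborel. aH i y * bH i (y, w)) * q w)"
    proof (intro sum.cong refl)
      fix i
      have "heat \<epsilon> (\<lambda>y. u y $ i * hgrad \<epsilon> i q y) x = (LINT y|lborel. aH i y * (LINT w|lborel. bH i (y, w) * q w))"
        using eps by (simp add: hgrad_def aH_def bH_def heat_pos mult.assoc)
      then show "heat \<epsilon> (\<lambda>y. u y $ i * hgrad \<epsilon> i q y) x = (LINT w|lborel. (LINT y|lborel. aH i y * bH i (y, w)) * q w)"
        using kH(1)[of i] c0 by simp
    qed
    finally show ?thesis .
  qed
  \<comment> \<open>the Gaussians centred at \<open>x\<close> and \<open>w\<close> combine to one centred at their midpoint \<open>c\<close> with variance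
    \<open>\<epsilon> / 2\<close>, and the difference of the two linear factors is \<open>(y - c) / (\<epsilon> / 2)\<close>\<close>
  have inner: "(\<Sum>i\<in>UNIV. (LINT y|lborel. aD i y * bD (y, w)) - (LINT y|lborel. aH i y * bH i (y, w))) = (LINT y|lam. (g y * gk \<epsilon> (y - x)) * gk \<epsilon> (w - y))" for w
  proof -
    define c where "c = (1 / (\<epsilon> + \<epsilon>)) *\<^sub>R (\<epsilon> *\<^sub>R x + \<epsilon> *\<^sub>R w)"
    define r where "r = \<epsilon> * \<epsilon> / (\<epsilon> + \<epsilon>)"
    have r: "0 < r" "r = \<epsilon> / 2" using eps by (auto simp: r_def field_simps)
    have gg: "gk \<epsilon> (y - x) * gk \<epsilon> (w - y) = gk (\<epsilon> + \<epsilon>) (w - x) * gk r (y - c)" for y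
      unfolding c_def r_def by (rule gk_mult_gk[OF eps eps])
    have c2: "c = (1 / 2) *\<^sub>R (x + w)" unfolding c_def using eps by (simp add: scaleR_add_right[symmetric] del: scaleR_add_right)
    have iD: "integrable lborel (\<lambda>y. aD i y * bD (y, w))" for i
    proof -
      have "integrable lborel (\<lambda>y. (y - x) $ i / \<epsilon> * gk \<epsilon> (y - x) * (u y $ i * gk \<epsilon> (w - y)))"
        by (rule integrable_gk_component[OF eps, of _ "B * (1 / sqrt \<epsilon>) ^ CARD('n)"])
          (auto simp: abs_mult intro!: mult_mono ub gk_le_sup[OF eps] B)
      then show ?thesis by (simp add: aD_def bD_def mult_ac)
    qed
    have iH: "integrable lborel (\<lambda>y. aH i y * bH i (y, w))" for i
    proof -
      have i: "integrable lborel (\<lambda>y. - ((y - w) $ i / \<epsilon> * gk \<epsilon> (y - w) * (u y $ i * gk \<epsilon> (y - x))))"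
        by (intro integrable_minus integrable_gk_component[OF eps, of _ "B * (1 / sqrt \<epsilon>) ^ CARD('n)"])
          (auto simp: abs_mult intro!: mult_mono ub gk_le_sup[OF eps] B)
      have e: "- ((y - w) $ i / \<epsilon> * gk \<epsilon> (y - w) * (u y $ i * gk \<epsilon> (y - x))) = aH i y * bH i (y, w)" for y
        by (simp add: aH_def bH_def gk_minus_commute[of \<epsilon> y w] minus_mult_left minus_divide_left del: mult_minus_left minus_divide_left[symmetric])
      show ?thesis using i unfolding e .
    qed
    have pt: "(\<Sum>i\<in>UNIV. aD i y * bD (y, w) - aH i y * bH i (y, w)) = gk (\<epsilon> + \<epsilon>) (w - x) * (\<Sum>i\<in>UNIV. u y $ i * ((y - c) $ i / r * gk r (y - c)))" for y
    proof -
      have "aD i y * bD (y, w) - aH i y * bH i (y, w) = u y $ i * ((y - c) $ i / r) * (gk \<epsilon> (y - x) * gk \<epsilon> (w - y))" for i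
      proof -
        have "(y - x) $ i / \<epsilon> - (w - y) $ i / \<epsilon> = (y - c) $ i / r" using eps unfolding r(2) c2 by (simp add: field_simps)
        then have "((y - x) $ i / \<epsilon> - (w - y) $ i / \<epsilon>) * (u y $ i * (gk \<epsilon> (y - x) * gk \<epsilon> (w - y))) = (y - c) $ i / r * (u y $ i * (gk \<epsilon> (y - x) * gk \<epsilon> (w - y)))"
          by simp
        then show ?thesis unfolding aD_def aH_def bD_def bH_def fst_conv snd_conv left_diff_distrib by (simp only: mult_ac)
      qed
      then show ?thesis unfolding gg by (simp only: sum_distrib_left mult_ac)
    qed
    have "(\<Sum>i\<in>UNIV. (LINT y|lborel. aD i y * bD (y, w)) - (LINT y|lborel. aH i y * bH i (y, w))) = (LINT y|lborel. (\<Sum>i\<in>UNIV. aD i y * bD (y, w) - aH i y * bH i (y, w)))"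
      by (subst Bochner_Integration.integral_sum)
        (auto intro: iD iH simp: Bochner_Integration.integral_diff[OF iD iH])
    also have "\<dots> = gk (\<epsilon> + \<epsilon>) (w - x) * (LINT y|lam. g y * gk r (y - c))"
      unfolding pt integral_mult_right_zero gdiv[OF r(1)] by (rule refl)
    also have "\<dots> = (LINT y|lam. g y * (gk (\<epsilon> + \<epsilon>) (w - x) * gk r (y - c)))"
      unfolding integral_mult_right_zero[symmetric] by (simp only: mult_ac)
    finally show ?thesis unfolding gg[symmetric] by (simp only: mult.assoc)
  qed
  have jD: "integrable lborel (\<lambda>w. (LINT y|lborel. aD i y * bD (y, w)) * q w)" for i
    using kD(2)[of i] by simp
  have jH: "integrable lborel (\<lambda>w. (LINT y|lborel. aH i y * bH i (y, w)) * q w)" for i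
    using kH(2)[of i] c0 by simp
  have gi: "integrable lam (\<lambda>y. g y * gk \<epsilon> (y - x))"
    using gK[OF eps, of x] by (intro integrableI_bounded) (auto simp: abs_mult intro: le_less_trans)
  have "(\<Sum>i\<in>UNIV. hgrad \<epsilon> i (\<lambda>y. u y $ i * heat \<epsilon> q y) x) - heat \<epsilon> (\<lambda>y. \<Sum>i\<in>UNIV. u y $ i * hgrad \<epsilon> i q y) x
     = (LINT w|lborel. (\<Sum>i\<in>UNIV. (LINT y|lborel. aD i y * bD (y, w)) * q w - (LINT y|lborel. aH i y * bH i (y, w)) * q w))"
    unfolding D H sum_subtractf[symmetric]
    by (subst Bochner_Integration.integral_sum)
      (auto intro!: Bochner_Integration.integrable_diff jD jH simp: Bochner_Integration.integral_diff[OF jD jH])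
  also have "\<dots> = (LINT w|lborel. (LINT y|lam. (g y * gk \<epsilon> (y - x)) * bD (y, w)) * q w)"
    unfolding left_diff_distrib[symmetric] sum_distrib_right[symmetric] inner by (simp add: bD_def)
  also have "\<dots> = (LINT y|lam. (g y * gk \<epsilon> (y - x)) * (LINT w|lborel. bD (y, w) * q w))"
  proof (rule kernel_comp(1)[OF lam sf _ qm gi bDb _ bdd_measD(2,3)[OF q], symmetric])
    show "bD \<in> borel_measurable (lam \<Otimes>\<^sub>M lborel)" unfolding bD_def by measurable
  qed simp
  also have "\<dots> = (LINT y|lam. (g y * gk \<epsilon> (y - x)) * heat \<epsilon> q y)"
    using eps by (simp add: bD_def heat_pos)
  finally show ?thesis by simp
qed

section \<open>Averages of the divergence along the diffusion\<close>

locale sde_div = sde_process M b B T Cw X W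
  for M :: "'w measure" and b :: "real \<Rightarrow> real ^ 'n::finite \<Rightarrow> real ^ 'n" and B T Cw :: real
    and X W :: "real \<Rightarrow> 'w \<Rightarrow> real ^ 'n" +
  fixes K0 :: real
  assumes K0_nonneg: "0 \<le> K0"
    and divergence: "\<And>t. t \<in> {0..T} \<Longrightarrow> \<exists>lam g. gauss_div (b t) K0 lam g"
begin

text \<open>The factor \<open>2 * _ + 1\<close> stems from \<open>bound_by_halving\<close>, the exponential from the weight in
  \<open>singular_kernel\<close>.\<close>

definition C_div :: real where
  "C_div = (2 * (K0 * (sqrt T + 1)) + 1) * exp (rate G * T)"

lemma C_div_nonneg: "0 \<le> C_div"
  unfolding C_div_def using K0_nonneg T_pos by simp

lemma inverse_sqrt_T: "0 < t \<Longrightarrow> t \<le> T \<Longrightarrow> 1 \<le> sqrt T * (1 / sqrt t)"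
  by (simp add: real_sqrt_le_mono le_divide_eq)

text \<open>Gaussian averages of the divergence, evaluated at \<open>X t\<close>, are \<open>O(1 / sqrt t)\<close> uniformly in the
  variance \<open>\<epsilon>\<close>. The heat flow only increases the variance, and by \<open>abs_hgrad_le_heat\<close> so does the
  gradient term in Duhamel's formula; hence the class of all variances above a given one is stable.\<close>

lemma expectation_gauss_div:
  assumes gd: "gauss_div u K0 lam g" and eps: "0 < \<epsilon>" and t: "0 < t" "t \<le> T"
  shows "expectation (\<lambda>\<omega>. LINT y|lam. \<bar>g y\<bar> * gk \<epsilon> (y - X t \<omega>)) \<le> C_div * (1 / sqrt t)"
proof -
  have lam: "sigma_finite_measure lam" and sl [measurable_cong]: "sets lam = sets borel" and gm [measurable]: "g \<in> borel_measurable borel"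
    and gK: "\<And>c s. 0 < s \<Longrightarrow> (\<integral>\<^sup>+y. ennreal (\<bar>g y\<bar> * gk s (y - c)) \<partial>lam) \<le> ennreal (K0 * (1 + 1 / sqrt s))"
    using gd by (auto simp: gauss_div_def)
  interpret lam: sigma_finite_measure lam by fact
  define \<Lambda> where "\<Lambda> \<epsilon> x = (LINT y|lam. \<bar>g y\<bar> * gk \<epsilon> (y - x))" for \<epsilon> x
  have \<Lambda>m [measurable]: "\<Lambda> \<epsilon> \<in> borel_measurable borel" for \<epsilon> unfolding \<Lambda>_def by measurable
  have \<Lambda>0: "0 \<le> \<Lambda> \<epsilon> x" for \<epsilon> x unfolding \<Lambda>_def by (intro integral_nonneg_AE) auto
  have \<Lambda>le: "\<Lambda> \<epsilon> x \<le> K0 * (1 + 1 / sqrt \<epsilon>)" if "0 < \<epsilon>" for \<epsilon> x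
    unfolding \<Lambda>_def using gK[OF that, of x] K0_nonneg that
    by (subst integral_eq_nn_integral) (auto intro!: enn2real_leI)
  have \<Lambda>b: "bdd_meas (K0 * (1 + 1 / sqrt \<epsilon>)) (\<Lambda> \<epsilon>)" if "0 < \<epsilon>" for \<epsilon>
    using \<Lambda>le[OF that] \<Lambda>0 by (auto simp: bdd_meas_def)
  have heat\<Lambda>: "heat \<tau> (\<Lambda> \<epsilon>) = \<Lambda> (\<epsilon> + \<tau>)" if e: "0 < \<epsilon>" and \<tau>: "0 < \<tau>" for \<epsilon> \<tau>
  proof
    fix x :: "real ^ 'n"
    define bk where "bk p = \<bar>g (snd p)\<bar> * gk \<epsilon> (snd p - fst p)" for p :: "(real ^ 'n) \<times> (real ^ 'n)"
    have bkm: "bk \<in> borel_measurable (lborel \<Otimes>\<^sub>M lam)" unfolding bk_def by measurable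
    have "heat \<tau> (\<Lambda> \<epsilon>) x = (LINT y|lborel. gk \<tau> (y - x) * (LINT w|lam. bk (y, w) * 1))"
      using \<tau> by (simp add: heat_pos \<Lambda>_def bk_def)
    also have "\<dots> = (LINT w|lam. (LINT y|lborel. gk \<tau> (y - x) * bk (y, w)) * 1)"
      by (rule kernel_comp(1)[OF lborel.sigma_finite_measure_axioms lam bkm _ integrable_gk[OF \<tau>], where C="K0 * (1 + 1 / sqrt \<epsilon>)" and K=1])
        (use gK[OF e] K0_nonneg e in \<open>auto simp: bk_def abs_mult\<close>)
    also have "\<dots> = (LINT w|lam. \<bar>g w\<bar> * (LINT y|lborel. gk \<tau> (y - x) * gk \<epsilon> (w - y)))"
      unfolding bk_def fst_conv snd_conv mult.left_commute[of _ "\<bar>g _\<bar>"] integral_mult_right_zero by simp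
    also have "\<dots> = \<Lambda> (\<epsilon> + \<tau>) x"
      by (simp add: integral_gk_gk[OF \<tau> e] \<Lambda>_def add.commute)
    finally show "heat \<tau> (\<Lambda> \<epsilon>) x = \<Lambda> (\<epsilon> + \<tau>) x" .
  qed
  define l where "l = rate G"
  have l: "0 < l" unfolding l_def by (rule rate_pos[OF G_nonneg])
  have ex: "1 \<le> exp (l * t)" if "0 \<le> t" for t using l that by simp
  define c where "c = K0 * (sqrt T + 1)"
  have c0: "0 \<le> c" using K0_nonneg T_pos by (simp add: c_def)
  define P where "P a \<longleftrightarrow> (\<forall>t e. 0 < t \<longrightarrow> t \<le> T \<longrightarrow> \<epsilon> \<le> e \<longrightarrow> expectation (\<lambda>\<omega>. \<Lambda> e (X t \<omega>)) \<le> a * (1 / sqrt t * exp (l * t)))" for a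
  have "P (2 * c + 1)"
  proof (rule bound_by_halving)
    show "P (K0 * (1 + 1 / sqrt \<epsilon>) * sqrt T)"
      unfolding P_def
    proof (intro allI impI)
      fix t e assume t: "0 < t" "t \<le> T" and e: "\<epsilon> \<le> e"
      have e0: "0 < e" using e eps by simp
      have "expectation (\<lambda>\<omega>. \<Lambda> e (X t \<omega>)) \<le> K0 * (1 + 1 / sqrt e)"
        using expectation_abs_le[OF bdd_measD(2)[OF \<Lambda>b[OF e0]]] by (simp add: abs_le_iff)
      also have "\<dots> \<le> K0 * (1 + 1 / sqrt \<epsilon>)" using e eps K0_nonneg by (intro mult_left_mono add_left_mono frac_le) auto
      also have "\<dots> \<le> K0 * (1 + 1 / sqrt \<epsilon>) * (sqrt T * (1 / sqrt t) * exp (l * t))"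
      proof -
        have "1 * 1 \<le> sqrt T * (1 / sqrt t) * exp (l * t)"
          using inverse_sqrt_T[OF t] ex[of t] t by (intro mult_mono) auto
        moreover have "0 \<le> K0 * (1 + 1 / sqrt \<epsilon>)" using K0_nonneg eps by simp
        ultimately have "K0 * (1 + 1 / sqrt \<epsilon>) * (1 * 1) \<le> K0 * (1 + 1 / sqrt \<epsilon>) * (sqrt T * (1 / sqrt t) * exp (l * t))"
          by (rule mult_left_mono)
        then show ?thesis by (simp only: mult_1_right)
      qed
      finally show "expectation (\<lambda>\<omega>. \<Lambda> e (X t \<omega>)) \<le> K0 * (1 + 1 / sqrt \<epsilon>) * sqrt T * (1 / sqrt t * exp (l * t))"
        by (simp add: mult_ac)
    qed
    show "0 \<le> K0 * (1 + 1 / sqrt \<epsilon>) * sqrt T" using K0_nonneg eps T_pos by simp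
    show "0 \<le> c" by (rule c0)
    show "P a'" if "P a" "a \<le> a'" for a a'
      unfolding P_def
    proof (intro allI impI)
      fix t e assume "0 < t" "t \<le> T" "\<epsilon> \<le> e"
      then have "expectation (\<lambda>\<omega>. \<Lambda> e (X t \<omega>)) \<le> a * (1 / sqrt t * exp (l * t))" using that by (simp add: P_def)
      also have "\<dots> \<le> a' * (1 / sqrt t * exp (l * t))" using that \<open>0 < t\<close> by (intro mult_right_mono) auto
      finally show "expectation (\<lambda>\<omega>. \<Lambda> e (X t \<omega>)) \<le> a' * (1 / sqrt t * exp (l * t))" .
    qed
    fix a assume a: "0 \<le> a" "P a"
    show "P (c + a / 2)"
      unfolding P_def
    proof (intro allI impI)
      fix t e assume t: "0 < t" "t \<le> T" and e: "\<epsilon> \<le> e"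
      have e0: "0 < e" using e eps by simp
      have "expectation (\<lambda>\<omega>. \<Lambda> e (X t \<omega>)) = expectation (\<lambda>\<omega>. heat t (\<Lambda> e) (X 0 \<omega>)) + (LINT r:{0..t}|lborel. J t (\<Lambda> e) r)"
        by (rule duhamel[OF t \<Lambda>b[OF e0]])
      moreover have "expectation (\<lambda>\<omega>. heat t (\<Lambda> e) (X 0 \<omega>)) \<le> c * (1 / sqrt t * exp (l * t))"
      proof -
        have "expectation (\<lambda>\<omega>. heat t (\<Lambda> e) (X 0 \<omega>)) \<le> K0 * (1 + 1 / sqrt (e + t))"
          unfolding heat\<Lambda>[OF e0 t(1)] using expectation_abs_le[OF bdd_measD(2)[OF \<Lambda>b[of "e + t"]]] e0 t by (simp add: abs_le_iff)
        also have "\<dots> \<le> K0 * (sqrt T * (1 / sqrt t) + 1 / sqrt t)"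
          using inverse_sqrt_T[OF t] e0 t K0_nonneg by (intro mult_left_mono add_mono frac_le) auto
        also have "\<dots> = c * (1 / sqrt t) * 1" by (simp add: c_def algebra_simps)
        also have "\<dots> \<le> c * (1 / sqrt t) * exp (l * t)" using ex[of t] t c0 by (intro mult_left_mono) auto
        finally show ?thesis by simp
      qed
      moreover have "(LINT r:{0..t}|lborel. J t (\<Lambda> e) r) \<le> a / 2 * (1 / sqrt t * exp (l * t))"
      proof -
        have "\<bar>LINT r:{0..t}|lborel. J t (\<Lambda> e) r\<bar> \<le> (LINT r:{0..t}|lborel. (a * G) * (1 / sqrt (t - r) * (1 / sqrt r * exp (l * r))))"
        proof (rule set_integral_bound_open)
          show "set_integrable lborel {0..t} (\<lambda>r. (a * G) * (1 / sqrt (t - r) * (1 / sqrt r * exp (l * r))))"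
            unfolding l_def by (intro set_integrable_mult_right singular_kernel(1)[OF t(1) G_nonneg])
          show "set_borel_measurable lborel {0..t} (J t (\<Lambda> e))"
            unfolding set_borel_measurable_def using J_measurable[OF \<Lambda>m] by measurable
          fix r assume r: "0 < r" "r < t"
          have tr: "0 < t - r" "0 < 2 * (t - r)" using r by auto
          have pt: "\<bar>drift_grad b r (t - r) (\<Lambda> e) x\<bar> \<le> G * (1 / sqrt (t - r)) * \<Lambda> (e + 2 * (t - r)) x" for x
          proof -
            have "\<bar>drift_grad b r (t - r) (\<Lambda> e) x\<bar> \<le> real CARD('n) * B * (dimc TYPE('n) / sqrt (t - r) * heat (2 * (t - r)) (\<lambda>y. \<bar>\<Lambda> e y\<bar>) x)"
              unfolding drift_grad_def by (intro sum_drift_le abs_hgrad_le_heat[OF tr(1) \<Lambda>b[OF e0]])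
            also have "heat (2 * (t - r)) (\<lambda>y. \<bar>\<Lambda> e y\<bar>) x = \<Lambda> (e + 2 * (t - r)) x"
              using heat\<Lambda>[OF e0 tr(2)] \<Lambda>0 by simp
            finally show ?thesis by (simp add: G_def mult_ac)
          qed
          have e2: "0 < e + 2 * (t - r)" using e0 r by simp
          have i: "integrable M (\<lambda>\<omega>. \<Lambda> (e + 2 * (t - r)) (X r \<omega>))"
            by (rule integrable_bdd[OF _ bdd_measD(2)[OF \<Lambda>b[OF e2]]]) measurable
          have "\<bar>J t (\<Lambda> e) r\<bar> \<le> expectation (\<lambda>\<omega>. G * (1 / sqrt (t - r)) * \<Lambda> (e + 2 * (t - r)) (X r \<omega>))"
            by (rule abs_integral_le[OF integrable_bdd[OF _ abs_drift_grad_le[OF less_imp_le[OF tr(1)] \<Lambda>b[OF e0]]] integrable_mult_right[OF i] pt]) measurable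
          also have "\<dots> = G * (1 / sqrt (t - r)) * expectation (\<lambda>\<omega>. \<Lambda> (e + 2 * (t - r)) (X r \<omega>))" by simp
          also have "\<dots> \<le> G * (1 / sqrt (t - r)) * (a * (1 / sqrt r * exp (l * r)))"
          proof (rule mult_left_mono)
            show "expectation (\<lambda>\<omega>. \<Lambda> (e + 2 * (t - r)) (X r \<omega>)) \<le> a * (1 / sqrt r * exp (l * r))"
              using a(2) r t e tr unfolding P_def by simp
          qed (use G_nonneg tr in auto)
          finally show "\<bar>J t (\<Lambda> e) r\<bar> \<le> (a * G) * (1 / sqrt (t - r) * (1 / sqrt r * exp (l * r)))" by (simp add: mult_ac)
        qed
        also have "\<dots> = a * (G * (LINT r:{0..t}|lborel. 1 / sqrt (t - r) * (1 / sqrt r * exp (l * r))))"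
          by (simp only: set_integral_mult_right mult.assoc)
        also have "\<dots> \<le> a * (1 / 2 * (1 / sqrt t * exp (l * t)))"
          unfolding l_def by (intro mult_left_mono singular_kernel(2)[OF t(1) G_nonneg] a)
        finally show ?thesis by simp
      qed
      ultimately show "expectation (\<lambda>\<omega>. \<Lambda> e (X t \<omega>)) \<le> (c + a / 2) * (1 / sqrt t * exp (l * t))"
        by (simp only: distrib_right)
    qed
  qed
  then have "expectation (\<lambda>\<omega>. \<Lambda> \<epsilon> (X t \<omega>)) \<le> (2 * c + 1) * (1 / sqrt t * exp (l * t))" using t by (simp add: P_def)
  also have "\<dots> \<le> (2 * c + 1) * (1 / sqrt t * exp (l * T))" using t l c0 by (intro mult_left_mono) auto
  finally show ?thesis unfolding \<Lambda>_def C_div_def c_def l_def by (simp add: mult_ac)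
qed

section \<open>The gradient along the drift in expectation\<close>

lemma drift_grad_scale:
  assumes "0 < \<tau>" "bdd_meas K q"
  shows "drift_grad b r \<tau> (\<lambda>x. a * q x) x = a * drift_grad b r \<tau> q x"
proof -
  have "bdd_meas 0 (\<lambda>_ :: real ^ 'n. 0)" by (simp add: bdd_meas_def)
  from hgrad_linear[OF assms this, of _ a 0] show ?thesis
    unfolding drift_grad_def by (simp add: sum_distrib_left mult_ac)
qed

lemma integral_inverse_sqrt_end:
  assumes "0 < e"
  shows "set_integrable lborel {t - e..t} (\<lambda>r. 1 / sqrt (t - r))" "(LINT r:{t - e..t}|lborel. 1 / sqrt (t - r)) = 2 * sqrt e"
proof -
  have *: "indicator {t - e..t} r *\<^sub>R (1 / sqrt (t - r)) = (\<lambda>s. indicator {0..e} s *\<^sub>R (1 / sqrt s)) (t + (-1) * r)" for r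
    by (auto simp: indicator_def)
  show "set_integrable lborel {t - e..t} (\<lambda>r. 1 / sqrt (t - r))"
    unfolding set_integrable_def *
    by (subst lborel_integrable_real_affine_iff) (use integral_inverse_sqrt_0(1)[OF assms] in \<open>auto simp: set_integrable_def\<close>)
  show "(LINT r:{t - e..t}|lborel. 1 / sqrt (t - r)) = 2 * sqrt e"
    using lborel_integral_real_affine[of "-1" "\<lambda>s. indicator {0..e} s *\<^sub>R (1 / sqrt s)" t] integral_inverse_sqrt_0(2)[OF assms]
    unfolding set_lebesgue_integral_def * by simp
qed

definition C_grad :: real where
  "C_grad = (2 * (sqrt 2 * G + sqrt 2 * C_div + 2 * G\<^sup>2 * sqrt T + G) + 1) * exp (rate (sqrt 2 * G) * T)"

lemma C_grad_nonneg: "0 \<le> C_grad"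
  unfolding C_grad_def using G_nonneg C_div_nonneg T_pos by (intro mult_nonneg_nonneg) auto

text \<open>The decisive estimate. Trivially \<open>b \<bullet> \<nabla> P q\<close> with \<open>P = heat \<epsilon>\<close> is of size \<open>1 / sqrt \<epsilon>\<close>; in
  expectation at time \<open>t\<close> it is only of size \<open>1 / sqrt t\<close>. The last piece \<open>[t - \<epsilon>, t]\<close> of Duhamel's formula
  contributes \<open>O(1)\<close>, because its integrand is \<open>O(1 / sqrt (\<epsilon> * (t - r)))\<close>, and leaves
  \<open>P (b \<bullet> \<nabla> P q)\<close> at time \<open>t - \<epsilon>\<close>. After integration by parts the term with the divergence is
  bounded by \<open>expectation_gauss_div\<close>, and Duhamel's formula for \<open>div P (b P q)\<close> reproduces expressions of the
  original form with a weakly singular kernel.\<close>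

theorem expectation_drift_grad_unit:
  assumes eps: "0 < \<epsilon>" and t: "0 < t" "t \<le> T" and q: "bdd_meas 1 q"
  shows "\<bar>expectation (\<lambda>\<omega>. drift_grad b t \<epsilon> q (X t \<omega>))\<bar> \<le> C_grad * (1 / sqrt t)"
proof -
  \<comment> \<open>the additional \<open>sqrt 2\<close> pays for \<open>1 / sqrt t' \<le> sqrt 2 / sqrt t\<close> below\<close>
  define l where "l = rate (sqrt 2 * G)"
  have G2: "0 \<le> sqrt 2 * G" using G_nonneg by simp
  have l: "0 < l" unfolding l_def by (rule rate_pos[OF G2])
  have ex: "1 \<le> exp (l * t)" if "0 \<le> t" for t using l that by simp
  define c where "c = sqrt 2 * G + sqrt 2 * C_div + 2 * G\<^sup>2 * sqrt T + G"
  have c0: "0 \<le> c" using G_nonneg C_div_nonneg T_pos by (simp add: c_def)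
  define P where "P a \<longleftrightarrow> (\<forall>t q. 0 < t \<longrightarrow> t \<le> T \<longrightarrow> bdd_meas 1 q \<longrightarrow>
    \<bar>expectation (\<lambda>\<omega>. drift_grad b t \<epsilon> q (X t \<omega>))\<bar> \<le> a * (1 / sqrt t * exp (l * t)))" for a
  have triv: "\<bar>expectation (\<lambda>\<omega>. drift_grad b t \<epsilon> q (X t \<omega>))\<bar> \<le> G * (1 / sqrt \<epsilon>)" if "bdd_meas 1 q" for t q
    using expectation_abs_le[OF abs_drift_grad_le[OF less_imp_le[OF eps] that]] by simp
  have "P (2 * c + 1)"
  proof (rule bound_by_halving)
    show "P (G * (1 / sqrt \<epsilon>) * sqrt T)"
      unfolding P_def
    proof (intro allI impI)
      fix t :: real and q :: "real ^ 'n \<Rightarrow> real" assume t: "0 < t" "t \<le> T" and q: "bdd_meas 1 q"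
      have "1 * 1 \<le> sqrt T * (1 / sqrt t) * exp (l * t)"
        using inverse_sqrt_T[OF t] ex[of t] t by (intro mult_mono) auto
      then have "G * (1 / sqrt \<epsilon>) * (1 * 1) \<le> G * (1 / sqrt \<epsilon>) * (sqrt T * (1 / sqrt t) * exp (l * t))"
        using G_nonneg eps by (intro mult_left_mono) auto
      with triv[OF q, of t] show "\<bar>expectation (\<lambda>\<omega>. drift_grad b t \<epsilon> q (X t \<omega>))\<bar> \<le> G * (1 / sqrt \<epsilon>) * sqrt T * (1 / sqrt t * exp (l * t))"
        by (simp only: mult_1_right mult.assoc)
    qed
    show "0 \<le> G * (1 / sqrt \<epsilon>) * sqrt T" using G_nonneg eps T_pos by simp
    show "0 \<le> c" by (rule c0)
    show "P a'" if "P a" "a \<le> a'" for a a'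
      unfolding P_def
    proof (intro allI impI)
      fix t :: real and q :: "real ^ 'n \<Rightarrow> real" assume t: "0 < t" "t \<le> T" "bdd_meas 1 q"
      then have "\<bar>expectation (\<lambda>\<omega>. drift_grad b t \<epsilon> q (X t \<omega>))\<bar> \<le> a * (1 / sqrt t * exp (l * t))" using that by (simp add: P_def)
      also have "\<dots> \<le> a' * (1 / sqrt t * exp (l * t))" using that \<open>0 < t\<close> by (intro mult_right_mono) auto
      finally show "\<bar>expectation (\<lambda>\<omega>. drift_grad b t \<epsilon> q (X t \<omega>))\<bar> \<le> a' * (1 / sqrt t * exp (l * t))" .
    qed
    fix a assume a: "0 \<le> a" "P a"
    show "P (c + a / 2)"
      unfolding P_def
    proof (intro allI impI)
      fix t :: real and q :: "real ^ 'n \<Rightarrow> real" assume t: "0 < t" "t \<le> T" and q: "bdd_meas 1 q"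
      have sT: "1 \<le> sqrt T * (1 / sqrt t)" by (rule inverse_sqrt_T[OF t])
      show "\<bar>expectation (\<lambda>\<omega>. drift_grad b t \<epsilon> q (X t \<omega>))\<bar> \<le> (c + a / 2) * (1 / sqrt t * exp (l * t))"
      proof (cases "t \<le> 2 * \<epsilon>")
        case True
        have "1 / sqrt \<epsilon> \<le> sqrt 2 * (1 / sqrt t)"
          using True t eps real_sqrt_le_mono[OF True] by (simp add: real_sqrt_mult field_simps)
        then have "G * (1 / sqrt \<epsilon>) \<le> G * (sqrt 2 * (1 / sqrt t))" using G_nonneg by (rule mult_left_mono)
        also have "\<dots> = (sqrt 2 * G) * (1 / sqrt t * 1)" by simp
        also have "\<dots> \<le> (c + a / 2) * (1 / sqrt t * exp (l * t))"
          using t ex[of t] a G_nonneg C_div_nonneg T_pos by (intro mult_mono) (auto simp: c_def)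
        finally show ?thesis using triv[OF q, of t] by linarith
      next
        case False
        define t' where "t' = t - \<epsilon>"
        have t': "0 < t'" "t' < t" "t' \<le> T" "t - t' = \<epsilon>" "t \<le> 2 * t'" using False eps t by (auto simp: t'_def)
        have st': "1 / sqrt t' \<le> sqrt 2 * (1 / sqrt t)"
          using real_sqrt_le_mono[OF t'(5)] t t' by (simp add: real_sqrt_mult field_simps)
        have tT: "t \<in> {0..T}" using t by simp
        obtain lam g where gd: "gauss_div (b t) K0 lam g" using divergence[OF tT] by blast
        have lam: "sigma_finite_measure lam" and sl [measurable_cong]: "sets lam = sets borel" and gm [measurable]: "g \<in> borel_measurable borel"
          and gK: "\<And>c s. 0 < s \<Longrightarrow> (\<integral>\<^sup>+y. ennreal (\<bar>g y\<bar> * gk s (y - c)) \<partial>lam) \<le> ennreal (K0 * (1 + 1 / sqrt s))"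
          using gd by (auto simp: gauss_div_def)
        interpret lam: sigma_finite_measure lam by fact
        note [measurable] = bdd_measD(1)[OF q]
        define \<psi> where "\<psi> = drift_grad b t \<epsilon> q"
        have \<psi>b: "bdd_meas (G * (1 / sqrt \<epsilon>)) \<psi>"
          using abs_drift_grad_le[OF less_imp_le[OF eps] q, of t] unfolding bdd_meas_def \<psi>_def by auto
        note [measurable] = bdd_measD(1)[OF \<psi>b]
        define F where "F i y = b t y $ i * heat \<epsilon> q y" for i y
        have Fb: "bdd_meas B (F i)" for i
        proof -
          have "\<bar>F i y\<bar> \<le> B * 1" for y
            unfolding F_def abs_mult using B_nonneg by (intro mult_mono b_bound abs_heat_le[OF less_imp_le[OF eps] q]) auto
          moreover have "F i \<in> borel_measurable borel" unfolding F_def by measurable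
          ultimately show ?thesis by (simp add: bdd_meas_def)
        qed
        define \<Psi> where "\<Psi> x = (\<Sum>i\<in>UNIV. hgrad \<epsilon> i (F i) x)" for x
        have sumF: "bdd_meas (G * (1 / sqrt \<tau>)) (\<lambda>x. \<Sum>i\<in>UNIV. hgrad \<tau> i (F i) x)" if "0 < \<tau>" for \<tau>
          unfolding bdd_meas_def
        proof (intro conjI allI)
          show "(\<lambda>x. \<Sum>i\<in>UNIV. hgrad \<tau> i (F i) x) \<in> borel_measurable borel"
            using bdd_measD(1)[OF Fb] by measurable
          fix x :: "real ^ 'n"
          have "\<bar>\<Sum>i\<in>UNIV. hgrad \<tau> i (F i) x\<bar> \<le> (\<Sum>i\<in>(UNIV :: 'n set). dimc TYPE('n) / sqrt \<tau> * B)"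
            by (rule order_trans[OF sum_abs sum_mono]) (rule abs_hgrad_le[OF that Fb])
          then show "\<bar>\<Sum>i\<in>UNIV. hgrad \<tau> i (F i) x\<bar> \<le> G * (1 / sqrt \<tau>)" by (simp add: G_def mult_ac)
        qed
        have \<Psi>b: "bdd_meas (G * (1 / sqrt \<epsilon>)) \<Psi>" unfolding \<Psi>_def by (rule sumF[OF eps])
        note [measurable] = bdd_measD(1)[OF \<Psi>b]
        define R where "R x = (LINT y|lam. (g y * gk \<epsilon> (y - x)) * heat \<epsilon> q y)" for x
        have Rm [measurable]: "R \<in> borel_measurable borel" unfolding R_def by measurable
        define \<Lambda> where "\<Lambda> x = (LINT y|lam. \<bar>g y\<bar> * gk \<epsilon> (y - x))" for x
        have \<Lambda>m [measurable]: "\<Lambda> \<in> borel_measurable borel" unfolding \<Lambda>_def by measurable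
        have \<Lambda>i: "integrable lam (\<lambda>y. \<bar>g y\<bar> * gk \<epsilon> (y - x))" for x
          using gK[OF eps, of x] by (intro integrableI_bounded) (auto simp: abs_mult intro: le_less_trans)
        have \<Lambda>le: "\<bar>\<Lambda> x\<bar> \<le> K0 * (1 + 1 / sqrt \<epsilon>)" for x
        proof -
          have "\<Lambda> x \<le> K0 * (1 + 1 / sqrt \<epsilon>)"
            unfolding \<Lambda>_def using gK[OF eps, of x] K0_nonneg eps
            by (subst integral_eq_nn_integral) (auto intro!: enn2real_leI)
          moreover have "0 \<le> \<Lambda> x" unfolding \<Lambda>_def by (intro integral_nonneg_AE) auto
          ultimately show ?thesis by simp
        qed
        have R\<Lambda>: "\<bar>R x\<bar> \<le> \<Lambda> x" for x
        proof -
          have le: "\<bar>(g y * gk \<epsilon> (y - x)) * heat \<epsilon> q y\<bar> \<le> \<bar>g y\<bar> * gk \<epsilon> (y - x)" for y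
            using mult_left_mono[OF abs_heat_le[OF less_imp_le[OF eps] q, of y], of "\<bar>g y\<bar> * gk \<epsilon> (y - x)"]
            by (simp add: abs_mult)
          show ?thesis unfolding R_def \<Lambda>_def
            by (rule abs_integral_le[OF Bochner_Integration.integrable_bound[OF \<Lambda>i[of x]] \<Lambda>i[of x] le]) (measurable, use le in \<open>simp\<close>)
        qed
        have parts: "heat \<epsilon> \<psi> x = \<Psi> x - R x" for x
          using heat_drift_by_parts[OF _ b_bound gd eps q, of x] unfolding \<psi>_def drift_grad_def \<Psi>_def F_def R_def by simp
        have i\<Psi>: "integrable M (\<lambda>\<omega>. \<Psi> (X t' \<omega>))" by (rule integrable_bdd[OF _ bdd_measD(2)[OF \<Psi>b]]) measurable
        have iR: "integrable M (\<lambda>\<omega>. R (X t' \<omega>))" by (rule integrable_bdd[OF _ order_trans[OF R\<Lambda> order_trans[OF abs_ge_self \<Lambda>le]]]) measurable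
        have i\<Lambda>: "integrable M (\<lambda>\<omega>. \<Lambda> (X t' \<omega>))" by (rule integrable_bdd[OF _ \<Lambda>le]) measurable
        \<comment> \<open>Duhamel's formula on the last piece\<close>
        have "expectation (\<lambda>\<omega>. \<psi> (X t \<omega>)) = expectation (\<lambda>\<omega>. heat \<epsilon> \<psi> (X t' \<omega>)) + (LINT r:{t'..t}|lborel. J t \<psi> r)"
        proof -
          have "(LINT r:{0..t}|lborel. J t \<psi> r) = (LINT r:{0..t'}|lborel. J t \<psi> r) + (LINT r:{t'..t}|lborel. J t \<psi> r)"
            by (rule set_integral_Icc_split[OF _ _ J_integrable[OF t(1) \<psi>b]]) (use t' in auto)
          then show ?thesis
            using duhamel[OF t \<psi>b] duhamel_before[OF t(2) less_imp_le[OF t'(1)] t'(2) \<psi>b] t'(4) by simp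
        qed
        then have split: "expectation (\<lambda>\<omega>. \<psi> (X t \<omega>)) = expectation (\<lambda>\<omega>. \<Psi> (X t' \<omega>)) - expectation (\<lambda>\<omega>. R (X t' \<omega>)) + (LINT r:{t'..t}|lborel. J t \<psi> r)"
          unfolding parts using i\<Psi> iR by simp
        have last: "\<bar>LINT r:{t'..t}|lborel. J t \<psi> r\<bar> \<le> 2 * G\<^sup>2"
        proof -
          have "\<bar>LINT r:{t'..t}|lborel. J t \<psi> r\<bar> \<le> (LINT r:{t'..t}|lborel. G * (G * (1 / sqrt \<epsilon>)) * (1 / sqrt (t - r)))"
          proof (rule set_integral_bound_open)
            show "set_integrable lborel {t'..t} (\<lambda>r. G * (G * (1 / sqrt \<epsilon>)) * (1 / sqrt (t - r)))"
              unfolding t'_def by (intro set_integrable_mult_right integral_inverse_sqrt_end eps)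
            show "set_borel_measurable lborel {t'..t} (J t \<psi>)"
              unfolding set_borel_measurable_def using J_measurable[OF bdd_measD(1)[OF \<psi>b]] by measurable
          qed (rule J_bound[OF _ \<psi>b], simp)
          also have "\<dots> = G * (G * (1 / sqrt \<epsilon>)) * (2 * sqrt \<epsilon>)"
            unfolding set_integral_mult_right t'_def integral_inverse_sqrt_end(2)[OF eps] ..
          also have "\<dots> = 2 * G\<^sup>2" using eps by (simp add: power2_eq_square)
          finally show ?thesis .
        qed
        have ER: "\<bar>expectation (\<lambda>\<omega>. R (X t' \<omega>))\<bar> \<le> C_div * (1 / sqrt t')"
        proof -
          have "\<bar>expectation (\<lambda>\<omega>. R (X t' \<omega>))\<bar> \<le> expectation (\<lambda>\<omega>. \<Lambda> (X t' \<omega>))"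
            by (rule abs_integral_le[OF iR i\<Lambda> R\<Lambda>])
          also have "\<dots> \<le> C_div * (1 / sqrt t')"
            unfolding \<Lambda>_def by (rule expectation_gauss_div[OF gd eps t'(1,3)])
          finally show ?thesis .
        qed
        have E\<Psi>: "\<bar>expectation (\<lambda>\<omega>. \<Psi> (X t' \<omega>))\<bar> \<le> G * (1 / sqrt t) + a / 2 * (1 / sqrt t * exp (l * t))"
        proof -
          have h: "heat t' \<Psi> x = (\<Sum>i\<in>UNIV. hgrad t i (F i) x)" for x
          proof -
            have "heat t' \<Psi> x = (\<Sum>i\<in>UNIV. heat t' (hgrad \<epsilon> i (F i)) x)"
              unfolding \<Psi>_def[abs_def] by (rule heat_sum[OF finite less_imp_le[OF t'(1)] bdd_meas_hgrad[OF eps Fb]])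
            also have "\<dots> = (\<Sum>i\<in>UNIV. hgrad t i (F i) x)"
              using heat_hgrad[OF less_imp_le[OF t'(1)] eps Fb] by (simp add: t'_def)
            finally show ?thesis .
          qed
          have 1: "\<bar>expectation (\<lambda>\<omega>. heat t' \<Psi> (X 0 \<omega>))\<bar> \<le> G * (1 / sqrt t)"
            unfolding h by (intro expectation_abs_le bdd_measD(2)[OF sumF[OF t(1)]])
          have "\<bar>LINT r:{0..t'}|lborel. J t' \<Psi> r\<bar> \<le> (LINT r:{0..t'}|lborel. (a * G) * (1 / sqrt (t' - r) * (1 / sqrt r * exp (l * r))))"
          proof (rule set_integral_bound_open)
            show "set_integrable lborel {0..t'} (\<lambda>r. (a * G) * (1 / sqrt (t' - r) * (1 / sqrt r * exp (l * r))))"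
              unfolding l_def by (intro set_integrable_mult_right singular_kernel(1)[OF t'(1) G2])
            show "set_borel_measurable lborel {0..t'} (J t' \<Psi>)"
              unfolding set_borel_measurable_def using J_measurable[OF bdd_measD(1)[OF \<Psi>b]] by measurable
            fix r assume r: "0 < r" "r < t'"
            have tr: "0 < t' - r" using r by simp
            define Q where "Q x = (\<Sum>i\<in>UNIV. hgrad (t' - r) i (F i) x)" for x
            have Qb: "bdd_meas (G * (1 / sqrt (t' - r))) Q" unfolding Q_def by (rule sumF[OF tr])
            \<comment> \<open>swapping the times of the two gradients restores \<epsilon> as the time of the outer one, so that the
              hypothesis on \<open>a\<close> applies with \<open>Q\<close> in place of \<open>q\<close>\<close>
            have dg: "drift_grad b r (t' - r) \<Psi> x = drift_grad b r \<epsilon> Q x" for x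
            proof -
              have "hgrad (t' - r) j \<Psi> x = hgrad \<epsilon> j Q x" for j
              proof -
                have "hgrad (t' - r) j \<Psi> x = (\<Sum>i\<in>UNIV. hgrad (t' - r) j (hgrad \<epsilon> i (F i)) x)"
                  unfolding \<Psi>_def[abs_def] by (rule hgrad_sum[OF finite tr bdd_meas_hgrad[OF eps Fb]])
                also have "\<dots> = (\<Sum>i\<in>UNIV. hgrad \<epsilon> j (hgrad (t' - r) i (F i)) x)"
                  by (rule sum.cong[OF refl]) (simp only: hgrad_hgrad_shift[OF tr eps eps tr add.commute Fb])
                also have "\<dots> = hgrad \<epsilon> j Q x"
                  unfolding Q_def[abs_def] by (rule hgrad_sum[OF finite eps bdd_meas_hgrad[OF tr Fb], symmetric])
                finally show ?thesis .
              qed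
              then show ?thesis unfolding drift_grad_def by simp
            qed
            define k where "k = G * (1 / sqrt (t' - r))"
            have k: "0 \<le> k" using G_nonneg tr by (simp add: k_def)
            have "\<bar>expectation (\<lambda>\<omega>. drift_grad b r \<epsilon> Q (X r \<omega>))\<bar> \<le> k * (a * (1 / sqrt r * exp (l * r)))"
            proof (cases "k = 0")
              case True
              then have "Q = (\<lambda>x. 0 * Q x)" using bdd_measD(2)[OF Qb] by (auto simp: k_def fun_eq_iff)
              then have "drift_grad b r \<epsilon> Q x = 0" for x using drift_grad_scale[OF eps Qb, of r 0 x] by simp
              then show ?thesis using True by simp
            next
              case False
              with k have k: "0 < k" by simp
              have b1: "bdd_meas 1 (\<lambda>x. (1 / k) * Q x)"
                using Qb k unfolding k_def[symmetric] by (auto simp: bdd_meas_def abs_mult)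
              have "drift_grad b r \<epsilon> Q x = k * drift_grad b r \<epsilon> (\<lambda>x. (1 / k) * Q x) x" for x
                using drift_grad_scale[OF eps Qb, of r "1 / k" x] k by simp
              then have "\<bar>expectation (\<lambda>\<omega>. drift_grad b r \<epsilon> Q (X r \<omega>))\<bar> = k * \<bar>expectation (\<lambda>\<omega>. drift_grad b r \<epsilon> (\<lambda>x. (1 / k) * Q x) (X r \<omega>))\<bar>"
                using k by (simp add: abs_mult)
              also have "\<dots> \<le> k * (a * (1 / sqrt r * exp (l * r)))"
                using a(2) b1 r t' k unfolding P_def by (intro mult_left_mono) auto
              finally show ?thesis .
            qed
            then show "\<bar>J t' \<Psi> r\<bar> \<le> (a * G) * (1 / sqrt (t' - r) * (1 / sqrt r * exp (l * r)))"
              unfolding dg k_def by (simp add: mult_ac)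
          qed
          also have "\<dots> = a * (1 / sqrt 2) * ((sqrt 2 * G) * (LINT r:{0..t'}|lborel. 1 / sqrt (t' - r) * (1 / sqrt r * exp (l * r))))"
          proof -
            have "a * G * L = a * (1 / sqrt 2) * ((sqrt 2 * G) * L)" for L by simp
            then show ?thesis unfolding set_integral_mult_right .
          qed
          also have "\<dots> \<le> a * (1 / sqrt 2) * (1 / 2 * (1 / sqrt t' * exp (l * t')))"
            unfolding l_def by (intro mult_left_mono singular_kernel(2)[OF t'(1) G2]) (use a in auto)
          also have "\<dots> \<le> a * (1 / sqrt 2) * (1 / 2 * (sqrt 2 * (1 / sqrt t) * exp (l * t)))"
            using a st' t' l by (intro mult_left_mono mult_mono) auto
          also have "\<dots> = a / 2 * (1 / sqrt t * exp (l * t))" by simp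
          finally show ?thesis using 1 unfolding duhamel[OF t'(1,3) \<Psi>b] by linarith
        qed
        have "\<bar>expectation (\<lambda>\<omega>. \<psi> (X t \<omega>))\<bar> \<le> (G * (1 / sqrt t) + a / 2 * (1 / sqrt t * exp (l * t))) + C_div * (1 / sqrt t') + 2 * G\<^sup>2"
          unfolding split using E\<Psi> ER last by linarith
        also have "\<dots> \<le> (G * (1 / sqrt t) + a / 2 * (1 / sqrt t * exp (l * t))) + C_div * (sqrt 2 * (1 / sqrt t)) + 2 * G\<^sup>2 * (sqrt T * (1 / sqrt t))"
        proof -
          have "2 * G\<^sup>2 * 1 \<le> 2 * G\<^sup>2 * (sqrt T * (1 / sqrt t))" by (intro mult_left_mono sT) auto
          then have "2 * G\<^sup>2 \<le> 2 * G\<^sup>2 * (sqrt T * (1 / sqrt t))" by (simp only: mult_1_right)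
          then show ?thesis by (intro add_mono[OF add_mono[OF order_refl]] mult_left_mono[OF st' C_div_nonneg])
        qed
        also have "\<dots> = (sqrt 2 * C_div + 2 * G\<^sup>2 * sqrt T + G) * (1 / sqrt t * 1) + a / 2 * (1 / sqrt t * exp (l * t))"
          by (simp add: algebra_simps add_divide_distrib)
        also have "\<dots> \<le> c * (1 / sqrt t * exp (l * t)) + a / 2 * (1 / sqrt t * exp (l * t))"
          using t ex[of t] G_nonneg C_div_nonneg T_pos by (intro add_right_mono mult_mono) (auto simp: c_def)
        finally show ?thesis unfolding \<psi>_def by (simp only: distrib_right)
      qed
    qed
  qed
  then have "\<bar>expectation (\<lambda>\<omega>. drift_grad b t \<epsilon> q (X t \<omega>))\<bar> \<le> (2 * c + 1) * (1 / sqrt t * exp (l * t))" using t q by (simp add: P_def)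
  also have "\<dots> \<le> (2 * c + 1) * (1 / sqrt t * exp (l * T))" using t l c0 by (intro mult_left_mono) auto
  finally show ?thesis unfolding C_grad_def c_def l_def by (simp add: mult_ac)
qed

corollary expectation_drift_grad:
  assumes eps: "0 < \<epsilon>" and t: "0 < t" "t \<le> T" and q: "bdd_meas K q"
  shows "\<bar>expectation (\<lambda>\<omega>. drift_grad b t \<epsilon> q (X t \<omega>))\<bar> \<le> C_grad * (1 / sqrt t) * K"
proof (cases "K = 0")
  case True
  then have "q = (\<lambda>x. 0 * q x)" using bdd_measD(2)[OF q] by (auto simp: fun_eq_iff)
  then have "drift_grad b t \<epsilon> q x = 0" for x using drift_grad_scale[OF eps q, of t 0 x] by simp
  then show ?thesis using True by simp
next
  case False
  with bdd_measD(3)[OF q] have K: "0 < K" by simp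
  have b1: "bdd_meas 1 (\<lambda>x. (1 / K) * q x)" using q K by (auto simp: bdd_meas_def abs_mult)
  have "drift_grad b t \<epsilon> q x = K * drift_grad b t \<epsilon> (\<lambda>x. (1 / K) * q x) x" for x
    using drift_grad_scale[OF eps q, of t "1 / K" x] K by simp
  then have "\<bar>expectation (\<lambda>\<omega>. drift_grad b t \<epsilon> q (X t \<omega>))\<bar> = K * \<bar>expectation (\<lambda>\<omega>. drift_grad b t \<epsilon> (\<lambda>x. (1 / K) * q x) (X t \<omega>))\<bar>"
    using K by (simp add: abs_mult)
  also have "\<dots> \<le> K * (C_grad * (1 / sqrt t))"
    using expectation_drift_grad_unit[OF eps t b1] K by (intro mult_left_mono) auto
  finally show ?thesis by (simp add: mult_ac)
qed

end

section \<open>Sums and integrals of weakly singular kernels\<close>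

lemma sum_inverse_sqrt_le: "(\<Sum>j\<in>{1..<Suc m}. 1 / sqrt (real j)) \<le> 2 * sqrt (real m)"
proof (induction m)
  case (Suc m)
  have "1 / sqrt (real (Suc m)) \<le> 2 * sqrt (real (Suc m)) - 2 * sqrt (real m)"
  proof -
    have "0 \<le> (sqrt (real (Suc m)) - sqrt (real m))\<^sup>2" by simp
    then have "2 * (sqrt (real (Suc m)) * sqrt (real m)) \<le> real (Suc m) + real m"
      by (simp add: power2_diff algebra_simps)
    then have "1 \<le> (2 * sqrt (real (Suc m)) - 2 * sqrt (real m)) * sqrt (real (Suc m))"
      by (simp add: algebra_simps)
    then show ?thesis by (simp add: divide_le_eq del: of_nat_Suc)
  qed
  then show ?case using Suc by simp
qed simp

lemma sum_inverse_le: "(\<Sum>j\<in>{1..<Suc m}. 1 / real j) \<le> 1 + ln (real (max 1 m))"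
proof (induction m)
  case (Suc m)
  show ?case
  proof (cases "m = 0")
    case False
    have "1 / real (Suc m) \<le> ln (real (Suc m)) - ln (real m)"
    proof -
      have "ln (real m / real (Suc m)) \<le> real m / real (Suc m) - 1"
        using False by (intro ln_le_minus_one) auto
      also have "\<dots> = - (1 / real (Suc m))" by (simp add: field_simps)
      finally show ?thesis using False by (simp add: ln_div)
    qed
    then show ?thesis using Suc False by (simp add: max_def split: if_splits)
  qed simp
qed simp

lemma sum_reflect: "(\<Sum>j\<in>{1..<n}. f (n - j)) = (\<Sum>j\<in>{1..<n}. f j)" for n :: nat and f :: "nat \<Rightarrow> real"
  by (rule sum.reindex_bij_witness[of _ "\<lambda>j. n - j" "\<lambda>j. n - j"]) auto

lemma sqrt_n_le:
  assumes "j \<in> {1..<n}"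
  shows "sqrt (real n) \<le> sqrt (real j) + sqrt (real (n - j))" "0 < real j" "0 < real (n - j)"
  using assms sqrt_add_le_add_sqrt[of "real j" "real (n - j)"] by (auto simp: of_nat_diff)

lemma sum_sqrt_sqrt:
  assumes n: "1 \<le> n"
  shows "(\<Sum>j\<in>{1..<n}. 1 / sqrt (real (n - j)) * (1 / sqrt (real j))) \<le> 4"
proof -
  obtain m where m: "n = Suc m" using n by (cases n) auto
  have s: "(\<Sum>j\<in>{1..<n}. 1 / sqrt (real j)) \<le> 2 * sqrt (real n)"
    using order_trans[OF sum_inverse_sqrt_le[of m], of "2 * sqrt (real n)"] m by simp
  have "sqrt (real n) * (\<Sum>j\<in>{1..<n}. 1 / sqrt (real (n - j)) * (1 / sqrt (real j))) \<le> (\<Sum>j\<in>{1..<n}. 1 / sqrt (real (n - j)) + 1 / sqrt (real j))"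
    unfolding sum_distrib_left
  proof (rule sum_mono)
    fix j assume j: "j \<in> {1..<n}"
    note p = sqrt_n_le[OF j]
    have "sqrt (real n) * (1 / sqrt (real (n - j)) * (1 / sqrt (real j))) \<le> (sqrt (real j) + sqrt (real (n - j))) * (1 / sqrt (real (n - j)) * (1 / sqrt (real j)))"
      using p by (intro mult_right_mono) auto
    also have "\<dots> = 1 / sqrt (real (n - j)) + 1 / sqrt (real j)" using p by (simp add: field_simps)
    finally show "sqrt (real n) * (1 / sqrt (real (n - j)) * (1 / sqrt (real j))) \<le> 1 / sqrt (real (n - j)) + 1 / sqrt (real j)" .
  qed
  also have "\<dots> = (\<Sum>j\<in>{1..<n}. 1 / sqrt (real j)) + (\<Sum>j\<in>{1..<n}. 1 / sqrt (real j))"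
    unfolding sum.distrib sum_reflect[of "\<lambda>j. 1 / sqrt (real j)"] ..
  also have "\<dots> \<le> sqrt (real n) * 4" using s by simp
  finally show ?thesis by (rule mult_left_le_imp_le) (use n in auto)
qed

lemma sum_sqrt_inverse:
  assumes n: "1 \<le> n"
  shows "(\<Sum>j\<in>{1..<n}. 1 / sqrt (real (n - j)) * (1 / real j)) \<le> 1 / sqrt (real n) * (5 + ln (real n))"
proof -
  obtain m where m: "n = Suc m" using n by (cases n) auto
  have "ln (real (max 1 m)) \<le> ln (real n)" using m by simp
  with sum_inverse_le[of m] have s: "(\<Sum>j\<in>{1..<n}. 1 / real j) \<le> 1 + ln (real n)" unfolding m by linarith
  have "sqrt (real n) * (\<Sum>j\<in>{1..<n}. 1 / sqrt (real (n - j)) * (1 / real j)) \<le> (\<Sum>j\<in>{1..<n}. 1 / sqrt (real (n - j)) * (1 / sqrt (real j)) + 1 / real j)"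
    unfolding sum_distrib_left
  proof (rule sum_mono)
    fix j assume j: "j \<in> {1..<n}"
    note p = sqrt_n_le[OF j]
    have "sqrt (real n) * (1 / sqrt (real (n - j)) * (1 / real j)) \<le> (sqrt (real j) + sqrt (real (n - j))) * (1 / sqrt (real (n - j)) * (1 / real j))"
      using p by (intro mult_right_mono) auto
    also have "\<dots> = 1 / sqrt (real (n - j)) * (sqrt (real j) / real j) + 1 / real j" using p by (simp add: field_simps)
    also have "sqrt (real j) / real j = 1 / sqrt (real j)" using p by (simp add: real_div_sqrt field_simps)
    finally show "sqrt (real n) * (1 / sqrt (real (n - j)) * (1 / real j)) \<le> 1 / sqrt (real (n - j)) * (1 / sqrt (real j)) + 1 / real j" .
  qed
  also have "\<dots> \<le> 5 + ln (real n)" unfolding sum.distrib using s sum_sqrt_sqrt[OF n] by simp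
  finally show ?thesis using n by (simp add: field_simps)
qed

lemma sum_inverse_reflect:
  assumes "1 \<le> n"
  shows "(\<Sum>j<n. 1 / real (n - j)) \<le> 1 + ln (real n)"
proof -
  have "(\<Sum>j<n. 1 / real (n - j)) = (\<Sum>j\<in>{1..<Suc n}. 1 / real j)"
    by (rule sum.reindex_bij_witness[of _ "\<lambda>j. n - j" "\<lambda>j. n - j"]) auto
  then show ?thesis using sum_inverse_le[of n] assms by (simp add: max_def)
qed

lemma integral_sqrt_sqrt:
  assumes s: "0 < s"
  shows "set_integrable lborel {0..s} (\<lambda>v. 1 / sqrt (s - v) * (1 / sqrt v))" "(LINT v:{0..s}|lborel. 1 / sqrt (s - v) * (1 / sqrt v)) \<le> 4"
proof -
  have i: "set_integrable lborel {0..s} (\<lambda>v. 1 / sqrt s * (1 / sqrt v + 1 / sqrt (s - v)))"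
    by (intro set_integrable_mult_right set_integral_add integral_inverse_sqrt_0 integral_inverse_sqrt_t s)
  have m: "set_borel_measurable lborel {0..s} (\<lambda>v. 1 / sqrt (s - v) * (1 / sqrt v))"
    unfolding set_borel_measurable_def by measurable
  have le: "\<bar>1 / sqrt (s - v) * (1 / sqrt v)\<bar> \<le> 1 / sqrt s * (1 / sqrt v + 1 / sqrt (s - v))" if "v \<in> {0..s}" for v
    using sqrt_kernel_split[OF s, of v] that by (simp add: abs_mult)
  show "set_integrable lborel {0..s} (\<lambda>v. 1 / sqrt (s - v) * (1 / sqrt v))" by (rule set_integral_bound(1)[OF i m le])
  have "(LINT v:{0..s}|lborel. 1 / sqrt (s - v) * (1 / sqrt v)) \<le> (LINT v:{0..s}|lborel. 1 / sqrt s * (1 / sqrt v + 1 / sqrt (s - v)))"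
    using set_integral_bound(2)[OF i m le] by simp
  also have "\<dots> = 1 / sqrt s * (2 * sqrt s + 2 * sqrt s)"
    unfolding set_integral_mult_right
    by (subst set_integral_add(2)[OF integral_inverse_sqrt_0(1)[OF s] integral_inverse_sqrt_t(1)[OF s]])
      (simp only: integral_inverse_sqrt_0(2)[OF s] integral_inverse_sqrt_t(2)[OF s])
  also have "\<dots> = 4" using s by simp
  finally show "(LINT v:{0..s}|lborel. 1 / sqrt (s - v) * (1 / sqrt v)) \<le> 4" .
qed

lemma integral_min_inverse:
  fixes h s :: real
  assumes h: "0 < h" "h \<le> s"
  shows "set_integrable lborel {0..s} (\<lambda>u. min 1 (h / u))" "(LINT u:{0..s}|lborel. min 1 (h / u)) \<le> h * (1 + ln (s / h))"
proof -
  show i: "set_integrable lborel {0..s} (\<lambda>u. min 1 (h / u))"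
    by (rule set_integral_bound(1)[OF set_integrable_const_Icc[of 0 s 1]])
      (use h in \<open>auto simp: set_borel_measurable_def abs_le_iff min_def intro: order_trans[of _ 0]\<close>)
  have "(LINT u:{0..s}|lborel. min 1 (h / u)) = (LINT u:{0..h}|lborel. min 1 (h / u)) + (LINT u:{h..s}|lborel. min 1 (h / u))"
    by (rule set_integral_Icc_split[OF _ _ i]) (use h in auto)
  moreover have "(LINT u:{0..h}|lborel. min 1 (h / u)) \<le> h"
  proof -
    have "\<bar>LINT u:{0..h}|lborel. min 1 (h / u)\<bar> \<le> (LINT u:{0..h}|lborel. 1)"
      by (rule set_integral_bound(2)[OF set_integrable_const_Icc])
        (use h in \<open>auto simp: set_borel_measurable_def abs_le_iff min_def intro: order_trans[of _ 0]\<close>)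
    then show ?thesis using h by (simp add: set_integral_const_Icc)
  qed
  moreover have "(LINT u:{h..s}|lborel. min 1 (h / u)) \<le> h * ln (s / h)"
  proof -
    have d: "((\<lambda>u. h * ln u) has_real_derivative h / u) (at u)" if "h \<le> u" for u
      using that h by (auto intro!: derivative_eq_intros)
    have v: "(LINT u|lborel. h / u * indicator {h..s} u) = h * ln s - h * ln h"
      by (rule integral_FTC_Icc_real[OF h(2) d]) (use h in \<open>auto intro!: continuous_intros\<close>)
    have "set_integrable lborel {h..s} (\<lambda>u. h / u)"
      by (rule borel_integrable_atLeastAtMost') (use h in \<open>auto intro!: continuous_intros\<close>)
    then have "\<bar>LINT u:{h..s}|lborel. min 1 (h / u)\<bar> \<le> (LINT u:{h..s}|lborel. h / u)"
      by (rule set_integral_bound(2)) (use h in \<open>auto simp: set_borel_measurable_def\<close>)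
    also have "\<dots> = h * ln (s / h)"
      using v h by (simp add: set_lebesgue_integral_def mult.commute ln_div right_diff_distrib)
    finally show ?thesis by simp
  qed
  ultimately show "(LINT u:{0..s}|lborel. min 1 (h / u)) \<le> h * (1 + ln (s / h))" by (simp add: algebra_simps)
qed

text \<open>Beyond \<open>h\<close> the kernel \<open>min 1 (h / u)\<close> decays like \<open>h / u\<close>, which produces the logarithm. The singularity at
  the other end is separated as in \<open>sqrt_kernel_split\<close>.\<close>

lemma integral_sqrt_min:
  fixes h s :: real
  assumes h: "0 < h" "h \<le> s"
  shows "set_integrable lborel {0..s} (\<lambda>v. 1 / sqrt v * min 1 (h / (s - v)))"
    and "(LINT v:{0..s}|lborel. 1 / sqrt v * min 1 (h / (s - v))) \<le> h * (5 + ln (s / h)) / sqrt s"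
proof -
  have s: "0 < s" using h by simp
  have m: "set_borel_measurable lborel {0..s} (\<lambda>v. 1 / sqrt v * min 1 (h / (s - v)))"
    unfolding set_borel_measurable_def by measurable
  have i1: "set_integrable lborel {0..s} (\<lambda>v. min 1 (h / (s - v)))" "(LINT v:{0..s}|lborel. min 1 (h / (s - v))) \<le> h * (1 + ln (s / h))"
    using integral_min_inverse[OF h] set_integral_reflect[of s "\<lambda>u. min 1 (h / u)"] by auto
  have i: "set_integrable lborel {0..s} (\<lambda>v. 1 / sqrt s * (min 1 (h / (s - v)) + h * (1 / sqrt (s - v) * (1 / sqrt v))))"
    by (intro set_integrable_mult_right set_integral_add i1 integral_sqrt_sqrt s)
  have le: "\<bar>1 / sqrt v * min 1 (h / (s - v))\<bar> \<le> 1 / sqrt s * (min 1 (h / (s - v)) + h * (1 / sqrt (s - v) * (1 / sqrt v)))"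
    if v: "v \<in> {0..s}" for v
  proof (cases "v = 0 \<or> v = s")
    case True
    then show ?thesis using h s by auto
  next
    case False
    then have v: "0 < v" "0 < s - v" using v by auto
    define q where "q = min 1 (h / (s - v))"
    have q: "0 \<le> q" "q \<le> h / (s - v)" using h v by (auto simp: q_def)
    have "sqrt s \<le> sqrt v + sqrt (s - v)" using sqrt_add_le_add_sqrt[of v "s - v"] v by simp
    then have "sqrt s * (1 / sqrt v * q) \<le> (sqrt v + sqrt (s - v)) * (1 / sqrt v * q)" using q v by (intro mult_right_mono) auto
    also have "\<dots> = q + sqrt (s - v) * (1 / sqrt v) * q" using v by (simp add: field_simps)
    also have "\<dots> \<le> q + sqrt (s - v) * (1 / sqrt v) * (h / (s - v))" using q v by (intro add_left_mono mult_left_mono) auto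
    also have "sqrt (s - v) * (1 / sqrt v) * (h / (s - v)) = h * (sqrt (s - v) / (s - v)) * (1 / sqrt v)" by (simp add: mult_ac)
    also have "sqrt (s - v) / (s - v) = 1 / sqrt (s - v)" using v by (simp add: field_simps)
    finally have "sqrt s * (1 / sqrt v * q) \<le> q + h * (1 / sqrt (s - v) * (1 / sqrt v))" by simp
    then have "1 / sqrt v * q \<le> 1 / sqrt s * (q + h * (1 / sqrt (s - v) * (1 / sqrt v)))" using s by (simp add: field_simps)
    moreover have "0 \<le> 1 / sqrt v * q" using v q by simp
    ultimately show ?thesis unfolding q_def by linarith
  qed
  show "set_integrable lborel {0..s} (\<lambda>v. 1 / sqrt v * min 1 (h / (s - v)))" by (rule set_integral_bound(1)[OF i m le])
  have "(LINT v:{0..s}|lborel. 1 / sqrt v * min 1 (h / (s - v))) \<le> (LINT v:{0..s}|lborel. 1 / sqrt s * (min 1 (h / (s - v)) + h * (1 / sqrt (s - v) * (1 / sqrt v))))"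
    using set_integral_bound(2)[OF i m le] by simp
  also have "\<dots> = 1 / sqrt s * ((LINT v:{0..s}|lborel. min 1 (h / (s - v))) + h * (LINT v:{0..s}|lborel. 1 / sqrt (s - v) * (1 / sqrt v)))"
    unfolding set_integral_mult_right
    by (subst set_integral_add(2)[OF i1(1) set_integrable_mult_right[OF integral_sqrt_sqrt(1)[OF s]]]) (simp only: set_integral_mult_right)
  also have "\<dots> \<le> 1 / sqrt s * (h * (1 + ln (s / h)) + h * 4)"
    using i1 integral_sqrt_sqrt(2)[OF s] h s by (intro mult_left_mono add_mono) auto
  also have "\<dots> = h * (5 + ln (s / h)) / sqrt s" by (simp add: algebra_simps add_divide_distrib)
  finally show "(LINT v:{0..s}|lborel. 1 / sqrt v * min 1 (h / (s - v))) \<le> h * (5 + ln (s / h)) / sqrt s" .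
qed

lemma set_integral_grid:
  fixes f :: "real \<Rightarrow> real"
  assumes h: "0 \<le> h" and f: "set_integrable lborel {0..real n * h} f"
  shows "(LINT x:{0..real n * h}|lborel. f x) = (\<Sum>j<n. LINT x:{real j * h..real (j + 1) * h}|lborel. f x)"
  using f
proof (induction n)
  case 0
  have "(LINT x:{0..0}|lborel. f x) = 0"
    unfolding set_lebesgue_integral_def by (rule integral_eq_zero_AE) (use AE_lborel_singleton[of "0::real"] in \<open>auto elim!: eventually_mono\<close>)
  then show ?case by simp
next
  case (Suc n)
  have le: "real n * h \<le> real (Suc n) * h" "0 \<le> real n * h" using h by (auto intro: mult_right_mono)
  have "set_integrable lborel {0..real n * h} f" by (rule set_integrable_subset[OF Suc.prems]) (use le in auto)
  from Suc.IH[OF this] set_integral_Icc_split[OF le(2,1) Suc.prems] show ?case by simp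
qed

section \<open>Regularity in time of the diffusion\<close>

context sde_div
begin

text \<open>The constant of \<open>heat_time_lipschitz\<close>.\<close>

definition C_heat_time :: real where
  "C_heat_time = 8 * real CARD('n) * real CARD('n) * (2 ^ CARD('n) * 2 ^ CARD('n))"

lemma C_heat_time_nonneg: "0 \<le> C_heat_time" by (simp add: C_heat_time_def)

definition C_grad_time :: real where "C_grad_time = C_grad * (2 + 2 * C_heat_time)"

lemma C_grad_time_nonneg: "0 \<le> C_grad_time"
  unfolding C_grad_time_def using C_grad_nonneg C_heat_time_nonneg by simp

text \<open>The difference of the two gradients is the gradient over the time \<open>\<tau> / 2\<close> of
  \<open>heat (\<tau> / 2 + \<sigma>) \<psi> - heat (\<tau> / 2) \<psi>\<close>, which is small by \<open>heat_time_lipschitz\<close>. The gradient then costs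
  nothing but \<open>1 / sqrt v\<close>, by \<open>expectation_drift_grad\<close>.\<close>

lemma expectation_drift_grad_time:
  assumes v: "0 < v" "v \<le> T" and \<tau>: "0 < \<tau>" and \<sigma>: "0 \<le> \<sigma>" "\<sigma> \<le> h" and \<psi>: "bdd_meas K \<psi>"
  shows "\<bar>expectation (\<lambda>\<omega>. drift_grad b v (\<tau> + \<sigma>) \<psi> (X v \<omega>)) - expectation (\<lambda>\<omega>. drift_grad b v \<tau> \<psi> (X v \<omega>))\<bar>
    \<le> C_grad_time * K * (1 / sqrt v * min 1 (h / \<tau>))"
proof -
  have t2: "0 < \<tau> / 2" using \<tau> by simp
  have K: "0 \<le> K" using bdd_measD(3)[OF \<psi>] .
  note [measurable] = bdd_measD(1)[OF \<psi>]
  have h1: "bdd_meas K (heat (\<tau> / 2 + \<sigma>) \<psi>)" "bdd_meas K (heat (\<tau> / 2) \<psi>)"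
    using \<tau> \<sigma> by (auto intro: bdd_meas_heat \<psi>)
  define q where "q x = 1 * heat (\<tau> / 2 + \<sigma>) \<psi> x + (-1) * heat (\<tau> / 2) \<psi> x" for x
  have qb: "bdd_meas ((2 + 2 * C_heat_time) * K * min 1 (h / \<tau>)) q"
    unfolding bdd_meas_def
  proof (intro conjI allI)
    show "q \<in> borel_measurable borel" unfolding q_def by measurable
    fix x
    have 1: "\<bar>q x\<bar> \<le> (2 + 2 * C_heat_time) * K * 1"
    proof -
      have "\<bar>q x\<bar> \<le> 2 * K" using bdd_measD(2)[OF h1(1), of x] bdd_measD(2)[OF h1(2), of x] by (simp add: q_def)
      also have "\<dots> \<le> (2 + 2 * C_heat_time) * K * 1" using K C_heat_time_nonneg by (simp add: distrib_right)
      finally show ?thesis .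
    qed
    have "\<bar>q x\<bar> \<le> \<sigma> / (\<tau> / 2) * (C_heat_time * K)"
      using heat_time_lipschitz[OF t2 \<sigma>(1) \<psi>, of x] by (simp add: q_def C_heat_time_def)
    also have "\<dots> \<le> h / (\<tau> / 2) * (C_heat_time * K)" using \<sigma> \<tau> K C_heat_time_nonneg by (intro mult_right_mono divide_right_mono) auto
    also have "\<dots> = 2 * C_heat_time * K * (h / \<tau>)" by simp
    also have "\<dots> \<le> (2 + 2 * C_heat_time) * K * (h / \<tau>)" using \<sigma> \<tau> K by (intro mult_right_mono) auto
    finally have 2: "\<bar>q x\<bar> \<le> (2 + 2 * C_heat_time) * K * (h / \<tau>)" .
    show "\<bar>q x\<bar> \<le> (2 + 2 * C_heat_time) * K * min 1 (h / \<tau>)" using 1 2 by (simp add: min_def)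
  qed
  have e: "drift_grad b v (\<tau> / 2) q x = drift_grad b v (\<tau> + \<sigma>) \<psi> x - drift_grad b v \<tau> \<psi> x" for x
  proof -
    have "hgrad (\<tau> / 2) i q x = hgrad (\<tau> + \<sigma>) i \<psi> x - hgrad \<tau> i \<psi> x" for i
    proof -
      have "hgrad (\<tau> / 2) i q x = 1 * hgrad (\<tau> / 2) i (heat (\<tau> / 2 + \<sigma>) \<psi>) x + (-1) * hgrad (\<tau> / 2) i (heat (\<tau> / 2) \<psi>) x"
        unfolding q_def[abs_def] by (rule hgrad_linear[OF t2 h1])
      also have "hgrad (\<tau> / 2) i (heat (\<tau> / 2 + \<sigma>) \<psi>) = hgrad (\<tau> + \<sigma>) i \<psi>"
        using \<tau> \<sigma> by (subst hgrad_heat[OF t2 _ \<psi>]) (auto simp: add.assoc[symmetric])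
      also have "hgrad (\<tau> / 2) i (heat (\<tau> / 2) \<psi>) = hgrad \<tau> i \<psi>"
        using \<tau> by (subst hgrad_heat[OF t2 _ \<psi>]) auto
      finally show ?thesis by simp
    qed
    then show ?thesis unfolding drift_grad_def by (simp add: right_diff_distrib sum_subtractf)
  qed
  have i: "integrable M (\<lambda>\<omega>. drift_grad b v \<tau>' \<psi> (X v \<omega>))" if "0 \<le> \<tau>'" for \<tau>'
    by (rule integrable_bdd[OF _ abs_drift_grad_le[OF that \<psi>]]) measurable
  have "\<bar>expectation (\<lambda>\<omega>. drift_grad b v (\<tau> / 2) q (X v \<omega>))\<bar> \<le> C_grad * (1 / sqrt v) * ((2 + 2 * C_heat_time) * K * min 1 (h / \<tau>))"
    by (rule expectation_drift_grad[OF t2 v qb])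
  then show ?thesis unfolding e using i[of "\<tau> + \<sigma>"] i[of \<tau>] \<tau> \<sigma> by (simp add: C_grad_time_def mult_ac)
qed

text \<open>Duhamel's formula is subtracted for the final times \<open>r\<close> and \<open>s\<close>. The initial terms differ by
  \<open>O(h / s)\<close>, the integral over \<open>{s..r}\<close> is \<open>O(h / sqrt s)\<close>, and on \<open>{0..s}\<close> the integrands are compared
  by \<open>expectation_drift_grad_time\<close>.\<close>

lemma expectation_time_regularity:
  assumes h: "0 < h" "h \<le> s" and r: "s < r" "r \<le> s + h" "r \<le> T" and \<psi>: "bdd_meas K \<psi>"
  shows "\<bar>expectation (\<lambda>\<omega>. \<psi> (X r \<omega>)) - expectation (\<lambda>\<omega>. \<psi> (X s \<omega>))\<bar>
    \<le> K * (C_heat_time * (h / s) + (C_grad + C_grad_time) * (h / sqrt s) * (5 + ln (s / h)))"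
proof -
  have s: "0 < s" "s \<le> T" and r0: "0 < r" using h r by auto
  have K: "0 \<le> K" using bdd_measD(3)[OF \<psi>] .
  note [measurable] = bdd_measD(1)[OF \<psi>]
  have ln0: "0 \<le> ln (s / h)" using h by simp
  have 1: "\<bar>expectation (\<lambda>\<omega>. heat r \<psi> (X 0 \<omega>)) - expectation (\<lambda>\<omega>. heat s \<psi> (X 0 \<omega>))\<bar> \<le> C_heat_time * (h / s) * K"
  proof -
    have i: "integrable M (\<lambda>\<omega>. heat r \<psi> (X 0 \<omega>))" "integrable M (\<lambda>\<omega>. heat s \<psi> (X 0 \<omega>))"
      by (rule integrable_bdd[OF _ abs_heat_le[OF less_imp_le[OF r0] \<psi>]], measurable) (rule integrable_bdd[OF _ abs_heat_le[OF less_imp_le[OF s(1)] \<psi>]], measurable)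
    have "\<bar>heat r \<psi> x - heat s \<psi> x\<bar> \<le> C_heat_time * (h / s) * K" for x
    proof -
      have "\<bar>heat (s + (r - s)) \<psi> x - heat s \<psi> x\<bar> \<le> (r - s) / s * (C_heat_time * K)"
        unfolding C_heat_time_def by (rule heat_time_lipschitz[OF s(1) _ \<psi>]) (use r in simp)
      also have "\<dots> \<le> h / s * (C_heat_time * K)" using r s K C_heat_time_nonneg by (intro mult_right_mono divide_right_mono) auto
      finally show ?thesis by (simp add: mult_ac)
    qed
    then have "\<bar>expectation (\<lambda>\<omega>. heat r \<psi> (X 0 \<omega>) - heat s \<psi> (X 0 \<omega>))\<bar> \<le> C_heat_time * (h / s) * K" by (rule expectation_abs_le)
    then show ?thesis using i by simp
  qed
  have 2: "\<bar>LINT v:{s..r}|lborel. J r \<psi> v\<bar> \<le> C_grad * (h / sqrt s) * K"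
  proof -
    have "\<bar>LINT v:{s..r}|lborel. J r \<psi> v\<bar> \<le> (LINT v:{s..r}|lborel. C_grad * (1 / sqrt s) * K)"
    proof (rule set_integral_bound_open[OF set_integrable_const_Icc])
      show "set_borel_measurable lborel {s..r} (J r \<psi>)"
        unfolding set_borel_measurable_def using J_measurable[OF bdd_measD(1)[OF \<psi>]] by measurable
      fix v assume v: "s < v" "v < r"
      have "\<bar>J r \<psi> v\<bar> \<le> C_grad * (1 / sqrt v) * K"
        by (rule expectation_drift_grad[OF _ _ _ \<psi>]) (use v r s in auto)
      also have "\<dots> \<le> C_grad * (1 / sqrt s) * K"
        using v s K C_grad_nonneg by (intro mult_right_mono mult_left_mono divide_left_mono real_sqrt_le_mono) auto
      finally show "\<bar>J r \<psi> v\<bar> \<le> C_grad * (1 / sqrt s) * K" .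
    qed
    also have "\<dots> = C_grad * (1 / sqrt s) * K * (r - s)" using r by (simp add: set_integral_const_Icc)
    also have "\<dots> \<le> C_grad * (1 / sqrt s) * K * h" using r s K C_grad_nonneg by (intro mult_left_mono) auto
    finally show ?thesis by (simp add: mult_ac)
  qed
  have Ji: "set_integrable lborel {0..s} (J r \<psi>)" "set_integrable lborel {0..s} (J s \<psi>)"
    by (rule J_integrable_sub[OF r0 \<psi>]; use r in simp) (rule J_integrable[OF s(1) \<psi>])
  have 3: "\<bar>(LINT v:{0..s}|lborel. J r \<psi> v) - (LINT v:{0..s}|lborel. J s \<psi> v)\<bar> \<le> C_grad_time * K * (h * (5 + ln (s / h)) / sqrt s)"
  proof -
    have "\<bar>LINT v:{0..s}|lborel. J r \<psi> v - J s \<psi> v\<bar> \<le> (LINT v:{0..s}|lborel. C_grad_time * K * (1 / sqrt v * min 1 (h / (s - v))))"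
    proof (rule set_integral_bound_open)
      show "set_integrable lborel {0..s} (\<lambda>v. C_grad_time * K * (1 / sqrt v * min 1 (h / (s - v))))"
        by (intro set_integrable_mult_right integral_sqrt_min h)
      show "set_borel_measurable lborel {0..s} (\<lambda>v. J r \<psi> v - J s \<psi> v)"
        using set_integral_diff(1)[OF Ji] by (auto simp: set_integrable_def set_borel_measurable_def)
      fix v assume v: "0 < v" "v < s"
      show "\<bar>J r \<psi> v - J s \<psi> v\<bar> \<le> C_grad_time * K * (1 / sqrt v * min 1 (h / (s - v)))"
        using expectation_drift_grad_time[of v "s - v" "r - s" h K \<psi>] v s r \<psi> by simp
    qed
    also have "\<dots> \<le> C_grad_time * K * (h * (5 + ln (s / h)) / sqrt s)"
      unfolding set_integral_mult_right using C_grad_time_nonneg K by (intro mult_left_mono integral_sqrt_min h) auto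
    finally show ?thesis using set_integral_diff(2)[OF Ji] by simp
  qed
  have "(LINT v:{0..r}|lborel. J r \<psi> v) = (LINT v:{0..s}|lborel. J r \<psi> v) + (LINT v:{s..r}|lborel. J r \<psi> v)"
    by (rule set_integral_Icc_split[OF _ _ J_integrable[OF r0 \<psi>]]) (use s r in auto)
  then have "\<bar>expectation (\<lambda>\<omega>. \<psi> (X r \<omega>)) - expectation (\<lambda>\<omega>. \<psi> (X s \<omega>))\<bar>
     \<le> C_heat_time * (h / s) * K + C_grad * (h / sqrt s) * K + C_grad_time * K * (h * (5 + ln (s / h)) / sqrt s)"
    unfolding duhamel[OF r0 r(3) \<psi>] duhamel[OF s \<psi>] using 1 2 3 by linarith
  also have "\<dots> \<le> C_heat_time * (h / s) * K + C_grad * (h / sqrt s) * K * (5 + ln (s / h)) + C_grad_time * K * (h * (5 + ln (s / h)) / sqrt s)"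
  proof -
    have "C_grad * (h / sqrt s) * K * 1 \<le> C_grad * (h / sqrt s) * K * (5 + ln (s / h))"
      using C_grad_nonneg h s K ln0 by (intro mult_left_mono) auto
    then show ?thesis by simp
  qed
  also have "\<dots> = K * (C_heat_time * (h / s) + (C_grad + C_grad_time) * (h / sqrt s) * (5 + ln (s / h)))"
    by (simp add: algebra_simps add_divide_distrib)
  finally show ?thesis .
qed

text \<open>The constant of \<open>heat_taylor\<close> for a displacement by \<open>h\<close> times the drift.\<close>

definition C_euler_step :: real where "C_euler_step = (real CARD('n) * B)\<^sup>2 * (2 * 2 ^ CARD('n))"

lemma C_euler_step_nonneg: "0 \<le> C_euler_step" by (simp add: C_euler_step_def)

text \<open>Collects all contributions to the error that do not involve earlier errors, see
  \<open>euler_error\<close>.\<close>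

definition C_consistency :: real where
  "C_consistency = C_grad_time * 5 + 3 * G + G * (C_heat_time * 5 + (C_grad + C_grad_time) * 20 * sqrt T) + C_euler_step * sqrt T"

definition C_euler :: real where
  "C_euler = (2 * C_consistency + 1) * exp (rate (sqrt 2 * G) * T)"

lemma C_consistency_nonneg: "0 \<le> C_consistency"
  unfolding C_consistency_def using C_grad_time_nonneg G_nonneg C_heat_time_nonneg C_grad_nonneg C_euler_step_nonneg T_pos by simp

end

section \<open>Comparison with the Euler scheme\<close>

text \<open>Of the scheme only the one-step law enters: displacement by the drift at a uniformly distributed
  time, followed by a step of the heat flow.\<close>

locale euler_scheme = sde_div M b B T Cw X W K0
  for M :: "'w measure" and b :: "real \<Rightarrow> real ^ 'n::finite \<Rightarrow> real ^ 'n" and B T Cw :: real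
    and X W :: "real \<Rightarrow> 'w \<Rightarrow> real ^ 'n" and K0 :: real +
  fixes h :: real and N :: nat and Y :: "nat \<Rightarrow> 'w \<Rightarrow> real ^ 'n"
  assumes h_pos: "0 < h" and N_le: "real N * h \<le> T"
    and Y_meas: "\<And>k. k \<le> N \<Longrightarrow> Y k \<in> borel_measurable M"
    and Y_init: "\<And>K f. bdd_meas K f \<Longrightarrow> expectation (\<lambda>\<omega>. f (Y 0 \<omega>)) = expectation (\<lambda>\<omega>. f (X 0 \<omega>))"
    and Y_step: "\<And>j K f. j < N \<Longrightarrow> bdd_meas K f \<Longrightarrow> expectation (\<lambda>\<omega>. f (Y (Suc j) \<omega>))
      = (1 / h) * (LINT r:{real j * h..real (j + 1) * h}|lborel. expectation (\<lambda>\<omega>. heat h f (Y j \<omega> + h *\<^sub>R b r (Y j \<omega>))))"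
begin

text \<open>One step of the scheme: the Brownian increment is again absorbed by the heat flow, and the drift
  enters to first order, frozen in space but averaged in time.\<close>

lemma euler_local:
  assumes j: "j < n" "n \<le> N" and \<phi>: "bdd_meas 1 \<phi>"
  defines "t \<equiv> real n * h"
  shows "\<bar>(expectation (\<lambda>\<omega>. heat (t - real (Suc j) * h) \<phi> (Y (Suc j) \<omega>)) - expectation (\<lambda>\<omega>. heat (t - real j * h) \<phi> (Y j \<omega>)))
      - (LINT r:{real j * h..real (j + 1) * h}|lborel. expectation (\<lambda>\<omega>. drift_grad b r (t - real j * h) \<phi> (Y j \<omega>)))\<bar>
    \<le> C_euler_step * h * (1 / real (n - j))"
proof -
  have [measurable]: "Y j \<in> borel_measurable M" using Y_meas j by simp
  note [measurable] = bdd_measD(1)[OF \<phi>]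
  define \<tau> where "\<tau> = t - real j * h"
  have \<tau>: "\<tau> = real (n - j) * h" using j by (simp add: \<tau>_def t_def of_nat_diff algebra_simps)
  have \<tau>0: "0 < \<tau>" unfolding \<tau> using j h_pos by simp
  have \<tau>h: "0 \<le> t - real (Suc j) * h"
  proof -
    have "real (Suc j) * h \<le> real n * h" using j h_pos by (intro mult_right_mono) auto
    then show ?thesis by (simp add: t_def)
  qed
  let ?I = "{real j * h..real (j + 1) * h}"
  have len: "real (j + 1) * h - real j * h = h" "real j * h \<le> real (j + 1) * h" using h_pos by (auto simp: algebra_simps)
  define u where "u = heat \<tau> \<phi>"
  have ub: "bdd_meas 1 u" unfolding u_def using \<tau>0 by (intro bdd_meas_heat \<phi>) simp
  note [measurable] = bdd_measD(1)[OF ub]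
  have st: "expectation (\<lambda>\<omega>. heat (t - real (Suc j) * h) \<phi> (Y (Suc j) \<omega>)) = (1 / h) * (LINT r:?I|lborel. expectation (\<lambda>\<omega>. u (Y j \<omega> + h *\<^sub>R b r (Y j \<omega>))))"
  proof -
    have "heat h (heat (t - real (Suc j) * h) \<phi>) = u"
      unfolding u_def using h_pos \<tau>h by (subst heat_heat[OF _ _ \<phi>]) (auto simp: \<tau>_def algebra_simps)
    then show ?thesis using Y_step[of j 1 "heat (t - real (Suc j) * h) \<phi>"] j bdd_meas_heat[OF \<tau>h \<phi>] by simp
  qed
  define JY where "JY r = expectation (\<lambda>\<omega>. drift_grad b r \<tau> \<phi> (Y j \<omega>))" for r
  define E1 where "E1 r = expectation (\<lambda>\<omega>. u (Y j \<omega> + h *\<^sub>R b r (Y j \<omega>)))" for r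
  define E0 where "E0 = expectation (\<lambda>\<omega>. u (Y j \<omega>))"
  have i1: "integrable M (\<lambda>\<omega>. u (Y j \<omega> + h *\<^sub>R b r (Y j \<omega>)))" for r
    by (rule integrable_bdd[OF _ bdd_measD(2)[OF ub]]) measurable
  have i0: "integrable M (\<lambda>\<omega>. u (Y j \<omega>))" by (rule integrable_bdd[OF _ bdd_measD(2)[OF ub]]) measurable
  have iJ: "integrable M (\<lambda>\<omega>. drift_grad b r \<tau> \<phi> (Y j \<omega>))" for r
    by (rule integrable_bdd[OF _ abs_drift_grad_le[OF less_imp_le[OF \<tau>0] \<phi>]]) measurable
  have pt: "\<bar>E1 r - E0 - h * JY r\<bar> \<le> h\<^sup>2 * (C_euler_step / \<tau>)" for r
  proof -
    have "\<bar>u (y + h *\<^sub>R b r y) - u y - h * drift_grad b r \<tau> \<phi> y\<bar> \<le> h\<^sup>2 * (C_euler_step / \<tau>)" for y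
    proof -
      have "\<bar>u (y + h *\<^sub>R b r y) - u y - (\<Sum>i\<in>UNIV. (h *\<^sub>R b r y) $ i * hgrad \<tau> i \<phi> y)\<bar> \<le> (nrm1 (h *\<^sub>R b r y))\<^sup>2 * (2 * 2 ^ CARD('n) / \<tau> * 1)"
        unfolding u_def by (rule heat_taylor[OF \<tau>0 \<phi>])
      also have "(\<Sum>i\<in>UNIV. (h *\<^sub>R b r y) $ i * hgrad \<tau> i \<phi> y) = h * drift_grad b r \<tau> \<phi> y"
        unfolding drift_grad_def by (simp add: sum_distrib_left mult_ac)
      also have "(nrm1 (h *\<^sub>R b r y))\<^sup>2 * (2 * 2 ^ CARD('n) / \<tau> * 1) \<le> (h * (real CARD('n) * B))\<^sup>2 * (2 * 2 ^ CARD('n) / \<tau> * 1)"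
      proof (intro mult_right_mono power_mono)
        have "nrm1 (h *\<^sub>R b r y) \<le> (\<Sum>i\<in>(UNIV :: 'n set). h * B)"
          using h_pos b_bound by (intro sum_mono) (auto simp: abs_mult)
        then show "nrm1 (h *\<^sub>R b r y) \<le> h * (real CARD('n) * B)" by (simp add: mult_ac)
      qed (use \<tau>0 in \<open>auto intro: sum_nonneg\<close>)
      also have "\<dots> = h\<^sup>2 * (C_euler_step / \<tau>)" by (simp add: C_euler_step_def power_mult_distrib)
      finally show ?thesis .
    qed
    then have "\<bar>expectation (\<lambda>\<omega>. u (Y j \<omega> + h *\<^sub>R b r (Y j \<omega>)) - u (Y j \<omega>) - h * drift_grad b r \<tau> \<phi> (Y j \<omega>))\<bar> \<le> h\<^sup>2 * (C_euler_step / \<tau>)"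
      by (rule expectation_abs_le)
    then show ?thesis unfolding E1_def E0_def JY_def using i1 i0 iJ by simp
  qed
  have E1m [measurable]: "E1 \<in> borel_measurable borel" unfolding E1_def by measurable
  have JYm [measurable]: "JY \<in> borel_measurable borel" unfolding JY_def by measurable
  have sE: "set_integrable lborel ?I E1"
    by (rule set_integral_bound(1)[OF set_integrable_const_Icc[of _ _ 1]])
      (use expectation_abs_le[OF bdd_measD(2)[OF ub]] in \<open>auto simp: set_borel_measurable_def E1_def\<close>)
  have sJ: "set_integrable lborel ?I JY"
    by (rule set_integral_bound(1)[OF set_integrable_const_Icc[of _ _ "G * 1 * (1 / sqrt \<tau>)"]])
      (use expectation_abs_le[OF abs_drift_grad_le[OF less_imp_le[OF \<tau>0] \<phi>]] in \<open>auto simp: set_borel_measurable_def JY_def\<close>)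
  have "(LINT r:?I|lborel. (1 / h) * (E1 r - E0 - h * JY r)) = (1 / h) * (LINT r:?I|lborel. E1 r) - E0 - (LINT r:?I|lborel. JY r)"
  proof -
    have "(LINT r:?I|lborel. E1 r - E0 - h * JY r) = (LINT r:?I|lborel. E1 r) - E0 * h - h * (LINT r:?I|lborel. JY r)"
      using sE sJ len set_integrable_const_Icc[of "real j * h" "real (j + 1) * h" E0]
      by (simp add: set_integral_diff set_integral_const_Icc)
    then show ?thesis unfolding set_integral_mult_right using h_pos by (simp add: field_simps)
  qed
  then have "\<bar>(expectation (\<lambda>\<omega>. heat (t - real (Suc j) * h) \<phi> (Y (Suc j) \<omega>)) - E0) - (LINT r:?I|lborel. JY r)\<bar> = \<bar>LINT r:?I|lborel. (1 / h) * (E1 r - E0 - h * JY r)\<bar>"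
    unfolding st E1_def[symmetric] by simp
  also have "\<dots> \<le> (LINT r:?I|lborel. h * (C_euler_step / \<tau>))"
  proof (rule set_integral_bound(2)[OF set_integrable_const_Icc])
    show "set_borel_measurable lborel ?I (\<lambda>r. (1 / h) * (E1 r - E0 - h * JY r))"
      unfolding set_borel_measurable_def by measurable
    show "\<bar>(1 / h) * (E1 r - E0 - h * JY r)\<bar> \<le> h * (C_euler_step / \<tau>)" for r
    proof -
      have "\<bar>(1 / h) * (E1 r - E0 - h * JY r)\<bar> = (1 / h) * \<bar>E1 r - E0 - h * JY r\<bar>"
        unfolding abs_mult using h_pos by simp
      also have "\<dots> \<le> (1 / h) * (h\<^sup>2 * (C_euler_step / \<tau>))"
        using h_pos pt[of r] by (intro mult_left_mono) auto
      finally show ?thesis using h_pos by (simp add: power2_eq_square)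
    qed
  qed
  also have "\<dots> = h * (C_euler_step / \<tau>) * h" using set_integral_const_Icc[OF len(2), of "h * (C_euler_step / \<tau>)"] len(1) by simp
  also have "\<dots> = C_euler_step * h * (1 / real (n - j))" unfolding \<tau> using h_pos by (simp add: field_simps)
  finally show ?thesis unfolding JY_def E0_def u_def \<tau>_def .
qed

text \<open>The error over \<open>n\<close> steps is the sum over the intervals of the difference of the integrand of Duhamel's
  formula and its counterpart for the scheme, plus the remainders of \<open>euler_local\<close>. Each difference is split
  into a difference of gradients (\<open>A\<close>), the regularity in time of the diffusion (\<open>reg\<close>) and an earlier error
  (\<open>dk\<close>). The recursion for the errors is solved by \<open>bound_by_halving\<close>, starting from the trivial bound 2;
  written in the weighted form this bound depends on the step size, the final one does not.\<close>

theorem euler_error: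
  assumes n: "1 \<le> n" "n \<le> N" and \<phi>: "bdd_meas 1 \<phi>"
  shows "\<bar>expectation (\<lambda>\<omega>. \<phi> (X (real n * h) \<omega>)) - expectation (\<lambda>\<omega>. \<phi> (Y n \<omega>))\<bar>
    \<le> C_euler * (1 / sqrt (real n * h)) * (1 + ln (real n)) * h"
proof -
  define l where "l = rate (sqrt 2 * G)"
  have G2: "0 \<le> sqrt 2 * G" using G_nonneg by simp
  have l: "0 < l" unfolding l_def by (rule rate_pos[OF G2])
  have ex: "1 \<le> exp (l * t)" if "0 \<le> t" for t using l that by simp
  define err where "err \<phi> k = \<bar>expectation (\<lambda>\<omega>. \<phi> (X (real k * h) \<omega>)) - expectation (\<lambda>\<omega>. \<phi> (Y k \<omega>))\<bar>" for \<phi> :: "real ^ 'n \<Rightarrow> real" and k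
  have kT: "0 < real k * h" "real k * h \<le> T" if "1 \<le> k" "k \<le> N" for k
    using that h_pos N_le order_trans[OF mult_right_mono[of "real k" "real N" h] N_le] by auto
  have ln1: "1 \<le> 1 + ln (real k)" if "1 \<le> k" for k :: nat using that by simp
  define P where "P a \<longleftrightarrow> (\<forall>k \<phi>. 1 \<le> k \<longrightarrow> k \<le> N \<longrightarrow> bdd_meas 1 \<phi> \<longrightarrow>
    err \<phi> k \<le> a * ((1 + ln (real k)) * h * (1 / sqrt (real k * h) * exp (l * (real k * h)))))" for a
  have "P (2 * C_consistency + 1)"
  proof (rule bound_by_halving)
    show "P (2 * sqrt T / h)"
      unfolding P_def
    proof (intro allI impI)
      fix k and \<phi> :: "real ^ 'n \<Rightarrow> real" assume k: "1 \<le> k" "k \<le> N" and \<phi>: "bdd_meas 1 \<phi>"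
      have "err \<phi> k \<le> 2"
        using expectation_abs_le[OF bdd_measD(2)[OF \<phi>], of "X (real k * h)"] expectation_abs_le[OF bdd_measD(2)[OF \<phi>], of "Y k"]
        unfolding err_def by linarith
      also have "\<dots> \<le> 2 * ((1 + ln (real k)) * ((sqrt T * (1 / sqrt (real k * h))) * exp (l * (real k * h))))"
      proof -
        have "1 * (1 * 1) \<le> (1 + ln (real k)) * ((sqrt T * (1 / sqrt (real k * h))) * exp (l * (real k * h)))"
          using ln1[OF k(1)] inverse_sqrt_T[OF kT[OF k]] ex[of "real k * h"] kT[OF k] by (intro mult_mono) auto
        then show ?thesis by simp
      qed
      also have "\<dots> = 2 * sqrt T / h * ((1 + ln (real k)) * h * (1 / sqrt (real k * h) * exp (l * (real k * h))))"
        using h_pos by simp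
      finally show "err \<phi> k \<le> 2 * sqrt T / h * ((1 + ln (real k)) * h * (1 / sqrt (real k * h) * exp (l * (real k * h))))" .
    qed
    show "0 \<le> 2 * sqrt T / h" using h_pos T_pos by simp
    show "0 \<le> C_consistency" by (rule C_consistency_nonneg)
    show "P a'" if "P a" "a \<le> a'" for a a'
      unfolding P_def
    proof (intro allI impI)
      fix k and \<phi> :: "real ^ 'n \<Rightarrow> real" assume k: "1 \<le> k" "k \<le> N" "bdd_meas 1 \<phi>"
      then have "err \<phi> k \<le> a * ((1 + ln (real k)) * h * (1 / sqrt (real k * h) * exp (l * (real k * h))))" using that by (simp add: P_def)
      also have "\<dots> \<le> a' * ((1 + ln (real k)) * h * (1 / sqrt (real k * h) * exp (l * (real k * h))))"
        using that h_pos ln1[OF k(1)] by (intro mult_right_mono) auto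
      finally show "err \<phi> k \<le> a' * ((1 + ln (real k)) * h * (1 / sqrt (real k * h) * exp (l * (real k * h))))" .
    qed
    fix a assume a: "0 \<le> a" "P a"
    show "P (C_consistency + a / 2)"
      unfolding P_def
    proof (intro allI impI)
      fix n and \<phi> :: "real ^ 'n \<Rightarrow> real" assume n: "1 \<le> n" "n \<le> N" and \<phi>: "bdd_meas 1 \<phi>"
      define t where "t = real n * h"
      have t: "0 < t" "t \<le> T" using kT[OF n] by (auto simp: t_def)
      have ht: "h \<le> t" using n h_pos by (simp add: t_def)
      have tn: "t / h = real n" using h_pos by (simp add: t_def)
      have sT: "1 \<le> sqrt T * (1 / sqrt t)" by (rule inverse_sqrt_T[OF t])
      define \<L> where "\<L> = 1 + ln (real n)"
      have \<L>: "1 \<le> \<L>" unfolding \<L>_def by (rule ln1[OF n(1)])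
      note [measurable] = bdd_measD(1)[OF \<phi>]
      let ?I = "\<lambda>j. {real j * h..real (j + 1) * h}"
      define JY where "JY j r = expectation (\<lambda>\<omega>. drift_grad b r (t - real j * h) \<phi> (Y j \<omega>))" for j r
      define g where "g j = expectation (\<lambda>\<omega>. heat (t - real j * h) \<phi> (Y j \<omega>))" for j
      have \<tau>: "t - real j * h = real (n - j) * h" "0 < t - real j * h" if "j < n" for j
        using that h_pos by (auto simp: t_def of_nat_diff algebra_simps)
      have JYm: "JY j \<in> borel_measurable borel" if "j < n" for j
      proof -
        have [measurable]: "Y j \<in> borel_measurable M" using Y_meas that n by simp
        show ?thesis unfolding JY_def by measurable
      qed
      have JYi: "set_integrable lborel (?I j) (JY j)" if j: "j < n" for j
      proof (rule set_integral_bound(1)[OF set_integrable_const_Icc])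
        show "set_borel_measurable lborel (?I j) (JY j)"
          unfolding set_borel_measurable_def using JYm[OF j] by measurable
        show "\<bar>JY j r\<bar> \<le> G * 1 * (1 / sqrt (t - real j * h))" for r
          unfolding JY_def by (intro expectation_abs_le abs_drift_grad_le[OF less_imp_le[OF \<tau>(2)[OF j]] \<phi>])
      qed
      have sub: "?I j \<subseteq> {0..t}" if "j < n" for j
      proof -
        have "real (j + 1) * h \<le> real n * h" using that h_pos by (intro mult_right_mono) auto
        then show ?thesis using h_pos by (auto simp: t_def intro: order_trans[of 0 "real j * h"])
      qed
      have Ji: "set_integrable lborel (?I j) (J t \<phi>)" if "j < n" for j
        by (rule set_integrable_subset[OF J_integrable[OF t(1) \<phi>] _ sub[OF that]]) simp
      have EX: "expectation (\<lambda>\<omega>. \<phi> (X t \<omega>)) = g 0 + (\<Sum>j<n. LINT r:?I j|lborel. J t \<phi> r)"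
      proof -
        have "(LINT r:{0..t}|lborel. J t \<phi> r) = (\<Sum>j<n. LINT r:?I j|lborel. J t \<phi> r)"
          unfolding t_def by (rule set_integral_grid) (use h_pos J_integrable[OF t(1) \<phi>] in \<open>auto simp: t_def\<close>)
        moreover have "expectation (\<lambda>\<omega>. heat t \<phi> (X 0 \<omega>)) = g 0"
          unfolding g_def using Y_init[OF bdd_meas_heat[OF less_imp_le[OF t(1)] \<phi>]] by simp
        ultimately show ?thesis using duhamel[OF t \<phi>] by simp
      qed
      have EY: "expectation (\<lambda>\<omega>. \<phi> (Y n \<omega>)) = g 0 + (\<Sum>j<n. g (Suc j) - g j)"
        unfolding sum_lessThan_telescope by (simp add: g_def t_def)
      \<comment> \<open>cost of freezing the time of the gradient, by \<open>expectation_drift_grad_time\<close>\<close>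
      define A where "A r = C_grad_time * (1 / sqrt r * min 1 (h / (t - r)))" for r
      have Ai: "set_integrable lborel {0..t} A"
        unfolding A_def by (intro set_integrable_mult_right integral_sqrt_min h_pos ht)
      have A0: "0 \<le> A r" if "0 \<le> r" "r \<le> t" for r unfolding A_def using that C_grad_time_nonneg h_pos by simp
      have Aint: "(\<Sum>j<n. LINT r:?I j|lborel. A r) \<le> C_grad_time * (h * (4 + \<L>) / sqrt t)"
      proof -
        have "(\<Sum>j<n. LINT r:?I j|lborel. A r) = (LINT r:{0..t}|lborel. A r)"
          unfolding t_def by (rule set_integral_grid[symmetric]) (use h_pos Ai in \<open>auto simp: t_def\<close>)
        also have "\<dots> \<le> C_grad_time * (h * (5 + ln (t / h)) / sqrt t)"
          unfolding A_def set_integral_mult_right by (intro mult_left_mono integral_sqrt_min h_pos ht C_grad_time_nonneg)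
        finally show ?thesis unfolding tn \<L>_def by simp
      qed
      \<comment> \<open>up to the factor \<open>G\<close>, a bound on the supremum of the frozen integrand\<close>
      define wt where "wt j = 1 / sqrt (t - real j * h)" for j
      \<comment> \<open>the bound of \<open>expectation_time_regularity\<close> on the interval starting at \<open>j * h\<close>\<close>
      define reg where "reg j = C_heat_time * (h / (real j * h)) + (C_grad + C_grad_time) * (h / sqrt (real j * h)) * (5 + ln (real j * h / h))" for j
      \<comment> \<open>the weighted bound \<open>P a\<close> on the error after \<open>j\<close> steps\<close>
      define dk where "dk j = a * ((1 + ln (real j)) * h * (1 / sqrt (real j * h) * exp (l * (real j * h))))" for j
      have cell: "\<bar>LINT r:?I j|lborel. J t \<phi> r - JY j r\<bar> \<le> (LINT r:?I j|lborel. A r) + h * (G * wt j * (reg j + dk j))"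
        if j: "1 \<le> j" "j < n" for j
      proof -
        define s where "s = real j * h"
        have s: "0 < s" "h \<le> s" "s < t" "s \<le> T" using j h_pos kT[of j] n by (auto simp: s_def t_def)
        have iA: "set_integrable lborel (?I j) A" by (rule set_integrable_subset[OF Ai _ sub[OF j(2)]]) simp
        have len: "real (j + 1) * h = s + h" by (simp add: s_def algebra_simps)
        have sht: "s + h \<le> t"
        proof -
          have "real (j + 1) * h \<le> real n * h" using j h_pos by (intro mult_right_mono) auto
          then show ?thesis unfolding len t_def[symmetric] .
        qed
        have "\<bar>LINT r:?I j|lborel. J t \<phi> r - JY j r\<bar> \<le> (LINT r:?I j|lborel. A r + G * wt j * (reg j + dk j))"
        proof (rule set_integral_bound_open)
          show "set_integrable lborel (?I j) (\<lambda>r. A r + G * wt j * (reg j + dk j))"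
            by (intro set_integral_add iA set_integrable_const_Icc)
          show "set_borel_measurable lborel (?I j) (\<lambda>r. J t \<phi> r - JY j r)"
            using set_integral_diff(1)[OF Ji[OF j(2)] JYi[OF j(2)]] by (auto simp: set_integrable_def set_borel_measurable_def)
          fix r assume r0: "real j * h < r" "r < real (j + 1) * h"
          have "s < r" "r < s + h" using r0(1) r0(2)[unfolded len] by (simp_all add: s_def)
          then have r: "s < r" "r < s + h" "r < t" "r \<le> T" "0 < r" "0 < t - r" using s sht t by linarith+
          define \<psi> where "\<psi> = drift_grad b r (t - s) \<phi>"
          have ts: "0 < t - s" using s by simp
          have \<psi>b: "bdd_meas (G * wt j) \<psi>"
            using abs_drift_grad_le[OF less_imp_le[OF ts] \<phi>, of r] unfolding bdd_meas_def \<psi>_def wt_def s_def by auto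
          have a1: "\<bar>J t \<phi> r - expectation (\<lambda>\<omega>. \<psi> (X r \<omega>))\<bar> \<le> A r"
            using expectation_drift_grad_time[OF r(5,4,6), of "r - s" h 1 \<phi>] r \<phi> unfolding \<psi>_def A_def by simp
          have a2: "\<bar>expectation (\<lambda>\<omega>. \<psi> (X r \<omega>)) - expectation (\<lambda>\<omega>. \<psi> (X s \<omega>))\<bar> \<le> G * wt j * reg j"
            unfolding reg_def s_def[symmetric] by (rule expectation_time_regularity[OF h_pos s(2) r(1) _ r(4) \<psi>b]) (use r in simp)
          have a3: "\<bar>expectation (\<lambda>\<omega>. \<psi> (X s \<omega>)) - JY j r\<bar> \<le> G * wt j * dk j"
          proof -
            define k where "k = G * wt j"
            have k: "0 \<le> k" unfolding k_def wt_def using G_nonneg s by (simp add: s_def)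
            have jY: "JY j r = expectation (\<lambda>\<omega>. \<psi> (Y j \<omega>))" unfolding JY_def \<psi>_def s_def ..
            show ?thesis
            proof (cases "k = 0")
              case True
              then have "\<psi> = (\<lambda>_. 0)" using bdd_measD(2)[OF \<psi>b] by (auto simp: k_def fun_eq_iff)
              then show ?thesis using True unfolding jY k_def[symmetric] by simp
            next
              case False
              with k have k: "0 < k" by simp
              have b1: "bdd_meas 1 (\<lambda>x. \<psi> x / k)"
                using \<psi>b k unfolding k_def[symmetric] by (auto simp: bdd_meas_def abs_divide)
              have "err (\<lambda>x. \<psi> x / k) j \<le> dk j" using a(2) j n b1 unfolding P_def dk_def by auto
              then have "\<bar>expectation (\<lambda>\<omega>. \<psi> (X s \<omega>)) / k - expectation (\<lambda>\<omega>. \<psi> (Y j \<omega>)) / k\<bar> \<le> dk j"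
                unfolding err_def s_def by simp
              then have "\<bar>expectation (\<lambda>\<omega>. \<psi> (X s \<omega>)) - expectation (\<lambda>\<omega>. \<psi> (Y j \<omega>))\<bar> / k \<le> dk j"
                using k by (simp add: diff_divide_distrib[symmetric] abs_divide)
              then show ?thesis unfolding jY k_def[symmetric] using k by (simp add: divide_le_eq mult.commute)
            qed
          qed
          show "\<bar>J t \<phi> r - JY j r\<bar> \<le> A r + G * wt j * (reg j + dk j)"
            using a1 a2 a3 unfolding distrib_left by linarith
        qed
        also have "\<dots> = (LINT r:?I j|lborel. A r) + h * (G * wt j * (reg j + dk j))"
        proof -
          have "real j * h \<le> real (j + 1) * h" "real (j + 1) * h - real j * h = h" using h_pos by (auto simp: algebra_simps)
          then have "(LINT r:?I j|lborel. c) = h * c" for c :: real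
            by (simp only: set_integral_const_Icc mult.commute)
          then show ?thesis by (subst set_integral_add(2)[OF iA set_integrable_const_Icc]) (simp only:)
        qed
        finally show ?thesis .
      qed
      \<comment> \<open>On the first interval no regularity of the law is available, but there the integrals of both
        integrands are already \<open>O(h / sqrt t)\<close>.\<close>
      have cell0: "\<bar>LINT r:?I 0|lborel. J t \<phi> r - JY 0 r\<bar> \<le> (LINT r:?I 0|lborel. A r) + 3 * G * h * (1 / sqrt t)"
      proof -
        have n0: "0 < n" using n by simp
        have iA: "set_integrable lborel {0..h} A" by (rule set_integrable_subset[OF Ai]) (use ht in auto)
        have i2: "set_integrable lborel {0..h} (\<lambda>r. G * (sqrt h * (1 / sqrt t)) * (1 / sqrt (h - r)))"
          by (intro set_integrable_mult_right integral_inverse_sqrt_t h_pos)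
        have i3: "set_integrable lborel {0..h} (\<lambda>r. G * (sqrt h * (1 / sqrt t)) * (1 / sqrt (h - r)) + G * (1 / sqrt t))"
          by (intro set_integral_add i2 set_integrable_const_Icc)
        have "\<bar>LINT r:{0..h}|lborel. J t \<phi> r - JY 0 r\<bar> \<le> (LINT r:{0..h}|lborel. G * (sqrt h * (1 / sqrt t)) * (1 / sqrt (h - r)) + G * (1 / sqrt t))"
        proof (rule set_integral_bound_open[OF i3])
          show "set_borel_measurable lborel {0..h} (\<lambda>r. J t \<phi> r - JY 0 r)"
            using set_integral_diff(1)[OF Ji[OF n0] JYi[OF n0]] by (auto simp: set_integrable_def set_borel_measurable_def)
          fix r assume r: "0 < r" "r < h"
          have "\<bar>J t \<phi> r\<bar> \<le> G * 1 * (1 / sqrt (t - r))" by (rule J_bound[OF _ \<phi>]) (use r ht in auto)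
          also have "1 / sqrt (t - r) \<le> sqrt h * (1 / sqrt t) * (1 / sqrt (h - r))"
          proof -
            have "t * (h - r) \<le> h * (t - r)" using r ht by (simp add: algebra_simps)
            then have "sqrt t * sqrt (h - r) \<le> sqrt h * sqrt (t - r)" by (simp add: real_sqrt_mult[symmetric])
            then show ?thesis using r ht t by (simp add: divide_le_eq le_divide_eq field_simps)
          qed
          finally have 1: "\<bar>J t \<phi> r\<bar> \<le> G * (sqrt h * (1 / sqrt t)) * (1 / sqrt (h - r))"
            using G_nonneg by (simp add: mult_left_mono mult.assoc)
          have "\<bar>JY 0 r\<bar> \<le> G * 1 * (1 / sqrt t)"
            unfolding JY_def using t by (intro expectation_abs_le abs_drift_grad_le[OF _ \<phi>, THEN order_trans]) auto
          with 1 show "\<bar>J t \<phi> r - JY 0 r\<bar> \<le> G * (sqrt h * (1 / sqrt t)) * (1 / sqrt (h - r)) + G * (1 / sqrt t)" by linarith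
        qed
        also have "\<dots> = G * (sqrt h * (1 / sqrt t)) * (2 * sqrt h) + G * (1 / sqrt t) * h"
          using h_pos by (subst set_integral_add(2)[OF i2 set_integrable_const_Icc])
            (simp only: set_integral_mult_right integral_inverse_sqrt_t(2)[OF h_pos], simp add: set_integral_const_Icc)
        also have "\<dots> = 2 * (sqrt h * sqrt h) * (G * (1 / sqrt t)) + G * (1 / sqrt t) * h" by (simp only: mult_ac)
        also have "\<dots> = 3 * G * h * (1 / sqrt t)" using h_pos by (simp add: algebra_simps)
        finally have "\<bar>LINT r:{0..h}|lborel. J t \<phi> r - JY 0 r\<bar> \<le> 3 * G * h * (1 / sqrt t)" .
        moreover have "0 \<le> (LINT r:{0..h}|lborel. A r)"
          unfolding set_lebesgue_integral_def by (intro integral_nonneg_AE AE_I2) (use A0 ht in \<open>auto simp: indicator_def\<close>)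
        ultimately show ?thesis by simp
      qed
      have main: "err \<phi> n \<le> (\<Sum>j<n. LINT r:?I j|lborel. A r) + 3 * G * h * (1 / sqrt t)
          + (\<Sum>j\<in>{1..<n}. h * (G * wt j * (reg j + dk j))) + C_euler_step * h * (\<Sum>j<n. 1 / real (n - j))"
      proof -
        have "expectation (\<lambda>\<omega>. \<phi> (X t \<omega>)) - expectation (\<lambda>\<omega>. \<phi> (Y n \<omega>))
          = (\<Sum>j<n. (LINT r:?I j|lborel. J t \<phi> r - JY j r) - ((g (Suc j) - g j) - (LINT r:?I j|lborel. JY j r)))"
        proof -
          have "expectation (\<lambda>\<omega>. \<phi> (X t \<omega>)) - expectation (\<lambda>\<omega>. \<phi> (Y n \<omega>)) = (\<Sum>j<n. LINT r:?I j|lborel. J t \<phi> r) - (\<Sum>j<n. g (Suc j) - g j)"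
            unfolding EX EY by simp
          also have "\<dots> = (\<Sum>j<n. (LINT r:?I j|lborel. J t \<phi> r) - (g (Suc j) - g j))"
            by (rule sum_subtractf[symmetric])
          also have "\<dots> = (\<Sum>j<n. (LINT r:?I j|lborel. J t \<phi> r - JY j r) - ((g (Suc j) - g j) - (LINT r:?I j|lborel. JY j r)))"
          proof (intro sum.cong refl)
            fix j assume "j \<in> {..<n}"
            then have j: "j < n" by simp
            show "(LINT r:?I j|lborel. J t \<phi> r) - (g (Suc j) - g j) = (LINT r:?I j|lborel. J t \<phi> r - JY j r) - ((g (Suc j) - g j) - (LINT r:?I j|lborel. JY j r))"
              using set_integral_diff(2)[OF Ji[OF j] JYi[OF j]] by linarith
          qed
          finally show ?thesis .
        qed
        then have "err \<phi> n \<le> (\<Sum>j<n. \<bar>LINT r:?I j|lborel. J t \<phi> r - JY j r\<bar> + C_euler_step * h * (1 / real (n - j)))"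
          unfolding err_def t_def[symmetric]
        proof (simp only:, intro order_trans[OF sum_abs] sum_mono)
          fix j assume "j \<in> {..<n}"
          then have j: "j < n" by simp
          show "\<bar>(LINT r:?I j|lborel. J t \<phi> r - JY j r) - ((g (Suc j) - g j) - (LINT r:?I j|lborel. JY j r))\<bar>
            \<le> \<bar>LINT r:?I j|lborel. J t \<phi> r - JY j r\<bar> + C_euler_step * h * (1 / real (n - j))"
          proof (rule order_trans[OF abs_triangle_ineq4 add_left_mono])
            show "\<bar>(g (Suc j) - g j) - (LINT r:?I j|lborel. JY j r)\<bar> \<le> C_euler_step * h * (1 / real (n - j))"
              unfolding g_def JY_def t_def by (rule euler_local[OF j n(2) \<phi>])
          qed
        qed
        also have "\<dots> = (\<Sum>j<n. \<bar>LINT r:?I j|lborel. J t \<phi> r - JY j r\<bar>) + C_euler_step * h * (\<Sum>j<n. 1 / real (n - j))"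
          by (simp only: sum.distrib sum_distrib_left)
        also have "(\<Sum>j<n. \<bar>LINT r:?I j|lborel. J t \<phi> r - JY j r\<bar>)
          = \<bar>LINT r:?I 0|lborel. J t \<phi> r - JY 0 r\<bar> + (\<Sum>j\<in>{1..<n}. \<bar>LINT r:?I j|lborel. J t \<phi> r - JY j r\<bar>)"
          using n by (simp only: lessThan_atLeast0) (subst sum.atLeast_Suc_lessThan, auto)
        also have "\<dots> \<le> ((LINT r:?I 0|lborel. A r) + 3 * G * h * (1 / sqrt t)) + (\<Sum>j\<in>{1..<n}. (LINT r:?I j|lborel. A r) + h * (G * wt j * (reg j + dk j)))"
          by (intro add_mono cell0 sum_mono cell) auto
        also have "\<dots> = ((LINT r:?I 0|lborel. A r) + (\<Sum>j\<in>{1..<n}. LINT r:?I j|lborel. A r)) + 3 * G * h * (1 / sqrt t) + (\<Sum>j\<in>{1..<n}. h * (G * wt j * (reg j + dk j)))"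
          by (simp only: sum.distrib add_ac)
        also have "(LINT r:?I 0|lborel. A r) + (\<Sum>j\<in>{1..<n}. LINT r:?I j|lborel. A r) = (\<Sum>j<n. LINT r:?I j|lborel. A r)"
          using n by (simp only: lessThan_atLeast0) (subst sum.atLeast_Suc_lessThan, auto)
        finally show ?thesis by simp
      qed
      have wt: "wt j = 1 / sqrt h * (1 / sqrt (real (n - j)))" if "j < n" for j
        unfolding wt_def \<tau>(1)[OF that] by (simp add: real_sqrt_mult mult.commute)
      have lnj: "5 + ln (real j * h / h) \<le> 5 * \<L>" "1 + ln (real j) \<le> \<L>" if "1 \<le> j" "j < n" for j
      proof -
        have "ln (real j) \<le> ln (real n)" "0 \<le> ln (real n)" using that by auto
        then show "5 + ln (real j * h / h) \<le> 5 * \<L>" "1 + ln (real j) \<le> \<L>"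
          using h_pos by (auto simp: \<L>_def)
      qed
      have S_reg: "(\<Sum>j\<in>{1..<n}. h * (G * wt j * reg j)) \<le> G * (C_heat_time * 5 + (C_grad + C_grad_time) * 20 * sqrt T) * (\<L> * h * (1 / sqrt t))"
      proof -
        define q where "q = sqrt h"
        have q: "0 < q" "h = q * q" using h_pos by (auto simp: q_def)
        have "(\<Sum>j\<in>{1..<n}. h * (G * wt j * reg j)) \<le> (\<Sum>j\<in>{1..<n}. G * C_heat_time * q * (1 / sqrt (real (n - j)) * (1 / real j))
            + G * (C_grad + C_grad_time) * 5 * \<L> * h * (1 / sqrt (real (n - j)) * (1 / sqrt (real j))))"
        proof (rule sum_mono)
          fix j assume "j \<in> {1..<n}"
          then have j: "1 \<le> j" "j < n" by auto
          have "reg j \<le> C_heat_time * (1 / real j) + (C_grad + C_grad_time) * (q * (1 / sqrt (real j))) * (5 * \<L>)"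
            unfolding reg_def
          proof (rule add_mono)
            show "C_heat_time * (h / (real j * h)) \<le> C_heat_time * (1 / real j)" using h_pos j by simp
            have sj: "sqrt (real j * h) = sqrt (real j) * q" by (simp add: real_sqrt_mult q_def)
            have "h / (sqrt (real j) * q) = q * (1 / sqrt (real j))" using q(1) by (subst q(2)) simp
            then have sq: "h / sqrt (real j * h) \<le> q * (1 / sqrt (real j))" unfolding sj by simp
            have ln0: "0 \<le> 5 + ln (real j * h / h)" using h_pos j by (simp add: add_nonneg_nonneg)
            show "(C_grad + C_grad_time) * (h / sqrt (real j * h)) * (5 + ln (real j * h / h)) \<le> (C_grad + C_grad_time) * (q * (1 / sqrt (real j))) * (5 * \<L>)"
              by (rule mult_mono[OF mult_left_mono[OF sq] lnj(1)[OF j]])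
                (use C_grad_nonneg C_grad_time_nonneg q ln0 in auto)
          qed
          then have "h * (G * wt j * reg j) \<le> h * (G * wt j * (C_heat_time * (1 / real j) + (C_grad + C_grad_time) * (q * (1 / sqrt (real j))) * (5 * \<L>)))"
            using h_pos G_nonneg \<tau>(2)[OF j(2)] by (intro mult_left_mono) (auto simp: wt_def)
          also have "\<dots> = G * C_heat_time * q * (1 / sqrt (real (n - j)) * (1 / real j))
            + G * (C_grad + C_grad_time) * 5 * \<L> * h * (1 / sqrt (real (n - j)) * (1 / sqrt (real j)))"
          proof -
            have e1: "h * (1 / q) = q" "h * (1 / q) * q = h" using q by auto
            have "h * (G * wt j * (C_heat_time * (1 / real j) + (C_grad + C_grad_time) * (q * (1 / sqrt (real j))) * (5 * \<L>)))
              = (h * (1 / q)) * G * C_heat_time * (1 / sqrt (real (n - j)) * (1 / real j))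
               + (h * (1 / q) * q) * G * (C_grad + C_grad_time) * 5 * \<L> * (1 / sqrt (real (n - j)) * (1 / sqrt (real j)))"
              unfolding wt[OF j(2)] q_def[symmetric] by (simp only: distrib_left mult_ac)
            also have "\<dots> = G * C_heat_time * q * (1 / sqrt (real (n - j)) * (1 / real j))
              + G * (C_grad + C_grad_time) * 5 * \<L> * h * (1 / sqrt (real (n - j)) * (1 / sqrt (real j)))"
              unfolding e1(2) unfolding e1(1) by (simp only: mult_ac)
            finally show ?thesis .
          qed
          finally show "h * (G * wt j * reg j) \<le> G * C_heat_time * q * (1 / sqrt (real (n - j)) * (1 / real j))
            + G * (C_grad + C_grad_time) * 5 * \<L> * h * (1 / sqrt (real (n - j)) * (1 / sqrt (real j)))" .
        qed
        also have "\<dots> = G * C_heat_time * q * (\<Sum>j\<in>{1..<n}. 1 / sqrt (real (n - j)) * (1 / real j))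
            + G * (C_grad + C_grad_time) * 5 * \<L> * h * (\<Sum>j\<in>{1..<n}. 1 / sqrt (real (n - j)) * (1 / sqrt (real j)))"
          by (simp only: sum.distrib sum_distrib_left)
        also have "\<dots> \<le> G * C_heat_time * q * (1 / sqrt (real n) * (5 + ln (real n))) + G * (C_grad + C_grad_time) * 5 * \<L> * h * 4"
          using G_nonneg C_heat_time_nonneg C_grad_nonneg C_grad_time_nonneg h_pos q \<L>
          by (intro add_mono mult_left_mono sum_sqrt_inverse sum_sqrt_sqrt n) auto
        also have "\<dots> \<le> G * C_heat_time * q * (1 / sqrt (real n) * (5 * \<L>)) + G * (C_grad + C_grad_time) * 5 * \<L> * h * 4 * (sqrt T * (1 / sqrt t))"
        proof (intro add_mono)
          show "G * C_heat_time * q * (1 / sqrt (real n) * (5 + ln (real n))) \<le> G * C_heat_time * q * (1 / sqrt (real n) * (5 * \<L>))"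
            using G_nonneg C_heat_time_nonneg q \<L> by (intro mult_left_mono) (auto simp: \<L>_def)
          have "G * (C_grad + C_grad_time) * 5 * \<L> * h * 4 * 1 \<le> G * (C_grad + C_grad_time) * 5 * \<L> * h * 4 * (sqrt T * (1 / sqrt t))"
            using G_nonneg C_grad_nonneg C_grad_time_nonneg h_pos \<L> by (intro mult_left_mono sT) auto
          then show "G * (C_grad + C_grad_time) * 5 * \<L> * h * 4 \<le> G * (C_grad + C_grad_time) * 5 * \<L> * h * 4 * (sqrt T * (1 / sqrt t))"
            by (simp only: mult_1_right)
        qed
        also have "q * (1 / sqrt (real n)) = h * (1 / sqrt t)"
          using q by (simp add: t_def real_sqrt_mult q_def[symmetric])
        then have "G * C_heat_time * q * (1 / sqrt (real n) * (5 * \<L>)) = G * C_heat_time * (h * (1 / sqrt t)) * (5 * \<L>)"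
          by (metis mult.assoc)
        finally show ?thesis by (simp add: algebra_simps add_divide_distrib)
      qed
      have S_dk: "(\<Sum>j\<in>{1..<n}. h * (G * wt j * dk j)) \<le> a / 2 * (\<L> * h * (1 / sqrt t * exp (l * t)))"
      proof -
        define k where "k s = 1 / sqrt (t - s) * (1 / sqrt s * exp (l * s))" for s
        have ki: "set_integrable lborel {0..t} k" unfolding k_def l_def by (rule singular_kernel(1)[OF t(1) G2])
        have k0: "0 \<le> k s" if "0 \<le> s" "s \<le> t" for s unfolding k_def using that by simp
        \<comment> \<open>over one step \<open>1 / sqrt s\<close> changes by at most a factor \<open>sqrt 2\<close>, and the other factors of the kernel
          increase, so the sum is at most \<open>sqrt 2\<close> times the integral\<close>
        have step: "h * k (real j * h) \<le> sqrt 2 * (LINT s:?I j|lborel. k s)" if "j \<in> {1..<n}" for j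
        proof -
          have j: "1 \<le> j" "j < n" using that by auto
          define s0 where "s0 = real j * h"
          have s0: "0 < s0" "h \<le> s0" "s0 < t" using j h_pos by (auto simp: s0_def t_def)
          have len: "real (j + 1) * h = s0 + h" by (simp add: s0_def algebra_simps)
          have sht: "s0 + h \<le> t"
          proof -
            have "real (j + 1) * h \<le> real n * h" using j h_pos by (intro mult_right_mono) auto
            then show ?thesis unfolding len t_def[symmetric] .
          qed
          have i: "set_integrable lborel {s0..s0 + h} (\<lambda>s. sqrt 2 * k s)"
            by (intro set_integrable_mult_right set_integrable_subset[OF ki]) (use s0 sht in auto)
          have "\<bar>LINT s:{s0..s0 + h}|lborel. k s0\<bar> \<le> (LINT s:{s0..s0 + h}|lborel. sqrt 2 * k s)"
          proof (rule set_integral_bound_open[OF i])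
            show "set_borel_measurable lborel {s0..s0 + h} (\<lambda>s. k s0)" unfolding set_borel_measurable_def by measurable
            fix s assume s: "s0 < s" "s < s0 + h"
            have st: "0 < t - s" "0 < t - s0" using s sht s0 by auto
            have "1 / sqrt s0 \<le> sqrt 2 * (1 / sqrt s)"
            proof -
              have "sqrt s \<le> sqrt (2 * s0)" using s s0 by (intro real_sqrt_le_mono) auto
              then show ?thesis using s s0 by (simp add: real_sqrt_mult field_simps)
            qed
            then have "1 / sqrt (t - s0) * (1 / sqrt s0 * exp (l * s0)) \<le> 1 / sqrt (t - s) * (sqrt 2 * (1 / sqrt s) * exp (l * s))"
              using s s0 st l by (intro mult_mono frac_le) auto
            then show "\<bar>k s0\<bar> \<le> sqrt 2 * k s" using k0[of s0] s0 by (simp add: k_def mult_ac)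
          qed
          then show ?thesis unfolding len s0_def[symmetric] using h_pos k0[of s0] s0 by (simp add: set_integral_const_Icc mult.commute)
        qed
        have "(\<Sum>j\<in>{1..<n}. h * (G * wt j * dk j)) \<le> (\<Sum>j\<in>{1..<n}. (a * \<L> * h) * (G * (sqrt 2 * (LINT s:?I j|lborel. k s))))"
        proof (rule sum_mono)
          fix j assume jj: "j \<in> {1..<n}"
          then have j: "1 \<le> j" "j < n" by auto
          have kk: "0 \<le> k (real j * h)" using j h_pos by (intro k0) (auto simp: t_def)
          have "h * (G * wt j * dk j) = (a * h) * G * (h * k (real j * h)) * (1 + ln (real j))"
            unfolding dk_def wt_def k_def by (simp only: mult_ac)
          also have "\<dots> \<le> (a * h) * G * (h * k (real j * h)) * \<L>"
            using lnj(2)[OF j] a h_pos G_nonneg kk by (intro mult_left_mono) auto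
          also have "\<dots> = (a * \<L> * h) * (G * (h * k (real j * h)))" by (simp only: mult_ac)
          also have "\<dots> \<le> (a * \<L> * h) * (G * (sqrt 2 * (LINT s:?I j|lborel. k s)))"
            using step[OF jj] a \<L> h_pos G_nonneg by (intro mult_left_mono) auto
          finally show "h * (G * wt j * dk j) \<le> (a * \<L> * h) * (G * (sqrt 2 * (LINT s:?I j|lborel. k s)))" .
        qed
        also have "\<dots> = (a * \<L> * h) * (sqrt 2 * G * (\<Sum>j\<in>{1..<n}. LINT s:?I j|lborel. k s))"
          by (simp only: sum_distrib_left mult_ac)
        also have "\<dots> \<le> (a * \<L> * h) * (1 / 2 * (1 / sqrt t * exp (l * t)))"
        proof (rule mult_left_mono)
          have "(\<Sum>j\<in>{1..<n}. LINT s:?I j|lborel. k s) \<le> (\<Sum>j<n. LINT s:?I j|lborel. k s)"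
          proof (rule sum_mono2)
            fix j assume "j \<in> {..<n} - {1..<n}"
            then have "j < n" by simp
            then show "0 \<le> (LINT s:?I j|lborel. k s)"
              unfolding set_lebesgue_integral_def using sub[of j] k0
              by (intro integral_nonneg_AE AE_I2) (auto simp: indicator_def subset_iff simp del: of_nat_add)
          qed auto
          also have "\<dots> = (LINT s:{0..t}|lborel. k s)"
            unfolding t_def by (rule set_integral_grid[symmetric]) (use h_pos ki in \<open>auto simp: t_def\<close>)
          finally have "sqrt 2 * G * (\<Sum>j\<in>{1..<n}. LINT s:?I j|lborel. k s) \<le> sqrt 2 * G * (LINT s:{0..t}|lborel. k s)"
            using G2 by (rule mult_left_mono)
          also have "\<dots> \<le> 1 / 2 * (1 / sqrt t * exp (l * t))"
            unfolding k_def l_def by (rule singular_kernel(2)[OF t(1) G2])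
          finally show "sqrt 2 * G * (\<Sum>j\<in>{1..<n}. LINT s:?I j|lborel. k s) \<le> 1 / 2 * (1 / sqrt t * exp (l * t))" .
        qed (use a \<L> h_pos in auto)
        finally show ?thesis by simp
      qed
      have "err \<phi> n \<le> C_grad_time * (h * (4 + \<L>) / sqrt t) + 3 * G * h * (1 / sqrt t)
          + (G * (C_heat_time * 5 + (C_grad + C_grad_time) * 20 * sqrt T) * (\<L> * h * (1 / sqrt t)) + a / 2 * (\<L> * h * (1 / sqrt t * exp (l * t)))) + C_euler_step * h * \<L>"
      proof -
        have "(\<Sum>j\<in>{1..<n}. h * (G * wt j * (reg j + dk j))) = (\<Sum>j\<in>{1..<n}. h * (G * wt j * reg j)) + (\<Sum>j\<in>{1..<n}. h * (G * wt j * dk j))"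
          by (simp only: distrib_left sum.distrib)
        moreover have "C_euler_step * h * (\<Sum>j<n. 1 / real (n - j)) \<le> C_euler_step * h * \<L>"
          unfolding \<L>_def using C_euler_step_nonneg h_pos by (intro mult_left_mono sum_inverse_reflect n) auto
        ultimately show ?thesis using main Aint S_reg S_dk by linarith
      qed
      also have "\<dots> \<le> C_consistency * (\<L> * h * (1 / sqrt t)) + a / 2 * (\<L> * h * (1 / sqrt t * exp (l * t)))"
      proof -
        have 1: "C_grad_time * (h * (4 + \<L>) / sqrt t) \<le> C_grad_time * 5 * (\<L> * h * (1 / sqrt t))"
        proof -
          have "C_grad_time * (h * (1 / sqrt t)) * (4 + \<L>) \<le> C_grad_time * (h * (1 / sqrt t)) * (5 * \<L>)"
            using \<L> C_grad_time_nonneg h_pos t by (intro mult_left_mono) auto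
          then show ?thesis by (simp add: mult_ac)
        qed
        have 2: "3 * G * h * (1 / sqrt t) \<le> 3 * G * (\<L> * h * (1 / sqrt t))"
        proof -
          have "3 * G * h * (1 / sqrt t) * 1 \<le> 3 * G * h * (1 / sqrt t) * \<L>"
            using \<L> G_nonneg h_pos t by (intro mult_left_mono) auto
          then show ?thesis by (simp add: mult_ac)
        qed
        have 3: "C_euler_step * h * \<L> \<le> C_euler_step * sqrt T * (\<L> * h * (1 / sqrt t))"
        proof -
          have "C_euler_step * h * \<L> * 1 \<le> C_euler_step * h * \<L> * (sqrt T * (1 / sqrt t))"
            using \<L> C_euler_step_nonneg h_pos by (intro mult_left_mono sT) auto
          then show ?thesis by (simp add: mult_ac)
        qed
        show ?thesis unfolding C_consistency_def distrib_right using 1 2 3 by linarith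
      qed
      also have "\<dots> \<le> C_consistency * (\<L> * h * (1 / sqrt t * exp (l * t))) + a / 2 * (\<L> * h * (1 / sqrt t * exp (l * t)))"
      proof -
        have "C_consistency * (\<L> * h * (1 / sqrt t * 1)) \<le> C_consistency * (\<L> * h * (1 / sqrt t * exp (l * t)))"
          using C_consistency_nonneg \<L> h_pos t ex[of t] by (intro mult_left_mono) auto
        then show ?thesis by simp
      qed
      finally show "err \<phi> n \<le> (C_consistency + a / 2) * ((1 + ln (real n)) * h * (1 / sqrt (real n * h) * exp (l * (real n * h))))"
        unfolding \<L>_def t_def by (simp only: distrib_right)
    qed
  qed
  then have "err \<phi> n \<le> (2 * C_consistency + 1) * ((1 + ln (real n)) * h * (1 / sqrt (real n * h) * exp (l * (real n * h))))"
    using n \<phi> by (simp add: P_def)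
  also have "\<dots> \<le> (2 * C_consistency + 1) * ((1 + ln (real n)) * h * (1 / sqrt (real n * h) * exp (l * T)))"
    using kT[OF n] l C_consistency_nonneg h_pos ln1[OF n(1)] by (intro mult_left_mono) auto
  finally show ?thesis unfolding err_def C_euler_def l_def by (simp only: mult_ac)
qed

end

section \<open>Independence of random variables\<close>

context prob_space
begin

lemma indep_rv_measurable:
  assumes "indep_rv M A X B Y" shows "X \<in> M \<rightarrow>\<^sub>M A" "Y \<in> M \<rightarrow>\<^sub>M B"
  using assms by (auto simp: indep_rv_def)

lemma indep_rvD:
  assumes "indep_rv M A X B Y" "S \<in> sets A" "U \<in> sets B"
  shows "prob ((X -` S \<inter> space M) \<inter> (Y -` U \<inter> space M)) = prob (X -` S \<inter> space M) * prob (Y -` U \<inter> space M)"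
proof (rule indep_setD)
  show "indep_set (sets (vimage_algebra (space M) X A)) (sets (vimage_algebra (space M) Y B))"
    using assms by (auto simp: indep_rv_def)
qed (use assms in \<open>auto intro: in_vimage_algebra\<close>)

lemma indep_rvI:
  assumes X: "X \<in> M \<rightarrow>\<^sub>M A" and Y: "Y \<in> M \<rightarrow>\<^sub>M B"
    and ind: "\<And>S U. S \<in> sets A \<Longrightarrow> U \<in> sets B \<Longrightarrow>
      prob ((X -` S \<inter> space M) \<inter> (Y -` U \<inter> space M)) = prob (X -` S \<inter> space M) * prob (Y -` U \<inter> space M)"
  shows "indep_rv M A X B Y"
  unfolding indep_rv_def
proof (intro conjI X Y)
  have s: "X \<in> space M \<rightarrow> space A" "Y \<in> space M \<rightarrow> space B" using X Y by (auto dest: measurable_space)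
  show "indep_set (sets (vimage_algebra (space M) X A)) (sets (vimage_algebra (space M) Y B))"
    unfolding sets_vimage_algebra2[OF s(1)] sets_vimage_algebra2[OF s(2)]
    by (rule indep_setI) (use X Y ind in \<open>auto intro: measurable_sets\<close>)
qed

lemma indep_rv_compose:
  assumes i: "indep_rv M A X B Y" and f: "f \<in> A \<rightarrow>\<^sub>M A'" and g: "g \<in> B \<rightarrow>\<^sub>M B'"
  shows "indep_rv M A' (\<lambda>\<omega>. f (X \<omega>)) B' (\<lambda>\<omega>. g (Y \<omega>))"
proof (rule indep_rvI)
  note XY = indep_rv_measurable[OF i]
  show "(\<lambda>\<omega>. f (X \<omega>)) \<in> M \<rightarrow>\<^sub>M A'" "(\<lambda>\<omega>. g (Y \<omega>)) \<in> M \<rightarrow>\<^sub>M B'" using XY f g by measurable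
  fix S U assume SU: "S \<in> sets A'" "U \<in> sets B'"
  have e: "(\<lambda>\<omega>. f (X \<omega>)) -` S \<inter> space M = X -` (f -` S \<inter> space A) \<inter> space M"
    "(\<lambda>\<omega>. g (Y \<omega>)) -` U \<inter> space M = Y -` (g -` U \<inter> space B) \<inter> space M"
    using XY by (auto dest: measurable_space)
  show "prob (((\<lambda>\<omega>. f (X \<omega>)) -` S \<inter> space M) \<inter> ((\<lambda>\<omega>. g (Y \<omega>)) -` U \<inter> space M))
    = prob ((\<lambda>\<omega>. f (X \<omega>)) -` S \<inter> space M) * prob ((\<lambda>\<omega>. g (Y \<omega>)) -` U \<inter> space M)"
    unfolding e by (rule indep_rvD[OF i]) (use f g SU in \<open>auto intro: measurable_sets\<close>)
qed

lemma indep_rv_of_indep_var: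
  assumes "indep_var A X B Y" shows "indep_rv M A X B Y"
proof (rule indep_rvI)
  fix S U assume SU: "S \<in> sets A" "U \<in> sets B"
  have "(\<lambda>x. (X x, Y x)) -` (S \<times> U) \<inter> space M = (X -` S \<inter> space M) \<inter> (Y -` U \<inter> space M)" by auto
  then show "prob ((X -` S \<inter> space M) \<inter> (Y -` U \<inter> space M)) = prob (X -` S \<inter> space M) * prob (Y -` U \<inter> space M)"
    using indep_varD[OF assms SU] by simp
qed (use indep_var_rv1[OF assms] indep_var_rv2[OF assms] in auto)

lemma indep_rv_distr:
  assumes i: "indep_rv M A X B Y"
  shows "distr M A X \<Otimes>\<^sub>M distr M B Y = distr M (A \<Otimes>\<^sub>M B) (\<lambda>\<omega>. (X \<omega>, Y \<omega>))"
proof (rule pair_measure_eqI)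
  note [measurable] = indep_rv_measurable[OF i]
  interpret X: prob_space "distr M A X" by (rule prob_space_distr) simp
  interpret Y: prob_space "distr M B Y" by (rule prob_space_distr) simp
  show "sigma_finite_measure (distr M A X)" "sigma_finite_measure (distr M B Y)" by unfold_locales
  fix S U assume SU: "S \<in> sets (distr M A X)" "U \<in> sets (distr M B Y)"
  have "(\<lambda>\<omega>. (X \<omega>, Y \<omega>)) -` (S \<times> U) \<inter> space M = (X -` S \<inter> space M) \<inter> (Y -` U \<inter> space M)" by auto
  then show "emeasure (distr M A X) S * emeasure (distr M B Y) U = emeasure (distr M (A \<Otimes>\<^sub>M B) (\<lambda>\<omega>. (X \<omega>, Y \<omega>))) (S \<times> U)"
    using SU indep_rvD[OF i, of S U]
    by (simp add: emeasure_distr emeasure_eq_measure ennreal_mult[symmetric])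
qed simp

text \<open>Fubini's theorem for the product law \<open>indep_rv_distr\<close>.\<close>

lemma indep_rv_expectation:
  fixes F :: "'b \<times> 'c \<Rightarrow> real"
  assumes i: "indep_rv M A X B Y" and F [measurable]: "F \<in> borel_measurable (A \<Otimes>\<^sub>M B)" and b: "\<And>p. \<bar>F p\<bar> \<le> K"
  shows "expectation (\<lambda>\<omega>. F (X \<omega>, Y \<omega>)) = expectation (\<lambda>\<omega>'. expectation (\<lambda>\<omega>. F (X \<omega>, Y \<omega>')))"
proof -
  note [measurable] = indep_rv_measurable[OF i]
  interpret X: prob_space "distr M A X" by (rule prob_space_distr) simp
  interpret Y: prob_space "distr M B Y" by (rule prob_space_distr) simp
  interpret P: pair_prob_space "distr M A X" "distr M B Y" ..
  have int: "integrable (distr M A X \<Otimes>\<^sub>M distr M B Y) F"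
    by (rule P.P.integrable_const_bound[of _ K]) (use b in auto)
  have "expectation (\<lambda>\<omega>. F (X \<omega>, Y \<omega>)) = (\<integral>p. F p \<partial>distr M (A \<Otimes>\<^sub>M B) (\<lambda>\<omega>. (X \<omega>, Y \<omega>)))"
    by (subst integral_distr) auto
  also have "\<dots> = (\<integral>p. F p \<partial>(distr M A X \<Otimes>\<^sub>M distr M B Y))" unfolding indep_rv_distr[OF i] ..
  also have "\<dots> = (\<integral>y. (\<integral>x. F (x, y) \<partial>distr M A X) \<partial>distr M B Y)"
    using P.integral_snd[of "\<lambda>x y. F (x, y)"] int by simp
  also have "\<dots> = expectation (\<lambda>\<omega>'. \<integral>x. F (x, Y \<omega>') \<partial>distr M A X)"
    by (subst integral_distr) auto
  also have "\<dots> = expectation (\<lambda>\<omega>'. expectation (\<lambda>\<omega>. F (X \<omega>, Y \<omega>')))"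
  proof (rule Bochner_Integration.integral_cong[OF refl])
    fix \<omega>' assume "\<omega>' \<in> space M"
    then have "Y \<omega>' \<in> space B" using measurable_space[OF indep_rv_measurable(2)[OF i]] by simp
    then have "(\<lambda>x. F (x, Y \<omega>')) \<in> borel_measurable A" by measurable
    then show "(\<integral>x. F (x, Y \<omega>') \<partial>distr M A X) = expectation (\<lambda>\<omega>. F (X \<omega>, Y \<omega>'))"
      by (subst integral_distr) auto
  qed
  finally show ?thesis .
qed

lemma indep_rv_sym: "indep_rv M A X B Y \<Longrightarrow> indep_rv M B Y A X"
  using indep_rvD[of A X B Y] by (intro indep_rvI) (auto dest: indep_rv_measurable simp: Int_commute[of "Y -` _ \<inter> _"] mult.commute)

lemma gauss_expectation:
  fixes D :: "'a \<Rightarrow> real ^ 'n::finite"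
  assumes D: "distributed M lborel D (\<lambda>x. ennreal (gk t x))" and t: "0 < t" and [measurable]: "f \<in> borel_measurable borel"
  shows "expectation (\<lambda>\<omega>. f (z + D \<omega>)) = heat t f z"
proof -
  have "expectation (\<lambda>\<omega>. f (z + D \<omega>)) = (LINT x|lborel. gk t x * f (z + x))"
    by (rule distributed_integral[OF D, symmetric]) auto
  also have "\<dots> = (LINT x|lborel. gk t (0 - x) * f (z + (0 - x)))"
    by (rule integral_reflect[symmetric]) measurable
  also have "\<dots> = (LINT x|lborel. gk t ((z - x) - z) * f (z - x))" by simp
  also have "\<dots> = (LINT y|lborel. gk t (y - z) * f y)"
    by (rule integral_reflect) measurable
  finally show ?thesis using t by (simp add: heat_pos)
qed

lemma gauss_step_indep:
  fixes D Z :: "'a \<Rightarrow> real ^ 'n::finite"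
  assumes i: "indep_rv M borel Z borel D" and D: "distributed M lborel D (\<lambda>x. ennreal (gk t x))" and t: "0 < t" and f: "bdd_meas K f"
  shows "expectation (\<lambda>\<omega>. f (Z \<omega> + D \<omega>)) = expectation (\<lambda>\<omega>. heat t f (Z \<omega>))"
proof -
  note [measurable] = bdd_measD(1)[OF f] indep_rv_measurable[OF i]
  have "expectation (\<lambda>\<omega>. (\<lambda>(d, z). f (z + d)) (D \<omega>, Z \<omega>)) = expectation (\<lambda>\<omega>'. expectation (\<lambda>\<omega>. (\<lambda>(d, z). f (z + d)) (D \<omega>, Z \<omega>')))"
    by (rule indep_rv_expectation[OF indep_rv_sym[OF i], where K=K]) (use bdd_measD(2)[OF f] in auto)
  then show ?thesis by (simp add: gauss_expectation[OF D t])
qed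

lemma uniform_expectation:
  assumes \<delta>: "distr M borel \<delta> = uniform_measure lborel {a..a + h}" and \<delta>m [measurable]: "\<delta> \<in> borel_measurable M" and h: "0 < h"
    and [measurable]: "H \<in> borel_measurable borel"
  shows "expectation (\<lambda>\<omega>. H (\<delta> \<omega>) :: real) = (1 / h) * (LINT r:{a..a + h}|lborel. H r)"
proof -
  have "expectation (\<lambda>\<omega>. H (\<delta> \<omega>)) = (\<integral>r. H r \<partial>distr M borel \<delta>)" by (subst integral_distr) auto
  also have "\<dots> = (\<integral>r. H r \<partial>density lborel (\<lambda>r. ennreal (indicator {a..a + h} r / h)))"
  proof -
    have "indicator {a..a + h} r / emeasure lborel {a..a + h} = ennreal (indicator {a..a + h} r / h)" for r
      using h by (simp add: divide_ennreal[symmetric] ennreal_indicator)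
    then show ?thesis unfolding \<delta> uniform_measure_def by simp
  qed
  also have "\<dots> = (\<integral>r. (indicator {a..a + h} r / h) *\<^sub>R H r \<partial>lborel)"
    using h by (intro integral_density) auto
  also have "\<dots> = (1 / h) * (LINT r:{a..a + h}|lborel. H r)"
    unfolding set_lebesgue_integral_def integral_mult_right_zero[symmetric] by simp
  finally show ?thesis .
qed

text \<open>With the present value and the random time frozen, the Brownian increment averages to the heat flow
  by \<open>gauss_expectation\<close>; averaging over the random time then gives the mean over the interval.\<close>

lemma euler_step_law:
  fixes b :: "real \<Rightarrow> real ^ 'n::finite \<Rightarrow> real ^ 'n"
  assumes ZDd: "indep_rv M borel Z (borel \<Otimes>\<^sub>M borel) (\<lambda>\<omega>. (D \<omega>, \<delta> \<omega>))" and Dd: "indep_rv M borel D borel \<delta>"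
    and D: "distributed M lborel D (\<lambda>x. ennreal (gk h x))" and h: "0 < h"
    and \<delta>: "distr M borel \<delta> = uniform_measure lborel {a..a + h}"
    and b: "(\<lambda>p. b (fst p) (snd p)) \<in> borel_measurable borel" and f: "bdd_meas K f"
  shows "expectation (\<lambda>\<omega>. f (Z \<omega> + D \<omega> + h *\<^sub>R b (\<delta> \<omega>) (Z \<omega>)))
    = (1 / h) * (LINT r:{a..a + h}|lborel. expectation (\<lambda>\<omega>. heat h f (Z \<omega> + h *\<^sub>R b r (Z \<omega>))))"
proof -
  have [measurable]: "Z \<in> borel_measurable M" by (rule indep_rv_measurable(1)[OF ZDd])
  have [measurable]: "D \<in> borel_measurable M" "\<delta> \<in> borel_measurable M" using indep_rv_measurable[OF Dd] by auto
  note [measurable] = bdd_measD(1)[OF f]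
  note bf = bdd_measD(2)[OF f]
  define F where "F p = f (fst p + fst (snd p) + h *\<^sub>R b (snd (snd p)) (fst p))" for p :: "(real ^ 'n) \<times> (real ^ 'n) \<times> real"
  have Fm [measurable]: "F \<in> borel_measurable (borel \<Otimes>\<^sub>M (borel \<Otimes>\<^sub>M borel))"
  proof -
    have "(\<lambda>p. b (snd (snd p)) (fst p)) \<in> borel_measurable (borel \<Otimes>\<^sub>M (borel \<Otimes>\<^sub>M borel))"
      using measurable_compose[OF borel_measurable_Pair b, of "\<lambda>p. snd (snd p)" "borel \<Otimes>\<^sub>M (borel \<Otimes>\<^sub>M borel)" fst] by simp
    then show ?thesis unfolding F_def by measurable
  qed
  have 1: "expectation (\<lambda>\<omega>. F (Z \<omega>, (D \<omega>, \<delta> \<omega>))) = expectation (\<lambda>\<omega>'. expectation (\<lambda>\<omega>. F (Z \<omega>, (D \<omega>', \<delta> \<omega>'))))"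
    by (rule indep_rv_expectation[OF ZDd Fm, of K]) (use bf in \<open>auto simp: F_def\<close>)
  define Q where "Q p = expectation (\<lambda>\<omega>. F (Z \<omega>, p))" for p
  have Qm [measurable]: "Q \<in> borel_measurable (borel \<Otimes>\<^sub>M borel)" unfolding Q_def by measurable
  have Qb: "\<bar>Q p\<bar> \<le> K" for p
  proof -
    have "\<bar>Q p\<bar> \<le> expectation (\<lambda>\<omega>. \<bar>F (Z \<omega>, p)\<bar>)" unfolding Q_def by (rule integral_abs_bound)
    also have "\<dots> \<le> expectation (\<lambda>\<omega>. K)"
      by (rule integral_mono_AE') (use bf bdd_measD(3)[OF f] in \<open>auto simp: F_def\<close>)
    finally show ?thesis by (simp add: prob_space)
  qed
  have 2: "expectation (\<lambda>\<omega>'. Q (D \<omega>', \<delta> \<omega>')) = expectation (\<lambda>\<omega>''. expectation (\<lambda>\<omega>'. Q (D \<omega>', \<delta> \<omega>'')))"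
    by (rule indep_rv_expectation[OF Dd Qm Qb])
  define H where "H r = expectation (\<lambda>\<omega>. heat h f (Z \<omega> + h *\<^sub>R b r (Z \<omega>)))" for r
  have 3: "expectation (\<lambda>\<omega>'. Q (D \<omega>', r)) = H r" for r
  proof -
    interpret P: pair_prob_space M M ..
    have [measurable]: "(\<lambda>\<omega>. b r (Z \<omega>)) \<in> borel_measurable M"
      using measurable_compose[OF borel_measurable_Pair b, of "\<lambda>_. r" M Z] by simp
    have "integrable (M \<Otimes>\<^sub>M M) (\<lambda>(\<omega>', \<omega>). f (Z \<omega> + D \<omega>' + h *\<^sub>R b r (Z \<omega>)))"
      by (rule P.P.integrable_const_bound[of _ K]) (use bf in \<open>auto\<close>)
    from P.Fubini_integral[OF this]
    have "expectation (\<lambda>\<omega>. expectation (\<lambda>\<omega>'. f (Z \<omega> + D \<omega>' + h *\<^sub>R b r (Z \<omega>)))) = expectation (\<lambda>\<omega>'. Q (D \<omega>', r))"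
      by (simp add: Q_def F_def)
    moreover have "expectation (\<lambda>\<omega>'. f (Z \<omega> + D \<omega>' + h *\<^sub>R b r (Z \<omega>))) = heat h f (Z \<omega> + h *\<^sub>R b r (Z \<omega>))" for \<omega>
      using gauss_expectation[OF D h bdd_measD(1)[OF f], of "Z \<omega> + h *\<^sub>R b r (Z \<omega>)"] by (simp add: algebra_simps)
    ultimately show ?thesis by (simp add: H_def)
  qed
  have Hm: "H \<in> borel_measurable borel"
    unfolding 3[symmetric] by measurable
  have "expectation (\<lambda>\<omega>. F (Z \<omega>, (D \<omega>, \<delta> \<omega>))) = expectation (\<lambda>\<omega>''. H (\<delta> \<omega>''))"
    using 1 2 unfolding Q_def[symmetric] 3 by simp
  also have "\<dots> = (1 / h) * (LINT r:{a..a + h}|lborel. H r)"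
    by (rule uniform_expectation[OF \<delta> _ h Hm]) simp
  finally show ?thesis unfolding F_def H_def by simp
qed

text \<open>The process is the pointwise limit of its values on the grids of mesh \<open>1 / m\<close>, which are
  measurable because they involve only countably many times.\<close>

lemma joint_measurable_continuous:
  fixes Z :: "real \<Rightarrow> 'a \<Rightarrow> 'b::metric_space"
  assumes m: "\<And>t. Z t \<in> borel_measurable M" and c: "\<And>\<omega>. \<omega> \<in> space M \<Longrightarrow> continuous_on UNIV (\<lambda>t. Z t \<omega>)"
  shows "(\<lambda>p. Z (fst p) (snd p)) \<in> borel_measurable (borel \<Otimes>\<^sub>M M)"
proof (rule borel_measurable_LIMSEQ_metric)
  fix m
  have g: "(\<lambda>p. \<lfloor>fst p * real (Suc m)\<rfloor>) \<in> borel \<Otimes>\<^sub>M M \<rightarrow>\<^sub>M count_space UNIV" by measurable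
  show "(\<lambda>p. Z (real_of_int \<lfloor>fst p * real (Suc m)\<rfloor> / real (Suc m)) (snd p)) \<in> borel_measurable (borel \<Otimes>\<^sub>M M)"
    by (rule measurable_compose_countable'[OF _ g, of "\<lambda>i p. Z (real_of_int i / real (Suc m)) (snd p)"]) (use m in measurable)
next
  define fl where "fl m t = real_of_int \<lfloor>t * real (Suc m)\<rfloor> / real (Suc m)" for m and t :: real
  fix p :: "real \<times> 'a" assume p: "p \<in> space (borel \<Otimes>\<^sub>M M)"
  define t where "t = fst p"
  have "(\<lambda>m. fl m t - t) \<longlonglongrightarrow> 0"
  proof (rule tendsto_rabs_zero_cancel, rule tendsto_sandwich[OF _ _ tendsto_const LIMSEQ_Suc[OF lim_1_over_n]])
    show "\<forall>\<^sub>F m in sequentially. \<bar>fl m t - t\<bar> \<le> 1 / real (Suc m)"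
    proof (intro always_eventually allI)
      fix m
      have "\<bar>real_of_int \<lfloor>t * real (Suc m)\<rfloor> - t * real (Suc m)\<bar> \<le> 1" by linarith
      then have "\<bar>real_of_int \<lfloor>t * real (Suc m)\<rfloor> - t * real (Suc m)\<bar> / real (Suc m) \<le> 1 / real (Suc m)"
        by (intro divide_right_mono) auto
      moreover have "fl m t - t = (real_of_int \<lfloor>t * real (Suc m)\<rfloor> - t * real (Suc m)) / real (Suc m)"
        by (simp add: fl_def diff_divide_distrib)
      ultimately show "\<bar>fl m t - t\<bar> \<le> 1 / real (Suc m)" by (simp add: abs_divide)
    qed
  qed auto
  from tendsto_add[OF this tendsto_const[of t]] have l: "(\<lambda>m. fl m t) \<longlonglongrightarrow> t" by simp
  have "snd p \<in> space M" using p by (auto simp: space_pair_measure)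
  from c[OF this] have "isCont (\<lambda>t. Z t (snd p)) t" by (simp add: continuous_on_eq_continuous_at)
  from isCont_tendsto_compose[OF this l]
  show "(\<lambda>m. Z (real_of_int \<lfloor>fst p * real (Suc m)\<rfloor> / real (Suc m)) (snd p)) \<longlonglongrightarrow> Z (fst p) (snd p)"
    by (simp add: fl_def t_def)
qed

text \<open>All random inputs of the scheme form one independent family: the initial value, the Brownian
  increments and the random times. To speak of a single family, the times are embedded into the
  diagonal of \<open>real ^ 'n\<close>.\<close>

definition scheme_input ::
    "('a \<Rightarrow> real ^ 'n::finite) \<Rightarrow> (real \<Rightarrow> 'a \<Rightarrow> real ^ 'n) \<Rightarrow> real \<Rightarrow> (nat \<Rightarrow> 'a \<Rightarrow> real) \<Rightarrow> nat + nat \<Rightarrow> 'a \<Rightarrow> real ^ 'n" where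
  "scheme_input X0 W h \<delta> = case_sum
     (case_nat X0 (\<lambda>j \<omega>. W (real (Suc j) * h) \<omega> - W (real j * h) \<omega>)) (\<lambda>j \<omega>. \<delta> j \<omega> *\<^sub>R (\<chi> i. 1))"

abbreviation input_index :: "nat \<Rightarrow> (nat + nat) set" where
  "input_index k \<equiv> Inl ` {..k} \<union> Inr ` {..<k}"

text \<open>The event that all inputs lie in given sets splits into an event on the random times, one on the
  initial value and one on the Brownian path. The hypotheses give the independence of these three, and then
  of the random times and of the increments among themselves.\<close>

lemma scheme_input_indep:
  fixes X0 :: "'a \<Rightarrow> real ^ 'n::finite"
  assumes W: "brownian_motion M W" and X0: "X0 \<in> borel_measurable M" and indep: "indep_rv M borel X0 path_space (path_of W)"
    and rt: "random_times M X0 W h N \<delta>" and h: "0 < h" and N: "0 < N"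
  shows "indep_vars (\<lambda>_. borel) (scheme_input X0 W h \<delta>) (input_index N)"
proof -
  let ?U = "scheme_input X0 W h \<delta>"
  define D where "D j \<omega> = W (real (Suc j) * h) \<omega> - W (real j * h) \<omega>" for j \<omega>
  have U: "?U (Inl 0) = X0" "\<And>j. ?U (Inl (Suc j)) = D j" "\<And>j. ?U (Inr j) = (\<lambda>\<omega>. \<delta> j \<omega> *\<^sub>R (\<chi> i. 1))"
    by (auto simp: scheme_input_def D_def fun_eq_iff)
  have Wm: "W t \<in> borel_measurable M" if "0 \<le> t" for t using W that by (auto simp: brownian_motion_def)
  have Dm [measurable]: "D j \<in> borel_measurable M" for j
    using Wm[of "real (Suc j) * h"] Wm[of "real j * h"] h unfolding D_def by simp
  have \<delta>i: "indep_vars (\<lambda>_. borel) \<delta> {..<N}" using rt by (simp add: random_times_def)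
  then have \<delta>m: "\<delta> j \<in> borel_measurable M" if "j < N" for j using that by (auto simp: indep_vars_def)
  have Di: "indep_vars (\<lambda>_. borel) D {..<N}"
  proof -
    have "0 \<le> real 0 * h \<and> (\<forall>i<N. real i * h \<le> real (Suc i) * h)" using h by (auto intro: mult_right_mono)
    moreover have "indep_vars (\<lambda>_. borel) (\<lambda>i \<omega>. W (\<tau> (Suc i)) \<omega> - W (\<tau> i) \<omega>) {..<n}"
      if "0 \<le> \<tau> 0 \<and> (\<forall>i<n. \<tau> i \<le> \<tau> (Suc i))" for \<tau> and n :: nat
      using W that unfolding brownian_motion_def by blast
    from this[of "\<lambda>i. real i * h" N] calculation show ?thesis unfolding D_def by simp
  qed
  have rd: "indep_rv M (\<Pi>\<^sub>M k\<in>{..<N}. borel) (\<lambda>\<omega>. \<lambda>k\<in>{..<N}. \<delta> k \<omega>) (borel \<Otimes>\<^sub>M path_space) (\<lambda>\<omega>. (X0 \<omega>, path_of W \<omega>))"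
    using rt by (simp add: random_times_def)
  show ?thesis
  proof (subst indep_vars_finite[where E="\<lambda>_. sets borel"])
    show "input_index N \<noteq> {}" "finite (input_index N)" by auto
    show "?U i \<in> borel_measurable M" if "i \<in> input_index N" for i
    proof (cases i)
      case (Inl j)
      then show ?thesis using X0 Dm U by (cases j) auto
    next
      case (Inr j)
      then have "j < N" using that by auto
      then show ?thesis using Inr U(3)[of j] \<delta>m[of j] by simp
    qed
    show "\<forall>A\<in>input_index N \<rightarrow> sets borel. prob (\<Inter>j\<in>input_index N. ?U j -` A j \<inter> space M) = (\<Prod>j\<in>input_index N. prob (?U j -` A j \<inter> space M))"
    proof
      fix A assume A: "A \<in> input_index N \<rightarrow> sets (borel :: (real ^ 'n) measure)"
      have A0: "A (Inl 0) \<in> sets borel" and A1: "\<And>j. j < N \<Longrightarrow> A (Inl (Suc j)) \<in> sets borel" and A2: "\<And>j. j < N \<Longrightarrow> A (Inr j) \<in> sets borel"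
        using A by (auto simp: Pi_iff)
      define C where "C j = {d :: real. d *\<^sub>R (\<chi> i. 1) \<in> A (Inr j)}" for j
      have Cs: "C j \<in> sets borel" if "j < N" for j
      proof -
        have "(\<lambda>d :: real. d *\<^sub>R ((\<chi> i. 1) :: real ^ 'n)) \<in> borel_measurable borel" by measurable
        from measurable_sets[OF this A2[OF that]] show ?thesis by (simp add: C_def vimage_def)
      qed
      define SP where "SP = {p \<in> space (path_space :: (real \<Rightarrow> real ^ 'n) measure). \<forall>j\<in>{..<N}. p (real (Suc j) * h) - p (real j * h) \<in> A (Inl (Suc j))}"
      have SPs: "SP \<in> sets path_space"
        unfolding SP_def
      proof (rule sets.sets_Collect_finite_All)
        fix j assume "j \<in> {..<N}"
        then have j: "j < N" by simp
        have "(\<lambda>p :: real \<Rightarrow> real ^ 'n. p (real (Suc j) * h) - p (real j * h)) \<in> borel_measurable path_space"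
          using h by (intro borel_measurable_diff measurable_component_singleton) auto
        from measurable_sets[OF this A1[OF j]]
        show "{p \<in> space path_space. p (real (Suc j) * h) - p (real j * h) \<in> A (Inl (Suc j))} \<in> sets path_space"
          by (simp add: vimage_def Int_def conj_commute)
      qed simp
      define SD where "SD = {d \<in> space (\<Pi>\<^sub>M k\<in>{..<N}. borel). \<forall>j\<in>{..<N}. d j \<in> C j}"
      have SDs: "SD \<in> sets (\<Pi>\<^sub>M k\<in>{..<N}. borel)"
        unfolding SD_def
      proof (rule sets.sets_Collect_finite_All)
        fix j assume j: "j \<in> {..<N}"
        then have "(\<lambda>d. d j) \<in> borel_measurable (\<Pi>\<^sub>M k\<in>{..<N}. borel :: real measure)" by simp
        from measurable_sets[OF this Cs[of j]] j
        show "{d \<in> space (\<Pi>\<^sub>M k\<in>{..<N}. borel). d j \<in> C j} \<in> sets (\<Pi>\<^sub>M k\<in>{..<N}. borel)"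
          by (simp add: vimage_def Int_def conj_commute)
      qed simp
      define eX where "eX = X0 -` A (Inl 0) \<inter> space M"
      define eW where "eW = {\<omega> \<in> space M. \<forall>j<N. D j \<omega> \<in> A (Inl (Suc j))}"
      define eD where "eD = {\<omega> \<in> space M. \<forall>j<N. \<delta> j \<omega> \<in> C j}"
      have pW: "path_of W -` SP \<inter> space M = eW"
        using h by (auto simp: SP_def eW_def D_def path_of_def space_PiM)
      have pXW: "(\<lambda>\<omega>. (X0 \<omega>, path_of W \<omega>)) -` (A (Inl 0) \<times> SP) \<inter> space M = eX \<inter> eW"
        unfolding eX_def pW[symmetric] by auto
      have pD: "(\<lambda>\<omega>. \<lambda>k\<in>{..<N}. \<delta> k \<omega>) -` SD \<inter> space M = eD"
        by (auto simp: SD_def eD_def space_PiM)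
      have iDW: "prob (eD \<inter> (eX \<inter> eW)) = prob eD * prob (eX \<inter> eW)"
        using indep_rvD[OF rd SDs, of "A (Inl 0) \<times> SP"] A0 SPs unfolding pXW pD by simp
      have iXW: "prob (eX \<inter> eW) = prob eX * prob eW"
        using indep_rvD[OF indep A0 SPs] unfolding pW eX_def[symmetric] .
      have ne: "{..<N} \<noteq> {}" using N by auto
      have eWp: "prob eW = (\<Prod>j<N. prob (D j -` A (Inl (Suc j)) \<inter> space M))"
      proof -
        have "eW = (\<Inter>j\<in>{..<N}. D j -` A (Inl (Suc j)) \<inter> space M)" using ne by (auto simp: eW_def)
        then show ?thesis using indep_varsD_finite[OF Di ne, of "\<lambda>j. A (Inl (Suc j))"] A1 by simp
      qed
      have eDp: "prob eD = (\<Prod>j<N. prob (\<delta> j -` C j \<inter> space M))"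
      proof -
        have "eD = (\<Inter>j\<in>{..<N}. \<delta> j -` C j \<inter> space M)" using ne by (auto simp: eD_def)
        then show ?thesis using indep_varsD_finite[OF \<delta>i ne, of C] Cs by simp
      qed
      have all: "(\<Inter>j\<in>input_index N. ?U j -` A j \<inter> space M) = eD \<inter> (eX \<inter> eW)"
      proof (intro set_eqI iffI)
        fix \<omega> assume \<omega>: "\<omega> \<in> (\<Inter>j\<in>input_index N. ?U j -` A j \<inter> space M)"
        have mem: "?U i \<omega> \<in> A i" "\<omega> \<in> space M" if "i \<in> input_index N" for i
          using \<omega> that by blast+
        have "\<omega> \<in> space M" by (rule mem(2)[of "Inl 0"]) simp
        moreover have "X0 \<omega> \<in> A (Inl 0)" using mem(1)[of "Inl 0"] by (simp add: U(1))
        then have "\<omega> \<in> eX" using calculation by (simp add: eX_def)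
        moreover have "D j \<omega> \<in> A (Inl (Suc j))" if "j < N" for j
          using mem(1)[of "Inl (Suc j)"] that by (simp add: U(2))
        moreover have "\<delta> j \<omega> \<in> C j" if "j < N" for j
          using mem(1)[of "Inr j"] that by (simp add: U(3) C_def)
        ultimately show "\<omega> \<in> eD \<inter> (eX \<inter> eW)" by (auto simp: eD_def eW_def)
      next
        fix \<omega> assume \<omega>: "\<omega> \<in> eD \<inter> (eX \<inter> eW)"
        show "\<omega> \<in> (\<Inter>j\<in>input_index N. ?U j -` A j \<inter> space M)"
        proof
          fix i assume "i \<in> input_index N"
          then consider "i = Inl 0" | j where "i = Inl (Suc j)" "j < N" | j where "i = Inr j" "j < N"
            by (metis (no_types, lifting) Suc_le_eq UnE atMost_iff image_iff lessThan_iff not0_implies_Suc)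
          then show "\<omega> \<in> ?U i -` A i \<inter> space M"
            using \<omega> U by cases (auto simp: eX_def eW_def eD_def C_def)
        qed
      qed
      have "(\<Prod>j\<in>input_index N. prob (?U j -` A j \<inter> space M)) = (\<Prod>j\<in>Inl ` {..N}. prob (?U j -` A j \<inter> space M)) * (\<Prod>j\<in>Inr ` {..<N}. prob (?U j -` A j \<inter> space M))"
        by (rule prod.union_disjoint) auto
      also have "(\<Prod>j\<in>Inl ` {..N}. prob (?U j -` A j \<inter> space M)) = (\<Prod>j\<le>N. prob (?U (Inl j) -` A (Inl j) \<inter> space M))"
        by (subst prod.reindex) auto
      also have "\<dots> = prob eX * prob eW"
        unfolding prod.atMost_shift eWp by (simp add: U(1,2) eX_def)
      also have "(\<Prod>j\<in>Inr ` {..<N}. prob (?U j -` A j \<inter> space M)) = (\<Prod>j<N. prob (?U (Inr j) -` A (Inr j) \<inter> space M))"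
        by (subst prod.reindex) auto
      also have "\<dots> = prob eD"
        unfolding eDp by (simp add: U(3) C_def vimage_def)
      finally show "prob (\<Inter>j\<in>input_index N. ?U j -` A j \<inter> space M) = (\<Prod>j\<in>input_index N. prob (?U j -` A j \<inter> space M))"
        unfolding all iDW iXW by simp
    qed
  qed (use sets.sigma_sets_eq[of "borel :: (real ^ 'n) measure"] in \<open>auto simp: Int_stable_def\<close>)
qed

text \<open>Together with \<open>scheme_input_indep\<close> this makes the value at time \<open>k h\<close> independent of the next increment
  and the next random time.\<close>

lemma scheme_representation:
  fixes X0 :: "'a \<Rightarrow> real ^ 'n::finite"
  assumes re: "randomized_euler M b X0 W h N \<delta> Y" and b: "(\<lambda>p. b (fst p) (snd p)) \<in> borel_measurable borel" and k: "k \<le> N"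
  shows "\<exists>\<Phi>. \<Phi> \<in> borel_measurable (PiM (input_index k) (\<lambda>_. borel)) \<and>
    (AE \<omega> in M. Y k \<omega> = \<Phi> (\<lambda>i\<in>input_index k. scheme_input X0 W h \<delta> i \<omega>))"
  using k
proof (induction k)
  case 0
  have "(\<lambda>x. x (Inl 0)) \<in> borel_measurable (PiM (input_index 0) (\<lambda>_. borel :: (real ^ 'n) measure))" by simp
  moreover have "AE \<omega> in M. Y 0 \<omega> = (\<lambda>i\<in>input_index 0. scheme_input X0 W h \<delta> i \<omega>) (Inl 0)"
    using re by (simp add: randomized_euler_def scheme_input_def)
  ultimately show ?case by blast
next
  case (Suc k)
  have "k \<le> N" using Suc.prems by simp
  from Suc.IH[OF this] obtain \<Phi> where \<Phi>: "\<Phi> \<in> borel_measurable (PiM (input_index k) (\<lambda>_. borel))"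
    "AE \<omega> in M. Y k \<omega> = \<Phi> (\<lambda>i\<in>input_index k. scheme_input X0 W h \<delta> i \<omega>)" by blast
  let ?P = "PiM (input_index (Suc k)) (\<lambda>_. borel :: (real ^ 'n) measure)"
  define \<Psi> where "\<Psi> x = \<Phi> (restrict x (input_index k))" for x
  have sub: "input_index k \<subseteq> input_index (Suc k)" by auto
  have [measurable]: "\<Psi> \<in> borel_measurable ?P"
    unfolding \<Psi>_def by (rule measurable_compose[OF measurable_restrict_subset[OF sub] \<Phi>(1)])
  have c1 [measurable]: "(\<lambda>x. x (Inl (Suc k))) \<in> borel_measurable ?P" by (rule measurable_component_singleton) auto
  have c2 [measurable]: "(\<lambda>x. x (Inr k)) \<in> borel_measurable ?P" by (rule measurable_component_singleton) auto
  have "(\<lambda>x. b (x (Inr k) $ undefined) (\<Psi> x)) \<in> borel_measurable ?P"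
    using measurable_compose[OF borel_measurable_Pair b, of "\<lambda>x. x (Inr k) $ undefined" ?P \<Psi>] by simp
  then have m: "(\<lambda>x. \<Psi> x + x (Inl (Suc k)) + h *\<^sub>R b (x (Inr k) $ undefined) (\<Psi> x)) \<in> borel_measurable ?P"
    by measurable
  have r: "restrict (\<lambda>i\<in>input_index (Suc k). scheme_input X0 W h \<delta> i \<omega>) (input_index k) = (\<lambda>i\<in>input_index k. scheme_input X0 W h \<delta> i \<omega>)" for \<omega>
    using sub by (auto simp: fun_eq_iff restrict_def)
  have "AE \<omega> in M. Y (Suc k) \<omega> = Y k \<omega> + (W (real (k + 1) * h) \<omega> - W (real k * h) \<omega>) + h *\<^sub>R b (\<delta> k \<omega>) (Y k \<omega>)"
    using re Suc.prems by (simp add: randomized_euler_def)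
  with \<Phi>(2) have "AE \<omega> in M. Y (Suc k) \<omega> = (\<lambda>x. \<Psi> x + x (Inl (Suc k)) + h *\<^sub>R b (x (Inr k) $ undefined) (\<Psi> x)) (\<lambda>i\<in>input_index (Suc k). scheme_input X0 W h \<delta> i \<omega>)"
  proof eventually_elim
    case (elim \<omega>)
    have "(\<lambda>i\<in>input_index (Suc k). scheme_input X0 W h \<delta> i \<omega>) (Inl (Suc k)) = W (real (k + 1) * h) \<omega> - W (real k * h) \<omega>"
      "(\<lambda>i\<in>input_index (Suc k). scheme_input X0 W h \<delta> i \<omega>) (Inr k) $ undefined = \<delta> k \<omega>"
      by (auto simp: scheme_input_def)
    then show ?case using elim unfolding \<Psi>_def r by simp
  qed
  with m show ?case by blast
qed

lemma euler_step_expectation: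
  fixes X0 :: "'a \<Rightarrow> real ^ 'n::finite"
  assumes W: "brownian_motion M W" and X0: "X0 \<in> borel_measurable M" and indep: "indep_rv M borel X0 path_space (path_of W)"
    and rt: "random_times M X0 W h N \<delta>" and re: "randomized_euler M b X0 W h N \<delta> Y"
    and b: "(\<lambda>p. b (fst p) (snd p)) \<in> borel_measurable borel" and h: "0 < h" and k: "k < N" and f: "bdd_meas K f"
  shows "expectation (\<lambda>\<omega>. f (Y (Suc k) \<omega>))
    = (1 / h) * (LINT r:{real k * h..real (k + 1) * h}|lborel. expectation (\<lambda>\<omega>. heat h f (Y k \<omega> + h *\<^sub>R b r (Y k \<omega>))))"
proof -
  let ?U = "scheme_input X0 W h \<delta>"
  have N: "0 < N" using k by simp
  note iv = scheme_input_indep[OF W X0 indep rt h N]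
  obtain \<Phi> where \<Phi>: "\<Phi> \<in> borel_measurable (PiM (input_index k) (\<lambda>_. borel))"
    "AE \<omega> in M. Y k \<omega> = \<Phi> (\<lambda>i\<in>input_index k. ?U i \<omega>)"
    using scheme_representation[OF re b less_imp_le[OF k]] by blast
  define Z where "Z \<omega> = \<Phi> (\<lambda>i\<in>input_index k. ?U i \<omega>)" for \<omega>
  define D where "D \<omega> = W (real (Suc k) * h) \<omega> - W (real k * h) \<omega>" for \<omega>
  have UD: "?U (Inl (Suc k)) = D" "\<And>\<omega>. ?U (Inr k) \<omega> $ undefined = \<delta> k \<omega>"
    by (auto simp: scheme_input_def D_def fun_eq_iff)
  have ZDd: "indep_rv M borel Z (borel \<Otimes>\<^sub>M borel) (\<lambda>\<omega>. (D \<omega>, \<delta> k \<omega>))"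
  proof -
    let ?B = "{Inl (Suc k), Inr k} :: (nat + nat) set"
    have "indep_var (PiM (input_index k) (\<lambda>_. borel)) (\<lambda>\<omega>. restrict (\<lambda>i. ?U i \<omega>) (input_index k)) (PiM ?B (\<lambda>_. borel)) (\<lambda>\<omega>. restrict (\<lambda>i. ?U i \<omega>) ?B)"
      by (rule indep_var_restrict[OF iv]) (use k in auto)
    note i = indep_rv_of_indep_var[OF this]
    have m: "(\<lambda>x. (x (Inl (Suc k)), x (Inr k) $ undefined)) \<in> PiM ?B (\<lambda>_. borel :: (real ^ 'n) measure) \<rightarrow>\<^sub>M borel \<Otimes>\<^sub>M borel"
    proof -
      have "(\<lambda>x. x (Inl (Suc k))) \<in> borel_measurable (PiM ?B (\<lambda>_. borel :: (real ^ 'n) measure))"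
        "(\<lambda>x. x (Inr k)) \<in> borel_measurable (PiM ?B (\<lambda>_. borel :: (real ^ 'n) measure))" by (auto intro: measurable_component_singleton)
      then show ?thesis by measurable
    qed
    from indep_rv_compose[OF i \<Phi>(1) m] show ?thesis by (simp add: Z_def[abs_def] UD)
  qed
  have Dd: "indep_rv M borel D borel (\<delta> k)"
  proof -
    have "indep_var (PiM {Inl (Suc k)} (\<lambda>_. borel)) (\<lambda>\<omega>. restrict (\<lambda>i. ?U i \<omega>) {Inl (Suc k)}) (PiM {Inr k} (\<lambda>_. borel)) (\<lambda>\<omega>. restrict (\<lambda>i. ?U i \<omega>) {Inr k})"
      by (rule indep_var_restrict[OF iv]) (use k in auto)
    note i = indep_rv_of_indep_var[OF this]
    have m1: "(\<lambda>x. x (Inl (Suc k))) \<in> borel_measurable (PiM {Inl (Suc k)} (\<lambda>_. borel :: (real ^ 'n) measure))" by simp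
    have "(\<lambda>x. x (Inr k)) \<in> borel_measurable (PiM {Inr k} (\<lambda>_. borel :: (real ^ 'n) measure))" by simp
    then have m2: "(\<lambda>x. x (Inr k) $ undefined) \<in> borel_measurable (PiM {Inr k} (\<lambda>_. borel :: (real ^ 'n) measure))" by measurable
    from indep_rv_compose[OF i m1 m2] show ?thesis by (simp add: UD)
  qed
  have Dg: "distributed M lborel D (\<lambda>x. ennreal (gk h x))"
  proof -
    have "0 \<le> real k * h \<and> real k * h < real (Suc k) * h" using h by simp
    then have "distributed M lborel D (\<lambda>x. ennreal (\<Prod>i\<in>UNIV. normal_density 0 (sqrt (real (Suc k) * h - real k * h)) (x $ i)))"
      using W unfolding brownian_motion_def D_def by blast
    moreover have "real (Suc k) * h - real k * h = h" by (simp add: algebra_simps)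
    ultimately show ?thesis by (simp only: gk_def)
  qed
  have len: "real (k + 1) * h = real k * h + h" by (simp add: algebra_simps)
  have \<delta>: "distr M borel (\<delta> k) = uniform_measure lborel {real k * h..real k * h + h}"
    using rt k unfolding random_times_def len[symmetric] by blast
  note [measurable] = bdd_measD(1)[OF f]
  have [measurable]: "Z \<in> borel_measurable M" by (rule indep_rv_measurable(1)[OF ZDd])
  have [measurable]: "D \<in> borel_measurable M" "\<delta> k \<in> borel_measurable M" using indep_rv_measurable[OF Dd] by auto
  have [measurable]: "Y k \<in> borel_measurable M" "Y (Suc k) \<in> borel_measurable M"
    using re k by (auto simp: randomized_euler_def)
  have bm [measurable]: "(\<lambda>\<omega>. b (u \<omega>) (v \<omega>)) \<in> borel_measurable M" if "u \<in> borel_measurable M" "v \<in> borel_measurable M" for u v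
    using measurable_compose[OF borel_measurable_Pair[OF that] b] by simp
  have [measurable]: "(\<lambda>\<omega>. b (\<delta> k \<omega>) (Z \<omega>)) \<in> borel_measurable M" by (rule bm) measurable
  have [measurable]: "(\<lambda>\<omega>. b r (Z \<omega>)) \<in> borel_measurable M" "(\<lambda>\<omega>. b r (Y k \<omega>)) \<in> borel_measurable M" for r by (rule bm; measurable)+
  have AE1: "AE \<omega> in M. Y (Suc k) \<omega> = Z \<omega> + D \<omega> + h *\<^sub>R b (\<delta> k \<omega>) (Z \<omega>)"
  proof -
    have "AE \<omega> in M. Y (Suc k) \<omega> = Y k \<omega> + (W (real (k + 1) * h) \<omega> - W (real k * h) \<omega>) + h *\<^sub>R b (\<delta> k \<omega>) (Y k \<omega>)"
      using re k by (simp add: randomized_euler_def)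
    with \<Phi>(2) show ?thesis by eventually_elim (simp add: Z_def D_def)
  qed
  have "expectation (\<lambda>\<omega>. f (Y (Suc k) \<omega>)) = expectation (\<lambda>\<omega>. f (Z \<omega> + D \<omega> + h *\<^sub>R b (\<delta> k \<omega>) (Z \<omega>)))"
    by (rule integral_cong_AE) (measurable, use AE1 in \<open>auto elim!: eventually_mono\<close>)
  also have "\<dots> = (1 / h) * (LINT r:{real k * h..real k * h + h}|lborel. expectation (\<lambda>\<omega>. heat h f (Z \<omega> + h *\<^sub>R b r (Z \<omega>))))"
    by (rule euler_step_law[OF ZDd Dd Dg h \<delta> b f])
  also have "(\<lambda>r. expectation (\<lambda>\<omega>. heat h f (Z \<omega> + h *\<^sub>R b r (Z \<omega>)))) = (\<lambda>r. expectation (\<lambda>\<omega>. heat h f (Y k \<omega> + h *\<^sub>R b r (Y k \<omega>))))"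
    by (intro ext integral_cong_AE) (measurable, use \<Phi>(2) in \<open>auto simp: Z_def elim!: eventually_mono\<close>)
  finally show ?thesis unfolding len .
qed

text \<open>The solution is replaced by a modification that is continuous for every outcome, hence jointly
  measurable. It may fail to be adapted, but the independence of the future increments depends on the
  almost sure class only.\<close>

lemma sde_process_exists:
  fixes b :: "real \<Rightarrow> real ^ 'n::finite \<Rightarrow> real ^ 'n"
  assumes T: "0 < T" and W: "brownian_motion M W"
    and b: "(\<lambda>p. b (fst p) (snd p)) \<in> borel_measurable borel" and bb: "\<And>t x i. \<bar>b t x $ i\<bar> \<le> B"
    and X: "sde_solution M T b X0 W X"
  shows "\<exists>X'. sde_process M b B T (real CARD('n) * dimc TYPE('n)) X' W \<and>
    (\<forall>t\<in>{0..T}. X t \<in> borel_measurable M \<and> (AE \<omega> in M. X' t \<omega> = X t \<omega>)) \<and> (AE \<omega> in M. X' 0 \<omega> = X0 \<omega>)"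
proof -
  obtain F where F: "filtration (space M) F" "\<And>t. subalgebra M (F t)"
    and Find: "\<And>s t. 0 \<le> s \<Longrightarrow> s < t \<Longrightarrow> indep_set (sets (F s)) (sets (vimage_algebra (space M) (\<lambda>\<omega>. W t \<omega> - W s \<omega>) borel))"
    and FX: "\<And>t. t \<in> {0..T} \<Longrightarrow> X t \<in> borel_measurable (F t)"
    and cont: "AE \<omega> in M. continuous_on {0..T} (\<lambda>t. X t \<omega>)"
    and eq: "AE \<omega> in M. \<forall>t\<in>{0..T}. X t \<omega> = X0 \<omega> + W t \<omega> + (LINT s:{0..t}|lborel. b s (X s \<omega>))"
    using X unfolding sde_solution_def by blast
  have Xm: "X t \<in> borel_measurable M" if "t \<in> {0..T}" for t
    using measurable_from_subalg[OF F(2) FX[OF that]] .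
  have Wm: "W t \<in> borel_measurable M" if "0 \<le> t" for t using W that by (auto simp: brownian_motion_def)
  have W0: "AE \<omega> in M. W 0 \<omega> = 0" using W by (simp add: brownian_motion_def)
  from cont obtain N where N: "{\<omega> \<in> space M. \<not> continuous_on {0..T} (\<lambda>t. X t \<omega>)} \<subseteq> N" "N \<in> sets M" "emeasure M N = 0"
    by (auto elim!: AE_E)
  have Nae: "AE \<omega> in M. \<omega> \<notin> N" using N by (intro AE_not_in) auto
  define cl where "cl t = max 0 (min T t)" for t
  have cl: "cl t \<in> {0..T}" for t using T by (auto simp: cl_def)
  have clr: "range cl \<subseteq> {0..T}" using cl by blast
  have clc: "continuous_on UNIV cl" unfolding cl_def by (intro continuous_intros)
  have cl_id: "cl t = t" if "t \<in> {0..T}" for t using that by (simp add: cl_def)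
  define X' where "X' t \<omega> = (if \<omega> \<in> N then 0 else X (cl t) \<omega>)" for t \<omega>
  have X'm: "X' t \<in> borel_measurable M" for t
    unfolding X'_def using N(2) Xm[OF cl] by (intro measurable_If_set) (auto simp: Int_def intro: sets.Int)
  have X'c: "continuous_on UNIV (\<lambda>t. X' t \<omega>)" if "\<omega> \<in> space M" for \<omega>
  proof (cases "\<omega> \<in> N")
    case False
    then have "continuous_on {0..T} (\<lambda>t. X t \<omega>)" using N(1) that by blast
    from continuous_on_compose2[OF this clc clr] False show ?thesis by (simp add: X'_def)
  qed (simp add: X'_def)
  have X'pair: "(\<lambda>p. X' (fst p) (snd p)) \<in> borel_measurable (borel \<Otimes>\<^sub>M M)"
    by (rule joint_measurable_continuous[OF X'm X'c])
  have X'X: "AE \<omega> in M. X' t \<omega> = X t \<omega>" if "t \<in> {0..T}" for t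
    using Nae by eventually_elim (simp add: X'_def cl_id[OF that])
  have eq': "AE \<omega> in M. \<forall>t\<in>{0..T}. X' t \<omega> = X0 \<omega> + W t \<omega> + (LINT s:{0..t}|lborel. b s (X' s \<omega>))"
    using Nae eq
  proof eventually_elim
    case (elim \<omega>)
    have "(LINT s:{0..t}|lborel. b s (X' s \<omega>)) = (LINT s:{0..t}|lborel. b s (X s \<omega>))" if "t \<in> {0..T}" for t
      by (rule set_lebesgue_integral_cong) (use that elim(1) cl_id in \<open>auto simp: X'_def\<close>)
    then show ?case using elim by (auto simp: X'_def cl_id)
  qed
  have path: "(\<lambda>s. b s (X' s \<omega>)) \<in> borel_measurable borel" if "\<omega> \<in> space M" for \<omega>
  proof -
    have "(\<lambda>s. X' s \<omega>) \<in> borel_measurable borel" using X'c[OF that] by (rule borel_measurable_continuous_onI)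
    from measurable_compose[OF borel_measurable_Pair[OF measurable_ident_sets[OF refl] this] b] show ?thesis by simp
  qed
  have nb: "norm (b t x) \<le> real CARD('n) * B" for t x
  proof -
    have "norm (b t x) \<le> nrm1 (b t x)" by (rule norm_le_l1_cart)
    also have "\<dots> \<le> (\<Sum>i\<in>(UNIV :: 'n set). B)" by (rule sum_mono) (rule bb)
    finally show ?thesis by simp
  qed
  have inc: "AE \<omega> in M. \<forall>i. (X' t \<omega> - X' s \<omega> - (W t \<omega> - W s \<omega>)) $ i = (LINT r:{s..t}|lborel. b r (X' r \<omega>) $ i)"
    if st: "0 \<le> s" "s < t" "t \<le> T" for s t
    using eq' AE_space
  proof eventually_elim
    case (elim \<omega>)
    note [measurable] = path[OF elim(2)]
    have iv: "set_integrable lborel {0..r} (\<lambda>v. b v (X' v \<omega>))" for r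
      unfolding set_integrable_def
    proof (rule Bochner_Integration.integrable_bound)
      show "integrable lborel (\<lambda>v. indicator {0..r} v *\<^sub>R (real CARD('n) * B))"
        using set_integrable_const_Icc[of 0 r] by (simp add: set_integrable_def)
      show "AE v in lborel. norm (indicator {0..r} v *\<^sub>R b v (X' v \<omega>)) \<le> norm (indicator {0..r} v *\<^sub>R (real CARD('n) * B))"
        using nb by (auto simp: indicator_def intro!: AE_I2 order_trans[OF _ abs_ge_self])
    qed measurable
    have ci: "(LINT v:{0..r}|lborel. b v (X' v \<omega>)) $ i = (LINT v:{0..r}|lborel. b v (X' v \<omega>) $ i)" for r i
      using integral_bounded_linear[OF bounded_linear_vec_nth iv[of r, unfolded set_integrable_def], of i]
      unfolding set_lebesgue_integral_def by simp
    have ist: "set_integrable lborel {0..t} (\<lambda>v. b v (X' v \<omega>) $ i)" for i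
      using integrable_bounded_linear[OF bounded_linear_vec_nth iv[of t, unfolded set_integrable_def], of i]
      unfolding set_integrable_def by simp
    show ?case
    proof
      fix i
      have "X' t \<omega> - X' s \<omega> - (W t \<omega> - W s \<omega>) = (LINT v:{0..t}|lborel. b v (X' v \<omega>)) - (LINT v:{0..s}|lborel. b v (X' v \<omega>))"
        using elim(1) st by simp
      then have "(X' t \<omega> - X' s \<omega> - (W t \<omega> - W s \<omega>)) $ i = (LINT v:{0..t}|lborel. b v (X' v \<omega>) $ i) - (LINT v:{0..s}|lborel. b v (X' v \<omega>) $ i)"
        by (simp only: vector_minus_component ci)
      also have "\<dots> = (LINT r:{s..t}|lborel. b r (X' r \<omega>) $ i)"
        using set_integral_Icc_split[OF st(1) less_imp_le[OF st(2)] ist[of i]] by simp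
      finally show "(X' t \<omega> - X' s \<omega> - (W t \<omega> - W s \<omega>)) $ i = (LINT r:{s..t}|lborel. b r (X' r \<omega>) $ i)" .
    qed
  qed
  have Wd: "distributed M lborel (\<lambda>\<omega>. W t \<omega> - W s \<omega>) (\<lambda>x. ennreal (gk (t - s) x))" if "0 \<le> s" "s < t" for s t
    using W that unfolding brownian_motion_def gk_def by blast
  have gs: "expectation (\<lambda>\<omega>. f (X' s \<omega> + (W t \<omega> - W s \<omega>))) = expectation (\<lambda>\<omega>. heat (t - s) f (X' s \<omega>))"
    if st: "0 \<le> s" "s < t" "t \<le> T" and f: "bdd_meas K f" for s t K f
  proof -
    have s: "s \<in> {0..T}" using st by simp
    note [measurable] = bdd_measD(1)[OF f] X'm Xm[OF s]
    have [measurable]: "W t \<in> borel_measurable M" "W s \<in> borel_measurable M" using Wm st by auto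
    have i: "indep_rv M borel (X s) borel (\<lambda>\<omega>. W t \<omega> - W s \<omega>)"
    proof (rule indep_rvI)
      fix S U :: "(real ^ 'n) set" assume SU: "S \<in> sets borel" "U \<in> sets borel"
      show "prob ((X s -` S \<inter> space M) \<inter> ((\<lambda>\<omega>. W t \<omega> - W s \<omega>) -` U \<inter> space M))
        = prob (X s -` S \<inter> space M) * prob ((\<lambda>\<omega>. W t \<omega> - W s \<omega>) -` U \<inter> space M)"
      proof (rule indep_setD[OF Find[OF st(1,2)]])
        show "X s -` S \<inter> space M \<in> sets (F s)"
          using measurable_sets[OF FX[OF s] SU(1)] F(2)[of s] by (simp add: subalgebra_def)
      qed (use SU in \<open>auto intro: in_vimage_algebra\<close>)
    qed measurable
    have "expectation (\<lambda>\<omega>. f (X' s \<omega> + (W t \<omega> - W s \<omega>))) = expectation (\<lambda>\<omega>. f (X s \<omega> + (W t \<omega> - W s \<omega>)))"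
      by (rule integral_cong_AE) (measurable, use X'X[OF s] in \<open>auto elim!: eventually_mono\<close>)
    also have "\<dots> = expectation (\<lambda>\<omega>. heat (t - s) f (X s \<omega>))"
      by (rule gauss_step_indep[OF i Wd[OF st(1,2)] _ f]) (use st in simp)
    also have "\<dots> = expectation (\<lambda>\<omega>. heat (t - s) f (X' s \<omega>))"
      by (rule integral_cong_AE) (measurable, use X'X[OF s] in \<open>auto elim!: eventually_mono\<close>)
    finally show ?thesis .
  qed
  have mom: "integrable M (\<lambda>\<omega>. nrm1 (W t \<omega> - W s \<omega>))" "expectation (\<lambda>\<omega>. nrm1 (W t \<omega> - W s \<omega>)) \<le> real CARD('n) * dimc TYPE('n) * sqrt (t - s)"
    if st: "0 \<le> s" "s < t" for s t
  proof -
    have ts: "0 < t - s" using st by simp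
    have e: "integrable lborel (\<lambda>x :: real ^ 'n. gk (t - s) x * nrm1 x)" "(LINT x|lborel. gk (t - s) x * nrm1 (x :: real ^ 'n)) \<le> real CARD('n) * dimc TYPE('n) * sqrt (t - s)"
      using expectation_nrm1_gauss[OF ts, of "0 :: real ^ 'n"] by (simp_all add: mult.commute[of "nrm1 _"])
    show "integrable M (\<lambda>\<omega>. nrm1 (W t \<omega> - W s \<omega>))"
      using distributed_integrable[OF Wd[OF st], of "\<lambda>x. nrm1 x"] e(1) by simp
    show "expectation (\<lambda>\<omega>. nrm1 (W t \<omega> - W s \<omega>)) \<le> real CARD('n) * dimc TYPE('n) * sqrt (t - s)"
      using distributed_integral[OF Wd[OF st], of "\<lambda>x. nrm1 x"] e(2) by simp
  qed
  have "sde_process M b B T (real CARD('n) * dimc TYPE('n)) X' W"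
    by unfold_locales (fact T b bb X'pair Wm inc gs mom)+
  moreover have "AE \<omega> in M. X' 0 \<omega> = X0 \<omega>"
    using eq' W0
  proof eventually_elim
    case (elim \<omega>)
    have "(LINT s:{0..0}|lborel. b s (X' s \<omega>)) = 0"
      unfolding set_lebesgue_integral_def by (rule integral_eq_zero_AE) (use AE_lborel_singleton[of "0::real"] in \<open>auto elim!: eventually_mono\<close>)
    then show ?case using elim T by simp
  qed
  ultimately show ?thesis using Xm X'X by blast
qed

end

section \<open>The rate of convergence\<close>

lemma gauss_div_mono:
  assumes g: "gauss_div u K lam g" and K: "K \<le> K'"
  shows "gauss_div u K' lam g"
proof -
  have "K * (1 + 1 / sqrt s) \<le> K' * (1 + 1 / sqrt s)" if "0 < s" for s :: real
    using K that by (intro mult_right_mono) auto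
  then show ?thesis using g unfolding gauss_div_def by (meson order_trans ennreal_leI)
qed

theorem theorem2p3:
  fixes T B :: real
    and m :: "(real ^ 'n::finite) measure"
    and M :: "'w measure"
    and b :: "real \<Rightarrow> real ^ 'n \<Rightarrow> real ^ 'n"
    and X0 :: "'w \<Rightarrow> real ^ 'n"
    and W X :: "real \<Rightarrow> 'w \<Rightarrow> real ^ 'n"
  assumes T: "0 < T"
    and m: "prob_space m" "sets m = sets borel"
    and M: "prob_space M"
    and W: "brownian_motion M W"
    and X0: "X0 \<in> borel_measurable M" "distr M borel X0 = m"
    and indep: "indep_rv M borel X0 path_space (path_of W)"
    and b_meas: "(\<lambda>(t, x). b t x) \<in> borel_measurable (restrict_space borel ({0..T} \<times> UNIV))"
    and b_bdd: "\<And>i t x. t \<in> {0..T} \<Longrightarrow> \<bar>b t x $ i\<bar> \<le> B"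
    and b_reg: "(\<exists>\<rho>. ereal (real CARD('n)) \<le> \<rho> \<and> (SUP t\<in>{0..T}. div_Lp_norm \<rho> (b t)) < \<infinity>) \<or>
                (CARD('n) = 1 \<and> (SUP t\<in>{0..T}. div_TV_norm (b t)) < \<infinity>)"
    and X: "sde_solution M T b X0 W X"
  shows "\<exists>C::real. \<forall>h \<delta> Y. 0 < h \<and> h \<le> T \<and>
           random_times M X0 W h (nat \<lfloor>T / h\<rfloor>) \<delta> \<and>
           randomized_euler M b X0 W h (nat \<lfloor>T / h\<rfloor>) \<delta> Y \<longrightarrow>
           (\<forall>k::nat. 1 \<le> k \<and> int k \<le> \<lfloor>T / h\<rfloor> \<longrightarrow>
              TV_norm_diff (distr M borel (X (real k * h))) (distr M borel (Y k))
                \<le> ereal (C / sqrt (real k * h) * (1 + ln (real k)) * h))"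
proof -
  interpret prob_space M by (rule M)
  \<comment> \<open>the drift is extended by 0 in time, which changes neither the equation nor the scheme\<close>
  define b' where "b' t x = (if t \<in> {0..T} then b t x else 0)" for t x
  have b'b: "b' t = b t" if "t \<in> {0..T}" for t using that by (simp add: b'_def fun_eq_iff)
  have B: "0 \<le> B" using b_bdd[of 0 undefined] T by (auto intro: order_trans[OF abs_ge_zero])
  have b'bd: "\<bar>b' t x $ i\<bar> \<le> B" for t x i using b_bdd B by (simp add: b'_def)
  have b'm: "(\<lambda>p. b' (fst p) (snd p)) \<in> borel_measurable borel"
  proof -
    have "{0..T} \<times> (UNIV :: (real ^ 'n) set) \<in> sets borel" by (intro borel_closed closed_Times) auto
    then have "(\<lambda>p. if p \<in> {0..T} \<times> UNIV then (case p of (t, x) \<Rightarrow> b t x) else 0) \<in> borel_measurable borel"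
      using b_meas by (subst (asm) measurable_restrict_space_iff[where c=0]) auto
    moreover have "(\<lambda>p. if p \<in> {0..T} \<times> UNIV then (case p of (t, x) \<Rightarrow> b t x) else 0) = (\<lambda>p. b' (fst p) (snd p))"
      by (auto simp: b'_def fun_eq_iff)
    ultimately show ?thesis by simp
  qed
  have b'tm: "b' t \<in> borel_measurable borel" for t
    using measurable_compose[OF borel_measurable_Pair[OF measurable_const measurable_ident_sets[OF refl]] b'm, of t] by simp
  have X': "sde_solution M T b' X0 W X"
  proof -
    have "(LINT s:{0..t}|lborel. b' s (X s \<omega>)) = (LINT s:{0..t}|lborel. b s (X s \<omega>))" if "t \<in> {0..T}" for t \<omega>
      by (rule set_lebesgue_integral_cong) (use that in \<open>auto simp: b'_def\<close>)
    then show ?thesis using X unfolding sde_solution_def by (auto cong: ball_cong)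
  qed
  obtain X' where sp: "sde_process M b' B T (real CARD('n) * dimc TYPE('n)) X' W"
    and Xm: "\<And>t. t \<in> {0..T} \<Longrightarrow> X t \<in> borel_measurable M" and X'X: "\<And>t. t \<in> {0..T} \<Longrightarrow> AE \<omega> in M. X' t \<omega> = X t \<omega>"
    and X'0: "AE \<omega> in M. X' 0 \<omega> = X0 \<omega>"
    using sde_process_exists[OF T W b'm b'bd X'] by blast
  obtain K where K: "\<And>t. t \<in> {0..T} \<Longrightarrow> \<exists>lam g. gauss_div (b t) K lam g"
    using gauss_div_uniform[of "{0..T}" b B, OF _ b_bdd b_reg] b'tm b'b by (metis (no_types, lifting))
  interpret S: sde_process M b' B T "real CARD('n) * dimc TYPE('n)" X' W by (rule sp)
  interpret S: sde_div M b' B T "real CARD('n) * dimc TYPE('n)" X' W "max 0 K"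
  proof
    show "\<exists>lam g. gauss_div (b' t) (max 0 K) lam g" if "t \<in> {0..T}" for t
      using K[OF that] gauss_div_mono[of "b t" K _ _ "max 0 K"] b'b[OF that] by auto
  qed simp
  show ?thesis
  proof (intro exI[of _ S.C_euler] allI impI)
    fix h \<delta> Y k
    assume asm: "0 < h \<and> h \<le> T \<and> random_times M X0 W h (nat \<lfloor>T / h\<rfloor>) \<delta> \<and> randomized_euler M b X0 W h (nat \<lfloor>T / h\<rfloor>) \<delta> Y"
      and k: "1 \<le> k \<and> int k \<le> \<lfloor>T / h\<rfloor>"
    define N where "N = nat \<lfloor>T / h\<rfloor>"
    have h: "0 < h" "h \<le> T" and rt: "random_times M X0 W h N \<delta>" and re: "randomized_euler M b X0 W h N \<delta> Y"
      using asm by (auto simp: N_def)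
    have kN: "1 \<le> k" "k \<le> N" using k by (auto simp: N_def)
    have NT: "real N * h \<le> T"
    proof -
      have "real N \<le> T / h" using h by (simp add: N_def of_nat_nat)
      then show ?thesis using h by (simp add: le_divide_eq)
    qed
    have jT: "real j * h \<in> {0..T}" if "j \<le> N" for j
      using that h NT order_trans[OF mult_right_mono[of "real j" "real N" h] NT] by auto
    have re': "randomized_euler M b' X0 W h N \<delta> Y"
      unfolding randomized_euler_def
    proof (intro conjI allI impI)
      fix j assume j: "j < N"
      have \<delta>m: "\<delta> j \<in> borel_measurable M" using rt j by (auto simp: random_times_def indep_vars_def)
      have "AE x in distr M borel (\<delta> j). x \<in> {real j * h..real (j + 1) * h}"
      proof -
        have "distr M borel (\<delta> j) = uniform_measure lborel {real j * h..real (j + 1) * h}" using rt j by (simp add: random_times_def)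
        then show ?thesis by (simp only:) (intro AE_uniform_measureI, auto)
      qed
      then have "AE \<omega> in M. \<delta> j \<omega> \<in> {real j * h..real (j + 1) * h}"
        using \<delta>m by (subst (asm) AE_distr_iff) auto
      moreover have "{real j * h..real (j + 1) * h} \<subseteq> {0..T}" using jT[of j] jT[of "j + 1"] j by auto
      moreover have "AE \<omega> in M. Y (Suc j) \<omega> = Y j \<omega> + (W (real (j + 1) * h) \<omega> - W (real j * h) \<omega>) + h *\<^sub>R b (\<delta> j \<omega>) (Y j \<omega>)"
        using re j by (simp add: randomized_euler_def)
      ultimately show "AE \<omega> in M. Y (Suc j) \<omega> = Y j \<omega> + (W (real (j + 1) * h) \<omega> - W (real j * h) \<omega>) + h *\<^sub>R b' (\<delta> j \<omega>) (Y j \<omega>)"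
        by (auto simp: b'_def elim!: eventually_elim2)
    qed (use re in \<open>auto simp: randomized_euler_def\<close>)
    have Ym: "Y j \<in> borel_measurable M" if "j \<le> N" for j using re that by (simp add: randomized_euler_def)
    interpret E: euler_scheme M b' B T "real CARD('n) * dimc TYPE('n)" X' W "max 0 K" h N Y
    proof
      fix L and f :: "real ^ 'n \<Rightarrow> real" assume f: "bdd_meas L f"
      have Y0: "AE \<omega> in M. Y 0 \<omega> = X0 \<omega>" using re by (simp add: randomized_euler_def)
      note [measurable] = bdd_measD(1)[OF f] Ym[of 0]
      have "AE \<omega> in M. f (Y 0 \<omega>) = f (X' 0 \<omega>)" using Y0 X'0 by eventually_elim simp
      then show "expectation (\<lambda>\<omega>. f (Y 0 \<omega>)) = expectation (\<lambda>\<omega>. f (X' 0 \<omega>))"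
        by (intro integral_cong_AE) auto
    next
      fix j L and f :: "real ^ 'n \<Rightarrow> real" assume "j < N" "bdd_meas L f"
      then show "expectation (\<lambda>\<omega>. f (Y (Suc j) \<omega>)) = (1 / h) * (LINT r:{real j * h..real (j + 1) * h}|lborel. expectation (\<lambda>\<omega>. heat h f (Y j \<omega> + h *\<^sub>R b' r (Y j \<omega>))))"
        by (rule euler_step_expectation[OF W X0(1) indep rt re' b'm h(1)])
    qed (use h NT Ym in auto)
    show "TV_norm_diff (distr M borel (X (real k * h))) (distr M borel (Y k)) \<le> ereal (S.C_euler / sqrt (real k * h) * (1 + ln (real k)) * h)"
      unfolding TV_norm_diff_def
    proof (rule SUP_least)
      fix \<phi> :: "real ^ 'n \<Rightarrow> real" assume "\<phi> \<in> {\<phi>. \<phi> \<in> borel_measurable borel \<and> (\<forall>x. \<phi> x \<in> {-1..1})}"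
      then have \<phi>: "bdd_meas 1 \<phi>" by (auto simp: bdd_meas_def abs_le_iff)
      note [measurable] = bdd_measD(1)[OF \<phi>] Ym[OF kN(2)] Xm[OF jT[OF kN(2)]]
      have "(LINT x|distr M borel (X (real k * h)). \<phi> x) = expectation (\<lambda>\<omega>. \<phi> (X (real k * h) \<omega>))"
        by (rule integral_distr) auto
      also have "\<dots> = expectation (\<lambda>\<omega>. \<phi> (X' (real k * h) \<omega>))"
        using X'X[OF jT[OF kN(2)]] by (intro integral_cong_AE) (auto elim!: eventually_mono)
      finally have 1: "(LINT x|distr M borel (X (real k * h)). \<phi> x) = expectation (\<lambda>\<omega>. \<phi> (X' (real k * h) \<omega>))" .
      have 2: "(LINT x|distr M borel (Y k). \<phi> x) = expectation (\<lambda>\<omega>. \<phi> (Y k \<omega>))"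
        by (rule integral_distr) auto
      have "(LINT x|distr M borel (X (real k * h)). \<phi> x) - (LINT x|distr M borel (Y k). \<phi> x) \<le> S.C_euler * (1 / sqrt (real k * h)) * (1 + ln (real k)) * h"
        using E.euler_error[OF kN \<phi>] unfolding 1 2 by linarith
      then show "ereal ((LINT x|distr M borel (X (real k * h)). \<phi> x) - (LINT x|distr M borel (Y k). \<phi> x)) \<le> ereal (S.C_euler / sqrt (real k * h) * (1 + ln (real k)) * h)"
        by simp
    qed
  qed
qed

end
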